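(* Assume: (i) conditionally on $K$, the law of the vector of jump times $(T_1,\ldots,T_K)$ admits a density; (ii) the functions $a:[0,1]\times\mathbb R\to\mathbb R$, $b:[0,1]\times\mathbb R\to\mathbb R$ and $c:\mathbb R^2\to\mathbb R$ are continuous; (iii) almost surely $c(X_{T_k-},\Lambda_k)\ne0$ for all $k\in\{1,\ldots,K\}$; (iv) $u_n\sim n^{-\varpi}$ with $\varpi\in(0,1/2)$. Then $\sqrt n(\widehat J^{n}-J)$ converges in law to $Z=(Z_k)_{k\ge1}$ (in the sense of convergence of all finite-dimensional marginals), where the limit can be described on the extended space $\widetilde\Omega$ by $$Z_k=\sqrt{U_k}\,a(T_k,X_{T_k-})N_k^-+\sqrt{1-U_k}\,a(T_k,X_{T_k})N_k^+\quad\text{for }k\le K,\qquad Z_k=0\quad\text{for }k>K.$$ Moreover the convergence is stable with respect to the sigma-field $\mathcal F$.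
   Context: Model. On $(\Omega,\mathcal F,\mathbb P)=(\Omega^1\times\Omega^2,\ldots,\mathbb P^1\otimes\mathbb P^2)$, a canonical product space, are defined mutually independent: a standard Brownian motion $W=(W_t)_{t\in[0,1]}$, a nondecreasing sequence $(T_k)_{k\ge1}$ and a sequence of marks $(\Lambda_k)_{k\ge1}$, with $K=\operatorname{Card}\{k: T_k\le1\}$ almost surely finite (and $0<T_1<\cdots<T_K<1$). The filtration $(\mathcal F_t)$ is the right-continuous completed filtration generated by $W$ up to time $t$ and all of $((T_k)_k,(\Lambda_k)_k)$; $\mathcal F=\mathcal F_1$. The càdlàg adapted real process $X$ is a solution of $$X_t=x_0+\int_0^tb(s,X_s)\,ds+\int_0^ta(s,X_s)\,dW_s+\sum_{T_k\le t}c(X_{T_k-},\Lambda_k),\quad t\in[0,1].$$ $J=(J_k)_{k\ge1}$ is defined by $J_k=\Delta X_{T_k}=c(X_{T_k-},\Lambda_k)$ for $k\le K$ and $J_k=0$ for $k>K$. Extension. $\widetilde\Omega=\Omega\times\Omega'$ with the product probability carries in addition, independently of $\Omega$, mutually independent $U_k$ (uniform on $[0,1]$), $N_k^-,N_k^+$ (standard Gaussian), $k\ge1$. Estimator. $(u_n)$ is a sequence of positive numbers tending to $0$. Set $\hat i_1^n=\inf\{0\le i\le n-1: |X_{(i+1)/n}-X_{i/n}|\ge u_n\}$ and, for $k\ge2$, $\hat i_k^n=\inf\{\hat i_{k-1}^n<i\le n-1:|X_{(i+1)/n}-X_{i/n}|\ge u_n\}$, with $\inf\varnothing=+\infty$.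 Let $\widehat K_n=\sup\{k\ge1:\hat i_k^n<\infty\}$ be the number of increments exceeding the threshold, and $\widehat J^n_k=X_{(\hat i_k^n+1)/n}-X_{\hat i_k^n/n}$ if $k\le\widehat K_n$, $\widehat J_k^n=0$ if $k>\widehat K_n$. Stable convergence in law with respect to $\mathcal F$: $V_n\to V$ stably if $(V_n,Y)\to(V,Y)$ in law for every $\mathcal F$-measurable random variable $Y$, $V$ being defined on the extension $\widetilde\Omega$. *)

theory Defs
  imports "HOL-Probability.Probability" "HOL-Library.Landau_Symbols" "HOL-Library.Extended_Nat"
begin

text \<open>
  Sequences are indexed from 0: \<open>T k\<close>, \<open>\<Lambda> k\<close>, \<open>Z k\<close>, \<open>thr_index u n x k\<close>, ... are the \<open>(k+1)\<close>-st
  jump time, mark, limit variable, exceedance index, ... Hence "\<open>k \<le> K\<close>" for \<open>k \<ge> 1\<close> reads \<open>k < K\<close>.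
  Processes are functions of a real time of which only the values on \<open>[0,1]\<close> matter.
\<close>

section \<open>Paths\<close>

definition cadlag_on_unit :: "(real \<Rightarrow> real) \<Rightarrow> bool" where
  "cadlag_on_unit x \<longleftrightarrow>
     (\<forall>t\<in>{0..<1}. continuous (at_right t) x) \<and> (\<forall>t\<in>{0<..1}. \<exists>l. (x \<longlongrightarrow> l) (at_left t))"

definition left_lim :: "(real \<Rightarrow> real) \<Rightarrow> real \<Rightarrow> real" where
  "left_lim x t = Lim (at_left t) x"

section \<open>Brownian motion, jump times\<close>

definition standard_brownian_motion :: "'a measure \<Rightarrow> (real \<Rightarrow> 'a \<Rightarrow> real) \<Rightarrow> bool" where
  "standard_brownian_motion M W \<longleftrightarrow>
     prob_space M \<and>
     (\<forall>t\<in>{0..1}. W t \<in> borel_measurable M) \<and>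
     (AE \<omega> in M. W 0 \<omega> = 0) \<and>
     (\<forall>s t. 0 \<le> s \<and> s < t \<and> t \<le> 1 \<longrightarrow>
        distributed M lborel (\<lambda>\<omega>. W t \<omega> - W s \<omega>) (normal_density 0 (sqrt (t - s)))) \<and>
     (\<forall>m (\<tau>::nat \<Rightarrow> real). incseq \<tau> \<and> range \<tau> \<subseteq> {0..1} \<longrightarrow>
        prob_space.indep_vars M (\<lambda>_. borel) (\<lambda>i \<omega>. W (\<tau> (Suc i)) \<omega> - W (\<tau> i) \<omega>) {..<m}) \<and>
     (AE \<omega> in M. continuous_on {0..1} (\<lambda>t. W t \<omega>))"

definition num_jumps :: "(nat \<Rightarrow> 'b \<Rightarrow> real) \<Rightarrow> 'b \<Rightarrow> nat" where
  "num_jumps T \<omega> = card {k. T k \<omega> \<le> 1}"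

definition jump_times :: "'b measure \<Rightarrow> (nat \<Rightarrow> 'b \<Rightarrow> real) \<Rightarrow> bool" where
  "jump_times M T \<longleftrightarrow>
     prob_space M \<and>
     (\<forall>k. T k \<in> borel_measurable M) \<and>
     (AE \<omega> in M. incseq (\<lambda>k. T k \<omega>)) \<and>
     (AE \<omega> in M. finite {k. T k \<omega> \<le> 1}) \<and>
     (AE \<omega> in M. (\<forall>k<num_jumps T \<omega>. 0 < T k \<omega> \<and> T k \<omega> < 1) \<and>
                 (\<forall>k. Suc k < num_jumps T \<omega> \<longrightarrow> T k \<omega> < T (Suc k) \<omega>))"

text \<open>\<open>uniform_measure M A\<close> is the conditional probability given the event \<open>A\<close>.\<close>

definition jump_times_cond_density :: "'b measure \<Rightarrow> (nat \<Rightarrow> 'b \<Rightarrow> real) \<Rightarrow> bool" where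
  "jump_times_cond_density M T \<longleftrightarrow>
     (\<forall>k. measure M {\<omega> \<in> space M. num_jumps T \<omega> = k} > 0 \<longrightarrow>
        (\<exists>f. distributed (uniform_measure M {\<omega> \<in> space M. num_jumps T \<omega> = k})
               (\<Pi>\<^sub>M i\<in>{..<k}. lborel) (\<lambda>\<omega>. \<lambda>i\<in>{..<k}. T i \<omega>) f))"

section \<open>The probability space and its filtration\<close>

text \<open>The product space is completed, so that it carries the completed filtration.\<close>

definition model_measure :: "'a measure \<Rightarrow> 'b measure \<Rightarrow> ('a \<times> 'b) measure" where
  "model_measure M1 M2 = completion (M1 \<Otimes>\<^sub>M M2)"

definition raw_events ::
  "'a measure \<Rightarrow> 'b measure \<Rightarrow> (real \<Rightarrow> 'a \<Rightarrow> real) \<Rightarrow> (nat \<Rightarrow> 'b \<Rightarrow> real) \<Rightarrow> (nat \<Rightarrow> 'b \<Rightarrow> real) \<Rightarrow>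
    real \<Rightarrow> ('a \<times> 'b) set set"
where
  "raw_events M1 M2 W T \<Lambda> t =
     (let \<Omega> = space M1 \<times> space M2 in
      sigma_sets \<Omega>
       ({{\<omega>\<in>\<Omega>. W s (fst \<omega>) \<in> A} | s A. s \<in> {0..t} \<and> A \<in> sets borel} \<union>
        {{\<omega>\<in>\<Omega>. T k (snd \<omega>) \<in> A} | k A. A \<in> sets borel} \<union>
        {{\<omega>\<in>\<Omega>. \<Lambda> k (snd \<omega>) \<in> A} | k A. A \<in> sets borel} \<union>
        null_sets (model_measure M1 M2)))"

text \<open>Right-continuous regularisation on \<open>[0,1]\<close>; at the terminal time 1 there is nothing to regularise.\<close>

definition model_filtration ::
  "'a measure \<Rightarrow> 'b measure \<Rightarrow> (real \<Rightarrow> 'a \<Rightarrow> real) \<Rightarrow> (nat \<Rightarrow> 'b \<Rightarrow> real) \<Rightarrow> (nat \<Rightarrow> 'b \<Rightarrow> real) \<Rightarrow>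
    real \<Rightarrow> ('a \<times> 'b) measure"
where
  "model_filtration M1 M2 W T \<Lambda> t =
     sigma (space M1 \<times> space M2)
       (\<Inter>s\<in>{s\<in>{t..1}. t < s \<or> s = 1}. raw_events M1 M2 W T \<Lambda> s)"

section \<open>The Ito integral on the unit interval\<close>

definition progressive :: "(real \<Rightarrow> 'w measure) \<Rightarrow> (real \<Rightarrow> 'w \<Rightarrow> real) \<Rightarrow> bool" where
  "progressive F H \<longleftrightarrow>
     (\<forall>t\<in>{0..1}. (\<lambda>(s, \<omega>). H s \<omega>) \<in> borel_measurable (restrict_space borel {0..t} \<Otimes>\<^sub>M F t))"

definition tendsto_in_prob :: "'w measure \<Rightarrow> (nat \<Rightarrow> 'w \<Rightarrow> real) \<Rightarrow> ('w \<Rightarrow> real) \<Rightarrow> bool" where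
  "tendsto_in_prob P Y Y' \<longleftrightarrow>
     (\<forall>n. Y n \<in> borel_measurable P) \<and> Y' \<in> borel_measurable P \<and>
     (\<forall>\<epsilon>>0. (\<lambda>n. measure P {\<omega> \<in> space P. \<bar>Y n \<omega> - Y' \<omega>\<bar> > \<epsilon>}) \<longlonglongrightarrow> 0)"

text \<open>
  The data \<open>m\<close>, \<open>\<tau>\<close>, \<open>\<xi>\<close> encode the simple predictable integrand
  \<open>\<Sum>i<m. \<xi> i * indicator {\<tau> i<..\<tau> (i+1)}\<close>.
\<close>

definition simple_data ::
  "'w measure \<Rightarrow> (real \<Rightarrow> 'w measure) \<Rightarrow> nat \<Rightarrow> (nat \<Rightarrow> real) \<Rightarrow> (nat \<Rightarrow> 'w \<Rightarrow> real) \<Rightarrow> bool"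
where
  "simple_data P F m \<tau> \<xi> \<longleftrightarrow>
     incseq \<tau> \<and> range \<tau> \<subseteq> {0..1} \<and>
     (\<forall>i<m. \<xi> i \<in> borel_measurable (F (\<tau> i)) \<and> (\<exists>C. \<forall>\<omega>\<in>space P. \<bar>\<xi> i \<omega>\<bar> \<le> C))"

definition simple_integrand :: "nat \<Rightarrow> (nat \<Rightarrow> real) \<Rightarrow> (nat \<Rightarrow> 'w \<Rightarrow> real) \<Rightarrow> real \<Rightarrow> 'w \<Rightarrow> real" where
  "simple_integrand m \<tau> \<xi> s \<omega> = (\<Sum>i<m. \<xi> i \<omega> * indicator {\<tau> i<..\<tau> (Suc i)} s)"

definition simple_integral ::
  "(real \<Rightarrow> 'w \<Rightarrow> real) \<Rightarrow> nat \<Rightarrow> (nat \<Rightarrow> real) \<Rightarrow> (nat \<Rightarrow> 'w \<Rightarrow> real) \<Rightarrow> real \<Rightarrow> 'w \<Rightarrow> real"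
where
  "simple_integral W m \<tau> \<xi> t \<omega> =
     (\<Sum>i<m. \<xi> i \<omega> * (W (min t (\<tau> (Suc i))) \<omega> - W (min t (\<tau> i)) \<omega>))"

text \<open>
  \<open>I\<close> is (a version with continuous paths of) the Ito integral process \<open>\<integral>\<^sub>0\<^sup>t H\<^sub>s dW\<^sub>s\<close>, \<open>t \<in> [0,1]\<close>, of a
  progressive \<open>H\<close> with \<open>\<integral>\<^sub>0\<^sup>1 H\<^sub>s\<^sup>2 ds < \<infinity>\<close> a.s.: the limit in probability of the integrals of simple
  integrands \<open>H\<^sup>n\<close> such that \<open>\<integral>\<^sub>0\<^sup>1 (H\<^sup>n\<^sub>s - H\<^sub>s)\<^sup>2 ds\<close> tends to 0 in probability. The limit depends neither
  on the choice of the \<open>H\<^sup>n\<close> nor, up to indistinguishability, on the version.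
\<close>

definition is_ito_integral ::
  "'w measure \<Rightarrow> (real \<Rightarrow> 'w measure) \<Rightarrow> (real \<Rightarrow> 'w \<Rightarrow> real) \<Rightarrow> (real \<Rightarrow> 'w \<Rightarrow> real) \<Rightarrow>
    (real \<Rightarrow> 'w \<Rightarrow> real) \<Rightarrow> bool"
where
  "is_ito_integral P F W H I \<longleftrightarrow>
     progressive F H \<and>
     (AE \<omega> in P. (\<integral>\<^sup>+s\<in>{0..1}. ennreal ((H s \<omega>)\<^sup>2) \<partial>lborel) < \<infinity>) \<and>
     (\<forall>t\<in>{0..1}. I t \<in> borel_measurable (F t)) \<and>
     (AE \<omega> in P. continuous_on {0..1} (\<lambda>t. I t \<omega>)) \<and>
     (\<exists>m \<tau> \<xi>.
        (\<forall>n. simple_data P F (m n) (\<tau> n) (\<xi> n)) \<and>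
        (\<forall>\<epsilon>>0. (\<lambda>n. measure P {\<omega> \<in> space P.
            (\<integral>\<^sup>+s\<in>{0..1}. ennreal ((simple_integrand (m n) (\<tau> n) (\<xi> n) s \<omega> - H s \<omega>)\<^sup>2) \<partial>lborel)
              > ennreal \<epsilon>}) \<longlonglongrightarrow> 0) \<and>
        (\<forall>t\<in>{0..1}. tendsto_in_prob P (\<lambda>n. simple_integral W (m n) (\<tau> n) (\<xi> n) t) (I t)))"

section \<open>The jump diffusion\<close>

definition solves_jump_sde ::
  "'a measure \<Rightarrow> 'b measure \<Rightarrow> (real \<Rightarrow> 'a \<Rightarrow> real) \<Rightarrow> (nat \<Rightarrow> 'b \<Rightarrow> real) \<Rightarrow> (nat \<Rightarrow> 'b \<Rightarrow> real) \<Rightarrow>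
    real \<Rightarrow> (real \<Rightarrow> real \<Rightarrow> real) \<Rightarrow> (real \<Rightarrow> real \<Rightarrow> real) \<Rightarrow> (real \<Rightarrow> real \<Rightarrow> real) \<Rightarrow>
    (real \<Rightarrow> 'a \<times> 'b \<Rightarrow> real) \<Rightarrow> bool"
where
  "solves_jump_sde M1 M2 W T \<Lambda> x0 b a c X \<longleftrightarrow>
     (\<exists>I. is_ito_integral (model_measure M1 M2) (model_filtration M1 M2 W T \<Lambda>)
            (\<lambda>t \<omega>. W t (fst \<omega>)) (\<lambda>s \<omega>. a s (X s \<omega>)) I \<and>
          (AE \<omega> in model_measure M1 M2. \<forall>t\<in>{0..1}.
             X t \<omega> = x0 + (LINT s:{0..t}|lborel. b s (X s \<omega>)) + I t \<omega> +
               (\<Sum>k | T k (snd \<omega>) \<le> t.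
                  c (left_lim (\<lambda>s. X s \<omega>) (T k (snd \<omega>))) (\<Lambda> k (snd \<omega>)))))"

definition jump_size ::
  "(nat \<Rightarrow> 'b \<Rightarrow> real) \<Rightarrow> (real \<Rightarrow> 'a \<times> 'b \<Rightarrow> real) \<Rightarrow> nat \<Rightarrow> 'a \<times> 'b \<Rightarrow> real"
where
  "jump_size T X k \<omega> =
     (if k < num_jumps T (snd \<omega>)
      then X (T k (snd \<omega>)) \<omega> - left_lim (\<lambda>s. X s \<omega>) (T k (snd \<omega>)) else 0)"

section \<open>The estimator, as a function of the observed path\<close>

definition increment :: "nat \<Rightarrow> (real \<Rightarrow> real) \<Rightarrow> nat \<Rightarrow> real" where
  "increment n x i = x (real (i + 1) / real n) - x (real i / real n)"

primrec thr_index :: "real \<Rightarrow> nat \<Rightarrow> (real \<Rightarrow> real) \<Rightarrow> nat \<Rightarrow> enat" where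
  "thr_index u n x 0 = Inf {enat i | i. i < n \<and> \<bar>increment n x i\<bar> \<ge> u}"
| "thr_index u n x (Suc k) =
     Inf {enat i | i. thr_index u n x k < enat i \<and> i < n \<and> \<bar>increment n x i\<bar> \<ge> u}"

text \<open>The supremum of the empty set of naturals is 0.\<close>

definition num_exceed :: "real \<Rightarrow> nat \<Rightarrow> (real \<Rightarrow> real) \<Rightarrow> nat" where
  "num_exceed u n x = Sup {Suc k | k. thr_index u n x k < \<infinity>}"

definition jump_estimator :: "real \<Rightarrow> nat \<Rightarrow> (real \<Rightarrow> real) \<Rightarrow> nat \<Rightarrow> real" where
  "jump_estimator u n x k =
     (if k < num_exceed u n x then increment n x (the_enat (thr_index u n x k)) else 0)"

section \<open>The extension and the limit\<close>

definition extension_variables ::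
  "'e measure \<Rightarrow> (nat \<Rightarrow> 'e \<Rightarrow> real) \<Rightarrow> (nat \<Rightarrow> 'e \<Rightarrow> real) \<Rightarrow> (nat \<Rightarrow> 'e \<Rightarrow> real) \<Rightarrow> bool"
where
  "extension_variables M' U Nm Np \<longleftrightarrow>
     prob_space M' \<and>
     prob_space.indep_vars M' (\<lambda>_. borel) (case_sum U (case_sum Nm Np))
       (UNIV :: (nat + nat + nat) set) \<and>
     (\<forall>k. distr M' lborel (U k) = uniform_measure lborel {0..1}) \<and>
     (\<forall>k. distributed M' lborel (Nm k) std_normal_density) \<and>
     (\<forall>k. distributed M' lborel (Np k) std_normal_density)"

definition limit_var ::
  "(nat \<Rightarrow> 'b \<Rightarrow> real) \<Rightarrow> (real \<Rightarrow> real \<Rightarrow> real) \<Rightarrow> (real \<Rightarrow> 'a \<times> 'b \<Rightarrow> real) \<Rightarrow>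
    (nat \<Rightarrow> 'e \<Rightarrow> real) \<Rightarrow> (nat \<Rightarrow> 'e \<Rightarrow> real) \<Rightarrow> (nat \<Rightarrow> 'e \<Rightarrow> real) \<Rightarrow>
    nat \<Rightarrow> ('a \<times> 'b) \<times> 'e \<Rightarrow> real"
where
  "limit_var T a X U Nm Np k = (\<lambda>(\<omega>, \<omega>').
     if k < num_jumps T (snd \<omega>) then
       (let t = T k (snd \<omega>) in
        sqrt (U k \<omega>') * a t (left_lim (\<lambda>s. X s \<omega>) t) * Nm k \<omega>' +
        sqrt (1 - U k \<omega>') * a t (X t \<omega>) * Np k \<omega>')
     else 0)"

section \<open>Convergence in law and stable convergence\<close>

text \<open>Convergence in law of \<open>V n\<close>, defined under \<open>P\<close>, to \<open>V'\<close>, defined under \<open>Q\<close>, in the topological space \<open>S\<close>.\<close>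

definition converges_in_law ::
  "'s topology \<Rightarrow> 'w measure \<Rightarrow> (nat \<Rightarrow> 'w \<Rightarrow> 's) \<Rightarrow> 'v measure \<Rightarrow> ('v \<Rightarrow> 's) \<Rightarrow> bool"
where
  "converges_in_law S P V Q V' \<longleftrightarrow>
     (\<forall>f. continuous_map S euclideanreal f \<and> bounded (f ` topspace S) \<longrightarrow>
        (\<lambda>n. \<integral>\<omega>. f (V n \<omega>) \<partial>P) \<longlonglongrightarrow> (\<integral>\<omega>. f (V' \<omega>) \<partial>Q))"

text \<open>
  For sequences \<open>V n = (V n k)\<^sub>k\<close> of real random variables: convergence of the finite-dimensional
  marginals, the marginal of index set \<open>I\<close> living in the space of functions on \<open>I\<close>.
\<close>

definition fidi_converges_in_law ::
  "'w measure \<Rightarrow> (nat \<Rightarrow> nat \<Rightarrow> 'w \<Rightarrow> real) \<Rightarrow> 'v measure \<Rightarrow> (nat \<Rightarrow> 'v \<Rightarrow> real) \<Rightarrow> bool"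
where
  "fidi_converges_in_law P V Q V' \<longleftrightarrow>
     (\<forall>n k. V n k \<in> borel_measurable P) \<and> (\<forall>k. V' k \<in> borel_measurable Q) \<and>
     (\<forall>I. finite I \<longrightarrow>
        converges_in_law (product_topology (\<lambda>_. euclideanreal) I)
          P (\<lambda>n \<omega>. \<lambda>k\<in>I. V n k \<omega>) Q (\<lambda>\<omega>. \<lambda>k\<in>I. V' k \<omega>))"

text \<open>Here \<open>V'\<close> lives on the product extension \<open>P \<Otimes>\<^sub>M M'\<close>, to which \<open>Y\<close> is extended by \<open>fst\<close>.\<close>

definition fidi_converges_stably ::
  "'w measure \<Rightarrow> 'w measure \<Rightarrow> (nat \<Rightarrow> nat \<Rightarrow> 'w \<Rightarrow> real) \<Rightarrow> 'e measure \<Rightarrow>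
    (nat \<Rightarrow> 'w \<times> 'e \<Rightarrow> real) \<Rightarrow> bool"
where
  "fidi_converges_stably P G V M' V' \<longleftrightarrow>
     (\<forall>n k. V n k \<in> borel_measurable P) \<and> (\<forall>k. V' k \<in> borel_measurable (P \<Otimes>\<^sub>M M')) \<and>
     (\<forall>I (Y :: 'w \<Rightarrow> real). finite I \<and> Y \<in> borel_measurable G \<longrightarrow>
        converges_in_law (prod_topology (product_topology (\<lambda>_. euclideanreal) I) euclideanreal)
          P (\<lambda>n \<omega>. (\<lambda>k\<in>I. V n k \<omega>, Y \<omega>))
          (P \<Otimes>\<^sub>M M') (\<lambda>\<omega>. (\<lambda>k\<in>I. V' k \<omega>, Y (fst \<omega>))))"

end

theory Submission
  imports Defs "HOL-Probability.Probability" "HOL-Real_Asymp.Real_Asymp"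
begin

text \<open>
Around a jump time \<open>T\<close> the increment of \<open>X\<close> over the grid interval containing \<open>T\<close> is the jump plus
\<open>a(T, X\<^bsub>T-\<^esub>)\<close> times the Brownian increment before \<open>T\<close>, plus \<open>a(T, X\<^sub>T)\<close> times the increment after \<open>T\<close>, up to
\<open>o(n\<^bsup>-1/2\<^esup>)\<close>. Three facts give the limit law.

Detection: the increments of the continuous martingale part over all \<open>n\<close> grid intervals stay below
\<open>u n / 2\<close> with probability tending to 1, since \<open>n u\<^sub>n\<^sup>2\<close> grows like a power of \<open>n\<close>, whereas the increments
containing a jump stay away from 0; so the exceedances are exactly the grid intervals with a jump
(\<open>increments_below_threshold\<close>, \<open>estimator_expansion\<close>).

Linearisation: no moment of the coefficient is available, so the stochastic integral is controlled by
an exponential inequality on the event that the quadratic variation is small. The jump times are known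
at time 0 in the filtration, and are independent of \<open>W\<close>; an interval with such random endpoints is a limit
of countably many deterministic ones, whence \<open>deviation_random_times\<close>, \<open>local_error_tendsto_0\<close> and
\<open>remainder_tendsto_0\<close>.

Mixing: given the jump times, the two normalised Brownian increments on either side of \<open>T\<close> are
independent centred Gaussians with variances \<open>frc (n T)\<close> and \<open>1 - frc (n T)\<close>. As \<open>(T\<^sub>1, ..., T\<^sub>\<kappa>)\<close> has a density, the
fractional parts become uniform and independent of everything (\<open>torus_equidistribution\<close>, a
Riemann-Lebesgue argument by averaging over translations). Increments near the jump times for
different \<open>n\<close> are taken over disjoint intervals once a short piece next to \<open>T\<close> is removed, so the centred test
functions are orthogonal and tend weakly to 0 (\<open>renyi_weakly_null\<close>, \<open>trim_dev_weakly_null\<close>). Hence the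
increments are asymptotically independent of every event of the space (\<open>increments_mixing\<close>), and
mixing upgrades to joint convergence with the random coefficients (\<open>stable_from_mixing\<close>).

The event that there are exactly \<open>kp\<close> jumps is treated separately for each \<open>kp\<close>. Throughout, \<open>om\<close> is a
sample point, \<open>th\<close> a vector of times, and \<open>---->\<close> is convergence of sequences.
\<close>

abbreviation (input) LIMSEQ_ascii :: "(nat => 'a::topological_space) => 'a => bool" (infixr "---->" 60) where
 "X ----> L == filterlim X (nhds L) sequentially"

section \<open>Asymptotic orthogonality and equidistribution on the torus\<close>

lemma abs_integral_le:
 fixes f g :: "'a => real"
 assumes "integrable M f" "integrable M g" "\<And>x. x : space M ==> \<bar>f x\<bar> <= g x"
 shows "\<bar>\<integral>x. f x \<partial>M\<bar> <= (\<integral>x. g x \<partial>M)"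
proof -
 have "\<bar>\<integral>x. f x \<partial>M\<bar> <= (\<integral>x. \<bar>f x\<bar> \<partial>M)" by (rule integral_abs_bound)
 also have "... <= (\<integral>x. g x \<partial>M)" using assms by (intro integral_mono) auto
 finally show ?thesis .
qed

lemma AE_pair_fst:
 assumes "sigma_finite_measure N" "AE x in M. P x"
 shows "AE z in M \<Otimes>\<^sub>M N. P (fst z)"
proof -
 interpret N: sigma_finite_measure N by fact
 obtain S where S: "S : null_sets M" "{x : space M. \<not> P x} \<subseteq> S" using assms(2) by (auto simp: eventually_ae_filter)
 have "S \<times> space N : null_sets (M \<Otimes>\<^sub>M N)"
  using S(1) by (auto simp: null_sets_def N.emeasure_pair_measure_Times)
 then show ?thesis by (rule AE_I') (use S(2) in \<open>auto simp: space_pair_measure\<close>)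
qed

text \<open>Bessel's inequality: were the integrals against \<open>Z\<close> bounded away from 0 along a subsequence, a further
subsequence would be orthogonal, and the projection of \<open>Z\<close> on it would have infinite square norm.\<close>

lemma renyi_weakly_null:
 fixes h :: "nat => 'a => real" and Z :: "'a => real"
 assumes "prob_space M"
  and hm [measurable]: "\<And>n. h n : borel_measurable M"
  and hb: "\<And>n x. x : space M ==> \<bar>h n x\<bar> <= C"
  and orth: "\<And>n. EX N. \<forall>m\<ge>N. (\<integral>x. h n x * h m x \<partial>M) = 0"
  and Zm [measurable]: "Z : borel_measurable M"
  and Zb: "\<And>x. x : space M ==> \<bar>Z x\<bar> <= B"
 shows "(%n. \<integral>x. Z x * h n x \<partial>M) ----> 0"
proof (rule ccontr)
 interpret prob_space M by fact
 assume "\<not> ?thesis"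
 then obtain e where e: "e > 0" "\<And>N. \<exists>n\<ge>N. \<bar>\<integral>x. Z x * h n x \<partial>M\<bar> >= e"
  unfolding LIMSEQ_iff by (auto simp: not_less)
 obtain N where N: "\<And>n m. m >= N n ==> (\<integral>x. h n x * h m x \<partial>M) = 0"
  using orth by metis
 have "EX r. ALL j. \<bar>\<integral>x. Z x * h (r j) x \<partial>M\<bar> >= e & (r j < r (Suc j) & (\<forall>i\<le>r j. N i <= r (Suc j)))"
 proof (rule dependent_nat_choice)
  show "EX n. \<bar>\<integral>x. Z x * h n x \<partial>M\<bar> >= e" using e(2)[of 0] by auto
  fix x and n :: nat
  obtain y where y: "y >= Suc x + (\<Sum>i\<le>x. N i)" "\<bar>\<integral>z. Z z * h y z \<partial>M\<bar> >= e" using e(2) by blast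
  have "N i <= y" if "i <= x" for i
  proof -
   have "N i <= (\<Sum>i\<le>x. N i)" using that by (intro member_le_sum) auto
   then show ?thesis using y(1) by simp
  qed
  then show "EX y. \<bar>\<integral>z. Z z * h y z \<partial>M\<bar> >= e & (x < y & (\<forall>i\<le>x. N i <= y))"
   using y by (intro exI[of _ y]) auto
 qed
 then obtain r where r: "\<And>j. \<bar>\<integral>x. Z x * h (r j) x \<partial>M\<bar> >= e" "\<And>j. r j < r (Suc j)"
  "\<And>i j. i <= r j ==> N i <= r (Suc j)" by blast
 have sm: "strict_mono r" using r(2) by (simp add: strict_mono_Suc_iff)
 have cross: "(\<integral>x. h (r i) x * h (r j) x \<partial>M) = 0" if "i < j" for i j
 proof (rule N)
  obtain j' where j': "j = Suc j'" using \<open>i < j\<close> by (cases j) auto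
  have "r i <= r j'" using that j' sm by (simp add: strict_mono_less_eq)
  then show "N (r i) <= r j" using r(3) j' by simp
 qed
 have cross': "(\<integral>x. h (r i) x * h (r j) x \<partial>M) = 0" if "i ~= j" for i j
  using cross[of i j] cross[of j i] that by (cases "i < j") (auto simp: mult.commute)
 have Cpos: "C >= 0" using hb not_empty by (metis abs_ge_zero all_not_in_conv order_trans)
 have Bpos: "B >= 0" using Zb not_empty by (metis abs_ge_zero all_not_in_conv order_trans)
 define D where "D = C + 1"
 have D: "D > 0" "\<And>n x. x : space M ==> \<bar>h n x\<bar> <= D" unfolding D_def using Cpos hb by (simp, meson add_increasing2 zero_le_one)
 define s where "s j = sgn (\<integral>x. Z x * h (r j) x \<partial>M)" for j
 have s: "s j * (\<integral>x. Z x * h (r j) x \<partial>M) >= e" "\<bar>s j\<bar> <= 1" for j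
  using r(1)[of j] by (auto simp: s_def sgn_if)
 \<comment> \<open>This multiple minimises the resulting quadratic bound.\<close>
 define lam where "lam = e / D\<^sup>2"
 have lam: "lam > 0" using e D by (simp add: lam_def)
 have ib: "integrable M f" if "f : borel_measurable M" "\<And>x. x : space M ==> \<bar>f x\<bar> <= c" for f :: "'a => real" and c
  using that by (intro integrable_const_bound[where B=c]) auto
 have iZ: "integrable M (%x. Z x * h n x)" for n
  using Zb hb by (intro ib[of _ "B*C"]) (auto simp: abs_mult intro!: mult_mono Bpos)
 have ih: "integrable M (%x. h n x * h m x)" for n m
  using hb by (intro ib[of _ "C*C"]) (auto simp: abs_mult intro!: mult_mono Cpos)
 have iZZ: "integrable M (%x. Z x * Z x)"
  by (intro ib[of _ "B*B"]) (measurable, simp only: abs_mult, intro mult_mono Zb, auto simp: Bpos)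
 \<comment> \<open>Bessel's inequality for the almost orthonormal signed family\<close>
 have bessel: "real L * (e\<^sup>2 / D\<^sup>2) <= (\<integral>x. Z x * Z x \<partial>M)" for L
 proof -
  have "0 <= (\<integral>x. (Z x - lam * (\<Sum>j<L. s j * h (r j) x))\<^sup>2 \<partial>M)"
   by (intro integral_nonneg_AE) auto
  also have "... = (\<integral>x. Z x * Z x - 2 * lam * (\<Sum>j<L. s j * (Z x * h (r j) x))
    + lam\<^sup>2 * (\<Sum>i<L. \<Sum>j<L. s i * s j * (h (r i) x * h (r j) x)) \<partial>M)"
   by (intro Bochner_Integration.integral_cong refl)
    (simp add: power2_eq_square algebra_simps sum_distrib_left sum_distrib_right sum_product)
  also have "... = (\<integral>x. Z x * Z x \<partial>M) - 2 * lam * (\<Sum>j<L. s j * (\<integral>x. Z x * h (r j) x \<partial>M))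
    + lam\<^sup>2 * (\<Sum>i<L. \<Sum>j<L. s i * s j * (\<integral>x. h (r i) x * h (r j) x \<partial>M))"
   using iZ ih iZZ by (simp add: Bochner_Integration.integral_sum)
  also have "(\<Sum>i<L. \<Sum>j<L. s i * s j * (\<integral>x. h (r i) x * h (r j) x \<partial>M))
    = (\<Sum>i<L. s i * s i * (\<integral>x. h (r i) x * h (r i) x \<partial>M))"
  proof (intro sum.cong refl)
   fix i assume "i : {..<L}"
   then have "(\<Sum>j<L. s i * s j * (\<integral>x. h (r i) x * h (r j) x \<partial>M))
    = (\<Sum>j<L. if j = i then s i * s i * (\<integral>x. h (r i) x * h (r i) x \<partial>M) else 0)"
    using cross' by (intro sum.cong) auto
   then show "(\<Sum>j<L. s i * s j * (\<integral>x. h (r i) x * h (r j) x \<partial>M)) = s i * s i * (\<integral>x. h (r i) x * h (r i) x \<partial>M)"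
    using \<open>i : {..<L}\<close> by (simp add: sum.delta)
  qed
  also have "(\<Sum>i<L. s i * s i * (\<integral>x. h (r i) x * h (r i) x \<partial>M)) <= (\<Sum>i<L. 1 * D\<^sup>2)"
  proof (intro sum_mono mult_mono)
   fix i
   show "s i * s i <= 1" using s(2)[of i] by (metis abs_mult_self_eq abs_ge_zero mult_le_one)
   have "(\<integral>x. h (r i) x * h (r i) x \<partial>M) <= (\<integral>x. D\<^sup>2 \<partial>M)"
   proof (intro integral_mono ih)
    fix x assume "x : space M"
    then show "h (r i) x * h (r i) x <= D\<^sup>2" using D(2)[of x "r i"] D(1)
    by (metis abs_le_square_iff abs_of_pos power2_eq_square)
   qed simp
   then show "(\<integral>x. h (r i) x * h (r i) x \<partial>M) <= D\<^sup>2" by (simp add: prob_space)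
   show "0 <= (\<integral>x. h (r i) x * h (r i) x \<partial>M)" by (intro integral_nonneg_AE) auto
  qed auto
  finally have 1: "0 <= (\<integral>x. Z x * Z x \<partial>M) - 2 * lam * (\<Sum>j<L. s j * (\<integral>x. Z x * h (r j) x \<partial>M)) + lam\<^sup>2 * (real L * D\<^sup>2)"
   by (simp add: mult_left_mono)
  have "(\<Sum>j<L. e) <= (\<Sum>j<L. s j * (\<integral>x. Z x * h (r j) x \<partial>M))" by (intro sum_mono s)
  then have "2 * lam * (real L * e) <= 2 * lam * (\<Sum>j<L. s j * (\<integral>x. Z x * h (r j) x \<partial>M))"
   using lam by (intro mult_left_mono) auto
  then have "2 * lam * (real L * e) - lam\<^sup>2 * (real L * D\<^sup>2) <= (\<integral>x. Z x * Z x \<partial>M)" using 1 by linarith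
  moreover have "2 * lam * (real L * e) - lam\<^sup>2 * (real L * D\<^sup>2) = real L * (e\<^sup>2 / D\<^sup>2)"
   using D by (simp add: lam_def field_simps power2_eq_square)
  ultimately show ?thesis by simp
 qed
 have "e\<^sup>2 / D\<^sup>2 > 0" using e D by simp
 then obtain L :: nat where "(\<integral>x. Z x * Z x \<partial>M) < real L * (e\<^sup>2 / D\<^sup>2)" using reals_Archimedean3 by blast
 then show False using bessel[of L] by simp
qed

text \<open>The fractional part with values in \<open>(0, 1]\<close>: a jump at a grid point belongs to the interval ending there.\<close>

definition frc :: "real => real" where "frc x = x - of_int \<lceil>x\<rceil> + 1"

lemma frc_measurable [measurable]: "frc : borel_measurable borel"
 unfolding frc_def by measurable

lemma frc_bounds: "0 < frc x" "frc x <= 1"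
 unfolding frc_def by linarith+

lemma frc_add_int: "frc (x + of_int k) = frc x"
 by (simp add: frc_def)

lemma frc_cases:
 assumes "0 < x" "x <= 1" "0 <= d" "d < 1"
 shows "frc (x + d) = (if x <= 1 - d then x + d else x + d - 1)"
proof (cases "x <= 1 - d")
 case True
 then have "\<lceil>x + d\<rceil> = 1" using assms by (intro ceiling_unique) auto
 then show ?thesis using True by (simp add: frc_def)
next
 case False
 then have "\<lceil>x + d\<rceil> = 2" using assms by (intro ceiling_unique) auto
 then show ?thesis using False by (simp add: frc_def)
qed

abbreviation unif :: "real measure" where "unif \<equiv> uniform_measure lborel {0..1}"

lemma prob_space_unif: "prob_space unif"
 by (rule prob_space_uniform_measure) auto

lemma emeasure_unif:
 assumes "A : sets borel" shows "emeasure unif A = emeasure lborel ({0<..1} Int A)"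
proof -
 have "emeasure unif A = emeasure lborel ({0..1} Int A)"
  using assms by (simp add: emeasure_uniform_measure divide_ennreal_def)
 also have "... = emeasure lborel ({0<..1} Int A)"
 proof (rule emeasure_eq_AE)
  have "AE x in lborel. x ~= (0::real)" by (rule AE_lborel_singleton)
  then show "AE x in lborel. x : {0..1} Int A \<longleftrightarrow> x : {0<..1::real} Int A" by eventually_elim auto
 qed (use assms in auto)
 finally show ?thesis .
qed

lemma emeasure_lborel_shift:
 assumes "A : sets borel"
 shows "emeasure lborel {x. x + d : A} = emeasure lborel (A :: real set)"
proof -
 have "emeasure lborel A = emeasure (distr lborel borel ((+) d)) A" by (simp add: lborel_distr_plus)
 also have "... = emeasure lborel {x. x + d : A}"
  using assms by (subst emeasure_distr) (auto simp: vimage_def add.commute)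
 finally show ?thesis by simp
qed

lemma distr_unif_frc_shift: "distr unif borel (%x. frc (x + c)) = unif"
proof (rule measure_eqI)
 fix A assume "A : sets (distr unif borel (%x. frc (x + c)))"
 then have A [measurable]: "A : sets borel" by simp
 define d where "d = c - of_int \<lfloor>c\<rfloor>"
 have d: "0 <= d" "d < 1" unfolding d_def by linarith+
 have eq: "frc (x + c) = frc (x + d)" for x
  using frc_add_int[of "x + d" "\<lfloor>c\<rfloor>"] by (simp add: d_def)
 have "emeasure (distr unif borel (%x. frc (x + c))) A = emeasure unif {x. frc (x + d) : A}"
  by (subst emeasure_distr) (auto simp: eq vimage_def)
 also have "... = emeasure lborel ({0<..1} Int {x. frc (x + d) : A})"
  by (rule emeasure_unif) measurable
 also have "{0<..1} Int {x. frc (x + d) : A} =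
  {x. x + d : {d<..1} Int A} Un {x. x + (d - 1) : {0<..d} Int A}"
  using d by (auto simp: frc_cases split: if_splits) (auto simp: algebra_simps)
 also have "emeasure lborel ... = emeasure lborel {x. x + d : {d<..1} Int A}
   + emeasure lborel {x. x + (d - 1) : {0<..d} Int A}"
  by (rule plus_emeasure[symmetric]) (auto, measurable)
 also have "... = emeasure lborel ({d<..1} Int A) + emeasure lborel ({0<..d} Int A)"
 proof (rule arg_cong2[where f="(+)"])
  have "{d<..1} Int A : sets borel" "{0<..d} Int A : sets borel" by measurable
  then show "emeasure lborel {x. x + d : {d<..1} Int A} = emeasure lborel ({d<..1} Int A)"
   "emeasure lborel {x. x + (d - 1) : {0<..d} Int A} = emeasure lborel ({0<..d} Int A)"
   by (simp_all only: emeasure_lborel_shift)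
 qed
 also have "... = emeasure lborel (({d<..1} Int A) Un ({0<..d} Int A))"
  by (rule plus_emeasure) auto
 also have "({d<..1} Int A) Un ({0<..d} Int A) = {0<..1} Int A" using d by auto
 also have "emeasure lborel ... = emeasure unif A" by (rule emeasure_unif[symmetric]) simp
 finally show "emeasure (distr unif borel (%x. frc (x + c))) A = emeasure unif A" .
qed simp

abbreviation torus :: "'i set => ('i => real) measure" where "torus I \<equiv> PiM I (%_. unif)"

lemma prob_space_torus: "prob_space (torus I)"
 by (intro prob_space_PiM prob_space_unif)

lemma sets_torus [measurable_cong]: "sets (torus I) = sets (PiM I (%_. borel))"
 by (rule sets_PiM_cong) auto

lemma distr_torus_shift:
 assumes "finite I"
 shows "distr (torus I) (torus I) (%t. \<lambda>i\<in>I. frc (t i + g i)) = torus I"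
proof -
 interpret product_prob_space "%_. unif" I
  by (rule product_prob_spaceI) (rule prob_space_unif)
 have [measurable]: "(%t. \<lambda>i\<in>I. frc (t i + g i)) : torus I \<rightarrow>\<^sub>M torus I"
  by (rule measurable_restrict) measurable
 show ?thesis
 proof (rule PiM_eqI)
  fix A assume A: "\<And>i. i : I ==> A i : sets unif"
  have "emeasure (distr (torus I) (torus I) (%t. \<lambda>i\<in>I. frc (t i + g i))) (Pi\<^sub>E I A) =
   emeasure (torus I) (Pi\<^sub>E I (%i. {x. frc (x + g i) : A i}))"
  proof (subst emeasure_distr)
   show "Pi\<^sub>E I A : sets (torus I)" using A assms by (intro sets_PiM_I_finite) auto
  qed (auto intro!: arg_cong2[where f=emeasure] simp: space_PiM PiE_def Pi_def extensional_def)
  also have "... = (\<Prod>i\<in>I. emeasure unif {x. frc (x + g i) : A i})"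
  proof (rule emeasure_PiM)
   fix i assume "i : I" then have [measurable]: "A i : sets borel" using A by simp
   have "{x. frc (x + g i) : A i} : sets borel" by measurable
   then show "{x. frc (x + g i) : A i} : sets unif" by simp
  qed (use assms in simp)
  also have "... = (\<Prod>i\<in>I. emeasure unif (A i))"
  proof (rule prod.cong[OF refl])
   fix i assume "i : I" then have [measurable]: "A i : sets borel" using A by simp
   have "emeasure unif (A i) = emeasure (distr unif borel (%x. frc (x + g i))) (A i)"
    by (simp add: distr_unif_frc_shift)
   also have "... = emeasure unif {x. frc (x + g i) : A i}"
    by (subst emeasure_distr) (auto simp: vimage_def)
   finally show "emeasure unif {x. frc (x + g i) : A i} = emeasure unif (A i)" by simp
  qed
  finally show "emeasure (distr (torus I) (torus I) (%t. \<lambda>i\<in>I. frc (t i + g i))) (Pi\<^sub>E I A) =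
   (\<Prod>i\<in>I. emeasure unif (A i))" .
 qed (use assms in auto)
qed


lemma sets_PiM_borel_boxes:
 assumes "finite I"
 shows "sets (PiM I (%_. borel :: real measure)) =
  sigma_sets (Pi\<^sub>E I (%_. UNIV)) (range (%b. {f : Pi\<^sub>E I (%_. UNIV). \<forall>i\<in>I. f i <= b i}))"
proof -
 have "sets (PiM I (%_. borel :: real measure)) = sets (PiM I (%_. sigma UNIV (range (%a::real. {..a}))))"
  by (simp add: borel_eq_atMost)
 also have "... = sets (sigma (Pi\<^sub>E I (%_. UNIV))
   {{f : Pi\<^sub>E I (%_. UNIV). \<forall>i\<in>j. f i : A i} | A j. j : {I} & A : Pi j (%_. range (%a::real. {..a}))})"
 proof (rule sets_PiM_sigma)
  fix i
  show "\<exists>S\<subseteq>range (%a::real. {..a}). countable S & UNIV = \<Union>S"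
   by (rule exI[of _ "range (%n::nat. {..real n})"]) (auto intro: real_arch_simple)
 qed (use assms in auto)
 also have "{{f : Pi\<^sub>E I (%_. UNIV). \<forall>i\<in>j. f i : A i} | A j. j : {I} & A : Pi j (%_. range (%a::real. {..a}))}
   = range (%b. {f : Pi\<^sub>E I (%_. UNIV). \<forall>i\<in>I. f i <= b i})"
 proof (intro set_eqI iffI)
  fix S assume "S : {{f : Pi\<^sub>E I (%_. UNIV). \<forall>i\<in>j. f i : A i} | A j. j : {I} & A : Pi j (%_. range (%a::real. {..a}))}"
  then obtain A where S: "S = {f : Pi\<^sub>E I (%_. UNIV). \<forall>i\<in>I. f i : A i}" and A: "A : Pi I (%_. range (%a::real. {..a}))"
   by auto
  from A have "\<forall>i\<in>I. EX b. A i = {..b}" by (auto simp: Pi_iff)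
  then obtain b where "\<forall>i\<in>I. A i = {..b i}" by metis
  then have "S = {f : Pi\<^sub>E I (%_. UNIV). \<forall>i\<in>I. f i <= b i}" using S by auto
  then show "S : range (%b. {f : Pi\<^sub>E I (%_. UNIV). \<forall>i\<in>I. f i <= b i})" by simp
 next
  fix S assume "S : range (%b. {f : Pi\<^sub>E I (%_. UNIV :: real set). \<forall>i\<in>I. f i <= b i})"
  then obtain b where "S = {f : Pi\<^sub>E I (%_. UNIV). \<forall>i\<in>I. f i : {..b i}}" by auto
  then show "S : {{f : Pi\<^sub>E I (%_. UNIV). \<forall>i\<in>j. f i : A i} | A j. j : {I} & A : Pi j (%_. range (%a::real. {..a}))}"
   by (intro CollectI exI[of _ "%i. {..b i}"] exI[of _ I]) auto
 qed
 finally show ?thesis by (auto simp: sets_measure_of_conv split: if_splits)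
qed

lemma frc_mult_frc: "frc (real n * frc x) = frc (real n * x)"
proof -
 have "real n * frc x = real n * x + of_int (int n * (1 - \<lceil>x\<rceil>))"
  by (simp add: frc_def algebra_simps)
 then show ?thesis using frc_add_int by metis
qed

lemma AE_unif:
 assumes "AE x in lborel. P x"
 shows "AE x in unif. P x & 0 < x & x < 1"
proof -
 have "AE x in lborel. x ~= (0::real)" "AE x in lborel. x ~= (1::real)" by (rule AE_lborel_singleton)+
 then have "AE x in lborel. x : {0..1} --> P x & 0 < x & x < 1"
  using assms by eventually_elim auto
 then show ?thesis by (intro AE_uniform_measureI) auto
qed

lemma frc_shift_tendsto:
 assumes "0 < x" "x < 1"
 shows "(%n. frc (x + g / real n)) ----> x"
proof -
 have l: "(%n. x + g / real n) ----> x + 0" by (intro tendsto_intros lim_const_over_n)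
 have "eventually (%n. 0 < x + g / real n) sequentially" "eventually (%n. x + g / real n < 1) sequentially"
  using order_tendstoD[OF l] assms by auto
 then have "eventually (%n. x + g / real n = frc (x + g / real n)) sequentially"
 proof eventually_elim
  case (elim n)
  then have "\<lceil>x + g / real n\<rceil> = 1" by (intro ceiling_unique) auto
  then show ?case by (simp add: frc_def)
 qed
 then show ?thesis using l by (auto elim: Lim_transform_eventually)
qed

lemma measurable_torus_maps [measurable]:
 "(%t. \<lambda>i\<in>I. frc (real n * t i)) : torus I \<rightarrow>\<^sub>M PiM I (%_. borel)"
 "(%(t, g). \<lambda>i\<in>I. frc (t i + g i / real n)) : torus I \<Otimes>\<^sub>M torus I \<rightarrow>\<^sub>M PiM I (%_. borel)"
 "(%(t, g). \<lambda>i\<in>I. frc (real n * t i + g i)) : torus I \<Otimes>\<^sub>M torus I \<rightarrow>\<^sub>M PiM I (%_. borel)"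
 unfolding case_prod_beta
 by (rule measurable_restrict, measurable)+

text \<open>The measure is invariant under the translation by \<open>g / n\<close>, which turns \<open>frc (n t)\<close> into \<open>frc (n t + g)\<close>; averaging
over \<open>g\<close> makes the latter uniform, while the box moves only near its boundary as \<open>n\<close> grows.\<close>

lemma torus_equidistribution_box:
 fixes F :: "('i => real) => real"
 assumes I: "finite I"
  and F [measurable]: "F : borel_measurable (PiM I (%_. borel))"
  and Fb: "\<And>x. \<bar>F x\<bar> <= C"
  and A: "A = {f : Pi\<^sub>E I (%_. UNIV). \<forall>i\<in>I. f i <= b i}"
 shows "(%n. \<integral>t. indicator A t * F (\<lambda>i\<in>I. frc (real n * t i)) \<partial>torus I)
  ----> (\<integral>t. indicator A t \<partial>torus I) * (\<integral>t. F t \<partial>torus I)"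
proof -
 interpret T: prob_space "torus I" by (rule prob_space_torus)
 interpret TT: pair_prob_space "torus I" "torus I" ..
 have spT [simp]: "space (torus I) = Pi\<^sub>E I (%_. UNIV)" by (simp add: space_PiM)
 have [measurable]: "A : sets (PiM I (%_. borel))"
  using sets_PiM_borel_boxes[OF I] unfolding A by blast
 define p :: "('i => real) => real" where "p = indicator A"
 have pm [measurable]: "p : borel_measurable (PiM I (%_. borel))" unfolding p_def by measurable
 have Fi: "integrable (torus I) F" using Fb by (intro T.integrable_const_bound[where B=C]) auto
 define s where "s n t g = (\<lambda>i\<in>I. frc (t i + g i / real n))" for n and t g :: "'i => real"
 define v where "v n t g = (\<lambda>i\<in>I. frc (real n * t i + g i))" for n and t g :: "'i => real"
 have [measurable]: "(%x. s n (fst x) (snd x)) : torus I \<Otimes>\<^sub>M torus I \<rightarrow>\<^sub>M PiM I (%_. borel)"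
  "(%x. v n (fst x) (snd x)) : torus I \<Otimes>\<^sub>M torus I \<rightarrow>\<^sub>M PiM I (%_. borel)" for n
  using measurable_torus_maps[where 'a='i] unfolding s_def v_def case_prod_beta by auto
 have Cpos: "C >= 0" using Fb[of undefined] by linarith
 have pv: "p x = 0 \<or> p x = 1" for x by (simp add: p_def indicator_def)
 have pFb: "\<bar>p x * F y\<bar> <= C" for x y using pv[of x] Fb[of y] Cpos by auto
 have shifted: "(\<integral>t. p t * F (\<lambda>i\<in>I. frc (real n * t i)) \<partial>torus I)
   = (\<integral>t. p (s n t g) * F (v n t g) \<partial>torus I)" if "n > 0" for n g
 proof -
  have [measurable]: "(%t. \<lambda>i\<in>I. frc (t i + g i / real n)) : torus I \<rightarrow>\<^sub>M torus I"
   by (rule measurable_restrict) measurable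
  have "(\<integral>t. p t * F (\<lambda>i\<in>I. frc (real n * t i)) \<partial>torus I)
   = (\<integral>t. p t * F (\<lambda>i\<in>I. frc (real n * t i)) \<partial>(distr (torus I) (torus I) (%t. \<lambda>i\<in>I. frc (t i + g i / real n))))"
   by (simp only: distr_torus_shift[OF I])
  also have "... = (\<integral>t. p (s n t g) * F (v n t g) \<partial>torus I)"
  proof (subst integral_distr)
   show "(\<integral>t. p (\<lambda>i\<in>I. frc (t i + g i / real n)) *
    F (\<lambda>i\<in>I. frc (real n * (\<lambda>i\<in>I. frc (t i + g i / real n)) i)) \<partial>torus I) =
    (\<integral>t. p (s n t g) * F (v n t g) \<partial>torus I)"
   proof (rule Bochner_Integration.integral_cong[OF refl])
    fix t :: "'i => real"
    have "(\<lambda>i\<in>I. frc (real n * (\<lambda>i\<in>I. frc (t i + g i / real n)) i)) = v n t g"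
    using that by (auto simp: v_def fun_eq_iff frc_mult_frc distrib_left)
    then show "p (\<lambda>i\<in>I. frc (t i + g i / real n)) *
    F (\<lambda>i\<in>I. frc (real n * (\<lambda>i\<in>I. frc (t i + g i / real n)) i)) = p (s n t g) * F (v n t g)"
    by (simp add: s_def)
   qed
  qed measurable
  finally show ?thesis .
 qed
 have avg: "(\<integral>g. F (v n t g) \<partial>torus I) = (\<integral>x. F x \<partial>torus I)" for n t
 proof -
  have [measurable]: "(%g. \<lambda>i\<in>I. frc (g i + real n * t i)) : torus I \<rightarrow>\<^sub>M torus I"
   by (rule measurable_restrict) measurable
  have "(\<integral>x. F x \<partial>torus I) = (\<integral>x. F x \<partial>(distr (torus I) (torus I) (%g. \<lambda>i\<in>I. frc (g i + real n * t i))))"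
   by (simp only: distr_torus_shift[OF I])
  also have "... = (\<integral>g. F (\<lambda>i\<in>I. frc (g i + real n * t i)) \<partial>torus I)"
   by (rule integral_distr) measurable
  finally show ?thesis by (simp add: v_def add.commute)
 qed
 have i1: "integrable (torus I \<Otimes>\<^sub>M torus I) (%x. p (s n (fst x) (snd x)) * F (v n (fst x) (snd x)))" for n
  using pFb by (intro TT.integrable_const_bound[where B=C]) auto
 have i2: "integrable (torus I \<Otimes>\<^sub>M torus I) (%x. p (fst x) * F (v n (fst x) (snd x)))" for n
  using pFb by (intro TT.integrable_const_bound[where B=C]) auto
 have e1: "(\<integral>t. p t * F (\<lambda>i\<in>I. frc (real n * t i)) \<partial>torus I)
  = (\<integral>x. p (s n (fst x) (snd x)) * F (v n (fst x) (snd x)) \<partial>(torus I \<Otimes>\<^sub>M torus I))" if "n > 0" for n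
 proof -
  have "(\<integral>x. p (s n (fst x) (snd x)) * F (v n (fst x) (snd x)) \<partial>(torus I \<Otimes>\<^sub>M torus I))
   = (\<integral>g. (\<integral>t. p (s n t g) * F (v n t g) \<partial>torus I) \<partial>torus I)"
  proof -
   have "integrable (torus I \<Otimes>\<^sub>M torus I) (case_prod (%t g. p (s n t g) * F (v n t g)))"
    using i1[of n] by (simp add: case_prod_beta')
   from TT.integral_snd[OF this] show ?thesis by (simp add: case_prod_beta')
  qed
  also have "... = (\<integral>g. (\<integral>t. p t * F (\<lambda>i\<in>I. frc (real n * t i)) \<partial>torus I) \<partial>torus I)"
   by (rule Bochner_Integration.integral_cong) (simp_all add: shifted[OF that, symmetric])
  finally show ?thesis using T.prob_space by simp
 qed
 have e2: "(\<integral>x. p (fst x) * F (v n (fst x) (snd x)) \<partial>(torus I \<Otimes>\<^sub>M torus I))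
  = (\<integral>t. p t \<partial>torus I) * (\<integral>t. F t \<partial>torus I)" for n
 proof -
  have "(\<integral>x. p (fst x) * F (v n (fst x) (snd x)) \<partial>(torus I \<Otimes>\<^sub>M torus I))
   = (\<integral>t. (\<integral>g. p t * F (v n t g) \<partial>torus I) \<partial>torus I)"
  proof -
   have "integrable (torus I \<Otimes>\<^sub>M torus I) (case_prod (%t g. p t * F (v n t g)))"
    using i2[of n] by (simp add: case_prod_beta')
   from TT.integral_fst[OF this] show ?thesis by (simp add: case_prod_beta')
  qed
  also have "... = (\<integral>t. p t * (\<integral>x. F x \<partial>torus I) \<partial>torus I)"
   by (simp add: avg)
  finally show ?thesis by simp
 qed
 have AEp: "AE x in torus I \<Otimes>\<^sub>M torus I. (%n. p (s n (fst x) (snd x))) ----> p (fst x)"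
 proof -
  have "AE t in torus I. \<forall>i\<in>I. t i ~= b i & 0 < t i & t i < 1"
  proof (rule AE_finite_allI[OF I])
   fix i assume i: "i : I"
   have "AE x in unif. x ~= b i & 0 < x & x < 1" by (rule AE_unif) (rule AE_lborel_singleton)
   then show "AE t in torus I. t i ~= b i & 0 < t i & t i < 1"
    using i by (intro AE_PiM_component prob_space_unif) auto
  qed
  then have "AE x in torus I \<Otimes>\<^sub>M torus I. \<forall>i\<in>I. fst x i ~= b i & 0 < fst x i & fst x i < 1"
   by (rule AE_pair_fst[rotated]) (rule T.sigma_finite_measure_axioms)
  moreover have "AE x in torus I \<Otimes>\<^sub>M torus I. fst x : Pi\<^sub>E I (%_. UNIV)"
   by (intro AE_I2) (auto simp: space_pair_measure)
  ultimately show ?thesis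
  proof eventually_elim
   case (elim x)
   obtain t g where x: "x = (t, g)" by (cases x)
   have tex: "t : Pi\<^sub>E I (%_. UNIV)" using elim x by simp
   have "eventually (%n. frc (t i + g i / real n) <= b i \<longleftrightarrow> t i <= b i) sequentially" if "i : I" for i
   proof (cases "t i <= b i")
    case True
    then have "t i < b i" using elim that x by force
    from order_tendstoD(2)[OF frc_shift_tendsto this] show ?thesis
    by (rule eventually_mono[where P="%n. frc (t i + g i / real n) < b i"]) (use elim that x True in auto)
   next
    case False
    then have "b i < t i" by simp
    from order_tendstoD(1)[OF frc_shift_tendsto this] show ?thesis
    by (rule eventually_mono[where P="%n. b i < frc (t i + g i / real n)"]) (use elim that x False in auto)
   qed
   then have "eventually (%n. \<forall>i\<in>I. frc (t i + g i / real n) <= b i \<longleftrightarrow> t i <= b i) sequentially"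
    using I by (simp add: eventually_ball_finite_distrib)
   then have "eventually (%n. p (s n (fst x) (snd x)) = (if \<forall>i\<in>I. t i <= b i then 1 else 0)) sequentially"
    by eventually_elim (auto simp: p_def s_def A x indicator_def)
   moreover have "p t = (if \<forall>i\<in>I. t i <= b i then 1 else 0)"
    using tex by (auto simp: p_def A indicator_def)
   ultimately have "eventually (%n. p (s n t g) = p t) sequentially" by (simp add: x)
   then show ?case unfolding x fst_conv snd_conv by (rule tendsto_eventually)
  qed
 qed
 have "(%n. \<integral>x. p (s n (fst x) (snd x)) * F (v n (fst x) (snd x)) - p (fst x) * F (v n (fst x) (snd x)) \<partial>(torus I \<Otimes>\<^sub>M torus I))
  ----> (\<integral>x. 0 \<partial>(torus I \<Otimes>\<^sub>M torus I))"
 proof (rule integral_dominated_convergence[where w="%_. 2 * C"])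
  show "AE x in torus I \<Otimes>\<^sub>M torus I.
   (%n. p (s n (fst x) (snd x)) * F (v n (fst x) (snd x)) - p (fst x) * F (v n (fst x) (snd x))) ----> 0"
   using AEp
  proof eventually_elim
   case (elim x)
   have "(%n. (p (s n (fst x) (snd x)) - p (fst x)) * F (v n (fst x) (snd x))) ----> 0"
   proof (rule Lim_null_comparison)
    show "\<forall>\<^sub>F n in sequentially. norm ((p (s n (fst x) (snd x)) - p (fst x)) * F (v n (fst x) (snd x)))
    <= \<bar>p (s n (fst x) (snd x)) - p (fst x)\<bar> * C"
    using Fb by (intro always_eventually allI) (auto simp: abs_mult intro!: mult_left_mono)
    show "(%n. \<bar>p (s n (fst x) (snd x)) - p (fst x)\<bar> * C) ----> 0"
    using elim by (intro tendsto_mult_left_zero tendsto_rabs_zero LIM_zero)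
   qed
   then show ?case by (simp add: left_diff_distrib)
  qed
  fix n
  show "AE x in torus I \<Otimes>\<^sub>M torus I.
   norm (p (s n (fst x) (snd x)) * F (v n (fst x) (snd x)) - p (fst x) * F (v n (fst x) (snd x))) <= 2 * C"
  proof (rule AE_I2)
   fix x show "norm (p (s n (fst x) (snd x)) * F (v n (fst x) (snd x)) - p (fst x) * F (v n (fst x) (snd x))) <= 2 * C"
    using pFb[of "s n (fst x) (snd x)" "v n (fst x) (snd x)"] pFb[of "fst x" "v n (fst x) (snd x)"]
    by (simp add: abs_le_iff)
  qed
 qed auto
 then have l: "(%n. (\<integral>x. p (s n (fst x) (snd x)) * F (v n (fst x) (snd x)) \<partial>(torus I \<Otimes>\<^sub>M torus I))
   - (\<integral>t. p t \<partial>torus I) * (\<integral>t. F t \<partial>torus I)) ----> 0"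
  using i1 i2 e2 by simp
 have "eventually (%n. (\<integral>x. p (s n (fst x) (snd x)) * F (v n (fst x) (snd x)) \<partial>(torus I \<Otimes>\<^sub>M torus I))
  = (\<integral>t. p t * F (\<lambda>i\<in>I. frc (real n * t i)) \<partial>torus I)) sequentially"
  using eventually_gt_at_top[of 0] by eventually_elim (simp add: e1)
 with LIM_zero_cancel[OF l] show ?thesis unfolding p_def by (rule Lim_transform_eventually)
qed

lemma torus_equidistribution_indicator:
 fixes F :: "('i => real) => real"
 assumes I: "finite I"
  and F [measurable]: "F : borel_measurable (PiM I (%_. borel))"
  and Fb: "\<And>x. \<bar>F x\<bar> <= C"
  and A: "A : sets (PiM I (%_. borel))"
 shows "(%n. \<integral>t. indicator A t * F (\<lambda>i\<in>I. frc (real n * t i)) \<partial>torus I)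
  ----> (\<integral>t. indicator A t \<partial>torus I) * (\<integral>t. F t \<partial>torus I)"
proof -
 interpret T: prob_space "torus I" by (rule prob_space_torus)
 define G where "G = range (%b. {f : Pi\<^sub>E I (%_. UNIV :: real set). \<forall>i\<in>I. f i <= b i})"
 define c where "c = (\<integral>t. F t \<partial>torus I)"
 define Fn where "Fn n t = F (\<lambda>i\<in>I. frc (real n * t i))" for n t
 have sG: "sets (torus I) = sigma_sets (Pi\<^sub>E I (%_. UNIV)) G"
  unfolding sets_torus G_def by (rule sets_PiM_borel_boxes[OF I])
 have spT: "space (torus I) = Pi\<^sub>E I (%_. UNIV)" by (simp add: space_PiM)
 have Fnm [measurable]: "Fn n : borel_measurable (torus I)" for n unfolding Fn_def by measurable
 have Fnb: "\<bar>Fn n t\<bar> <= C" for n t using Fb by (simp add: Fn_def)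
 have Cpos: "C >= 0" using Fb[of undefined] by linarith
 have int: "integrable (torus I) (%t. indicator A t * Fn n t)" if "A : sets (torus I)" for A n
  using that Fnb Cpos by (intro T.integrable_const_bound[where B=C]) (auto simp: indicator_def)
 have intF: "integrable (torus I) (Fn n)" for n
  using Fnb by (intro T.integrable_const_bound[where B=C]) auto
 have box: "(%n. \<integral>t. indicator B t * Fn n t \<partial>torus I) ----> T.prob B * c" if BG: "B : G" for B
 proof -
  have [measurable]: "B : sets (torus I)" unfolding sG using that by (rule sigma_sets.Basic)
  obtain b where "B = {f : Pi\<^sub>E I (%_. UNIV). \<forall>i\<in>I. f i <= b i}" using BG[unfolded G_def] by (elim rangeE)
  from torus_equidistribution_box[OF I F Fb this] show ?thesis by (simp add: Fn_def c_def)
 qed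
 have all: "(%n. \<integral>t. Fn n t \<partial>torus I) ----> c"
 proof -
  define B where "B = {f : Pi\<^sub>E I (%_. UNIV). \<forall>i\<in>I. f i <= (1::real)}"
  have BG: "B : G" unfolding B_def G_def by (rule range_eqI[of _ _ "%_. 1"]) simp
  then have B [measurable]: "B : sets (torus I)" unfolding sG by (rule sigma_sets.Basic)
  have "AE t in torus I. \<forall>i\<in>I. t i <= 1"
  proof (rule AE_finite_allI[OF I])
   fix i assume i: "i : I"
   have "AE x in unif. True & 0 < x & x < 1" by (rule AE_unif) auto
   then have "AE x in unif. x <= 1" by eventually_elim auto
   then show "AE t in torus I. t i <= 1"
    using i by (intro AE_PiM_component prob_space_unif) auto
  qed
  moreover have "AE t in torus I. t : Pi\<^sub>E I (%_. UNIV)" using spT by (intro AE_I2) auto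
  ultimately have 1: "AE t in torus I. t : B" by eventually_elim (auto simp: B_def)
  have "(\<integral>t. Fn n t \<partial>torus I) = (\<integral>t. indicator B t * Fn n t \<partial>torus I)" for n
  proof (rule integral_cong_AE)
   show "AE t in torus I. Fn n t = indicator B t * Fn n t" using 1 by eventually_elim simp
  qed measurable
  moreover have "T.prob B = 1" using T.prob_eq_1[OF B] 1 by simp
  ultimately show ?thesis using box[OF BG] by simp
 qed
 have Int: "Int_stable G"
  proof (rule Int_stableI)
   fix a b assume "a : G" "b : G"
   then obtain x y where "a = {f : Pi\<^sub>E I (%_. UNIV). \<forall>i\<in>I. f i <= x i}" "b = {f : Pi\<^sub>E I (%_. UNIV). \<forall>i\<in>I. f i <= y i}"
    by (auto simp: G_def)
   then have "a Int b = {f : Pi\<^sub>E I (%_. UNIV). \<forall>i\<in>I. f i <= min (x i) (y i)}" by auto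
   then show "a Int b : G" unfolding G_def by (rule range_eqI[of _ _ "%i. min (x i) (y i)"])
  qed
 have Gp: "G \<subseteq> Pow (Pi\<^sub>E I (%_. UNIV))" by (auto simp: G_def)
 have "(%n. \<integral>t. indicator A t * Fn n t \<partial>torus I) ----> T.prob A * c"
  if A: "A : sigma_sets (Pi\<^sub>E I (%_. UNIV)) G"
  using Int Gp A
 proof (induction rule: sigma_sets_induct_disjoint)
  case (basic A) then show ?case by (rule box)
 next
  case empty then show ?case by simp
 next
  case (compl A)
  then have [measurable]: "A : sets (torus I)" unfolding sG by simp
  have eq: "(\<integral>t. indicator (Pi\<^sub>E I (%_. UNIV) - A) t * Fn n t \<partial>torus I)
   = (\<integral>t. Fn n t \<partial>torus I) - (\<integral>t. indicator A t * Fn n t \<partial>torus I)" for n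
  proof -
   have "(\<integral>t. indicator (Pi\<^sub>E I (%_. UNIV) - A) t * Fn n t \<partial>torus I)
    = (\<integral>t. Fn n t - indicator A t * Fn n t \<partial>torus I)"
    by (rule Bochner_Integration.integral_cong) (auto simp: spT indicator_def)
   also have "... = (\<integral>t. Fn n t \<partial>torus I) - (\<integral>t. indicator A t * Fn n t \<partial>torus I)"
    by (rule Bochner_Integration.integral_diff) (auto intro: intF int)
   finally show ?thesis .
  qed
  have "T.prob (Pi\<^sub>E I (%_. UNIV) - A) * c = c - T.prob A * c"
  proof -
   have "T.prob (Pi\<^sub>E I (%_. UNIV) - A) = 1 - T.prob A" using T.prob_compl[of A] by (simp add: spT)
   then show ?thesis by (simp only: left_diff_distrib)
  qed
  then show ?case unfolding eq using tendsto_diff[OF all compl.IH] by simp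
 next
  case (union A)
  have A [measurable]: "A i : sets (torus I)" for i unfolding sG using union(2) by blast
  have intd: "(\<integral>t. indicator (\<Union>i. A i) t * Fn n t \<partial>torus I) = (\<Sum>i. \<integral>t. indicator (A i) t * Fn n t \<partial>torus I)" for n
  proof -
   have "(\<integral>t\<in>(\<Union>i. A i). Fn n t \<partial>torus I) = (\<Sum>i. \<integral>t\<in>A i. Fn n t \<partial>torus I)"
   proof (rule lebesgue_integral_countable_add)
    show "set_integrable (torus I) (\<Union>i. A i) (Fn n)"
    using int[of "\<Union>i. A i"] by (simp add: set_integrable_def)
    show "\<And>i j. i ~= j ==> A i Int A j = {}" using union(1) by (auto simp: disjoint_family_on_def)
   qed (rule A)
   then show ?thesis by (simp add: set_lebesgue_integral_def)
  qed
  have sums: "(%i. T.prob (A i)) sums T.prob (\<Union>i. A i)"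
   by (rule T.finite_measure_UNION) (use A union(1) in blast)+
  then have sm: "summable (%i. T.prob (A i))" by (rule sums_summable)
  have bd: "norm (\<integral>t. indicator (A k) t * Fn n t \<partial>torus I) <= C * T.prob (A k)" for n k
  proof -
   have "norm (\<integral>t. indicator (A k) t * Fn n t \<partial>torus I) <= (\<integral>t. norm (indicator (A k) t * Fn n t) \<partial>torus I)"
    by (rule integral_norm_bound)
   also have "... <= (\<integral>t. C * indicator (A k) t \<partial>torus I)"
    using Fnb Cpos A by (intro integral_mono integrable_norm int integrable_mult_right integrable_real_indicator)
    (auto simp: indicator_def T.emeasure_eq_measure)
   finally show ?thesis using A[of k] by simp
  qed
  have "(%n. \<Sum>i. \<integral>t. indicator (A i) t * Fn n t \<partial>torus I) ----> (\<Sum>i. T.prob (A i) * c)"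
  proof (rule tannerys_theorem[THEN conjunct2, THEN conjunct2])
   show "summable (%i. C * T.prob (A i))" using sm by (rule summable_mult)
   show "\<forall>\<^sub>F (k, n) in at_top \<times>\<^sub>F sequentially. norm (\<integral>t. indicator (A k) t * Fn n t \<partial>torus I) <= C * T.prob (A k)"
    by (rule always_eventually) (use bd in auto)
  qed (rule union.IH, simp)
  moreover have "(\<Sum>i. T.prob (A i) * c) = T.prob (\<Union>i. A i) * c"
  proof -
   have "(\<Sum>i. T.prob (A i)) = T.prob (\<Union>i. A i)" using sums by (rule sums_unique[symmetric])
   then show ?thesis using suminf_mult2[OF sm, of c] by simp
  qed
  ultimately show ?case by (simp add: intd)
 qed
 then show ?thesis using A sG by (simp add: sets_torus Fn_def c_def)
qed

text \<open>Indicators are dense among the integrable functions. Applied with \<open>p\<close> the density of the jump times on an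
event, it makes their fractional parts on the grid uniform in the limit and independent of the event.\<close>

lemma torus_equidistribution:
 fixes F :: "('i => real) => real"
 assumes I: "finite I"
  and F [measurable]: "F : borel_measurable (PiM I (%_. borel))"
  and Fb: "\<And>x. \<bar>F x\<bar> <= C"
  and p: "integrable (torus I) p"
 shows "(%n. \<integral>t. p t * F (\<lambda>i\<in>I. frc (real n * t i)) \<partial>torus I)
  ----> (\<integral>t. p t \<partial>torus I) * (\<integral>t. F t \<partial>torus I)"
proof -
 interpret T: prob_space "torus I" by (rule prob_space_torus)
 define c where "c = (\<integral>t. F t \<partial>torus I)"
 define Fn where "Fn n t = F (\<lambda>i\<in>I. frc (real n * t i))" for n t
 have Fnm [measurable]: "Fn n : borel_measurable (torus I)" for n unfolding Fn_def by measurable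
 have Fnb: "\<bar>Fn n t\<bar> <= C" for n t using Fb by (simp add: Fn_def)
 have Cpos: "C >= 0" using Fb[of undefined] by linarith
 have int: "integrable (torus I) (%t. q t * Fn n t)" if "integrable (torus I) q" for q n
 proof (rule Bochner_Integration.integrable_bound[OF integrable_mult_left[OF that, of C]])
  show "AE t in torus I. norm (q t * Fn n t) <= norm (q t * C)"
   using Fnb Cpos by (auto simp: abs_mult intro!: mult_left_mono)
 qed (use that in measurable)
 have cb: "\<bar>c\<bar> <= C"
 proof -
  have "integrable (torus I) F" using Fb by (intro T.integrable_const_bound[where B=C]) auto
  then have "\<bar>c\<bar> <= (\<integral>t. C \<partial>torus I)" unfolding c_def using Fb
   by (intro abs_integral_le) auto
  then show ?thesis using T.prob_space by simp
 qed
 have "(%n. \<integral>t. p t * Fn n t \<partial>torus I) ----> (\<integral>t. p t \<partial>torus I) * c"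
  using p
 proof (induction rule: integrable_induct)
  case (base A k)
  have "(%n. k * (\<integral>t. indicator A t * Fn n t \<partial>torus I)) ----> k * ((\<integral>t. indicator A t \<partial>torus I) * c)"
   using base torus_equidistribution_indicator[OF I F Fb, of A]
   by (intro tendsto_intros) (auto simp: Fn_def c_def sets_torus)
  moreover have "(\<integral>t. indicator A t *\<^sub>R k * Fn n t \<partial>torus I) = k * (\<integral>t. indicator A t * Fn n t \<partial>torus I)" for n
   by (subst integral_mult_right_zero[symmetric]) (simp add: ac_simps)
  moreover have "(\<integral>t. indicator A t *\<^sub>R k \<partial>torus I) = k * (\<integral>t. indicator A t \<partial>torus I)"
   by (subst integral_mult_right_zero[symmetric]) (simp add: ac_simps)
  ultimately show ?case by (simp add: ac_simps)
 next
  case (add f g)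
  then show ?case using int by (simp add: distrib_right) (intro tendsto_add)
 next
  case (lim f s)
  have sf: "(%i. \<integral>t. \<bar>s i t - f t\<bar> \<partial>torus I) ----> (\<integral>t. 0 \<partial>torus I)"
  proof (rule integral_dominated_convergence[where w="%t. 3 * \<bar>f t\<bar>"])
   show "AE x in torus I. (%i. \<bar>s i x - f x\<bar>) ----> 0"
    using lim.hyps(2) by (intro AE_I2 tendsto_rabs_zero LIM_zero) auto
   fix i show "AE x in torus I. norm \<bar>s i x - f x\<bar> <= 3 * \<bar>f x\<bar>"

   proof (rule AE_I2)
    fix x assume "x : space (torus I)"
    then have "\<bar>s i x\<bar> <= 2 * \<bar>f x\<bar>" using lim.hyps(3) by simp
    then show "norm \<bar>s i x - f x\<bar> <= 3 * \<bar>f x\<bar>" by simp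
   qed
  qed (use lim in auto)
  show ?case
  proof (rule LIMSEQ_I)
   fix e :: real assume e: "e > 0"
   define d where "d = e / (3 * (C + 1))"
   have d: "d > 0" "C * d < e / 3" using e Cpos by (auto simp: d_def field_simps)
   obtain i where i: "(\<integral>t. \<bar>s i t - f t\<bar> \<partial>torus I) < d"
    using order_tendstoD(2)[OF sf, of d] d by (auto simp: eventually_sequentially)
   obtain N where N: "\<And>n. n >= N ==> \<bar>(\<integral>t. s i t * Fn n t \<partial>torus I) - (\<integral>t. s i t \<partial>torus I) * c\<bar> < e / 3"
    using LIMSEQ_D[OF lim.IH(1)[of i], of "e/3"] e by auto
   have "\<bar>(\<integral>t. f t * Fn n t \<partial>torus I) - (\<integral>t. f t \<partial>torus I) * c\<bar> < e" if "n >= N" for n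
   proof -
    have "\<bar>(\<integral>t. s i t * Fn n t \<partial>torus I) - (\<integral>t. f t * Fn n t \<partial>torus I)\<bar>
    = \<bar>\<integral>t. (s i t - f t) * Fn n t \<partial>torus I\<bar>"
    using int lim by (simp add: left_diff_distrib)
    also have "... <= (\<integral>t. \<bar>s i t - f t\<bar> * C \<partial>torus I)"
    using Fnb Cpos lim int by (intro abs_integral_le) (auto simp: abs_mult intro!: mult_left_mono)
    also have "... <= d * C" using i Cpos by (simp add: mult_right_mono)
    finally have 1: "\<bar>(\<integral>t. s i t * Fn n t \<partial>torus I) - (\<integral>t. f t * Fn n t \<partial>torus I)\<bar> < e / 3"
    using d by (simp add: mult.commute)
    have "\<bar>(\<integral>t. s i t \<partial>torus I) - (\<integral>t. f t \<partial>torus I)\<bar> <= (\<integral>t. \<bar>s i t - f t\<bar> \<partial>torus I)"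
    using integral_abs_bound[of "torus I" "%t. s i t - f t"] lim.hyps by simp
    then have "\<bar>(\<integral>t. s i t \<partial>torus I) * c - (\<integral>t. f t \<partial>torus I) * c\<bar> <= d * C"
    using i cb d(1) unfolding left_diff_distrib[symmetric] abs_mult by (intro mult_mono) auto
    then have 2: "\<bar>(\<integral>t. s i t \<partial>torus I) * c - (\<integral>t. f t \<partial>torus I) * c\<bar> < e / 3"
    using d by (simp add: mult.commute)
    show ?thesis using 1 2 N[OF that] by linarith
   qed
   then show "EX N. \<forall>n\<ge>N. norm ((\<integral>t. f t * Fn n t \<partial>torus I) - (\<integral>t. f t \<partial>torus I) * c) < e"
    by auto
  qed
 qed
 then show ?thesis by (simp add: Fn_def c_def)
qed

section \<open>Brownian increments\<close>

abbreviation clamp01 :: "real => real" where "clamp01 t \<equiv> max 0 (min 1 t)"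

text \<open>The process is the limit of its values at the next point after \<open>t\<close> of finer and finer grids.\<close>

lemma joint_measurable_right_continuous:
 fixes f :: "real => 'w => real"
 assumes m: "\<And>t. f t : borel_measurable M"
  and rc: "\<And>om t. om : space M ==> continuous (at_right t) (%t. f t om)"
 shows "(%(t, om). f t om) : borel_measurable (borel \<Otimes>\<^sub>M M)"
proof (rule borel_measurable_LIMSEQ_real)
 define q where "q m t = (of_int (\<lfloor>real (Suc m) * t\<rfloor> + 1) :: real) / real (Suc m)" for m and t :: real
 have q: "t < q m t" "q m t <= t + 1 / real (Suc m)" for m t
 proof -
  have "real (Suc m) * t < of_int (\<lfloor>real (Suc m) * t\<rfloor> + 1)" by linarith
  then show "t < q m t" unfolding q_def by (subst pos_less_divide_eq) (auto simp: mult.commute)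
  have "of_int (\<lfloor>real (Suc m) * t\<rfloor> + 1) <= real (Suc m) * t + 1" by linarith
  then have "q m t <= (real (Suc m) * t + 1) / real (Suc m)" unfolding q_def by (intro divide_right_mono) auto
  then show "q m t <= t + 1 / real (Suc m)" by (simp add: add_divide_distrib)
 qed
 have ql: "filterlim (%m. q m t) (at_right t) sequentially" for t
 proof -
  have "(%m. t + 1 / real (Suc m)) ----> t + 0"
   by (intro tendsto_intros LIMSEQ_Suc[OF lim_1_over_n])
  then have "(%m. q m t) ----> t"
   by (intro tendsto_sandwich[of "%_. t" "%m. q m t" _ "%m. t + 1 / real (Suc m)"])
    (use q in \<open>auto intro!: always_eventually less_imp_le\<close>)
  then show ?thesis using q(1) unfolding filterlim_at
   by (auto intro!: always_eventually simp: less_imp_neq[THEN not_sym])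
 qed
 show "(%m. case x of (t, om) => f (q m t) om) ----> (case x of (t, om) => f t om)"
  if "x : space (borel \<Otimes>\<^sub>M M)" for x
 proof -
  obtain t om where x: "x = (t, om)" by (cases x)
  then have "om : space M" using that by (auto simp: space_pair_measure)
  then have "((%t. f t om) \<longlongrightarrow> f t om) (at_right t)" using rc by (auto simp: continuous_within)
  from filterlim_compose[OF this ql] show ?thesis by (simp add: x)
 qed
 show "(%x. case x of (t, om) => f (q m t) om) : borel_measurable (borel \<Otimes>\<^sub>M M)" for m
 proof -
  have "(%x. f (of_int (\<lfloor>real (Suc m) * fst x\<rfloor> + 1) / real (Suc m)) (snd x)) : borel_measurable (borel \<Otimes>\<^sub>M M)"
   by (rule measurable_compose_countable[where f="%i x. f (of_int (i + 1) / real (Suc m)) (snd x)" and g="%x. \<lfloor>real (Suc m) * fst x\<rfloor>"])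
    (use m in measurable)
  then show ?thesis by (simp add: q_def case_prod_beta')
 qed
qed

lemma bm_grid_indep:
 assumes "standard_brownian_motion M W" "incseq \<tau>" "range \<tau> \<subseteq> {0..1}"
 shows "prob_space.indep_vars M (%_. borel) (%i om. W (\<tau> (Suc i)) om - W (\<tau> i) om) {..<m}"
 using assms(1) assms(2,3) unfolding standard_brownian_motion_def by (elim conjE allE[of _ m] allE[of _ \<tau>]) simp

text \<open>Increments over disjoint intervals, given in any order, are sums of increments along the common sorted
grid, where the defining property applies; the intervals are grouped into disjoint blocks.\<close>

lemma bm_block_indep:
 fixes u v :: "'j => real" and cls :: "'j => 'b"
 assumes bm: "standard_brownian_motion M W" and J: "finite J"
  and uv: "\<And>j. j : J ==> 0 <= u j & u j <= v j & v j <= 1"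
  and disj: "\<And>i j. i : J ==> j : J ==> cls i ~= cls j ==> {u i<..v i} Int {u j<..v j} = {}"
 shows "prob_space.indep_vars M (%b. PiM {j\<in>J. cls j = b} (%_. borel))
   (%b om. \<lambda>j\<in>{j\<in>J. cls j = b}. W (v j) om - W (u j) om) L"
proof -
 interpret prob_space M using bm by (simp add: standard_brownian_motion_def)
 define S where "S = insert 0 (u ` J Un v ` J)"
 have S: "finite S" "S \<subseteq> {0..1}" "0 : S" using J uv by (force simp: S_def)+
 define xs where "xs = sorted_list_of_set S"
 define n where "n = length xs"
 have xs: "sorted_wrt (<) xs" "set xs = S" using S by (auto simp: xs_def)
 have n: "n > 0" using xs S by (auto simp: n_def)
 have mono: "xs ! i < xs ! j" if "i < j" "j < n" for i j
  using xs(1) that by (auto simp: sorted_wrt_iff_nth_less n_def)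
 define \<tau> where "\<tau> i = xs ! min i (n - 1)" for i
 have inS: "\<tau> i : S" for i using n xs(2) by (subst xs(2)[symmetric], unfold \<tau>_def n_def) (rule nth_mem, use n in \<open>auto simp: n_def min_less_iff_disj\<close>)
 have inc: "incseq \<tau>"
 proof (rule incseq_SucI)
  fix i show "\<tau> i <= \<tau> (Suc i)"
  proof (cases "Suc i < n")
   case True then show ?thesis using mono[of i "Suc i"] by (simp add: \<tau>_def min_def less_imp_le)
  next
   case False
  then have "min i (n - 1) = min (Suc i) (n - 1)" by auto
  then show ?thesis by (simp add: \<tau>_def)
  qed
 qed
 define D where "D i om = W (\<tau> (Suc i)) om - W (\<tau> i) om" for i om
 have indD: "indep_vars (%_. borel) D {..<n}"
 proof -
  have "range \<tau> \<subseteq> {0..1}" using inS S(2) by (metis image_subsetI subsetD)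
  from bm_grid_indep[OF bm inc this] show ?thesis by (simp add: D_def[abs_def])
 qed
 have idx: "EX p<n. s = \<tau> p" if sS: "s : S" for s
 proof -
  obtain p where "p < n" "s = xs ! p" using sS xs(2) by (metis in_set_conv_nth n_def)
  then show ?thesis by (intro exI[of _ p]) (simp add: \<tau>_def)
 qed
 define N where "N j = {i. i < n & \<tau> i < \<tau> (Suc i) & u j <= \<tau> i & \<tau> (Suc i) <= v j}" for j
 have tele: "W (v j) om - W (u j) om = (\<Sum>i\<in>N j. D i om)" if jJ: "j : J" for j om
 proof -
  obtain p q where pq: "p < n" "q < n" "u j = \<tau> p" "v j = \<tau> q"
   using idx[of "u j"] idx[of "v j"] jJ by (auto simp: S_def)
  have le_iff: "\<tau> a <= \<tau> b \<longleftrightarrow> a <= b" if "a < n" "b < n" for a b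
  proof -
   have "\<tau> a = xs ! a" "\<tau> b = xs ! b" using that by (auto simp: \<tau>_def min_def)
   then show ?thesis using mono[of a b] mono[of b a] that by (cases a b rule: linorder_cases) auto
  qed
  have "p <= q" using uv[OF jJ] pq le_iff by auto
  have "N j = {p..<q}"
  proof (intro set_eqI iffI)
   fix i assume i: "i : N j"
   have "Suc i < n"
   proof (rule ccontr)
    assume "\<not> Suc i < n"
    then have "min i (n - 1) = min (Suc i) (n - 1)" by auto
    then have "\<tau> i = \<tau> (Suc i)" by (simp add: \<tau>_def)
    then show False using i by (simp add: N_def)
   qed
   then show "i : {p..<q}" using i pq le_iff[of p i] le_iff[of "Suc i" q] by (auto simp: N_def)
  next
   fix i assume i: "i : {p..<q}"
   then have "Suc i < n" using pq by auto
   then show "i : N j" using i pq le_iff[of p i] le_iff[of "Suc i" q] le_iff[of "Suc i" i] by (auto simp: N_def not_le[symmetric])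
  qed
  then show ?thesis using sum_Suc_diff'[OF \<open>p <= q\<close>, of "%i. W (\<tau> i) om"] pq by (simp add: D_def)
 qed
 define K where "K b = (\<Union>j\<in>{j\<in>J. cls j = b}. N j)" for b
 have "indep_vars (%b. PiM (K b) (%_. borel)) (%b om. restrict (%i. D i om) (K b)) L"
 proof (rule indep_vars_restrict[OF indD])
  show "K b \<subseteq> {..<n}" for b by (auto simp: K_def N_def)
  show "disjoint_family_on K L"
   unfolding disjoint_family_on_def
  proof (intro ballI impI, rule ccontr)
   fix b b' assume b: "b ~= b'" "K b Int K b' ~= {}"
   then obtain i j j' where "i : N j" "i : N j'" "j : J" "j' : J" "cls j = b" "cls j' = b'" by (auto simp: K_def)
   then have "\<tau> (Suc i) : {u j<..v j} Int {u j'<..v j'}" by (auto simp: N_def)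
   then show False using disj[of j j'] b \<open>j : J\<close> \<open>j' : J\<close> \<open>cls j = b\<close> \<open>cls j' = b'\<close> by auto
  qed
 qed
 then have "indep_vars (%b. PiM {j\<in>J. cls j = b} (%_. borel))
   (%b om. (%f. \<lambda>j\<in>{j\<in>J. cls j = b}. \<Sum>i\<in>N j. f i) (restrict (%i. D i om) (K b))) L"
 proof (rule indep_vars_compose2)
  fix b
  show "(%f. \<lambda>j\<in>{j : J. cls j = b}. \<Sum>i\<in>N j. f i) : Pi\<^sub>M (K b) (%_. borel) \<rightarrow>\<^sub>M Pi\<^sub>M {j : J. cls j = b} (%_. borel :: real measure)"
  proof (rule measurable_restrict)
   fix j assume "j : {j : J. cls j = b}"
   then have "N j \<subseteq> K b" by (auto simp: K_def)
   then show "(%f. \<Sum>i\<in>N j. f i) : borel_measurable (Pi\<^sub>M (K b) (%_. borel :: real measure))"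
    by (intro borel_measurable_sum measurable_component_singleton) auto
  qed
 qed
 moreover have "(%b om. (%f. \<lambda>j\<in>{j\<in>J. cls j = b}. \<Sum>i\<in>N j. f i) (restrict (%i. D i om) (K b)))
  = (%b om. \<lambda>j\<in>{j\<in>J. cls j = b}. W (v j) om - W (u j) om)"
 proof (intro ext)
  fix b om j
  have "(\<Sum>i\<in>N j. restrict (%i. D i om) (K b) i) = (\<Sum>i\<in>N j. D i om)" if "j : J" "cls j = b"
   using that by (intro sum.cong) (auto simp: K_def)
  then show "(\<lambda>j\<in>{j\<in>J. cls j = b}. \<Sum>i\<in>N j. restrict (%i. D i om) (K b) i) j =
    (\<lambda>j\<in>{j\<in>J. cls j = b}. W (v j) om - W (u j) om) j"
   using tele by (auto simp: restrict_def)
 qed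
 ultimately show ?thesis by simp
qed

lemma bm_indep_two_blocks:
 fixes u v :: "'j => real"
 assumes bm: "standard_brownian_motion M W" and J: "finite J1" "finite J2" "J1 Int J2 = {}"
  and uv: "\<And>j. j : J1 Un J2 ==> 0 <= u j & u j <= v j & v j <= 1"
  and disj: "\<And>i j. i : J1 ==> j : J2 ==> {u i<..v i} Int {u j<..v j} = {}"
 shows "prob_space.indep_var M (PiM J1 (%_. borel)) (%om. \<lambda>j\<in>J1. W (v j) om - W (u j) om)
  (PiM J2 (%_. borel)) (%om. \<lambda>j\<in>J2. W (v j) om - W (u j) om)"
proof -
 interpret prob_space M using bm by (simp add: standard_brownian_motion_def)
 have "indep_vars (%b. PiM {j\<in>J1 Un J2. (j : J1) = b} (%_. borel))
   (%b om. \<lambda>j\<in>{j\<in>J1 Un J2. (j : J1) = b}. W (v j) om - W (u j) om) UNIV"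
 proof (rule bm_block_indep[OF bm])
  fix i j assume "i : J1 Un J2" "j : J1 Un J2" "(i : J1) ~= (j : J1)"
  then show "{u i<..v i} Int {u j<..v j} = {}" using disj[of i j] disj[of j i] by blast
 qed (use J uv in auto)
 moreover have "{j\<in>J1 Un J2. (j : J1) = b} = case_bool J1 J2 b" for b
  using J(3) by (auto split: bool.split)
 ultimately have "indep_vars (%b. PiM (case_bool J1 J2 b) (%_. borel))
   (%b om. \<lambda>j\<in>case_bool J1 J2 b. W (v j) om - W (u j) om) UNIV" by simp
 moreover have "(%b. PiM (case_bool J1 J2 b) (%_. borel :: real measure)) = case_bool (PiM J1 (%_. borel)) (PiM J2 (%_. borel))"
  "(%b om. \<lambda>j\<in>case_bool J1 J2 b. W (v j) om - W (u j) om) =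
   case_bool (%om. \<lambda>j\<in>J1. W (v j) om - W (u j) om) (%om. \<lambda>j\<in>J2. W (v j) om - W (u j) om)"
  by (auto simp: fun_eq_iff split: bool.split)
 ultimately show ?thesis unfolding indep_var_def by simp
qed

lemma bm_indep_increments:
 fixes u v :: "'j => real"
 assumes bm: "standard_brownian_motion M W" and J: "finite J"
  and uv: "\<And>j. j : J ==> 0 <= u j & u j <= v j & v j <= 1"
  and disj: "\<And>i j. i : J ==> j : J ==> i ~= j ==> {u i<..v i} Int {u j<..v j} = {}"
 shows "prob_space.indep_vars M (%_. borel) (%j om. W (v j) om - W (u j) om) J"
proof -
 interpret prob_space M using bm by (simp add: standard_brownian_motion_def)
 have "indep_vars (%b. PiM {j\<in>J. id j = b} (%_. borel))
   (%b om. \<lambda>j\<in>{j\<in>J. id j = b}. W (v j) om - W (u j) om) J"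
  by (rule bm_block_indep[OF bm J]) (use uv disj in auto)
 then have "indep_vars (%_. borel)
   (%b om. (%f. f b) (\<lambda>j\<in>{j\<in>J. id j = b}. W (v j) om - W (u j) om)) J"
  by (rule indep_vars_compose2) (auto intro!: measurable_component_singleton)
 then show ?thesis by (rule indep_vars_cong[THEN iffD1, rotated -1]) auto
qed

abbreviation gauss :: "real measure" where "gauss \<equiv> density lborel std_normal_density"

lemma prob_space_gauss: "prob_space gauss"
 by (rule prob_space_normal_density) simp

lemma distr_gauss_scale:
 assumes "0 < s"
 shows "distr gauss borel (%x. s * x) = density lborel (normal_density 0 s)"
proof -
 interpret prob_space gauss by (rule prob_space_gauss)
 have "distributed gauss lborel (%x. x) std_normal_density"
  unfolding distributed_def by (auto simp: distr_id2)
 then have "distributed gauss lborel (%x. 0 + s * x) (normal_density (0 + s * 0) (\<bar>s\<bar> * 1))"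
  by (rule normal_density_affine) (use assms in auto)
 then show ?thesis using assms unfolding distributed_def by (simp cong: distr_cong)
qed

lemma bm_measurable:
 assumes "standard_brownian_motion M W" "0 <= t" "t <= 1"
 shows "W t : borel_measurable M"
 using assms by (auto simp: standard_brownian_motion_def)

lemma bm_increment_distr:
 assumes bm: "standard_brownian_motion M W" and "0 <= u" "u <= v" "v <= 1"
 shows "distr M borel (%om. W v om - W u om) = distr gauss borel (%x. sqrt (v - u) * x)"
proof (cases "u = v")
 case True
 interpret prob_space M using bm by (simp add: standard_brownian_motion_def)
 interpret g: prob_space gauss by (rule prob_space_gauss)
 have "distr M borel (%om. 0 :: real) = distr gauss borel (%x. 0)"
  by (rule measure_eqI) (auto simp: emeasure_distr emeasure_space_1 g.emeasure_space_1[simplified] vimage_def)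
 then show ?thesis using True by simp
next
 case False
 then have "distributed M lborel (%om. W v om - W u om) (normal_density 0 (sqrt (v - u)))"
  using assms by (simp add: standard_brownian_motion_def)
 then have "distr M lborel (%om. W v om - W u om) = density lborel (normal_density 0 (sqrt (v - u)))"
  by (simp add: distributed_def)
 moreover have "distr M lborel (%om. W v om - W u om) = distr M borel (%om. W v om - W u om)"
  by (rule distr_cong) auto
 ultimately show ?thesis using False assms distr_gauss_scale[of "sqrt (v - u)"] by simp
qed

lemma gauss_second_moment:
 "integrable gauss (%x. x\<^sup>2)" "(\<integral>x. x\<^sup>2 \<partial>gauss) = 1"
proof -
 have "has_bochner_integral lborel (%x. std_normal_density x * x ^ (2 * 1)) (fact (2 * 1) / (2 ^ 1 * fact 1))"
  by (rule std_normal_moment_even)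
 then have "has_bochner_integral lborel (%x. std_normal_density x *\<^sub>R x\<^sup>2) 1" by simp
 then have "has_bochner_integral gauss (%x. x\<^sup>2) 1"
  by (intro has_bochner_integral_density) auto
 then show "integrable gauss (%x. x\<^sup>2)" "(\<integral>x. x\<^sup>2 \<partial>gauss) = 1"
  by (auto simp: has_bochner_integral_iff)
qed

lemma bm_increment_chebyshev:
 assumes bm: "standard_brownian_motion M W" and uv: "0 <= u" "u <= v" "v <= 1" and r: "r > 0"
 shows "measure M {om : space M. \<bar>W v om - W u om\<bar> > r} <= (v - u) / r\<^sup>2"
proof -
 interpret prob_space M using bm by (simp add: standard_brownian_motion_def)
 interpret g: prob_space gauss by (rule prob_space_gauss)
 have [measurable]: "W v : borel_measurable M" "W u : borel_measurable M"
  using bm_measurable[OF bm] uv by auto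
 have "measure M {om : space M. \<bar>W v om - W u om\<bar> > r}
   = measure (distr M borel (%om. W v om - W u om)) {x. \<bar>x\<bar> > r}"
  by (subst measure_distr) (auto intro!: arg_cong[where f=prob])
 also have "... = measure gauss {x. \<bar>sqrt (v - u) * x\<bar> > r}"
  unfolding bm_increment_distr[OF bm uv] by (subst measure_distr) (auto simp: vimage_def)
 also have "... <= measure gauss {x : space gauss. r\<^sup>2 <= (v - u) * x\<^sup>2}"
 proof (rule g.finite_measure_mono)
  show "{x. r < \<bar>sqrt (v - u) * x\<bar>} \<subseteq> {x : space gauss. r\<^sup>2 <= (v - u) * x\<^sup>2}"
  proof safe
   fix x assume "r < \<bar>sqrt (v - u) * x\<bar>"
   then have "r\<^sup>2 <= (sqrt (v - u) * x)\<^sup>2" using r by (metis abs_le_square_iff abs_of_pos less_imp_le)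
   then show "r\<^sup>2 <= (v - u) * x\<^sup>2" using uv by (simp add: power_mult_distrib)
  qed simp
 qed simp
 also have "... <= (\<integral>x. (v - u) * x\<^sup>2 \<partial>gauss) / r\<^sup>2"
  by (rule integral_Markov_inequality_measure[where A="{}"])
   (use gauss_second_moment r uv in auto)
 also have "... = (v - u) / r\<^sup>2" using gauss_second_moment by simp
 finally show ?thesis .
qed

text \<open>Only almost all paths of the given process are continuous, and nothing is known off \<open>[0, 1]\<close>. Evaluation at
random times needs joint measurability, hence this modification.\<close>

lemma bm_continuous_version:
 assumes bm: "standard_brownian_motion M W"
 obtains w where "standard_brownian_motion M w"
  "(%(t, om). w t om) : borel_measurable (borel \<Otimes>\<^sub>M M)"
  "\<And>om. continuous_on UNIV (%t. w t om)"
  "\<And>om. w 0 om = 0"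
  "AE om in M. \<forall>t\<in>{0..1}. w t om = W t om"
proof -
 interpret prob_space M using bm by (simp add: standard_brownian_motion_def)
 have "AE om in M. continuous_on {0..1} (%t. W t om) & W 0 om = 0"
  using bm by (auto simp: standard_brownian_motion_def)
 then obtain N where N: "N : null_sets M" "{om : space M. \<not> (continuous_on {0..1} (%t. W t om) & W 0 om = 0)} \<subseteq> N"
  by (auto simp: eventually_ae_filter)
 define w where "w t om = (if om : space M - N then W (clamp01 t) om else 0)" for t om
 have [measurable]: "N : sets M" using N by auto
 have wm [measurable]: "w t : borel_measurable M" for t
 proof -
  have [measurable]: "W (clamp01 t) : borel_measurable M" by (rule bm_measurable[OF bm]) auto
  show ?thesis unfolding w_def by measurable
 qed
 have cont: "continuous_on UNIV (%t. w t om)" for om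
 proof (cases "om : space M - N")
  case True
  then have "continuous_on {0..1} (%t. W t om)" using N by auto
  then have "continuous_on UNIV ((%t. W t om) \<circ> (%t. clamp01 t))"
   by (intro continuous_on_compose continuous_intros) (auto elim: continuous_on_subset)
  then show ?thesis using True by (simp add: w_def o_def)
 next
  case False then show ?thesis unfolding w_def by (subst if_not_P) auto
 qed
 have AEeq: "AE om in M. \<forall>t\<in>{0..1}. w t om = W t om"
  using AE_not_in[OF N(1)] by (rule eventually_rev_mp) (auto simp: w_def intro!: AE_I2)
 have "standard_brownian_motion M w"
  unfolding standard_brownian_motion_def
 proof (intro conjI allI impI ballI)
  show "AE om in M. w 0 om = 0" using N by (intro AE_I2) (auto simp: w_def)
  show "AE om in M. continuous_on {0..1} (%t. w t om)"
   using cont by (intro AE_I2) (auto intro: continuous_on_subset)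
 next
  fix s t :: real assume st: "0 <= s & s < t & t <= 1"
  then have [measurable]: "W s : borel_measurable M" "W t : borel_measurable M" using bm_measurable[OF bm] by auto
  have "distr M lborel (%om. w t om - w s om) = distr M lborel (%om. W t om - W s om)"
  proof (rule distr_cong_AE)
   show "AE x in M. w t x - w s x = W t x - W s x" using AEeq st by auto
  qed auto
  then show "distributed M lborel (%om. w t om - w s om) (normal_density 0 (sqrt (t - s)))"
   using bm st unfolding standard_brownian_motion_def distributed_def by auto
 next
  fix m and \<tau> :: "nat => real" assume \<tau>: "incseq \<tau> & range \<tau> \<subseteq> {0..1}"
  have iv: "indep_vars (%_. borel) (%i om. W (\<tau> (Suc i)) om - W (\<tau> i) om) {..<m}"
   using bm_grid_indep[OF bm] \<tau> by simp
  have \<tau>': "0 <= \<tau> i" "\<tau> i <= 1" for i using \<tau> by (auto simp: image_subset_iff)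
  have [measurable]: "W (\<tau> i) : borel_measurable M" for i using bm_measurable[OF bm \<tau>'] .
  show "indep_vars (%_. borel) (%i om. w (\<tau> (Suc i)) om - w (\<tau> i) om) {..<m}"
  proof (cases "m = 0")
   case True then show ?thesis by (simp add: indep_vars_def indep_sets_def)
  next
   case False
   then have ne: "{..<m} ~= {}" by auto
   have "distr M (Pi\<^sub>M {..<m} (%_. borel)) (%x. \<lambda>i\<in>{..<m}. w (\<tau> (Suc i)) x - w (\<tau> i) x)
    = distr M (Pi\<^sub>M {..<m} (%_. borel)) (%x. \<lambda>i\<in>{..<m}. W (\<tau> (Suc i)) x - W (\<tau> i) x)"
   proof (rule distr_cong_AE)
    show "AE x in M. (\<lambda>i\<in>{..<m}. w (\<tau> (Suc i)) x - w (\<tau> i) x) = (\<lambda>i\<in>{..<m}. W (\<tau> (Suc i)) x - W (\<tau> i) x)"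
    using AEeq by eventually_elim (use \<tau>' in auto)
   qed (rule refl | (rule measurable_restrict, measurable))+
   also have "... = Pi\<^sub>M {..<m} (%i. distr M borel (%x. W (\<tau> (Suc i)) x - W (\<tau> i) x))"
    using iv by (subst (asm) indep_vars_iff_distr_eq_PiM'[OF ne]) auto
   also have "... = Pi\<^sub>M {..<m} (%i. distr M borel (%x. w (\<tau> (Suc i)) x - w (\<tau> i) x))"
    by (intro PiM_cong refl distr_cong_AE) (use AEeq \<tau>' in \<open>auto elim!: eventually_mono\<close>)
   finally show ?thesis by (subst indep_vars_iff_distr_eq_PiM'[OF ne]) auto
  qed
 qed (use prob_space_axioms in auto)
 moreover have "(%(t, om). w t om) : borel_measurable (borel \<Otimes>\<^sub>M M)"
  by (rule joint_measurable_right_continuous[OF wm])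
   (use cont in \<open>auto simp: continuous_on_eq_continuous_within intro: continuous_within_subset\<close>)
 moreover have "w 0 om = 0" for om using N by (auto simp: w_def)
 ultimately show thesis using cont AEeq by (intro that[of w])
qed

section \<open>The model space and exponential inequalities\<close>

text \<open>The part of the hypotheses concerning only the product space and its filtration.\<close>

locale jump_model =
 fixes M1 :: "'a measure" and M2 :: "'b measure" and W :: "real => 'a => real"
  and T \<Lambda> :: "nat => 'b => real"
 assumes bm: "standard_brownian_motion M1 W" and jt: "jump_times M2 T"
  and marks [measurable]: "\<And>k. \<Lambda> k : borel_measurable M2"
begin

abbreviation "P \<equiv> model_measure M1 M2"
abbreviation "F \<equiv> model_filtration M1 M2 W T \<Lambda>"
abbreviation "raw \<equiv> raw_events M1 M2 W T \<Lambda>"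

sublocale M1: prob_space M1 using bm by (simp add: standard_brownian_motion_def)
sublocale M2: prob_space M2 using jt by (simp add: jump_times_def)
sublocale M12: pair_prob_space M1 M2 ..
sublocale P: prob_space P unfolding model_measure_def by (rule M12.prob_space_completion)

lemma T_measurable [measurable]: "T k : borel_measurable M2"
 using jt by (simp add: jump_times_def)

lemma space_P: "space P = space M1 \<times> space M2"
 by (simp add: model_measure_def space_pair_measure)

lemma measurable_P_prod: "f : measurable (M1 \<Otimes>\<^sub>M M2) N ==> f : measurable P N"
 unfolding model_measure_def by (rule measurable_completion)

lemma measurable_P_fst: "f : measurable M1 N ==> (%om. f (fst om)) : measurable P N"
 by (rule measurable_P_prod) (rule measurable_compose[OF measurable_fst])

lemma measurable_P_snd: "f : measurable M2 N ==> (%om. f (snd om)) : measurable P N"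
 by (rule measurable_P_prod) (rule measurable_compose[OF measurable_snd])

lemma W_measurable_P: "0 <= t ==> t <= 1 ==> (%om. W t (fst om)) : borel_measurable P"
 by (intro measurable_P_fst bm_measurable[OF bm])

lemma AE_P_fst: "AE x in M1. Q x ==> AE om in P. Q (fst om)"
proof -
 assume "AE x in M1. Q x"
 then obtain S where S: "S : null_sets M1" "{x : space M1. \<not> Q x} \<subseteq> S" by (auto simp: eventually_ae_filter)
 have "S \<times> space M2 : null_sets (M1 \<Otimes>\<^sub>M M2)"
  using S(1) by (auto simp: null_sets_def M2.emeasure_pair_measure_Times)
 then have "AE om in M1 \<Otimes>\<^sub>M M2. Q (fst om)" by (rule AE_I') (use S(2) in \<open>auto simp: space_pair_measure\<close>)
 then show ?thesis unfolding model_measure_def by (simp add: AE_completion)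
qed

lemma AE_P_snd: "AE x in M2. Q x ==> AE om in P. Q (snd om)"
proof -
 assume "AE x in M2. Q x"
 then obtain S where S: "S : null_sets M2" "{x : space M2. \<not> Q x} \<subseteq> S" by (auto simp: eventually_ae_filter)
 have "space M1 \<times> S : null_sets (M1 \<Otimes>\<^sub>M M2)"
  using S(1) by (auto simp: null_sets_def M2.emeasure_pair_measure_Times)
 then have "AE om in M1 \<Otimes>\<^sub>M M2. Q (snd om)" by (rule AE_I') (use S(2) in \<open>auto simp: space_pair_measure\<close>)
 then show ?thesis unfolding model_measure_def by (simp add: AE_completion)
qed

definition gens :: "real => ('a \<times> 'b) set set" where
 "gens t = {{om\<in>space M1 \<times> space M2. W s (fst om) : A} | s A. s : {0..t} & A : sets borel} \<union>
    {{om\<in>space M1 \<times> space M2. T k (snd om) : A} | k A. A : sets borel} \<union>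
    {{om\<in>space M1 \<times> space M2. \<Lambda> k (snd om) : A} | k A. A : sets borel} \<union>
    null_sets P"

lemma raw_eq: "raw t = sigma_sets (space M1 \<times> space M2) (gens t)"
 by (simp add: raw_events_def gens_def Let_def)

lemma gens_sets: "t <= 1 ==> gens t \<subseteq> sets P"
proof
 fix S assume "t <= 1" and "S : gens t"
 then consider s A where "0 <= s" "s <= 1" "A : sets borel" "S = {om\<in>space P. W s (fst om) : A}"
  | k A where "A : sets borel" "S = {om\<in>space P. T k (snd om) : A}"
  | k A where "A : sets borel" "S = {om\<in>space P. \<Lambda> k (snd om) : A}"
  | "S : null_sets P"
  unfolding gens_def space_P by fastforce
 then show "S : sets P"
 proof cases
  case 1
  then show ?thesis using measurable_sets[OF W_measurable_P[of s], of A] by (simp add: vimage_def Int_def conj_commute)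
 next
  case 2
  then show ?thesis using measurable_sets[OF measurable_P_snd[OF T_measurable], of A k] by (simp add: vimage_def Int_def conj_commute)
 next
  case 3
  then show ?thesis using measurable_sets[OF measurable_P_snd[OF marks], of A k] by (simp add: vimage_def Int_def conj_commute)
 qed auto
qed

lemma raw_sets: "t <= 1 ==> raw t \<subseteq> sets P"
 unfolding raw_eq space_P[symmetric] by (rule sets.sigma_sets_subset[OF gens_sets])

lemma gens_pow: "t <= 1 ==> gens t \<subseteq> Pow (space M1 \<times> space M2)"
 using gens_sets[of t] sets.space_closed[of P] by (auto simp: space_P)

lemma raw_mono: "s <= t ==> raw s \<subseteq> raw t"
 unfolding raw_eq gens_def
 by (intro sigma_sets_subseteq Un_mono order_refl Collect_mono impI) (elim exE conjE, intro exI conjI, assumption, auto)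

lemma raw_sigma_algebra: "t <= 1 ==> sigma_algebra (space M1 \<times> space M2) (raw t)"
 unfolding raw_eq by (rule sigma_algebra_sigma_sets) (rule gens_pow)

lemma F_sets: "sets (F t) = sigma_sets (space M1 \<times> space M2) (\<Inter>s\<in>{s\<in>{t..1}. t < s \<or> s = 1}. raw s)" if "t <= 1"
proof -
 have "(\<Inter>s\<in>{s\<in>{t..1}. t < s \<or> s = 1}. raw s) \<subseteq> raw 1" using that by auto
 also have "... \<subseteq> Pow (space M1 \<times> space M2)" using raw_sets[of 1] sets.space_closed[of P] by (auto simp: space_P)
 finally show ?thesis unfolding model_filtration_def by (rule sets_measure_of)
qed

lemma space_F: "space (F t) = space P"
 by (simp add: model_filtration_def space_P space_measure_of_conv)

lemma F_raw: "sets (F s) \<subseteq> raw t" if "s < t \<or> (s <= 1 & t = 1)" "t <= 1"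
proof -
 interpret sigma_algebra "space M1 \<times> space M2" "raw t" by (rule raw_sigma_algebra) fact
 have "(\<Inter>s\<in>{r\<in>{s..1}. s < r \<or> r = 1}. raw s) \<subseteq> raw t" using that by auto
 from sigma_sets_subset[OF this] show ?thesis using that by (subst F_sets) auto
qed

lemma raw_F: "t <= 1 ==> raw t \<subseteq> sets (F t)"
proof
 fix A assume "t <= 1" "A : raw t"
 then have "A : (\<Inter>s\<in>{s\<in>{t..1}. t < s \<or> s = 1}. raw s)" using raw_mono by auto
 then show "A : sets (F t)" unfolding F_sets[OF \<open>t <= 1\<close>] by (rule sigma_sets.Basic)
qed

lemma F_sets_P: "t <= 1 ==> sets (F t) \<subseteq> sets P"
 using F_raw[of t 1] raw_sets[of 1] by auto

lemma F_mono: "s <= t ==> t <= 1 ==> sets (F s) \<subseteq> sets (F t)"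
 by (simp add: F_sets) (rule sigma_sets_subseteq, auto)

lemma F_measurable_mono: "s <= t ==> t <= 1 ==> f : measurable (F s) N ==> f : measurable (F t) N"
 by (rule measurable_from_subalg[of _ "F s"]) (auto simp: subalgebra_def space_F dest: F_mono)

lemma F_measurable_P: "t <= 1 ==> f : measurable (F t) N ==> f : measurable P N"
 by (rule measurable_from_subalg[of _ "F t"]) (auto simp: subalgebra_def space_F dest: F_sets_P)

lemma W_measurable_F: "0 <= s ==> s <= t ==> t <= 1 ==> (%om. W s (fst om)) : borel_measurable (F t)"
proof (rule measurableI)
 fix A :: "real set" assume *: "0 <= s" "s <= t" "t <= 1" "A : sets borel"
 then have "{om\<in>space M1 \<times> space M2. W s (fst om) : A} : gens t" unfolding gens_def by auto
 then have "{om\<in>space M1 \<times> space M2. W s (fst om) : A} : sets (F t)"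
  using raw_F[of t] * unfolding raw_eq by auto
 then show "(%om. W s (fst om)) -` A Int space (F t) : sets (F t)"
  by (simp add: space_F space_P vimage_def Int_def conj_commute)
qed auto

lemma T_measurable_F: "t <= 1 ==> (%om. T k (snd om)) : borel_measurable (F t)"
proof (rule measurableI)
 fix A :: "real set" assume *: "t <= 1" "A : sets borel"
 then have "{om\<in>space M1 \<times> space M2. T k (snd om) : A} : gens t" unfolding gens_def by auto
 then have "{om\<in>space M1 \<times> space M2. T k (snd om) : A} : sets (F t)"
  using raw_F[of t] * unfolding raw_eq by auto
 then show "(%om. T k (snd om)) -` A Int space (F t) : sets (F t)"
  by (simp add: space_F space_P vimage_def Int_def conj_commute)
qed auto

lemma measure_P_times:
 assumes "A : sets M1" "B : sets M2"
 shows "measure P (A \<times> B) = measure M1 A * measure M2 B"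
 using assms unfolding model_measure_def
 by (simp add: measure_def M2.emeasure_pair_measure_Times enn2real_mult)

text \<open>Up to null sets the past is generated by rectangles: finitely many values of \<open>W\<close> up to \<open>s\<close>, times an event of
the second factor. On these, independence is that of the increments.\<close>

lemma indep_past_increment:
 assumes st: "0 <= s" "s < t" "t <= 1"
  and A0: "A0 : raw s" and B0: "B0 : sets borel"
 shows "P.prob (A0 Int {om\<in>space P. W t (fst om) - W s (fst om) : B0})
  = P.prob A0 * P.prob {om\<in>space P. W t (fst om) - W s (fst om) : B0}"
proof -
 define D where "D x = W t x - W s x" for x
 have [measurable]: "W s : borel_measurable M1" "W t : borel_measurable M1"
  using bm_measurable[OF bm] st by auto
 have Dm [measurable]: "D : borel_measurable M1" unfolding D_def using st by measurable
 have DP [measurable]: "(%om. D (fst om)) : borel_measurable P" by (rule measurable_P_fst) measurable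
 define rect where "rect B C = {om. (\<forall>r\<in>{0..s}. W r (fst om) : B r) & snd om : C}"
  for B :: "real => real set" and C :: "'b set"
 define good where "good B C \<longleftrightarrow> finite {r. B r ~= UNIV} & (ALL r. B r : sets borel) & C : sets M2"
  for B :: "real => real set" and C :: "'b set"
 define G1 where "G1 = {A : sets P. EX B C. good B C & (AE om in P. om : A \<longleftrightarrow> om : rect B C)}"
 define G2 where "G2 = {(%om. D (fst om)) -` A Int space P | A. A : sets borel}"
 have indM1: "M1.prob {x\<in>space M1. (\<forall>r\<in>{0..s}. W r x : B r) & D x : A}
   = M1.prob {x\<in>space M1. \<forall>r\<in>{0..s}. W r x : B r} * M1.prob {x\<in>space M1. D x : A}"
  "{x\<in>space M1. \<forall>r\<in>{0..s}. W r x : B r} : sets M1"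
  if g: "good B C" and A: "A : sets borel" for A B C
 proof -
  define R where "R = {r\<in>{0..s}. B r ~= UNIV}"
  have R: "finite R" using g by (auto simp: good_def R_def intro: finite_subset[OF _ conjunct1])
  have B [measurable]: "B r : sets borel" for r using g by (simp add: good_def)
  have R': "0 <= r" "r <= 1" "r <= s" if "r : R" for r using that st by (auto simp: R_def)
  have eqR: "(\<forall>r\<in>{0..s}. W r x : B r) \<longleftrightarrow> (\<forall>r\<in>R. W r x : B r)" for x by (auto simp: R_def)
  have [measurable]: "{x : space M1. W r x : B r} : sets M1" if "r : R" for r
  proof -
   have [measurable]: "W r : borel_measurable M1" using bm_measurable[OF bm] R'[OF that] by simp
   show ?thesis by measurable
  qed
  show S1: "{x\<in>space M1. \<forall>r\<in>{0..s}. W r x : B r} : sets M1"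
   unfolding eqR by (rule sets.sets_Collect_finite_All[OF _ R]) simp_all
  define u where "u j = (case j of None => s | Some (r::real) => 0)" for j
  define v where "v j = (case j of None => t | Some (r::real) => r)" for j
  have ind: "M1.indep_var (PiM (Some ` R) (%_. borel)) (%om. \<lambda>j\<in>Some ` R. W (v j) om - W (u j) om)
    (PiM {None} (%_. borel)) (%om. \<lambda>j\<in>{None}. W (v j) om - W (u j) om)"
  proof (rule bm_indep_two_blocks[OF bm])
   fix j assume "j : Some ` R Un {None}"
   then show "0 <= u j & u j <= v j & v j <= 1" using R' st by (auto simp: u_def v_def)
  next
   fix i j assume "i : Some ` R" "j : {None :: real option}"
   then obtain r where "r : R" "i = Some r" "j = None" by auto
   then show "{u i<..v i} Int {u j<..v j} = {}" using R'(3)[of r] by (auto simp: u_def v_def)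
  qed (use R in auto)
  define Xa where "Xa = Pi\<^sub>E (Some ` R) (%j. B (the j))"
  define Xb where "Xb = Pi\<^sub>E {None :: real option} (%j. A)"
  have Xa: "Xa : sets (PiM (Some ` R) (%_. borel))" unfolding Xa_def by (rule sets_PiM_I_finite) (use R in auto)
  have Xb: "Xb : sets (PiM {None} (%_. borel))" unfolding Xb_def by (rule sets_PiM_I_finite) (use A in auto)
  have W0: "AE x in M1. W 0 x = 0" using bm by (simp add: standard_brownian_motion_def)
  have iffXa: "(\<lambda>j\<in>Some ` R. W (v j) x - W (u j) x) : Xa \<longleftrightarrow> (\<forall>r\<in>{0..s}. W r x : B r)" if "W 0 x = 0" for x
   using that unfolding Xa_def eqR by (simp add: PiE_iff u_def v_def)
  have iffXb: "(\<lambda>j\<in>{None}. W (v j) x - W (u j) x) : Xb \<longleftrightarrow> D x : A" for x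
   unfolding Xb_def by (simp add: PiE_iff u_def v_def D_def)
  have a1: "M1.prob ((%x. \<lambda>j\<in>Some ` R. W (v j) x - W (u j) x) -` Xa Int space M1)
   = M1.prob {x\<in>space M1. \<forall>r\<in>{0..s}. W r x : B r}"
  proof (rule M1.finite_measure_eq_AE)
   show "AE x in M1. x : (%x. \<lambda>j\<in>Some ` R. W (v j) x - W (u j) x) -` Xa Int space M1 \<longleftrightarrow>
    x : {x\<in>space M1. \<forall>r\<in>{0..s}. W r x : B r}"
    using W0 by eventually_elim (auto simp: iffXa)
  qed (use measurable_sets[OF M1.indep_var_rv1[OF ind] Xa] S1 in auto)
  have a2: "(%x. \<lambda>j\<in>{None}. W (v j) x - W (u j) x) -` Xb Int space M1 = {x\<in>space M1. D x : A}"
   by (simp only: vimage_def iffXb) auto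
  have a3: "M1.prob ((%x. (\<lambda>j\<in>Some ` R. W (v j) x - W (u j) x, \<lambda>j\<in>{None}. W (v j) x - W (u j) x)) -` (Xa \<times> Xb) Int space M1)
   = M1.prob {x\<in>space M1. (\<forall>r\<in>{0..s}. W r x : B r) & D x : A}"
  proof (rule M1.finite_measure_eq_AE)
   show "AE x in M1. x : (%x. (\<lambda>j\<in>Some ` R. W (v j) x - W (u j) x, \<lambda>j\<in>{None}. W (v j) x - W (u j) x)) -` (Xa \<times> Xb) Int space M1 \<longleftrightarrow>
    x : {x\<in>space M1. (\<forall>r\<in>{0..s}. W r x : B r) & D x : A}"
    using W0 by eventually_elim (auto simp: iffXa iffXb)
   have Dset: "{x\<in>space M1. D x : A} : sets M1" using A by measurable
   have "{x\<in>space M1. (\<forall>r\<in>{0..s}. W r x : B r) & D x : A}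
    = {x\<in>space M1. \<forall>r\<in>{0..s}. W r x : B r} Int {x\<in>space M1. D x : A}" by auto
   with sets.Int[OF S1 Dset] show "{x\<in>space M1. (\<forall>r\<in>{0..s}. W r x : B r) & D x : A} : sets M1" by simp
   show "(%x. (\<lambda>j\<in>Some ` R. W (v j) x - W (u j) x, \<lambda>j\<in>{None}. W (v j) x - W (u j) x)) -` (Xa \<times> Xb) Int space M1 : sets M1"
    using Xa Xb by (intro measurable_sets[OF measurable_Pair[OF M1.indep_var_rv1[OF ind] M1.indep_var_rv2[OF ind]]]) auto
  qed
  show "M1.prob {x\<in>space M1. (\<forall>r\<in>{0..s}. W r x : B r) & D x : A}
   = M1.prob {x\<in>space M1. \<forall>r\<in>{0..s}. W r x : B r} * M1.prob {x\<in>space M1. D x : A}"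
   using M1.indep_varD[OF ind Xa Xb] unfolding a1 a2 a3 .
 qed
 have "P.indep_set G1 G2"
  unfolding P.indep_set_def
 proof (rule P.indep_setI[unfolded P.indep_set_def])
  show "G1 \<subseteq> P.events" by (auto simp: G1_def)
  show "G2 \<subseteq> P.events" by (auto simp: G2_def)
  fix a b assume "a : G1" "b : G2"
  then obtain B C A where a: "a : sets P" "good B C" "AE om in P. om : a \<longleftrightarrow> om : rect B C"
   and A: "A : sets borel" and b: "b = (%om. D (fst om)) -` A Int space P"
   by (auto simp: G1_def G2_def)
  have C: "C : sets M2" using a by (simp add: good_def)
  have Csp: "C \<subseteq> space M2" using sets.sets_into_space[OF C] .
  note i = indM1[OF a(2) A]
  let ?S = "{x\<in>space M1. \<forall>r\<in>{0..s}. W r x : B r}" and ?SD = "{x\<in>space M1. (\<forall>r\<in>{0..s}. W r x : B r) & D x : A}"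
  have Dset: "{x\<in>space M1. D x : A} : sets M1" using A by measurable
  have "?SD = ?S Int {x\<in>space M1. D x : A}" by auto
  with sets.Int[OF i(2) Dset] have SDset: "?SD : sets M1" by simp
  have SC: "?S \<times> C : sets P" "?SD \<times> C : sets P" using i(2) C SDset by (auto simp: model_measure_def)
  have "P.prob a = P.prob (?S \<times> C)"
  proof (rule P.finite_measure_eq_AE)
   show "AE om in P. om : a \<longleftrightarrow> om : ?S \<times> C"
    using a(3) AE_space by eventually_elim (auto simp: rect_def space_P)
  qed (use a SC in auto)
  then have 1: "P.prob a = M1.prob ?S * M2.prob C" using measure_P_times[OF i(2) C] by simp
  have bs: "b : sets P" using b A by auto
  have "P.prob (a Int b) = P.prob (?SD \<times> C)"
  proof (rule P.finite_measure_eq_AE)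
   show "AE om in P. om : a Int b \<longleftrightarrow> om : ?SD \<times> C"
    using a(3) AE_space by eventually_elim (auto simp: rect_def space_P b)
  qed (use a SC bs in auto)
  then have 2: "P.prob (a Int b) = M1.prob ?SD * M2.prob C" using measure_P_times[OF SDset C] by simp
  have "b = {x\<in>space M1. D x : A} \<times> space M2" by (auto simp: b space_P)
  then have 3: "P.prob b = M1.prob {x\<in>space M1. D x : A}" using measure_P_times[OF Dset sets.top] by (simp add: M2.prob_space)
  show "P.prob (a Int b) = P.prob a * P.prob b" using 1 2 3 i(1) by simp
 qed
 then have ind: "P.indep_set (sigma_sets (space P) G1) (sigma_sets (space P) G2)"
 proof (rule P.indep_set_sigma_sets)
  show "Int_stable G1"
  proof (rule Int_stableI)
   fix a a' assume "a : G1" "a' : G1"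
   then obtain B C B' C' where a: "a : sets P" "good B C" "AE om in P. om : a \<longleftrightarrow> om : rect B C"
    "a' : sets P" "good B' C'" "AE om in P. om : a' \<longleftrightarrow> om : rect B' C'"
    by (auto simp: G1_def)
   have "finite ({r. B r ~= UNIV} Un {r. B' r ~= UNIV})" using a by (auto simp: good_def)
   then have "finite {r. B r Int B' r ~= UNIV}" by (rule finite_subset[rotated]) auto
   then have "good (%r. B r Int B' r) (C Int C')" using a by (auto simp: good_def)
   moreover have "AE om in P. om : a Int a' \<longleftrightarrow> om : rect (%r. B r Int B' r) (C Int C')"
    using a(3,6) by eventually_elim (auto simp: rect_def)
   ultimately show "a Int a' : G1" using a by (auto simp: G1_def)
  qed
  show "Int_stable G2"
  proof (rule Int_stableI)
   fix a b assume "a : G2" "b : G2"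
   then obtain A B where "A : sets borel" "B : sets borel" "a = (%om. D (fst om)) -` A Int space P" "b = (%om. D (fst om)) -` B Int space P"
    by (auto simp: G2_def)
   then show "a Int b : G2" unfolding G2_def by (intro CollectI exI[of _ "A Int B"]) auto
  qed
 qed
 have gG: "gens s \<subseteq> G1"
 proof
  fix S assume S: "S : gens s"
  have SP: "S : sets P" using gens_sets[of s] S st by auto
  have cyl: "EX B C. good B C & (AE om in P. om : S \<longleftrightarrow> om : rect B C)"
   if C: "C : sets M2" "S = space M1 \<times> C" for C
   using C sets.sets_into_space[OF C(1)]
   by (intro exI[of _ "%_. UNIV"] exI[of _ C] conjI AE_I2) (auto simp: good_def rect_def space_P)
  have "EX B C. good B C & (AE om in P. om : S \<longleftrightarrow> om : rect B C)"
   using S unfolding gens_def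
  proof (elim UnE)
   assume "S : {{om : space M1 \<times> space M2. W r (fst om) : A} |r A. r : {0..s} & A : sets borel}"
   then obtain r A where "S = {om : space M1 \<times> space M2. W r (fst om) : A}" "r : {0..s}" "A : sets borel"
    by (elim CollectE exE conjE)
   then show ?thesis
    by (intro exI[of _ "%q. if q = r then A else UNIV"] exI[of _ "space M2"] conjI AE_I2)
    (auto simp: good_def rect_def space_P)
  next
   assume "S : {{om : space M1 \<times> space M2. T k (snd om) : A} |k A. A : sets borel}"
   then obtain k A where "S = {om : space M1 \<times> space M2. T k (snd om) : A}" "A : sets borel"
    by (elim CollectE exE conjE)
   then show ?thesis by (intro cyl[of "T k -` A Int space M2"]) (auto intro: measurable_sets[OF T_measurable])
  next
   assume "S : {{om : space M1 \<times> space M2. \<Lambda> k (snd om) : A} |k A. A : sets borel}"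
   then obtain k A where "S = {om : space M1 \<times> space M2. \<Lambda> k (snd om) : A}" "A : sets borel"
    by (elim CollectE exE conjE)
   then show ?thesis by (intro cyl[of "\<Lambda> k -` A Int space M2"]) (auto intro: measurable_sets[OF marks])
  next
   assume "S : null_sets P"
   then have "AE om in P. om : S \<longleftrightarrow> om : rect (%_. UNIV) {}"
    by (rule AE_not_in[THEN eventually_mono]) (auto simp: rect_def)
   then show ?thesis by (intro exI[of _ "%_. UNIV"] exI[of _ "{}"]) (auto simp: good_def)
  qed
  then show "S : G1" using SP by (simp add: G1_def)
 qed
 have "A0 : sigma_sets (space P) G1"
  using A0 sigma_sets_subseteq[OF gG, of "space P"] unfolding raw_eq space_P by blast
 moreover have "{om\<in>space P. D (fst om) : B0} : sigma_sets (space P) G2"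
  using B0 by (intro sigma_sets.Basic) (auto simp: G2_def)
 ultimately show ?thesis using P.indep_setD[OF ind] by (simp add: D_def)
qed

lemma indep_past_increment_integral:
 assumes st: "0 <= s" "s < t" "t <= 1"
  and Rm: "sets R = raw s" "space R = space P"
  and g: "g : borel_measurable (R \<Otimes>\<^sub>M borel)"
 shows "(\<integral>\<^sup>+om. g (om, W t (fst om) - W s (fst om)) \<partial>P)
  = (\<integral>\<^sup>+om. (\<integral>\<^sup>+x. g (om, x) \<partial>(density lborel (normal_density 0 (sqrt (t - s))))) \<partial>P)"
proof -
 define D where "D om = W t (fst om) - W s (fst om)" for om :: "'a \<times> 'b"
 have Dm [measurable]: "D : borel_measurable P" unfolding D_def
  using st by (intro borel_measurable_diff W_measurable_P) auto
 have rawP: "raw s \<subseteq> sets P" using raw_sets[of s] st by simp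
 have idm [measurable]: "(%om. om) : P \<rightarrow>\<^sub>M R"
  by (rule measurableI) (use Rm rawP in \<open>auto simp: sets.sets_into_space Int_absorb2\<close>)
 interpret D: prob_space "distr P borel D" by (rule P.prob_space_distr) simp
 interpret R: prob_space "distr P R (%om. om)" by (rule P.prob_space_distr) simp
 interpret RD: pair_prob_space "distr P R (%om. om)" "distr P borel D" ..
 have joint: "distr P R (%om. om) \<Otimes>\<^sub>M distr P borel D = distr P (R \<Otimes>\<^sub>M borel) (%om. (om, D om))"
 proof (rule pair_measure_eqI)
  fix A B assume "A : sets (distr P R (%om. om))" "B : sets (distr P borel D)"
  then have A: "A : raw s" "A : sets R" and B: "B : sets borel" using Rm by auto
  have vim: "(%om. (om, D om)) -` (A \<times> B) Int space P = A Int {om\<in>space P. D om : B}" by auto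
  have idD: "(%om. (om, D om)) : P \<rightarrow>\<^sub>M R \<Otimes>\<^sub>M borel" by measurable
  have AB: "A \<times> B : sets (R \<Otimes>\<^sub>M borel)" using A B by auto
  have "emeasure (distr P (R \<Otimes>\<^sub>M borel) (%om. (om, D om))) (A \<times> B) = ennreal (P.prob (A Int {om\<in>space P. D om : B}))"
   unfolding emeasure_distr[OF idD AB] vim by (rule P.emeasure_eq_measure)
  also have "... = ennreal (P.prob A * P.prob {om\<in>space P. D om : B})"
   using indep_past_increment[OF st A(1) B] by (simp add: D_def)
  also have "... = emeasure (distr P R (%om. om)) A * emeasure (distr P borel D) B"
   using A B rawP sets.sets_into_space[of A P]
   by (subst (1 2) emeasure_distr) (auto simp: P.emeasure_eq_measure ennreal_mult vimage_def Int_def Int_absorb2 conj_commute intro!: arg_cong2[where f="(*)"] arg_cong[where f=ennreal] arg_cong[where f="P.prob"])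
  finally show "emeasure (distr P R (%om. om)) A * emeasure (distr P borel D) B = emeasure (distr P (R \<Otimes>\<^sub>M borel) (%om. (om, D om))) (A \<times> B)" by (rule sym)
 qed (simp_all add: D.sigma_finite_measure_axioms R.sigma_finite_measure_axioms cong: sets_pair_measure_cong)
 have law: "distr P borel D = density lborel (normal_density 0 (sqrt (t - s)))"
 proof -
  have "distr P borel D = distr M1 borel (%x. W t x - W s x)"
  proof (rule measure_eqI)
   fix A assume "A : sets (distr P borel D)"
   then have A: "A : sets borel" by simp
   have m: "(%x. W t x - W s x) : borel_measurable M1"
    using st by (intro borel_measurable_diff bm_measurable[OF bm]) auto
   have S: "(%x. W t x - W s x) -` A Int space M1 : sets M1" using measurable_sets[OF m A] .
   have "D -` A Int space P = ((%x. W t x - W s x) -` A Int space M1) \<times> space M2" by (auto simp: D_def space_P)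
   then show "emeasure (distr P borel D) A = emeasure (distr M1 borel (%x. W t x - W s x)) A"
    using measure_P_times[OF S sets.top] m A
    by (simp add: emeasure_distr P.emeasure_eq_measure M1.emeasure_eq_measure M2.prob_space)
  qed simp
  also have "... = distr M1 lborel (%x. W t x - W s x)" by (rule distr_cong) auto
  also have "... = density lborel (normal_density 0 (sqrt (t - s)))"
   using bm st by (auto simp: standard_brownian_motion_def distributed_def)
  finally show ?thesis .
 qed
 have "(\<integral>\<^sup>+om. g (om, D om) \<partial>P) = (\<integral>\<^sup>+z. g z \<partial>distr P (R \<Otimes>\<^sub>M borel) (%om. (om, D om)))"
  by (rule nn_integral_distr[symmetric]) (use g in measurable)
 also have "... = (\<integral>\<^sup>+z. g z \<partial>(distr P R (%om. om) \<Otimes>\<^sub>M distr P borel D))" by (simp only: joint)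
 also have "... = (\<integral>\<^sup>+om. (\<integral>\<^sup>+x. g (om, x) \<partial>distr P borel D) \<partial>distr P R (%om. om))"
  by (rule D.nn_integral_fst[symmetric]) (use g in \<open>simp cong: measurable_cong_sets sets_pair_measure_cong\<close>)
 also have "... = (\<integral>\<^sup>+om. (\<integral>\<^sup>+x. g (om, x) \<partial>distr P borel D) \<partial>P)"
 proof (rule nn_integral_distr[OF idm], unfold measurable_distr_eq1)
  have "g : borel_measurable (R \<Otimes>\<^sub>M distr P borel D)" using g by (simp cong: measurable_cong_sets sets_pair_measure_cong)
  then show "(%om. \<integral>\<^sup>+x. g (om, x) \<partial>distr P borel D) : borel_measurable R"
   by (rule D.borel_measurable_nn_integral_fst)
 qed
 finally show ?thesis by (simp add: D_def law)
qed

lemma gaussian_exponential_mean: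
 assumes "\<sigma> > 0"
 shows "(\<integral>\<^sup>+x. ennreal (exp (z * x - z\<^sup>2 * \<sigma>\<^sup>2 / 2)) \<partial>(density lborel (normal_density 0 \<sigma>))) = 1"
proof -
 have "(\<integral>\<^sup>+x. ennreal (exp (z * x - z\<^sup>2 * \<sigma>\<^sup>2 / 2)) \<partial>(density lborel (normal_density 0 \<sigma>)))
  = (\<integral>\<^sup>+x. ennreal (normal_density 0 \<sigma> x) * ennreal (exp (z * x - z\<^sup>2 * \<sigma>\<^sup>2 / 2)) \<partial>lborel)"
  by (rule nn_integral_density) auto
 also have "... = (\<integral>\<^sup>+x. ennreal (normal_density (z * \<sigma>\<^sup>2) \<sigma> x) \<partial>lborel)"
 proof (rule nn_integral_cong)
  fix x
  have "- x\<^sup>2 / (2 * \<sigma>\<^sup>2) + (z * x - z\<^sup>2 * \<sigma>\<^sup>2 / 2) = - (x - z * \<sigma>\<^sup>2)\<^sup>2 / (2 * \<sigma>\<^sup>2)"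
   using assms by (simp add: field_simps power2_eq_square)
  then have "normal_density 0 \<sigma> x * exp (z * x - z\<^sup>2 * \<sigma>\<^sup>2 / 2) = normal_density (z * \<sigma>\<^sup>2) \<sigma> x"
   unfolding normal_density_def by (simp add: exp_add[symmetric])
  then show "ennreal (normal_density 0 \<sigma> x) * ennreal (exp (z * x - z\<^sup>2 * \<sigma>\<^sup>2 / 2)) = ennreal (normal_density (z * \<sigma>\<^sup>2) \<sigma> x)"
   by (simp add: ennreal_mult[symmetric])
 qed
 also have "... = 1"
  by (subst nn_integral_eq_integral) (auto simp: assms integrable_normal_density)
 finally show ?thesis .
qed

text \<open>One Gaussian step of the exponential martingale. The right-continuous filtration at \<open>s\<close> is contained in the raw
one at any \<open>q > s\<close>; the identity holds for the increment from \<open>q\<close>, and \<open>q\<close> decreases to \<open>s\<close> by continuity of the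
paths, with Fatou's lemma giving the inequality.\<close>

lemma exponential_step:
 assumes st: "0 <= s" "s <= t" "t <= 1"
  and G: "G : borel_measurable (F s)" and z: "z : borel_measurable (F s)"
 shows "(\<integral>\<^sup>+om. G om * ennreal (exp (z om * (W t (fst om) - W s (fst om)) - (z om)\<^sup>2 * (t - s) / 2)) \<partial>P)
  <= (\<integral>\<^sup>+om. G om \<partial>P)"
proof (cases "s = t")
 case False
 then have st': "s < t" using st by simp
 define q where "q m = s + (t - s) / real (Suc (Suc m))" for m
 have q: "s < q m" "q m < t" "q m <= 1" "0 <= q m" for m
 proof -
  show "s < q m" using st' by (simp add: q_def)
  have "(t - s) / real (Suc (Suc m)) < (t - s) / 1" using st' by (intro divide_strict_left_mono) auto
  then show "q m < t" by (simp add: q_def)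
  then show "q m <= 1" "0 <= q m" using st \<open>s < q m\<close> by auto
 qed
 have ql: "q ----> s"
 proof -
  have "(%n. (t - s) / real n) ----> 0" by (rule lim_const_over_n)
  from LIMSEQ_Suc[OF LIMSEQ_Suc[OF this]] have "(%m. s + (t - s) / real (Suc (Suc m))) ----> s + 0"
   by (intro tendsto_intros)
  then show ?thesis by (simp add: q_def[abs_def])
 qed
 define E where "E m om = G om * ennreal (exp (z om * (W t (fst om) - W (q m) (fst om)) - (z om)\<^sup>2 * (t - q m) / 2))" for m om
 have s1: "s <= 1" using st by simp
 have GP [measurable]: "G : borel_measurable P" "z : borel_measurable P"
  using F_measurable_P[OF s1] G z by auto
 have [measurable]: "(%om. W t (fst om)) : borel_measurable P" "(%om. W (q m) (fst om)) : borel_measurable P" for m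
  using W_measurable_P st q by auto
 have Em [measurable]: "E m : borel_measurable P" for m unfolding E_def using q st by measurable
 have eq: "(\<integral>\<^sup>+om. E m om \<partial>P) = (\<integral>\<^sup>+om. G om \<partial>P)" for m
 proof -
  define R where "R = sigma (space P) (raw (q m))"
  have R: "sets R = raw (q m)" "space R = space P"
   using raw_sigma_algebra[of "q m"] q(3)[of m] raw_sets[of "q m"] sets.space_closed[of P]
   by (simp_all add: R_def space_P sigma_algebra.sets_measure_of_eq space_measure_of_conv sigma_algebra.sigma_sets_eq)
  have FR: "f : measurable R N" if "f : measurable (F s) N" for f and N :: "'x measure"
   by (rule measurable_from_subalg[OF _ that]) (use F_raw[of s "q m"] q R in \<open>auto simp: space_F subalgebra_def\<close>)
  have [measurable]: "G : borel_measurable R" "z : borel_measurable R" using FR G z by auto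
  have "(\<integral>\<^sup>+om. E m om \<partial>P) = (\<integral>\<^sup>+om. (\<integral>\<^sup>+x. G om * ennreal (exp (z om * x - (z om)\<^sup>2 * (t - q m) / 2))
    \<partial>(density lborel (normal_density 0 (sqrt (t - q m))))) \<partial>P)"
   using indep_past_increment_integral[OF q(4) q(2) st(3) R, of "%(om, x). G om * ennreal (exp (z om * x - (z om)\<^sup>2 * (t - q m) / 2))"]
   by (simp add: E_def)
  also have "... = (\<integral>\<^sup>+om. G om \<partial>P)"
  proof (rule nn_integral_cong)
   fix om
   have "(\<integral>\<^sup>+x. G om * ennreal (exp (z om * x - (z om)\<^sup>2 * (t - q m) / 2)) \<partial>(density lborel (normal_density 0 (sqrt (t - q m)))))
    = G om * (\<integral>\<^sup>+x. ennreal (exp (z om * x - (z om)\<^sup>2 * (t - q m) / 2)) \<partial>(density lborel (normal_density 0 (sqrt (t - q m)))))"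
    by (rule nn_integral_cmult) simp
   also have "... = G om" using gaussian_exponential_mean[of "sqrt (t - q m)" "z om"] q(2)[of m] by simp
   finally show "(\<integral>\<^sup>+x. G om * ennreal (exp (z om * x - (z om)\<^sup>2 * (t - q m) / 2)) \<partial>(density lborel (normal_density 0 (sqrt (t - q m))))) = G om" .
  qed
  finally show ?thesis .
 qed
 have "AE x in M1. continuous_on {0..1} (%t. W t x)" using bm by (simp add: standard_brownian_motion_def)
 then have "AE om in P. continuous_on {0..1} (%t. W t (fst om))" by (rule AE_P_fst)
 then have ae: "AE om in P. G om * ennreal (exp (z om * (W t (fst om) - W s (fst om)) - (z om)\<^sup>2 * (t - s) / 2))
   <= liminf (%m. E m om)"
 proof eventually_elim
  case (elim om)
  have "(%m. W (q m) (fst om)) ----> W s (fst om)"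
   by (rule continuous_on_tendsto_compose[OF elim ql]) (use st q in \<open>auto simp: less_imp_le\<close>)
  then have "(%m. ennreal (exp (z om * (W t (fst om) - W (q m) (fst om)) - (z om)\<^sup>2 * (t - q m) / 2)))
   ----> ennreal (exp (z om * (W t (fst om) - W s (fst om)) - (z om)\<^sup>2 * (t - s) / 2))"
   using ql by (intro tendsto_ennrealI tendsto_intros) auto
  then have "(%m. E m om) ----> G om * ennreal (exp (z om * (W t (fst om) - W s (fst om)) - (z om)\<^sup>2 * (t - s) / 2))"
   unfolding E_def by (intro tendsto_mult_ennreal tendsto_const) auto
  then show ?case by (simp add: lim_imp_Liminf)
 qed
 have "(\<integral>\<^sup>+om. G om * ennreal (exp (z om * (W t (fst om) - W s (fst om)) - (z om)\<^sup>2 * (t - s) / 2)) \<partial>P)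
  <= (\<integral>\<^sup>+om. liminf (%m. E m om) \<partial>P)" by (rule nn_integral_mono_AE[OF ae])
 also have "... <= liminf (%m. \<integral>\<^sup>+om. E m om \<partial>P)" by (rule nn_integral_liminf) simp
 also have "... = (\<integral>\<^sup>+om. G om \<partial>P)" by (simp add: eq Liminf_const)
 finally show ?thesis .
qed simp

lemma exponential_sum:
 fixes rh :: "nat => real" and z :: "nat => 'a \<times> 'b => real"
 assumes rh: "incseq rh" "range rh \<subseteq> {0..1}"
  and z: "\<And>i. i < N ==> z i : borel_measurable (F (rh i))"
  and G: "G : borel_measurable (F (rh 0))"
 shows "(\<integral>\<^sup>+om. G om * ennreal (exp (\<Sum>i<N. z i om * (W (rh (Suc i)) (fst om) - W (rh i) (fst om))
    - (z i om)\<^sup>2 * (rh (Suc i) - rh i) / 2)) \<partial>P) <= (\<integral>\<^sup>+om. G om \<partial>P)"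
 using z
proof (induction N)
 case (Suc N)
 have rh01: "0 <= rh i" "rh i <= 1" for i using rh(2) by (auto simp: image_subset_iff)
 have mono: "rh i <= rh j" if "i <= j" for i j using rh(1) that by (simp add: incseqD)
 define H where "H om = G om * ennreal (exp (\<Sum>i<N. z i om * (W (rh (Suc i)) (fst om) - W (rh i) (fst om))
    - (z i om)\<^sup>2 * (rh (Suc i) - rh i) / 2))" for om
 have [measurable]: "G : borel_measurable (F (rh N))" using G F_measurable_mono[OF mono[of 0 N] rh01(2)] by simp
 have [measurable]: "z i : borel_measurable (F (rh N))" if "i < N" for i
  using F_measurable_mono[OF mono[of i N] rh01(2)] Suc.prems[of i] that by simp
 have [measurable]: "(%om. W (rh i) (fst om)) : borel_measurable (F (rh N))" if "i <= N" for i
  using W_measurable_F rh01 mono[OF that] by auto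
 have Hm: "H : borel_measurable (F (rh N))" unfolding H_def
  by (intro borel_measurable_times_ennreal measurable_compose[OF _ measurable_ennreal] borel_measurable_exp
    measurable_compose[OF _ borel_measurable_exp] borel_measurable_sum borel_measurable_diff
    borel_measurable_times borel_measurable_divide borel_measurable_power borel_measurable_const)
   (auto simp: Suc_le_eq)
 have "(\<integral>\<^sup>+om. G om * ennreal (exp (\<Sum>i<Suc N. z i om * (W (rh (Suc i)) (fst om) - W (rh i) (fst om))
    - (z i om)\<^sup>2 * (rh (Suc i) - rh i) / 2)) \<partial>P)
  = (\<integral>\<^sup>+om. H om * ennreal (exp (z N om * (W (rh (Suc N)) (fst om) - W (rh N) (fst om))
    - (z N om)\<^sup>2 * (rh (Suc N) - rh N) / 2)) \<partial>P)"
  unfolding H_def by (intro nn_integral_cong) (simp add: exp_add ennreal_mult mult.assoc del: ennreal_mult')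
 also have "... <= (\<integral>\<^sup>+om. H om \<partial>P)"
  by (rule exponential_step[OF rh01(1) mono rh01(2) Hm]) (use Suc.prems in auto)
 also have "... <= (\<integral>\<^sup>+om. G om \<partial>P)" unfolding H_def using Suc by simp
 finally show ?case .
qed simp

end

context jump_model
begin

abbreviation Wp :: "real => 'a \<times> 'b => real" where "Wp t om \<equiv> W t (fst om)"

lemma sum_inner_shift:
 fixes f :: "nat => nat => real"
 shows "(\<Sum>i<m+2. if 1 <= i & i <= m then f (i - 1) i else 0) = (\<Sum>j<m. f j (Suc j))"
proof -
 have "(\<Sum>i<m+2. if 1 <= i & i <= m then f (i - 1) i else 0) = (\<Sum>i\<in>Suc ` {..<m}. f (i - 1) i)"
  unfolding image_Suc_lessThan by (rule sum.mono_neutral_cong_right) auto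
 also have "... = (\<Sum>j<m. f j (Suc j))" by (subst sum.reindex) auto
 finally show ?thesis .
qed

text \<open>The exponential inequality for simple integrands: on the event that the quadratic variation is below \<open>c\<close> the
exponential martingale dominates \<open>exp (l u - l\<^sup>2 c / 2)\<close>, and \<open>l = u / c\<close> is the optimal choice. The term with
\<open>\<eta>\<close> is one more simple integrand.\<close>

lemma simple_deviation:
 assumes sd: "simple_data P F m \<tau> \<xi>"
  and st: "0 <= s" "s <= t" "t <= 1"
  and A: "A : sets (F s)" and \<eta>: "\<eta> : borel_measurable (F s)" and uc: "u > 0" "c > 0"
 defines "E \<equiv> A Int {om : space P.
   \<bar>simple_integral Wp m \<tau> \<xi> t om - simple_integral Wp m \<tau> \<xi> s om - \<eta> om * (Wp t om - Wp s om)\<bar> > u &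
   (\<integral>\<^sup>+x\<in>{s<..t}. ennreal ((simple_integrand m \<tau> \<xi> x om - \<eta> om)\<^sup>2) \<partial>lborel) <= ennreal c}"
 shows "E : sets P & P.prob E <= 2 * exp (- (u\<^sup>2 / (2 * c))) * P.prob A"
proof -
 have \<tau>: "incseq \<tau>" "0 <= \<tau> i" "\<tau> i <= 1" for i using sd by (auto simp: simple_data_def image_subset_iff)
 have \<xi>: "\<xi> i : borel_measurable (F (\<tau> i))" if "i < m" for i using sd that by (simp add: simple_data_def)
 define rh where "rh i = (if i = 0 then s else if i <= m + 1 then max s (min t (\<tau> (i - 1))) else t)" for i
 define z0 where "z0 i om = (if 1 <= i & i <= m then \<xi> (i - 1) om else 0) - \<eta> om" for i om
 define z where "z i om = (if rh i < rh (Suc i) then z0 i om else 0)" for i om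
 have rhst: "s <= rh i" "rh i <= t" for i using st by (auto simp: rh_def)
 have inc: "incseq rh"
 proof (rule incseq_SucI)
  fix i
  have "\<tau> (i - 1) <= \<tau> i" by (rule incseqD[OF \<tau>(1)]) simp
  then show "rh i <= rh (Suc i)" using rhst[of "Suc i"] rhst[of i] st by (auto simp: rh_def)
 qed
 have r01: "0 <= rh i" "rh i <= 1" for i using rhst[of i] st by auto
 have rng: "range rh \<subseteq> {0..1}" using r01 by auto
 have rh0: "rh 0 = s" and rhN: "rh (m + 2) = t" by (auto simp: rh_def)
 have \<eta>': "\<eta> : borel_measurable (F (rh i))" for i by (rule F_measurable_mono[OF rhst(1) r01(2) \<eta>])
 have zm: "z i : borel_measurable (F (rh i))" for i
 proof (cases "rh i < rh (Suc i) & 1 <= i & i <= m")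
  case True
  then have "\<tau> (i - 1) <= rh i" using rhst(2)[of "Suc i"] by (auto simp: rh_def split: if_splits)
  then have "\<xi> (i - 1) : borel_measurable (F (rh i))"
   by (rule F_measurable_mono[OF _ r01(2) \<xi>]) (use True in linarith)
  then show ?thesis using True \<eta>' unfolding z_def[abs_def] z0_def by simp
 next
  case False
  then have "z i = (%om. if rh i < rh (Suc i) then - \<eta> om else 0)" by (auto simp: z_def z0_def fun_eq_iff)
  then show ?thesis using \<eta>' by simp
 qed
 have s1: "s <= 1" using st by simp
 have AP [measurable]: "A : sets P" using F_sets_P[OF s1] A by auto
 have [measurable]: "\<eta> : borel_measurable P" using F_measurable_P[OF s1 \<eta>] .
 have [measurable]: "z i : borel_measurable P" for i using F_measurable_P[OF r01(2) zm] .
 have [measurable]: "Wp (rh i) : borel_measurable P" for i using W_measurable_P r01 by auto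
 define Y where "Y om = (\<Sum>i<m+2. z i om * (Wp (rh (Suc i)) om - Wp (rh i) om))" for om
 define V where "V om = (\<Sum>i<m+2. (z i om)\<^sup>2 * (rh (Suc i) - rh i))" for om
 have [measurable]: "Y : borel_measurable P" "V : borel_measurable P" unfolding Y_def V_def by measurable
 have Yeq: "simple_integral Wp m \<tau> \<xi> t om - simple_integral Wp m \<tau> \<xi> s om - \<eta> om * (Wp t om - Wp s om) = Y om" for om
 proof -
  have "Y om = (\<Sum>i<m+2. (if 1 <= i & i <= m then \<xi> (i - 1) om * (Wp (rh (Suc i)) om - Wp (rh i) om) else 0)
    - \<eta> om * (Wp (rh (Suc i)) om - Wp (rh i) om))"
   unfolding Y_def
  proof (rule sum.cong[OF refl])
   fix i
   have "rh i = rh (Suc i)" if "\<not> rh i < rh (Suc i)" using that incseqD[OF inc, of i "Suc i"] by simp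
   then show "z i om * (Wp (rh (Suc i)) om - Wp (rh i) om) =
    (if 1 <= i & i <= m then \<xi> (i - 1) om * (Wp (rh (Suc i)) om - Wp (rh i) om) else 0)
    - \<eta> om * (Wp (rh (Suc i)) om - Wp (rh i) om)"
    by (cases "rh i < rh (Suc i)") (auto simp: z_def z0_def left_diff_distrib)
  qed
  also have "... = (\<Sum>i<m+2. if 1 <= i & i <= m then \<xi> (i - 1) om * (Wp (rh (Suc i)) om - Wp (rh i) om) else 0)
    - \<eta> om * (\<Sum>i<m+2. Wp (rh (Suc i)) om - Wp (rh i) om)"
   unfolding sum_distrib_left by (rule sum_subtractf)
  also have "(\<Sum>i<m+2. Wp (rh (Suc i)) om - Wp (rh i) om) = Wp t om - Wp s om"
   by (subst sum_lessThan_telescope[of "%i. Wp (rh i) om"]) (simp add: rh0 rhN del: add_2_eq_Suc')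
  also have "(\<Sum>i<m+2. if 1 <= i & i <= m then \<xi> (i - 1) om * (Wp (rh (Suc i)) om - Wp (rh i) om) else 0)
   = (\<Sum>j<m. \<xi> j om * (Wp (rh (Suc (Suc j))) om - Wp (rh (Suc j)) om))"
   by (rule sum_inner_shift[of m "%j i. \<xi> j om * (Wp (rh (Suc i)) om - Wp (rh i) om)"])
  also have "... = (\<Sum>j<m. \<xi> j om * (Wp (min t (\<tau> (Suc j))) om - Wp (min t (\<tau> j)) om)
    - \<xi> j om * (Wp (min s (\<tau> (Suc j))) om - Wp (min s (\<tau> j)) om))"
  proof (rule sum.cong[OF refl])
   fix j assume "j : {..<m}"
   then have r: "rh (Suc j) = max s (min t (\<tau> j))" "rh (Suc (Suc j)) = max s (min t (\<tau> (Suc j)))"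
    by (auto simp: rh_def)
   have key: "Wp (min t x) om - Wp (min s x) om = Wp (max s (min t x)) om - Wp s om" for x
    using st by (auto simp: min_def max_def)
   show "\<xi> j om * (Wp (rh (Suc (Suc j))) om - Wp (rh (Suc j)) om) =
    \<xi> j om * (Wp (min t (\<tau> (Suc j))) om - Wp (min t (\<tau> j)) om)
    - \<xi> j om * (Wp (min s (\<tau> (Suc j))) om - Wp (min s (\<tau> j)) om)"
    unfolding r using key[of "\<tau> j"] key[of "\<tau> (Suc j)"]
    by (simp add: right_diff_distrib[symmetric])
  qed
  also have "... = simple_integral Wp m \<tau> \<xi> t om - simple_integral Wp m \<tau> \<xi> s om"
   by (simp add: simple_integral_def sum_subtractf)
  finally show ?thesis by simp
 qed
 have Veq: "(\<integral>\<^sup>+x\<in>{s<..t}. ennreal ((simple_integrand m \<tau> \<xi> x om - \<eta> om)\<^sup>2) \<partial>lborel) = ennreal (V om)" for om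
 proof -
  define e :: "nat => real => real" where "e i = indicator {rh i<..rh (Suc i)}" for i
  have ee: "e i x * e j x = 0" if "i ~= j" for i j x
  proof -
   have "x \<notin> {rh i<..rh (Suc i)} Int {rh j<..rh (Suc j)}" if "i < j" for i j
    using incseqD[OF inc, of "Suc i" j] that by auto
   from this[of i j] this[of j i] that show ?thesis by (cases "i < j") (auto simp: e_def indicator_def)
  qed
  have sq: "(simple_integrand m \<tau> \<xi> x om - \<eta> om)\<^sup>2 = (\<Sum>i<m+2. (z i om)\<^sup>2 * e i x)" if x: "x : {s<..t}" for x
  proof -
   define g :: "nat => real" where "g i = (if x <= rh i then 1 else 0)" for i
   have eg: "e i x = g (Suc i) - g i" for i
    using incseqD[OF inc, of i "Suc i"] by (auto simp: e_def g_def indicator_def)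
   have one: "(\<Sum>i<m+2. e i x) = 1"
    unfolding eg by (subst sum_lessThan_telescope) (use x rh0 rhN in \<open>auto simp: g_def simp del: add_2_eq_Suc'\<close>)
   have "simple_integrand m \<tau> \<xi> x om = (\<Sum>j<m. \<xi> j om * e (Suc j) x)"
    unfolding simple_integrand_def
   proof (rule sum.cong[OF refl])
    fix j assume "j : {..<m}"
    then have r: "rh (Suc j) = max s (min t (\<tau> j))" "rh (Suc (Suc j)) = max s (min t (\<tau> (Suc j)))"
    by (auto simp: rh_def)
    show "\<xi> j om * indicator {\<tau> j<..\<tau> (Suc j)} x = \<xi> j om * e (Suc j) x"
    unfolding e_def r using x by (auto simp: indicator_def)
   qed
   also have "... = (\<Sum>i<m+2. (if 1 <= i & i <= m then \<xi> (i - 1) om else 0) * e i x)"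
    unfolding if_distrib[of "%y. y * _"] mult_zero_left
    by (rule sum_inner_shift[of m "%j i. \<xi> j om * e i x", symmetric])
   finally have "simple_integrand m \<tau> \<xi> x om - \<eta> om
    = (\<Sum>i<m+2. (if 1 <= i & i <= m then \<xi> (i - 1) om else 0) * e i x) - \<eta> om * (\<Sum>i<m+2. e i x)"
    using one by simp
   also have "... = (\<Sum>i<m+2. z i om * e i x)"
    unfolding sum_distrib_left sum_subtractf[symmetric]
    by (rule sum.cong) (auto simp: z_def z0_def e_def indicator_def left_diff_distrib)
   finally have eq: "simple_integrand m \<tau> \<xi> x om - \<eta> om = (\<Sum>i<m+2. z i om * e i x)" .
   have "(\<Sum>i<m+2. z i om * e i x)\<^sup>2 = (\<Sum>i<m+2. \<Sum>j<m+2. (z i om * z j om) * (e i x * e j x))"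
    unfolding power2_eq_square sum_product by (simp add: ac_simps)
   also have "... = (\<Sum>i<m+2. \<Sum>j<m+2. if j = i then (z i om)\<^sup>2 * e i x else 0)"
   proof (intro sum.cong refl)
    fix i j
    show "z i om * z j om * (e i x * e j x) = (if j = i then (z i om)\<^sup>2 * e i x else 0)"
    proof (cases "j = i")
    case True
    have "e i x * e i x = e i x" by (simp add: e_def indicator_def)
    then show ?thesis using True by (simp add: power2_eq_square)
    next
    case False
    then show ?thesis using ee[of i j x] by simp
    qed
   qed
   also have "... = (\<Sum>i<m+2. (z i om)\<^sup>2 * e i x)"
    by (intro sum.cong refl) (auto simp: sum.delta simp del: sum.lessThan_Suc add_2_eq_Suc')
   finally show ?thesis unfolding eq .
  qed
  have "(\<integral>\<^sup>+x\<in>{s<..t}. ennreal ((simple_integrand m \<tau> \<xi> x om - \<eta> om)\<^sup>2) \<partial>lborel)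
   = (\<integral>\<^sup>+x. (\<Sum>i<m+2. ennreal ((z i om)\<^sup>2) * indicator {rh i<..rh (Suc i)} x) \<partial>lborel)"
  proof (rule nn_integral_cong)
   fix x
   show "ennreal ((simple_integrand m \<tau> \<xi> x om - \<eta> om)\<^sup>2) * indicator {s<..t} x
    = (\<Sum>i<m+2. ennreal ((z i om)\<^sup>2) * indicator {rh i<..rh (Suc i)} x)"
   proof (cases "x : {s<..t}")
    case True
    have "ennreal (\<Sum>i<m+2. (z i om)\<^sup>2 * e i x) = (\<Sum>i<m+2. ennreal ((z i om)\<^sup>2 * e i x))"
    by (rule sum_ennreal[symmetric]) (simp add: e_def)
    also have "... = (\<Sum>i<m+2. ennreal ((z i om)\<^sup>2) * indicator {rh i<..rh (Suc i)} x)"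
    by (intro sum.cong refl) (simp add: e_def indicator_def)
    finally show ?thesis using True sq[OF True] by simp
   next
    case False
    then have "x \<notin> {rh i<..rh (Suc i)}" for i using rhst(1)[of i] rhst(2)[of "Suc i"] by auto
    then show ?thesis using False by simp
   qed
  qed
  also have "... = (\<Sum>i<m+2. \<integral>\<^sup>+x. ennreal ((z i om)\<^sup>2) * indicator {rh i<..rh (Suc i)} x \<partial>lborel)"
   by (rule nn_integral_sum) measurable
  also have "... = (\<Sum>i<m+2. ennreal ((z i om)\<^sup>2 * (rh (Suc i) - rh i)))"
   using incseqD[OF inc] by (intro sum.cong refl) (simp add: nn_integral_cmult ennreal_mult)
  also have "... = ennreal (V om)"
   unfolding V_def using incseqD[OF inc] by (intro sum_ennreal) auto
  finally show ?thesis .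
 qed
 have V0: "V om >= 0" for om unfolding V_def using incseqD[OF inc] by (intro sum_nonneg mult_nonneg_nonneg) auto
 define Es where "Es g = A Int {om : space P. g * Y om > u & V om <= c}" for g :: real
 have Esm [measurable]: "Es g : sets P" for g unfolding Es_def by measurable
 have Es_bound: "P.prob (Es g) <= exp (- (u\<^sup>2 / (2 * c))) * P.prob A" if g: "g\<^sup>2 = 1" for g
 proof -
  define l where "l = u / c"
  have l: "l > 0" using uc by (simp add: l_def)
  have lu: "l * u - l\<^sup>2 * c / 2 = u\<^sup>2 / (2 * c)" using uc by (simp add: l_def field_simps power2_eq_square)
  have "ennreal (exp (u\<^sup>2 / (2 * c))) * emeasure P (Es g) = (\<integral>\<^sup>+om. ennreal (exp (u\<^sup>2 / (2 * c))) * indicator (Es g) om \<partial>P)"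
   by (rule nn_integral_cmult_indicator[symmetric]) simp
  also have "... <= (\<integral>\<^sup>+om. indicator A om * ennreal (exp (\<Sum>i<m+2. (l * g * z i om) * (W (rh (Suc i)) (fst om) - W (rh i) (fst om))
    - (l * g * z i om)\<^sup>2 * (rh (Suc i) - rh i) / 2)) \<partial>P)"
  proof (rule nn_integral_mono)
   fix om
   have ex: "(\<Sum>i<m+2. (l * g * z i om) * (W (rh (Suc i)) (fst om) - W (rh i) (fst om))
    - (l * g * z i om)\<^sup>2 * (rh (Suc i) - rh i) / 2) = l * (g * Y om) - l\<^sup>2 * V om / 2"
   proof -
    have "(l * g * z i om)\<^sup>2 = l\<^sup>2 * (z i om)\<^sup>2" for i using g by (simp add: power_mult_distrib)
    then show ?thesis
    unfolding Y_def V_def sum_subtractf sum_distrib_left sum_divide_distrib by (simp add: ac_simps)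
   qed
   show "ennreal (exp (u\<^sup>2 / (2 * c))) * indicator (Es g) om <= indicator A om * ennreal (exp (\<Sum>i<m+2. (l * g * z i om) * (W (rh (Suc i)) (fst om) - W (rh i) (fst om))
    - (l * g * z i om)\<^sup>2 * (rh (Suc i) - rh i) / 2))"
   proof (cases "om : Es g")
    case True
    then have "l * u <= l * (g * Y om)" "l\<^sup>2 * V om <= l\<^sup>2 * c" using l
    by (auto simp: Es_def intro!: mult_left_mono)
    then have "u\<^sup>2 / (2 * c) <= l * (g * Y om) - l\<^sup>2 * V om / 2" using lu by linarith
    then show ?thesis unfolding ex using True by (simp add: Es_def)
   qed simp
  qed
  also have "... <= (\<integral>\<^sup>+om. indicator A om \<partial>P)"
   by (rule exponential_sum[OF inc rng]) (use zm A rh0 in auto)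
  also have "... = emeasure P A" by simp
  finally have "ennreal (exp (u\<^sup>2 / (2 * c)) * P.prob (Es g)) <= ennreal (P.prob A)"
   by (simp add: P.emeasure_eq_measure ennreal_mult)
  then have "exp (u\<^sup>2 / (2 * c)) * P.prob (Es g) <= P.prob A" by (simp add: ennreal_le_iff)
  then have "exp (- (u\<^sup>2 / (2 * c))) * (exp (u\<^sup>2 / (2 * c)) * P.prob (Es g)) <= exp (- (u\<^sup>2 / (2 * c))) * P.prob A"
   by (rule mult_left_mono) simp
  then show ?thesis by (simp add: mult.assoc[symmetric] exp_add[symmetric])
 qed
 have Eeq: "E = Es 1 Un Es (-1)"
  unfolding E_def Es_def Yeq Veq using uc V0 by (auto simp: abs_if ennreal_le_iff less_imp_le split: if_splits)
 have "P.prob (Es 1 Un Es (-1)) <= P.prob (Es 1) + P.prob (Es (-1))" by (rule measure_Un_le) auto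
 also have "... <= 2 * exp (- (u\<^sup>2 / (2 * c))) * P.prob A" using Es_bound[of 1] Es_bound[of "-1"] by simp
 finally show ?thesis unfolding Eeq by simp
qed

lemma path_measurable:
 assumes "(%(x, om). H x om) : borel_measurable (borel \<Otimes>\<^sub>M P)" "om : space P"
 shows "(%x. H x om :: real) : borel_measurable borel"
 using measurable_Pair_compose_split[OF assms(1), of "%x. x" borel "%x. om"] assms(2) by simp

lemma measurable_time_integral:
 fixes f :: "real => 'a \<times> 'b => ennreal"
 assumes "(%(x, om). f x om) : borel_measurable (borel \<Otimes>\<^sub>M P)"
 shows "(%om. \<integral>\<^sup>+x. f x om \<partial>lborel) : borel_measurable P"
proof -
 have "(%(om, x). f x om) : borel_measurable (P \<Otimes>\<^sub>M lborel)"
  using measurable_compose[OF measurable_pair_swap' assms] by (simp add: case_prod_beta' cong: measurable_cong_sets sets_pair_measure_cong)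
 then show ?thesis by (intro sigma_finite_measure.borel_measurable_nn_integral lborel.sigma_finite_measure_axioms)
qed

lemma square_add_le: "(x + y)\<^sup>2 <= 2 * x\<^sup>2 + 2 * (y::real)\<^sup>2"
 using sum_squares_bound[of x y] by (simp add: power2_sum)

text \<open>The inequality survives the limit in probability that defines the Ito integral; the constant worsens
because the approximation error is split off both from the integral and from the quadratic variation.\<close>

lemma ito_deviation:
 assumes sd: "\<And>n. simple_data P F (m n) (\<tau> n) (\<xi> n)"
  and Hm: "(%(x, om). H x om) : borel_measurable (borel \<Otimes>\<^sub>M P)"
  and conv: "\<And>\<epsilon>. \<epsilon> > 0 ==> (%n. P.prob {om : space P.
    (\<integral>\<^sup>+x\<in>{0..1}. ennreal ((simple_integrand (m n) (\<tau> n) (\<xi> n) x om - H x om)\<^sup>2) \<partial>lborel) > ennreal \<epsilon>}) ----> 0"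
  and Il: "\<And>t. t : {0..1} ==> tendsto_in_prob P (%n. simple_integral Wp (m n) (\<tau> n) (\<xi> n) t) (I t)"
  and st: "0 <= s" "s <= t" "t <= 1"
  and A: "A : sets (F s)" and \<eta>: "\<eta> : borel_measurable (F s)" and uc: "u > 0" "c > 0"
 defines "E \<equiv> A Int {om : space P. \<bar>I t om - I s om - \<eta> om * (Wp t om - Wp s om)\<bar> > u &
   (\<integral>\<^sup>+x\<in>{s<..t}. ennreal ((H x om - \<eta> om)\<^sup>2) \<partial>lborel) < ennreal c}"
 shows "E : sets P & P.prob E <= 2 * exp (- (u\<^sup>2 / (32 * c))) * P.prob A"
proof -
 have s1: "s <= 1" and st': "s : {0..1}" "t : {0..1}" using st by auto
 have [measurable]: "A : sets P" using F_sets_P[OF s1] A by auto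
 have [measurable]: "\<eta> : borel_measurable P" using F_measurable_P[OF s1 \<eta>] .
 have [measurable]: "Wp s : borel_measurable P" "Wp t : borel_measurable P" using W_measurable_P st by auto
 have Im [measurable]: "I s : borel_measurable P" "I t : borel_measurable P"
  using Il st' by (auto simp: tendsto_in_prob_def)
 define h where "h n = simple_integrand (m n) (\<tau> n) (\<xi> n)" for n
 define J where "J n = simple_integral Wp (m n) (\<tau> n) (\<xi> n)" for n
 have Jm [measurable]: "J n s : borel_measurable P" "J n t : borel_measurable P" for n
  using Il st' by (auto simp: tendsto_in_prob_def J_def)
 have \<xi>P: "\<xi> n i : borel_measurable P" if "i < m n" for n i
 proof -
  have "\<tau> n i <= 1" "\<xi> n i : borel_measurable (F (\<tau> n i))" using sd[of n] that by (auto simp: simple_data_def image_subset_iff)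
  then show ?thesis by (rule F_measurable_P)
 qed
 have hm [measurable]: "(%x. h n (fst x) (snd x)) : borel_measurable (borel \<Otimes>\<^sub>M P)" for n
  unfolding h_def simple_integrand_def
  by (intro borel_measurable_sum borel_measurable_times measurable_compose[OF measurable_snd \<xi>P]
    measurable_compose[OF measurable_fst borel_measurable_indicator]) auto
 have Hm' [measurable]: "(%x. H (fst x) (snd x)) : borel_measurable (borel \<Otimes>\<^sub>M P)" using Hm by (simp add: case_prod_beta')
 have m1 [measurable]: "(%om. \<integral>\<^sup>+x\<in>{s<..t}. ennreal ((H x om - \<eta> om)\<^sup>2) \<partial>lborel) : borel_measurable P"
  by (rule measurable_time_integral) (simp add: case_prod_beta')
 have m2 [measurable]: "(%om. \<integral>\<^sup>+x\<in>{0..1}. ennreal ((h n x om - H x om)\<^sup>2) \<partial>lborel) : borel_measurable P" for n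
  by (rule measurable_time_integral) (simp add: case_prod_beta')
 have Em: "E : sets P" unfolding E_def by measurable
 define E1 where "E1 n = A Int {om : space P. \<bar>J n t om - J n s om - \<eta> om * (Wp t om - Wp s om)\<bar> > u / 2 &
   (\<integral>\<^sup>+x\<in>{s<..t}. ennreal ((h n x om - \<eta> om)\<^sup>2) \<partial>lborel) <= ennreal (4 * c)}" for n
 define E2 where "E2 r n = {om : space P. \<bar>J n r om - I r om\<bar> > u / 4}" for r n
 define E3 where "E3 n = {om : space P. (\<integral>\<^sup>+x\<in>{0..1}. ennreal ((h n x om - H x om)\<^sup>2) \<partial>lborel) > ennreal c}" for n
 have E1: "E1 n : sets P" "P.prob (E1 n) <= 2 * exp (- (u\<^sup>2 / (32 * c))) * P.prob A" for n
 proof -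
  have "E1 n : sets P & P.prob (E1 n) <= 2 * exp (- ((u/2)\<^sup>2 / (2 * (4 * c)))) * P.prob A"
   unfolding E1_def J_def h_def by (rule simple_deviation[OF sd st A \<eta>]) (use uc in auto)
  moreover have "(u/2)\<^sup>2 / (2 * (4 * c)) = u\<^sup>2 / (32 * c)" using uc by (simp add: field_simps power2_eq_square)
  ultimately show "E1 n : sets P" "P.prob (E1 n) <= 2 * exp (- (u\<^sup>2 / (32 * c))) * P.prob A" by simp_all
 qed
 have [measurable]: "E2 s n : sets P" "E2 t n : sets P" "E3 n : sets P" "E1 n : sets P" for n
  using E1 unfolding E2_def E3_def by measurable
 have sub: "E \<subseteq> E1 n Un (E2 s n Un (E2 t n Un E3 n))" for n
 proof
  fix om assume w: "om : E"
  then have wP: "om : space P" by (simp add: E_def)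
  show "om : E1 n Un (E2 s n Un (E2 t n Un E3 n))"
  proof (rule ccontr)
   assume n: "om \<notin> E1 n Un (E2 s n Un (E2 t n Un E3 n))"
   have "(\<integral>\<^sup>+x\<in>{s<..t}. ennreal ((h n x om - \<eta> om)\<^sup>2) \<partial>lborel)
    <= (\<integral>\<^sup>+x. 2 * (ennreal ((h n x om - H x om)\<^sup>2) * indicator {0..1} x) + 2 * (ennreal ((H x om - \<eta> om)\<^sup>2) * indicator {s<..t} x) \<partial>lborel)"
   proof (rule nn_integral_mono)
    fix x
    have "(h n x om - \<eta> om)\<^sup>2 <= 2 * (h n x om - H x om)\<^sup>2 + 2 * (H x om - \<eta> om)\<^sup>2"
    using square_add_le[of "h n x om - H x om" "H x om - \<eta> om"] by simp
    then have "ennreal ((h n x om - \<eta> om)\<^sup>2) <= 2 * ennreal ((h n x om - H x om)\<^sup>2) + 2 * ennreal ((H x om - \<eta> om)\<^sup>2)"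
    by (simp add: ennreal_mult[symmetric] ennreal_plus[symmetric] flip: ennreal_numeral del: ennreal_plus)
    then show "ennreal ((h n x om - \<eta> om)\<^sup>2) * indicator {s<..t} x
    <= 2 * (ennreal ((h n x om - H x om)\<^sup>2) * indicator {0..1} x) + 2 * (ennreal ((H x om - \<eta> om)\<^sup>2) * indicator {s<..t} x)"
    using st by (auto simp: indicator_def)
   qed
   also have "... = 2 * (\<integral>\<^sup>+x\<in>{0..1}. ennreal ((h n x om - H x om)\<^sup>2) \<partial>lborel) + 2 * (\<integral>\<^sup>+x\<in>{s<..t}. ennreal ((H x om - \<eta> om)\<^sup>2) \<partial>lborel)"
   proof -
    have [measurable]: "(%x. H x om) : borel_measurable borel" "(%x. h n x om) : borel_measurable borel"
    using path_measurable[OF _ wP, of H] path_measurable[OF _ wP, of "h n"] Hm hm[of n] by (simp_all add: case_prod_beta')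
    show ?thesis by (subst nn_integral_add) (auto simp: nn_integral_cmult)
   qed
   also have "... <= 2 * ennreal c + 2 * ennreal c"
    using n w wP by (intro add_mono mult_left_mono) (auto simp: E3_def E_def not_less)
   also have "... = ennreal (4 * c)" using uc
    by (simp add: ennreal_mult[symmetric] ennreal_plus[symmetric] flip: ennreal_numeral del: ennreal_plus)
   finally have 1: "(\<integral>\<^sup>+x\<in>{s<..t}. ennreal ((h n x om - \<eta> om)\<^sup>2) \<partial>lborel) <= ennreal (4 * c)" .
   have "\<bar>J n s om - I s om\<bar> <= u / 4" "\<bar>J n t om - I t om\<bar> <= u / 4" using n wP by (auto simp: E2_def)
   moreover have "\<bar>I t om - I s om - \<eta> om * (Wp t om - Wp s om)\<bar> > u" using w by (simp add: E_def)
   ultimately have 2: "\<bar>J n t om - J n s om - \<eta> om * (Wp t om - Wp s om)\<bar> > u / 2" by linarith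
   have "om : E1 n" using 1 2 w wP by (simp add: E1_def E_def)
   then show False using n by simp
  qed
 qed
 have bd: "P.prob E <= 2 * exp (- (u\<^sup>2 / (32 * c))) * P.prob A + (P.prob (E2 s n) + (P.prob (E2 t n) + P.prob (E3 n)))" for n
 proof -
  have "P.prob E <= P.prob (E1 n Un (E2 s n Un (E2 t n Un E3 n)))" by (rule P.finite_measure_mono[OF sub]) measurable
  also have "... <= P.prob (E1 n) + P.prob (E2 s n Un (E2 t n Un E3 n))" by (rule measure_Un_le) measurable
  also have "P.prob (E2 s n Un (E2 t n Un E3 n)) <= P.prob (E2 s n) + P.prob (E2 t n Un E3 n)" by (rule measure_Un_le) measurable
  also have "P.prob (E2 t n Un E3 n) <= P.prob (E2 t n) + P.prob (E3 n)" by (rule measure_Un_le) measurable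
  finally show ?thesis using E1(2)[of n] by linarith
 qed
 have "(%n. 2 * exp (- (u\<^sup>2 / (32 * c))) * P.prob A + (P.prob (E2 s n) + (P.prob (E2 t n) + P.prob (E3 n))))
  ----> 2 * exp (- (u\<^sup>2 / (32 * c))) * P.prob A + (0 + (0 + 0))"
 proof (intro tendsto_intros)
  have "(%n. P.prob (E2 r n)) ----> 0" if "r : {0..1}" for r
   using Il[OF that] uc(1) unfolding tendsto_in_prob_def E2_def J_def by (elim conjE allE[of _ "u / 4"]) simp
  then show "(%n. P.prob (E2 s n)) ----> 0" "(%n. P.prob (E2 t n)) ----> 0" using st' by auto
  show "(%n. P.prob (E3 n)) ----> 0" using conv[OF uc(2)] by (simp add: E3_def h_def)
 qed
 then have "P.prob E <= 2 * exp (- (u\<^sup>2 / (32 * c))) * P.prob A + (0 + (0 + 0))"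
  by (rule LIMSEQ_le_const) (use bd in auto)
 then show ?thesis using Em by simp
qed

end

section \<open>Stochastic integrals at random times\<close>

lemma measure_le_of_eventually:
 assumes "finite_measure M" and E: "E : sets M" and Em: "\<And>m::nat. D m : sets M"
  and ae: "AE om in M. om : E --> eventually (%m. om : D m) sequentially"
  and b: "\<And>m. measure M (D m) <= b"
 shows "measure M E <= b"
proof -
 interpret finite_measure M by fact
 have "(%m. \<integral>om. indicator (E Int D m) om \<partial>M) ----> (\<integral>om. indicator E om \<partial>M :: real)"
 proof (rule integral_dominated_convergence[where w="%_. 1"])
  show "AE om in M. (%m. indicator (E Int D m) om :: real) ----> indicator E om"
   using ae
  proof eventually_elim
   case (elim om)
   show ?case
   proof (cases "om : E")
    case True
    then have "eventually (%m. indicator (E Int D m) om = (indicator E om :: real)) sequentially"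
    using elim by (auto elim!: eventually_mono)
    then show ?thesis by (rule tendsto_eventually)
   qed simp
  qed
 qed (use E Em in \<open>auto simp: indicator_def\<close>)
 then have "(%m. measure M (E Int D m)) ----> measure M E" using E Em sets.sets_into_space[OF E]
  by (simp add: Int_absorb2 inf.absorb1 sets.Int_space_eq2)
 moreover have "measure M (E Int D m) <= b" for m
  using finite_measure_mono[of "E Int D m" "D m"] Em b[of m] by auto
 ultimately show ?thesis by (intro LIMSEQ_le_const2) auto
qed

text \<open>Events that almost surely fail eventually, up to events of vanishing probability.\<close>

lemma measure_tendsto_0_of_eventually:
 assumes "finite_measure M" and E: "\<And>n::nat. E n : sets M" and D: "\<And>n. D n : sets M"
  and ae: "AE om in M. eventually (%n. om : E n --> om : D n) sequentially"
  and b: "(%n. measure M (D n)) ----> 0"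
 shows "(%n. measure M (E n)) ----> 0"
proof -
 interpret finite_measure M by fact
 have "(%n. \<integral>om. indicator (E n - D n) om \<partial>M) ----> (\<integral>om. 0 \<partial>M :: real)"
 proof (rule integral_dominated_convergence[where w="%_. 1"])
  show "AE om in M. (%n. indicator (E n - D n) om :: real) ----> 0"
   using ae
  proof eventually_elim
   case (elim om)
   then have "eventually (%n. indicator (E n - D n) om = (0::real)) sequentially"
    by eventually_elim auto
   then show ?case by (rule tendsto_eventually)
  qed
 qed (use E D in \<open>auto simp: indicator_def\<close>)
 then have "(%n. measure M (E n - D n)) ----> 0" using E D
  by (simp add: sets.Int_space_eq2 sets.Diff)
 from tendsto_add[OF this b] have "(%n. measure M (E n - D n) + measure M (D n)) ----> 0" by simp
 then show ?thesis
 proof (rule tendsto_sandwich[OF _ _ tendsto_const, rotated -1])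
  show "\<forall>\<^sub>F n in sequentially. measure M (E n) <= measure M (E n - D n) + measure M (D n)"
  proof (intro always_eventually allI)
   fix n
   have "measure M (E n) <= measure M ((E n - D n) Un D n)" using E D by (intro finite_measure_mono) auto
   also have "... <= measure M (E n - D n) + measure M (D n)" using E D by (intro measure_Un_le) auto
   finally show "measure M (E n) <= measure M (E n - D n) + measure M (D n)" .
  qed
 qed simp
qed

text \<open>An almost surely continuous version \<open>I\<close> of the integral of \<open>H\<close>, with the approximating simple integrands
made explicit.\<close>

locale ito_model = jump_model M1 M2 W T \<Lambda>
 for M1 :: "'a measure" and M2 :: "'b measure" and W T \<Lambda> +
 fixes H I :: "real => 'a \<times> 'b => real" and m :: "nat => nat" and \<tau> :: "nat => nat => real"
  and \<xi> :: "nat => nat => 'a \<times> 'b => real"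
 assumes sd: "\<And>n. simple_data P F (m n) (\<tau> n) (\<xi> n)"
  and Hm: "(%(x, om). H x om) : borel_measurable (borel \<Otimes>\<^sub>M P)"
  and conv: "\<And>\<epsilon>. \<epsilon> > 0 ==> (%n. P.prob {om : space P.
    (\<integral>\<^sup>+x\<in>{0..1}. ennreal ((simple_integrand (m n) (\<tau> n) (\<xi> n) x om - H x om)\<^sup>2) \<partial>lborel) > ennreal \<epsilon>}) ----> 0"
  and Il: "\<And>t. t : {0..1} ==> tendsto_in_prob P (%n. simple_integral Wp (m n) (\<tau> n) (\<xi> n) t) (I t)"
  and HF: "\<And>t. t : {0..1} ==> H t : borel_measurable (F t)"
  and Hrc: "\<And>om t. om : space P ==> 0 <= t ==> t < 1 ==> continuous (at_right t) (%t. H t om)"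
  and Hb: "\<And>om. om : space P ==> EX B. \<forall>t\<in>{0..1}. \<bar>H t om\<bar> <= B"
  and Ic: "AE om in P. continuous_on {0..1} (%t. I t om)"
begin

lemma deviation:
 assumes "0 <= s" "s <= t" "t <= 1" "A : sets (F s)" "\<eta> : borel_measurable (F s)" "u > 0" "c > 0"
 defines "E \<equiv> A Int {om : space P. \<bar>I t om - I s om - \<eta> om * (Wp t om - Wp s om)\<bar> > u &
   (\<integral>\<^sup>+x\<in>{s<..t}. ennreal ((H x om - \<eta> om)\<^sup>2) \<partial>lborel) < ennreal c}"
 shows "E : sets P" "P.prob E <= 2 * exp (- (u\<^sup>2 / (32 * c))) * P.prob A"
 using ito_deviation[OF sd Hm conv Il assms(1-7)] unfolding E_def by auto

text \<open>Times known at time 0 are rounded up to a finite grid; on each cell the deterministic inequality applies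
to the event that the times lie in the cell, and the bounds add up to a bound independent of the grid.
Right-continuity of \<open>H\<close> and continuity of \<open>I\<close> remove the rounding.\<close>

lemma deviation_random_times:
 fixes S R :: "'a \<times> 'b => real"
 assumes Sm: "S : borel_measurable (F 0)" and Rm: "R : borel_measurable (F 0)"
  and SR: "\<And>om. om : space P ==> 0 <= S om & S om <= R om & R om <= 1"
  and uc: "u > 0" "c > 0" and E: "E : sets P"
  and ae: "AE om in P. om : E -->
   \<bar>I (R om) om - I (S om) om - H (S om) om * (Wp (R om) om - Wp (S om) om)\<bar> > u &
   (\<integral>\<^sup>+x\<in>{S om<..R om}. ennreal ((H x om - H (S om) om)\<^sup>2) \<partial>lborel) < ennreal c"
 shows "P.prob E <= 2 * exp (- (u\<^sup>2 / (32 * c)))"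
proof -
 define N where "N k = real (Suc k)" for k :: nat
 have N: "N k > 0" for k by (simp add: N_def)
 define q where "q k x = of_int \<lceil>N k * x\<rceil> / N k" for k x
 have qb: "x <= q k x" "q k x <= x + 1 / N k" for k x
 proof -
  have "N k * x <= of_int \<lceil>N k * x\<rceil>" by linarith
  then show "x <= q k x" using N[of k] by (simp add: q_def pos_le_divide_eq mult.commute)
  have "of_int \<lceil>N k * x\<rceil> <= N k * x + 1" by linarith
  then have "q k x <= (N k * x + 1) / N k" unfolding q_def using N[of k] by (intro divide_right_mono) auto
  then show "q k x <= x + 1 / N k" using N[of k] by (simp add: add_divide_distrib)
 qed
 have ql: "(%k. q k x) ----> x" for x
 proof -
  have "(%k. x + 1 / N k) ----> x + 0" unfolding N_def
   by (intro tendsto_intros LIMSEQ_Suc[OF lim_1_over_n])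
  then show ?thesis
   by (intro tendsto_sandwich[of "%_. x" "%k. q k x" _ "%k. x + 1 / N k"]) (use qb in auto)
 qed
 have q1: "q k x <= 1" if "x <= 1" for k x
 proof -
  have "N k * x <= N k" using that N[of k] by simp
  then have "\<lceil>N k * x\<rceil> <= int (Suc k)" by (simp add: N_def ceiling_le_iff)
  then have "of_int \<lceil>N k * x\<rceil> <= N k" unfolding N_def by (metis of_int_le_iff of_int_of_nat_eq)
  then show ?thesis using N[of k] by (simp add: q_def)
 qed
 have q_mono: "q k x <= q k y" if "x <= y" for k x y
  unfolding q_def using that N[of k] by (intro divide_right_mono) (auto intro!: ceiling_mono mult_left_mono)
 define Q where "Q s t om = (\<integral>\<^sup>+x\<in>{s<..t}. ennreal ((H x om - H s om)\<^sup>2) \<partial>lborel)" for s t om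
 define A where "A k i j = {om : space P. q k (S om) = real i / N k & q k (R om) = real j / N k}" for k i j
 define B where "B k i j = (if i <= j then A k i j Int {om : space P.
   \<bar>I (real j / N k) om - I (real i / N k) om - H (real i / N k) om * (Wp (real j / N k) om - Wp (real i / N k) om)\<bar> > u &
   Q (real i / N k) (real j / N k) om < ennreal c} else {})" for k i j
 have AF0: "A k i j : sets (F 0)" for k i j
 proof -
  have [measurable]: "S : borel_measurable (F 0)" "R : borel_measurable (F 0)" using Sm Rm .
  have "{om : space (F 0). q k (S om) = real i / N k & q k (R om) = real j / N k} : sets (F 0)"
   unfolding q_def by measurable
  then show ?thesis by (simp add: A_def space_F)
 qed
 have AP: "A k i j : sets P" for k i j using AF0 F_sets_P[of 0] by auto
 have B: "B k i j : sets P" "P.prob (B k i j) <= 2 * exp (- (u\<^sup>2 / (32 * c))) * P.prob (A k i j)"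
  if "j <= Suc k" for k i j
 proof -
  have "B k i j : sets P & P.prob (B k i j) <= 2 * exp (- (u\<^sup>2 / (32 * c))) * P.prob (A k i j)"
  proof (cases "i <= j")
   case True
   have st: "0 <= real i / N k" "real i / N k <= real j / N k" "real j / N k <= 1"
    using N[of k] True that by (auto simp: divide_right_mono N_def)
   have "A k i j : sets (F (real i / N k))" using AF0 F_mono[of 0 "real i / N k"] st by auto
   moreover have "H (real i / N k) : borel_measurable (F (real i / N k))" using HF st by auto
   ultimately show ?thesis using deviation[OF st _ _ uc, of "A k i j" "H (real i / N k)"] True
    unfolding B_def Q_def by simp
  qed (simp add: B_def)
  then show "B k i j : sets P" "P.prob (B k i j) <= 2 * exp (- (u\<^sup>2 / (32 * c))) * P.prob (A k i j)" by auto
 qed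
 define J where "J k = {0..Suc k} \<times> {0..Suc k}" for k :: nat
 have Jfin: "finite (J k)" for k by (simp add: J_def)
 define D where "D k = (\<Union>p\<in>J k. B k (fst p) (snd p))" for k
 have Dm: "D k : sets P" for k unfolding D_def using Jfin B by (intro sets.finite_UN) (auto simp: J_def)
 have Dp: "P.prob (D k) <= 2 * exp (- (u\<^sup>2 / (32 * c)))" for k
 proof -
  have "P.prob (D k) <= (\<Sum>p\<in>J k. P.prob (B k (fst p) (snd p)))"
   unfolding D_def using Jfin B by (intro measure_UNION_le) (auto simp: J_def)
  also have "... <= (\<Sum>p\<in>J k. 2 * exp (- (u\<^sup>2 / (32 * c))) * P.prob (A k (fst p) (snd p)))"
   using B by (intro sum_mono) (auto simp: J_def)
  also have "... = 2 * exp (- (u\<^sup>2 / (32 * c))) * (\<Sum>p\<in>J k. P.prob (A k (fst p) (snd p)))"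
   by (rule sum_distrib_left[symmetric])
  also have "(\<Sum>p\<in>J k. P.prob (A k (fst p) (snd p))) = P.prob (\<Union>p\<in>J k. A k (fst p) (snd p))"
  proof (rule P.finite_measure_finite_Union[symmetric])
   show "disjoint_family_on (%p. A k (fst p) (snd p)) (J k)"
    using N[of k] by (auto simp: disjoint_family_on_def A_def)
  qed (use Jfin AP in auto)
  also have "2 * exp (- (u\<^sup>2 / (32 * c))) * ... <= 2 * exp (- (u\<^sup>2 / (32 * c))) * 1"
   by (intro mult_left_mono) auto
  finally show ?thesis by simp
 qed
 have "AE om in P. om : E --> eventually (%k. om : D k) sequentially"
 proof -
  have "AE x in M1. continuous_on {0..1} (%t. W t x)" using bm by (simp add: standard_brownian_motion_def)
  from AE_P_fst[OF this] ae Ic show ?thesis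
  proof eventually_elim
   case (elim om)
   show ?case
   proof
    assume wE: "om : E"
    then have wP: "om : space P" using sets.sets_into_space[OF E] by auto
    let ?s = "S om" and ?r = "R om"
    have sr: "0 <= ?s" "?s <= ?r" "?r <= 1" "?s <= 1" "0 <= ?r" using SR[OF wP] by auto
    have q01: "q k ?s : {0..1}" "q k ?r : {0..1}" for k using qb(1)[of ?s k] qb(1)[of ?r k] q1 sr by auto
    have cI: "(%k. I (q k x) om) ----> I x om" if "x = ?s \<or> x = ?r" for x
    by (rule continuous_on_tendsto_compose[OF elim(3) ql]) (use that sr q01 in auto)
    have cW: "(%k. Wp (q k x) om) ----> Wp x om" if "x = ?s \<or> x = ?r" for x
    by (rule continuous_on_tendsto_compose[OF elim(1) ql]) (use that sr q01 in auto)
    have cH: "(%k. H (q k ?s) om) ----> H ?s om"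
    proof (cases "?s < 1")
    case True
    have "continuous (at ?s within {?s..}) (%t. H t om)"
    using Hrc[OF wP sr(1) True] by (simp add: continuous_within at_within_Ici_at_right)
    then show ?thesis
    by (rule continuous_within_tendsto_compose'[OF _ _ ql]) (use qb in auto)
    next
    case False
    then have "?s = 1" using sr by simp
    then have "q k ?s = ?s" for k using q1[of ?s k] qb(1)[of ?s k] by simp
    then show ?thesis by simp
    qed
    obtain b where b: "\<And>t. t : {0..1} ==> \<bar>H t om\<bar> <= b" using Hb[OF wP] by metis
    have Hpath [measurable]: "(%x. H x om) : borel_measurable borel" using path_measurable[OF Hm wP] .
    have Qc: "(%k. Q (q k ?s) (q k ?r) om) ----> Q ?s ?r om"
    unfolding Q_def
    proof (rule nn_integral_dominated_convergence[where w="%x. ennreal ((2 * b)\<^sup>2) * indicator {0..1} x"])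
    show "(\<integral>\<^sup>+x. ennreal ((2 * b)\<^sup>2) * indicator {0..1::real} x \<partial>lborel) < \<infinity>"
    by (subst nn_integral_cmult_indicator) auto
    show "AE x in lborel. ennreal ((H x om - H (q k ?s) om)\<^sup>2) * indicator {q k ?s<..q k ?r} x
    <= ennreal ((2 * b)\<^sup>2) * indicator {0..1} x" for k
    proof (rule AE_I2)
    fix x
    show "ennreal ((H x om - H (q k ?s) om)\<^sup>2) * indicator {q k ?s<..q k ?r} x
    <= ennreal ((2 * b)\<^sup>2) * indicator {0..1} x"
    proof (cases "x : {q k ?s<..q k ?r}")
    case True
    then have x01: "x : {0..1}" using q01[of k] by auto
    have "\<bar>H x om - H (q k ?s) om\<bar> <= \<bar>2 * b\<bar>" using b[OF x01] b[OF q01(1)[of k]] by linarith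
    then have "(H x om - H (q k ?s) om)\<^sup>2 <= (2 * b)\<^sup>2" by (simp only: abs_le_square_iff)
    then show ?thesis using x01 True by (simp add: ennreal_leI)
    qed simp
    qed
    have "AE x in lborel. x ~= ?s" "AE x in lborel. x ~= ?r" by (rule AE_lborel_singleton)+
    then show "AE x in lborel. (%k. ennreal ((H x om - H (q k ?s) om)\<^sup>2) * indicator {q k ?s<..q k ?r} x)
    ----> ennreal ((H x om - H ?s om)\<^sup>2) * indicator {?s<..?r} x"
    proof eventually_elim
    case (elim x)
    have e1: "eventually (%k. q k ?s < x \<longleftrightarrow> ?s < x) sequentially"
    proof (cases "?s < x")
    case True
    then show ?thesis using order_tendstoD(2)[OF ql True] by (auto elim!: eventually_mono)
    next
    case False
    then show ?thesis using qb(1)[of ?s] by (intro always_eventually allI) (smt (verit))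
    qed
    have e2: "eventually (%k. x <= q k ?r \<longleftrightarrow> x <= ?r) sequentially"
    proof (cases "x <= ?r")
    case True
    then show ?thesis using qb(1)[of ?r] by (intro always_eventually allI) (smt (verit))
    next
    case False
    then have "?r < x" by simp
    then show ?thesis using order_tendstoD(2)[OF ql \<open>?r < x\<close>] by (auto elim!: eventually_mono)
    qed
    have "eventually (%k. indicator {q k ?s<..q k ?r} x = (indicator {?s<..?r} x :: ennreal)) sequentially"
    using e1 e2 by eventually_elim (auto simp: indicator_def)
    then have i: "(%k. indicator {q k ?s<..q k ?r} x :: ennreal) ----> indicator {?s<..?r} x" by (rule tendsto_eventually)
    have "(%k. ennreal ((H x om - H (q k ?s) om)\<^sup>2)) ----> ennreal ((H x om - H ?s om)\<^sup>2)"
    using cH by (intro tendsto_ennrealI tendsto_intros)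
    from tendsto_mult_ennreal[OF this i] show ?case by (auto simp: indicator_def)
    qed
    qed measurable
    have dev: "\<bar>I ?r om - I ?s om - H ?s om * (Wp ?r om - Wp ?s om)\<bar> > u" "Q ?s ?r om < ennreal c"
    using elim(2) wE by (auto simp: Q_def)
    have l: "(%k. \<bar>I (q k ?r) om - I (q k ?s) om - H (q k ?s) om * (Wp (q k ?r) om - Wp (q k ?s) om)\<bar>)
    ----> \<bar>I ?r om - I ?s om - H ?s om * (Wp ?r om - Wp ?s om)\<bar>"
    using cI cW cH by (intro tendsto_intros) auto
    from order_tendstoD(1)[OF l dev(1)] order_tendstoD(2)[OF Qc dev(2)]
    show "eventually (%k. om : D k) sequentially"
    proof eventually_elim
    case (elim k)
    have "EX i. i : {0..Suc k} & q k x = real i / N k" if "0 <= x" "x <= 1" for x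
    proof -
    have "0 <= \<lceil>N k * x\<rceil>" using that N[of k] by (simp add: zero_le_ceiling) (smt (verit) mult_nonneg_nonneg)
    then have 1: "q k x = real (nat \<lceil>N k * x\<rceil>) / N k" by (simp add: q_def)
    then have "real (nat \<lceil>N k * x\<rceil>) <= N k" using q1[of x k] that N[of k] by simp
    then have "nat \<lceil>N k * x\<rceil> <= Suc k" unfolding N_def by (simp only: of_nat_le_iff)
    then show ?thesis using 1 by (intro exI[of _ "nat \<lceil>N k * x\<rceil>"]) auto
    qed
    from this[of ?s] this[of ?r] obtain i j where ij: "i : {0..Suc k}" "q k ?s = real i / N k"
    "j : {0..Suc k}" "q k ?r = real j / N k" using sr by auto
    have "real i / N k <= real j / N k" using q_mono[OF sr(2), of k] ij by simp
    then have "i <= j" using N[of k] by (simp add: divide_le_cancel)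
    then have "om : B k i j" using elim wP ij unfolding B_def A_def by simp
    then show ?case unfolding D_def J_def using ij by (intro UN_I[of "(i, j)"]) auto
    qed
   qed
  qed
 qed
 then show ?thesis by (rule measure_le_of_eventually[OF P.finite_measure_axioms E Dm _ Dp])
qed

lemma H_at_measurable:
 assumes "S : borel_measurable P"
 shows "(%om. H (S om) om) : borel_measurable P"
 using measurable_compose[OF measurable_Pair[OF assms measurable_ident_sets[OF refl]] Hm] by simp

text \<open>The integral has to exceed \<open>e / sqrt n\<close> while the quadratic variation is eventually below \<open>\<delta> / n\<close>, for every \<open>\<delta>\<close>;
the factors \<open>n\<close> cancel in the exponent, and the bound is arbitrarily small with \<open>\<delta>\<close>.\<close>

lemma local_error_tendsto_0:
 fixes S R :: "nat => 'a \<times> 'b => real"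
 assumes Sm: "\<And>n. S n : borel_measurable (F 0)" and Rm: "\<And>n. R n : borel_measurable (F 0)"
  and SR: "\<And>n om. om : space P ==> 0 <= S n om & S n om <= R n om & R n om <= 1"
  and small: "\<And>\<delta>. \<delta> > 0 ==> AE om in P. eventually (%n.
   (\<integral>\<^sup>+x\<in>{S n om<..R n om}. ennreal ((H x om - H (S n om) om)\<^sup>2) \<partial>lborel) < ennreal (\<delta> / real n)) sequentially"
  and E: "\<And>n. E n : sets P" and e: "e > 0"
  and ae: "\<And>n. AE om in P. om : E n -->
   sqrt (real n) * \<bar>I (R n om) om - I (S n om) om - H (S n om) om * (Wp (R n om) om - Wp (S n om) om)\<bar> > e"
 shows "(%n. P.prob (E n)) ----> 0"
proof (rule LIMSEQ_I)
 fix r :: real assume r: "r > 0"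
 have "((%d. 2 * exp (- (e\<^sup>2 / (32 * d)))) \<longlongrightarrow> 0) (at_right 0)" using e by real_asymp
 then have "eventually (%d. 2 * exp (- (e\<^sup>2 / (32 * d))) < r / 2) (at_right 0)" using r by (intro order_tendstoD) auto
 then obtain b where b: "b > 0" "\<And>y. y > 0 ==> y < b ==> 2 * exp (- (e\<^sup>2 / (32 * y))) < r / 2"
  unfolding eventually_at_right_field by auto
 define d where "d = b / 2"
 have d: "d > 0" "2 * exp (- (e\<^sup>2 / (32 * d))) < r / 2" using b(1) b(2)[of d] by (auto simp: d_def)
 define Q where "Q n om = (\<integral>\<^sup>+x\<in>{S n om<..R n om}. ennreal ((H x om - H (S n om) om)\<^sup>2) \<partial>lborel)" for n om
 have SP [measurable]: "S n : borel_measurable P" "R n : borel_measurable P" for n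
  using F_measurable_P[OF _ Sm] F_measurable_P[OF _ Rm] by auto
 have [measurable]: "(%om. H (S n om) om) : borel_measurable P" for n by (rule H_at_measurable) simp
 have [measurable]: "(%x. H (fst x) (snd x)) : borel_measurable (borel \<Otimes>\<^sub>M P)" using Hm by (simp add: case_prod_beta')
 have Qm [measurable]: "Q n : borel_measurable P" for n unfolding Q_def
  by (rule measurable_time_integral) (simp add: case_prod_beta' indicator_def)
 define G where "G n = {om : space P. ennreal (d / real n) <= Q n om}" for n
 have Gm [measurable]: "G n : sets P" for n unfolding G_def by measurable
 have "(%n. P.prob (G n)) ----> 0"
 proof (rule measure_tendsto_0_of_eventually[OF P.finite_measure_axioms Gm, where D="%_. {}"])
  show "AE om in P. \<forall>\<^sub>F n in sequentially. om : G n --> om : {}"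
   using small[OF d(1)] by eventually_elim (auto elim!: eventually_mono simp: G_def Q_def not_le)
 qed auto
 then have "eventually (%n. P.prob (G n) < r / 2) sequentially" using r by (intro order_tendstoD) auto
 then obtain n0 where n0: "\<And>n. n >= n0 ==> P.prob (G n) < r / 2"
  unfolding eventually_sequentially by metis
 have "P.prob (E n) < r" if n: "n >= max 1 n0" for n
 proof -
  have np: "real n > 0" using n by simp
  have [measurable]: "E n : sets P" by (rule E)
  have "P.prob (E n - G n) <= 2 * exp (- ((e / sqrt (real n))\<^sup>2 / (32 * (d / real n))))"
  proof (rule deviation_random_times[OF Sm[of n] Rm[of n] SR])
   show "AE om in P. om : E n - G n -->
    \<bar>I (R n om) om - I (S n om) om - H (S n om) om * (Wp (R n om) om - Wp (S n om) om)\<bar> > e / sqrt (real n) &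
    (\<integral>\<^sup>+x\<in>{S n om<..R n om}. ennreal ((H x om - H (S n om) om)\<^sup>2) \<partial>lborel) < ennreal (d / real n)"
    using ae[of n] AE_space
   proof eventually_elim
    case (elim om)
    then show ?case using np by (auto simp: G_def Q_def not_le pos_divide_less_eq mult.commute)
   qed
  qed (use e d np in auto)
  also have "(e / sqrt (real n))\<^sup>2 / (32 * (d / real n)) = e\<^sup>2 / (32 * d)"
   using np by (simp add: power_divide field_simps)
  finally have 1: "P.prob (E n - G n) < r / 2" using d(2) by simp
  have "P.prob (E n) <= P.prob ((E n - G n) Un G n)" by (intro P.finite_measure_mono) auto
  also have "... <= P.prob (E n - G n) + P.prob (G n)" by (intro measure_Un_le) auto
  finally show ?thesis using 1 n0[of n] n by simp
 qed
 then show "EX n0. \<forall>n\<ge>n0. norm (P.prob (E n) - 0) < r" by (intro exI[of _ "max 1 n0"]) simp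
qed

text \<open>A union bound over the \<open>n\<close> grid intervals, possible because the deviation is exponentially small in
\<open>n v\<^sub>n\<^sup>2\<close> on the event that \<open>H\<close> is bounded by a constant; each path has such a constant.\<close>

lemma increments_below_threshold:
 fixes v :: "nat => real"
 assumes v: "\<And>n. n >= 1 ==> v n > 0"
  and vl: "\<And>C. C > 0 ==> (%n. real n * exp (- (real n * (v n)\<^sup>2 / C))) ----> 0"
 defines "E n \<equiv> {om : space P. EX i<n. \<bar>I (real (i + 1) / real n) om - I (real i / real n) om\<bar> > v n}"
 shows "E n : sets P" "(%n. P.prob (E n)) ----> 0"
proof -
 have r: "0 <= real i / real n" "real i / real n <= real (i + 1) / real n" "real (i + 1) / real n <= 1" if "i < n" for i n
  using that by (auto simp: divide_right_mono)
 have Im: "I t : borel_measurable P" if "t : {0..1}" for t using Il[OF that] by (simp add: tendsto_in_prob_def)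
 show Em: "E n : sets P" for n
 proof -
  have "E n = (\<Union>i\<in>{..<n}. {om : space P. \<bar>I (real (i + 1) / real n) om - I (real i / real n) om\<bar> > v n})"
   by (auto simp: E_def)
  also have "... : sets P"
  proof (rule sets.finite_UN)
   fix i assume "i : {..<n}"
   then have [measurable]: "I (real (i + 1) / real n) : borel_measurable P" "I (real i / real n) : borel_measurable P"
    using r[of i n] by (auto intro!: Im)
   show "{om : space P. \<bar>I (real (i + 1) / real n) om - I (real i / real n) om\<bar> > v n} : sets P" by measurable
  qed simp
  finally show ?thesis .
 qed
 define B where "B c = {om : space P. \<forall>q\<in>\<rat> Int {0..1}. \<bar>H q om\<bar> <= real c}" for c :: nat
 have Bm: "B c : sets P" for c
 proof -
  have "B c = space P Int (\<Inter>q\<in>\<rat> Int {0..1}. {om : space P. \<bar>H q om\<bar> <= real c})"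
   by (auto simp: B_def)
  also have "... = (\<Inter>q\<in>\<rat> Int {0..1}. {om : space P. \<bar>H q om\<bar> <= real c})"
   using Rats_0 by fastforce
  also have "... : sets P"
  proof (rule sets.countable_INT')
   show "countable (\<rat> Int {0..1::real})" using countable_rat by (rule countable_Int1)
   show "\<rat> Int {0..1::real} ~= {}" using Rats_0 by fastforce
   show "(%q. {om : space P. \<bar>H q om\<bar> <= real c}) ` (\<rat> Int {0..1}) \<subseteq> sets P"
   proof
    fix S assume "S : (%q. {om : space P. \<bar>H q om\<bar> <= real c}) ` (\<rat> Int {0..1})"
    then obtain q where q: "q : {0..1}" "S = {om : space P. \<bar>H q om\<bar> <= real c}" by auto
    then have [measurable]: "H q : borel_measurable P" using F_measurable_P[OF _ HF[of q]] by auto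
    show "S : sets P" unfolding q by measurable
   qed
  qed
  finally show ?thesis .
 qed
 have Bb: "\<bar>H t om\<bar> <= real c" if w: "om : B c" and t: "t : {0..1}" for om c t
 proof (cases "t = 1")
  case True
  then show ?thesis using w by (auto simp: B_def)
 next
  case False
  then have t1: "0 <= t" "t < 1" using t by auto
  have wP: "om : space P" using w by (simp add: B_def)
  have lim: "((%t. H t om) \<longlongrightarrow> H t om) (at_right t)"
   using Hrc[OF wP t1] by (simp add: continuous_within)
  show ?thesis
  proof (rule ccontr)
   assume "\<not> \<bar>H t om\<bar> <= real c"
   then have "real c < \<bar>H t om\<bar>" by simp
   from order_tendstoD(1)[OF tendsto_rabs[OF lim] this]
   obtain b where b: "b > t" "\<And>y. t < y ==> y < b ==> real c < \<bar>H y om\<bar>"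
    unfolding eventually_at_right_field by auto
   obtain q where q: "q : \<rat>" "t < q" "q < min b 1" using Rats_dense_in_real[of t "min b 1"] b t1 by auto
   then have "\<bar>H q om\<bar> <= real c" using w t1 by (auto simp: B_def)
   then show False using b(2)[of q] q by auto
  qed
 qed
 have Blim: "(%c. P.prob (B c)) ----> 1"
 proof -
  have "incseq B" unfolding incseq_def B_def by (auto intro: order_trans)
  moreover have "(\<Union>c. B c) = space P"
  proof (intro subset_antisym subsetI)
   fix om assume wP: "om : space P"
   obtain b where "\<forall>t\<in>{0..1}. \<bar>H t om\<bar> <= b" using Hb[OF wP] by metis
   moreover obtain c :: nat where "b <= real c" using real_arch_simple by auto
   ultimately have "om : B c" using wP by (auto simp: B_def intro: order_trans)
   then show "om : (\<Union>c. B c)" by blast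
  qed (auto simp: B_def)
  ultimately show ?thesis using P.finite_Lim_measure_incseq[of B] Bm P.prob_space by auto
 qed
 show "(%n. P.prob (E n)) ----> 0"
 proof (rule LIMSEQ_I)
  fix e :: real assume e: "e > 0"
  obtain c where c: "P.prob (B c) > 1 - e / 2"
   using order_tendstoD(1)[OF Blim, of "1 - e/2"] e by (auto simp: eventually_sequentially)
  define C where "C = (real c)\<^sup>2 + 1"
  have C: "C > 0" "(real c)\<^sup>2 < C" by (auto simp: C_def add_nonneg_pos)
  define D where "D n i = space P Int {om : space P.
   \<bar>I (real (i + 1) / real n) om - I (real i / real n) om - 0 * (Wp (real (i + 1) / real n) om - Wp (real i / real n) om)\<bar> > v n &
   (\<integral>\<^sup>+x\<in>{real i / real n<..real (i + 1) / real n}. ennreal ((H x om - 0)\<^sup>2) \<partial>lborel) < ennreal (C / real n)}" for n i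
  have D: "D n i : sets P" "P.prob (D n i) <= 2 * exp (- ((v n)\<^sup>2 / (32 * (C / real n))))" if i: "i < n" for n i
  proof -
   have sp: "space P : sets (F (real i / real n))" using sets.top[of "F (real i / real n)"] by (simp add: space_F)
   have p: "v n > 0" "C / real n > 0" using v[of n] i C by auto
   from deviation[OF r[OF i] sp _ p, of "%_. 0"]
   show "D n i : sets P" "P.prob (D n i) <= 2 * exp (- ((v n)\<^sup>2 / (32 * (C / real n))))"
    unfolding D_def by (simp_all add: P.prob_space)
  qed
  have EB: "E n Int B c \<subseteq> (\<Union>i\<in>{..<n}. D n i)" for n
  proof
   fix om assume w: "om : E n Int B c"
   then obtain i where i: "i < n" "\<bar>I (real (i + 1) / real n) om - I (real i / real n) om\<bar> > v n" and wP: "om : space P"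
    by (auto simp: E_def)
   have np: "real n > 0" using i by simp
   have "(\<integral>\<^sup>+x\<in>{real i / real n<..real (i + 1) / real n}. ennreal ((H x om - 0)\<^sup>2) \<partial>lborel)
    <= (\<integral>\<^sup>+x\<in>{real i / real n<..real (i + 1) / real n}. ennreal ((real c)\<^sup>2) \<partial>lborel)"
   proof (rule nn_integral_mono)
    fix x
    show "ennreal ((H x om - 0)\<^sup>2) * indicator {real i / real n<..real (i + 1) / real n} x
    <= ennreal ((real c)\<^sup>2) * indicator {real i / real n<..real (i + 1) / real n} x"
    proof (cases "x : {real i / real n<..real (i + 1) / real n}")
    case True
    then have "x : {0..1}" using r(1)[OF i(1)] r(3)[OF i(1)]
    by (simp only: greaterThanAtMost_iff atLeastAtMost_iff) linarith
    then have "\<bar>H x om\<bar> <= \<bar>real c\<bar>" using Bb w by auto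
    then have "(H x om)\<^sup>2 <= (real c)\<^sup>2" by (simp only: abs_le_square_iff)
    then show ?thesis by (simp add: ennreal_leI mult_right_mono)
    qed simp
   qed
   also have "... = ennreal ((real c)\<^sup>2 / real n)"
    using np r[OF i(1)] by (simp add: nn_integral_cmult_indicator ennreal_mult[symmetric] diff_divide_distrib[symmetric])
   also have "... < ennreal (C / real n)" using C np by (intro ennreal_lessI) (auto simp: divide_strict_right_mono)
   finally show "om : (\<Union>i\<in>{..<n}. D n i)" using i wP by (auto simp: D_def)
  qed
  have bd: "P.prob (E n) <= 2 * (real n * exp (- (real n * (v n)\<^sup>2 / (32 * C)))) + e / 2" if "n >= 1" for n
  proof -
   have "P.prob (E n) <= P.prob ((\<Union>i\<in>{..<n}. D n i) Un (space P - B c))"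
   proof (rule P.finite_measure_mono)
    have "E n \<subseteq> space P" by (auto simp: E_def)
    then show "E n \<subseteq> (\<Union>i\<in>{..<n}. D n i) Un (space P - B c)" using EB[of n] by blast
    show "(\<Union>i\<in>{..<n}. D n i) Un (space P - B c) : sets P"
    using D(1) Bm by (intro sets.Un sets.Diff sets.finite_UN) auto
   qed
   also have "... <= P.prob (\<Union>i\<in>{..<n}. D n i) + P.prob (space P - B c)"
    using D Bm by (intro measure_Un_le) auto
   also have "P.prob (\<Union>i\<in>{..<n}. D n i) <= (\<Sum>i<n. P.prob (D n i))" using D by (intro measure_UNION_le) auto
   also have "... <= (\<Sum>i<n. 2 * exp (- ((v n)\<^sup>2 / (32 * (C / real n)))))" using D by (intro sum_mono) auto
   also have "... = 2 * (real n * exp (- (real n * (v n)\<^sup>2 / (32 * C))))" using that C by (simp add: field_simps)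
   also have "P.prob (space P - B c) <= e / 2" using c P.prob_compl[OF Bm] by simp
   finally show ?thesis by simp
  qed
  have l: "(%n. 2 * (real n * exp (- (real n * (v n)\<^sup>2 / (32 * C))))) ----> 2 * 0"
   using C by (intro tendsto_intros vl) auto
  have "eventually (%n. 2 * (real n * exp (- (real n * (v n)\<^sup>2 / (32 * C)))) < e / 2) sequentially"
   by (rule order_tendstoD(2)[OF l]) (use e in simp)
  then obtain n0 where n0: "\<And>n. n >= n0 ==> 2 * (real n * exp (- (real n * (v n)\<^sup>2 / (32 * C)))) < e / 2"
   unfolding eventually_sequentially by metis
  have "P.prob (E n) < e" if "n >= max 1 n0" for n
   using bd[of n] n0[of n] that by auto
  then show "EX n0. \<forall>n\<ge>n0. norm (P.prob (E n) - 0) < e" by (intro exI[of _ "max 1 n0"]) simp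
 qed
qed

end

section \<open>From mixing to stable convergence\<close>

lemma tendsto_fun_coordinatewise:
 fixes v :: "nat => 'i => real"
 assumes "\<And>i. (%n. v n i) ----> l i"
 shows "v ----> l"
proof -
 have "limitin (product_topology (%_. euclideanreal) UNIV) v l sequentially"
  using assms by (auto simp: limitin_componentwise)
 then show ?thesis by (simp add: euclidean_product_topology)
qed

lemma uniformly_continuous_on_box:
 fixes ph :: "('i::countable => real) => real"
 assumes cont: "continuous_on UNIV ph" and e: "e > 0"
 shows "\<exists>d>0. ALL v v'. (ALL i. i \<notin> J --> v i = 0 & v' i = 0) & (\<forall>i\<in>J. \<bar>v i\<bar> <= R & \<bar>v i - v' i\<bar> <= d)
   --> \<bar>ph v - ph v'\<bar> < e"
proof (rule ccontr)
 assume neg: "\<not> ?thesis"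
 define Q where "Q d v v' \<longleftrightarrow> (ALL i. i \<notin> J --> v i = 0 & v' i = 0) & (\<forall>i\<in>J. \<bar>v i\<bar> <= R & \<bar>v i - v' i\<bar> <= d)"
  for d and v v' :: "'i => real"
 have "\<not> (\<exists>d>0. ALL v v'. Q d v v' --> \<bar>ph v - ph v'\<bar> < e)" unfolding Q_def by (rule neg)
 then have negQ: "EX v v'. Q d v v' & \<not> \<bar>ph v - ph v'\<bar> < e" if "d > 0" for d using that by blast
 have "ALL n. EX v v'. Q (1 / real (Suc n)) v v' & \<not> \<bar>ph v - ph v'\<bar> < e"
  by (intro allI negQ) simp
 then obtain v v' where vv: "\<And>n. Q (1 / real (Suc n)) (v n) (v' n)" and ve': "\<And>n. \<not> \<bar>ph (v n) - ph (v' n)\<bar> < e"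
  by metis
 have v0: "v n i = 0 & v' n i = 0" if "i \<notin> J" for n i using vv[of n] that by (simp add: Q_def)
 have vb: "\<bar>v n i\<bar> <= R & \<bar>v n i - v' n i\<bar> <= 1 / real (Suc n)" if "i : J" for n i using vv[of n] that by (simp add: Q_def)
 have ve: "\<bar>ph (v n) - ph (v' n)\<bar> >= e" for n using ve'[of n] by simp
 define K where "K = Pi\<^sub>E (UNIV :: 'i set) (%i. if i : J then {- R..R} else {0::real})"
 have "compactin (product_topology (%_. euclideanreal) UNIV) K"
  unfolding K_def compactin_PiE by (auto simp: compactin_euclidean_iff)
 then have "compact K" by (simp add: euclidean_product_topology compactin_euclidean_iff)
 moreover have "v n : K" for n
  unfolding K_def using v0[of _ n] vb[of _ n] by (auto simp: abs_le_iff) (smt (verit))+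
 ultimately obtain l r where lr: "strict_mono r" "(v \<circ> r) ----> l"
  using compact_imp_seq_compact[of K] unfolding seq_compact_def by metis
 have vl: "(%n. v (r n) i) ----> l i" for i
 proof -
  have "isCont (%x::'i => real. x i) l"
   by (metis continuous_on_product_coordinates continuous_on_eq_continuous_at UNIV_I open_UNIV)
  from isCont_tendsto_compose[OF this lr(2)] show ?thesis by (simp add: o_def)
 qed
 have "(%n. v' (r n) i) ----> l i" for i
 proof (cases "i : J")
  case True
  have "(%n. 1 / real (Suc (r n))) ----> 0"
   using LIMSEQ_subseq_LIMSEQ[OF LIMSEQ_Suc[OF lim_1_over_n] lr(1)] by (simp add: o_def)
  then have "(%n. v (r n) i - v' (r n) i) ----> 0"
   by (rule Lim_null_comparison[rotated]) (use vb[OF True] in auto)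
  from tendsto_diff[OF vl[of i] this] show ?thesis by simp
 next
  case False
  then show ?thesis using vl[of i] v0[OF False] by simp
 qed
 then have v'l: "(%n. v' (r n)) ----> l" by (rule tendsto_fun_coordinatewise)
 have c: "isCont ph l" using cont by (simp add: continuous_on_eq_continuous_at)
 have "(%n. \<bar>ph (v (r n)) - ph (v' (r n))\<bar>) ----> \<bar>ph l - ph l\<bar>"
  using isCont_tendsto_compose[OF c lr(2)] isCont_tendsto_compose[OF c v'l]
  by (intro tendsto_intros) (auto simp: o_def)
 then have "e <= \<bar>ph l - ph l\<bar>" by (rule LIMSEQ_le_const) (use ve in auto)
 then show False using e by simp
qed

lemma borel_measurable_continuous_vector:
 fixes ph :: "('i::countable => real) => real"
 assumes "continuous_on UNIV ph" "\<And>i. (%om. v om i) : borel_measurable M"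
 shows "(%om. ph (v om)) : borel_measurable M"
 by (rule measurable_compose[OF measurable_coordinatewise_then_product[OF assms(2)] borel_measurable_continuous_onI[OF assms(1)]])

text \<open>A quantitative Slutsky lemma.\<close>

lemma continuous_vector_L1_close:
 fixes ph :: "('i::countable => real) => real"
 assumes cont: "continuous_on UNIV ph" and bd: "\<And>x. \<bar>ph x\<bar> <= C" and e: "e > 0" and J: "finite J"
 shows "\<exists>d>0. \<forall>(M :: 'w measure) D (v :: 'w => 'i => real) v'. prob_space M --> D : sets M -->
  (ALL i. (%om. v om i) : borel_measurable M) --> (ALL i. (%om. v' om i) : borel_measurable M) -->
  (ALL om i. i \<notin> J --> v om i = 0 & v' om i = 0) -->
  (\<integral>om. indicator D om * \<bar>ph (v om) - ph (v' om)\<bar> \<partial>M) <= e + 2 * C * (\<Sum>i\<in>J.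
    measure M (D Int {om : space M. \<bar>v om i\<bar> > R}) + measure M (D Int {om : space M. \<bar>v om i - v' om i\<bar> > d}))"
proof -
 obtain d where d: "d > 0" and dd: "\<And>v v'. (ALL i. i \<notin> J --> v i = 0 & v' i = 0) ==>
  (\<forall>i\<in>J. \<bar>v i\<bar> <= R & \<bar>v i - v' i\<bar> <= d) ==> \<bar>ph v - ph v'\<bar> < e"
  using uniformly_continuous_on_box[OF cont e, of J R] by metis
 have C0: "C >= 0" using bd[of undefined] by linarith
 show ?thesis
 proof (rule exI[of _ d], intro conjI allI impI)
  show "d > 0" by fact
  fix M :: "'w measure" and D and v v' :: "'w => 'i => real"
  assume "prob_space M" and D [measurable]: "D : sets M"
   and vm: "ALL i. (%om. v om i) : borel_measurable M" and v'm: "ALL i. (%om. v' om i) : borel_measurable M"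
   and z: "ALL om i. i \<notin> J --> v om i = 0 & v' om i = 0"
  interpret prob_space M by fact
  have [measurable]: "(%om. v om i) : borel_measurable M" "(%om. v' om i) : borel_measurable M" for i using vm v'm by auto
  have [measurable]: "(%om. ph (v om)) : borel_measurable M" "(%om. ph (v' om)) : borel_measurable M"
   using borel_measurable_continuous_vector[OF cont, of v M] borel_measurable_continuous_vector[OF cont, of v' M] vm v'm by auto
  define A where "A i = D Int {om : space M. \<bar>v om i\<bar> > R}" for i
  define B where "B i = D Int {om : space M. \<bar>v om i - v' om i\<bar> > d}" for i
  have [measurable]: "A i : sets M" "B i : sets M" for i unfolding A_def B_def by measurable
  have diff: "\<bar>ph x - ph y\<bar> <= 2 * C" for x y using bd[of x] bd[of y] by linarith
  have ind: "integrable M (%om. indicator S om :: real)" if "S : sets M" for S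
   using that by (intro integrable_real_indicator) (auto simp: emeasure_eq_measure)
  have "(\<integral>om. indicator D om * \<bar>ph (v om) - ph (v' om)\<bar> \<partial>M)
   <= (\<integral>om. e + 2 * C * (\<Sum>i\<in>J. indicator (A i) om + indicator (B i) om) \<partial>M)"
  proof (rule integral_mono)
   show "integrable M (%om. indicator D om * \<bar>ph (v om) - ph (v' om)\<bar>)"
    using diff C0 by (intro integrable_const_bound[where B="2 * C"]) (auto simp: indicator_def)
   show "integrable M (%om. e + 2 * C * (\<Sum>i\<in>J. indicator (A i) om + indicator (B i) om))"
    by (intro Bochner_Integration.integrable_add integrable_mult_right Bochner_Integration.integrable_sum ind) auto
   fix om assume w: "om : space M"
   have nn: "0 <= (\<Sum>i\<in>J. indicator (A i) om + indicator (B i) om :: real)" by (intro sum_nonneg) auto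
   show "indicator D om * \<bar>ph (v om) - ph (v' om)\<bar> <= e + 2 * C * (\<Sum>i\<in>J. indicator (A i) om + indicator (B i) om)"
   proof (cases "om : D")
    case True
    show ?thesis
    proof (cases "\<exists>i\<in>J. om : A i Un B i")
    case True
    then obtain i where i: "i : J" "om : A i Un B i" by auto
    have "1 <= indicator (A i) om + (indicator (B i) om :: real)" using i by (auto simp: indicator_def)
    also have "... <= (\<Sum>i\<in>J. indicator (A i) om + indicator (B i) om)"
    using i J by (intro member_le_sum) auto
    finally have "2 * C * 1 <= 2 * C * (\<Sum>i\<in>J. indicator (A i) om + indicator (B i) om :: real)"
    using C0 by (intro mult_left_mono) auto
    then show ?thesis using diff[of "v om" "v' om"] e \<open>om : D\<close> by simp
    next
    case False
    then have "\<forall>i\<in>J. \<bar>v om i\<bar> <= R & \<bar>v om i - v' om i\<bar> <= d"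
    using w True by (auto simp: A_def B_def not_less)
    then have "\<bar>ph (v om) - ph (v' om)\<bar> < e" using z by (intro dd) auto
    moreover have "0 <= 2 * C * (\<Sum>i\<in>J. indicator (A i) om + indicator (B i) om :: real)" using nn C0 by simp
    ultimately show ?thesis using True by simp
    qed
   next
    case False
    then show ?thesis using nn C0 e by simp
   qed
  qed
  also have "... = e + 2 * C * (\<Sum>i\<in>J. prob (A i) + prob (B i))"
   using ind by (subst Bochner_Integration.integral_add)
    (auto simp: Bochner_Integration.integral_sum prob_space sets.Int_space_eq2)
  finally show "(\<integral>om. indicator D om * \<bar>ph (v om) - ph (v' om)\<bar> \<partial>M) <= e + 2 * C * (\<Sum>i\<in>J.
    prob (D Int {om : space M. \<bar>v om i\<bar> > R}) + prob (D Int {om : space M. \<bar>v om i - v' om i\<bar> > d}))"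
   by (simp add: A_def B_def)
 qed
qed

lemma tail_tendsto_0:
 fixes f :: "'w => real"
 assumes "prob_space M" and f [measurable]: "f : borel_measurable M" and e: "e > 0"
 shows "EX R. measure M {om : space M. \<bar>f om\<bar> > R} < e"
proof -
 interpret prob_space M by fact
 have "(%n. prob {om : space M. \<bar>f om\<bar> > real n}) ----> prob (\<Inter>n. {om : space M. \<bar>f om\<bar> > real n})"
  by (rule finite_Lim_measure_decseq) (auto simp: decseq_def intro: le_less_trans)
 moreover have "(\<Inter>n::nat. {om : space M. \<bar>f om\<bar> > real n}) = {}"
 proof -
  have "\<exists>n::nat. \<not> real n < \<bar>f om\<bar>" for om using real_arch_simple[of "\<bar>f om\<bar>"] by (auto simp: not_less)
  then show ?thesis by blast
 qed
 ultimately have "eventually (%n::nat. prob {om : space M. \<bar>f om\<bar> > real n} < e) sequentially"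
  using e by (intro order_tendstoD) auto
 then show ?thesis unfolding eventually_sequentially by blast
qed

text \<open>The values of \<open>th\<close> are replaced by finitely many.\<close>

lemma discretisation_error:
 fixes \<Psi> :: "('i::countable => real) => real"
 assumes cont: "continuous_on UNIV \<Psi>" and bd: "\<And>x. \<bar>\<Psi> x\<bar> <= C" and e: "e > 0"
  and J1: "finite J1" and J2: "finite J2" and J12: "J1 Int J2 = {}"
 shows "EX d G. finite G & (\<forall>(M :: 'w measure) D (\<xi> :: 'w => 'i => real) (th :: 'w => 'i => real). prob_space M --> D : sets M -->
  (ALL i. (%om. \<xi> om i) : borel_measurable M) --> (ALL i. (%om. th om i) : borel_measurable M) -->
  (ALL om i. i \<notin> J1 --> \<xi> om i = 0) --> (ALL om i. i \<notin> J2 --> th om i = 0) -->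
  \<bar>(\<integral>om. indicator D om * \<Psi> (%i. \<xi> om i + th om i) \<partial>M)
   - (\<Sum>q\<in>G. \<integral>om. indicator ({om : space M. \<forall>i\<in>J2. \<lfloor>th om i / d\<rfloor> = q i} Int D) om * \<Psi> (%i. \<xi> om i + d * of_int (q i)) \<partial>M)\<bar>
  <= e + 3 * C * ((\<Sum>i\<in>J1. measure M (D Int {om : space M. \<bar>\<xi> om i\<bar> > R})) + (\<Sum>i\<in>J2. measure M (D Int {om : space M. \<bar>th om i\<bar> > R}))))"
proof -
 obtain d where d: "d > 0" and dd: "\<And>(M :: 'w measure) D (v :: 'w => 'i => real) v'. prob_space M ==> D : sets M ==>
  (ALL i. (%om. v om i) : borel_measurable M) ==> (ALL i. (%om. v' om i) : borel_measurable M) ==>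
  (ALL om i. i \<notin> J1 Un J2 --> v om i = 0 & v' om i = 0) ==>
  (\<integral>om. indicator D om * \<bar>\<Psi> (v om) - \<Psi> (v' om)\<bar> \<partial>M) <= e + 2 * C * (\<Sum>i\<in>J1 Un J2.
    measure M (D Int {om : space M. \<bar>v om i\<bar> > R}) + measure M (D Int {om : space M. \<bar>v om i - v' om i\<bar> > d}))"
  using continuous_vector_L1_close[OF cont bd e finite_UnI[OF J1 J2], of R] by blast
 have C0: "C >= 0" using bd[of undefined] by linarith
 define K where "K = \<lceil>\<bar>R\<bar> / d\<rceil> + 1"
 define G where "G = {q :: 'i => int. ALL i. (i : J2 --> q i : {- K..K}) & (i \<notin> J2 --> q i = 0)}"
 have G: "finite G" unfolding G_def by (rule finite_set_of_finite_funs[OF J2]) simp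
 show ?thesis
 proof (rule exI[of _ d], rule exI[of _ G], intro conjI allI impI)
  show "finite G" by fact
  fix M :: "'w measure" and D and \<xi> th :: "'w => 'i => real"
  assume "prob_space M" and D [measurable]: "D : sets M"
   and xm: "ALL i. (%om. \<xi> om i) : borel_measurable M" and tm: "ALL i. (%om. th om i) : borel_measurable M"
   and z1: "ALL om i. i \<notin> J1 --> \<xi> om i = 0" and z2: "ALL om i. i \<notin> J2 --> th om i = 0"
  interpret prob_space M by fact
  have [measurable]: "(%om. \<xi> om i) : borel_measurable M" "(%om. th om i) : borel_measurable M" for i using xm tm by auto
  define t where "t om i = d * of_int \<lfloor>th om i / d\<rfloor>" for om i
  have tm': "(%om. t om i) : borel_measurable M" for i unfolding t_def by measurable
  have tclose: "\<bar>th om i - t om i\<bar> <= d" for om i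
  proof -
   have "of_int \<lfloor>th om i / d\<rfloor> <= th om i / d" "th om i / d < of_int \<lfloor>th om i / d\<rfloor> + 1" by linarith+
   then have "of_int \<lfloor>th om i / d\<rfloor> * d <= th om i" "th om i < (of_int \<lfloor>th om i / d\<rfloor> + 1) * d"
    by (simp_all only: pos_le_divide_eq[OF d] pos_divide_less_eq[OF d])
   then show ?thesis by (simp add: t_def algebra_simps abs_le_iff)
  qed
  define v where "v om = (%i. \<xi> om i + th om i)" for om
  define v' where "v' om = (%i. \<xi> om i + t om i)" for om
  have vm: "(%om. v om i) : borel_measurable M" "(%om. v' om i) : borel_measurable M" for i
   using tm' unfolding v_def v'_def by measurable
  have \<Psi>m [measurable]: "(%om. \<Psi> (v om)) : borel_measurable M" "(%om. \<Psi> (v' om)) : borel_measurable M"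
   using borel_measurable_continuous_vector[OF cont, of v M] borel_measurable_continuous_vector[OF cont, of v' M] vm by auto
  define A where "A q = {om : space M. \<forall>i\<in>J2. \<lfloor>th om i / d\<rfloor> = q i} Int D" for q
  have Am [measurable]: "A q : sets M" for q
  proof -
   have "{om : space M. \<forall>i\<in>J2. \<lfloor>th om i / d\<rfloor> = q i} : sets M"
    by (rule sets.sets_Collect_finite_All[OF _ J2]) measurable
   then show ?thesis unfolding A_def by auto
  qed
  define B where "B = (\<Union>q\<in>G. A q)"
  have Bm [measurable]: "B : sets M" unfolding B_def using G by (intro sets.finite_UN) auto
  define T1 where "T1 = (\<Sum>i\<in>J1. prob (D Int {om : space M. \<bar>\<xi> om i\<bar> > R}))"
  define T2 where "T2 = (\<Sum>i\<in>J2. prob (D Int {om : space M. \<bar>th om i\<bar> > R}))"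
  have ib: "integrable M (%om. indicator S om * f om)"
   if "S : sets M" "f : borel_measurable M" "\<And>om. \<bar>f om\<bar> <= c" for S f and c :: real
   using that by (intro integrable_const_bound[where B="\<bar>c\<bar>"]) (auto simp: indicator_def intro!: AE_I2, smt (verit))
  have s1: "(\<Sum>q\<in>G. \<integral>om. indicator (A q) om * \<Psi> (%i. \<xi> om i + d * of_int (q i)) \<partial>M) = (\<integral>om. indicator B om * \<Psi> (v' om) \<partial>M)"
  proof -
   have "(\<integral>om. indicator (A q) om * \<Psi> (%i. \<xi> om i + d * of_int (q i)) \<partial>M) = (\<integral>om. indicator (A q) om * \<Psi> (v' om) \<partial>M)"
    if q: "q : G" for q
   proof (rule Bochner_Integration.integral_cong[OF refl])
    fix om
    have "v' om = (%i. \<xi> om i + d * of_int (q i))" if "om : A q"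
    proof
    fix i show "v' om i = \<xi> om i + d * of_int (q i)"
    using that q z2 by (cases "i : J2") (auto simp: v'_def t_def A_def G_def)
    qed
    then show "indicator (A q) om * \<Psi> (%i. \<xi> om i + d * of_int (q i)) = indicator (A q) om * \<Psi> (v' om)"
    by (auto simp: indicator_def)
   qed
   then have "(\<Sum>q\<in>G. \<integral>om. indicator (A q) om * \<Psi> (%i. \<xi> om i + d * of_int (q i)) \<partial>M)
    = (\<Sum>q\<in>G. \<integral>om. indicator (A q) om * \<Psi> (v' om) \<partial>M)" by simp
   also have "... = (\<integral>om. (\<Sum>q\<in>G. indicator (A q) om * \<Psi> (v' om)) \<partial>M)"
    using bd by (intro Bochner_Integration.integral_sum[symmetric] ib[of _ _ C]) auto
   also have "... = (\<integral>om. indicator B om * \<Psi> (v' om) \<partial>M)"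
   proof (rule Bochner_Integration.integral_cong[OF refl])
    fix om
    have "disjoint_family_on A G"
    unfolding disjoint_family_on_def
    proof (intro ballI impI)
    fix q q' assume q: "q : G" "q' : G" "q ~= q'"
    then obtain i where i: "q i ~= q' i" by auto
    then have "i : J2" using q by (auto simp: G_def)
    then show "A q Int A q' = {}" using i by (auto simp: A_def)
    qed
    then have "(\<Sum>q\<in>G. indicator (A q) om) = (indicator B om :: real)"
    unfolding B_def using G by (simp add: indicator_UN_disjoint)
    then show "(\<Sum>q\<in>G. indicator (A q) om * \<Psi> (v' om)) = indicator B om * \<Psi> (v' om)"
    by (simp add: sum_distrib_right[symmetric])
   qed
   finally show ?thesis .
  qed
  have BD: "B \<subseteq> D" by (auto simp: B_def A_def)
  have "D - B \<subseteq> (\<Union>i\<in>J2. D Int {om : space M. \<bar>th om i\<bar> > R})"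
  proof
   fix om assume w: "om : D - B"
   show "om : (\<Union>i\<in>J2. D Int {om : space M. \<bar>th om i\<bar> > R})"
   proof (rule ccontr)
    assume "\<not> ?thesis"
    then have le: "\<bar>th om i\<bar> <= R" if "i : J2" for i
    using w that sets.sets_into_space[OF D] by auto
    define q where "q i = (if i : J2 then \<lfloor>th om i / d\<rfloor> else 0)" for i
    have "q i : {- K..K}" if i: "i : J2" for i
    proof -
    have "\<bar>th om i / d\<bar> <= \<bar>R\<bar> / d" using le[OF i] d by (simp add: divide_right_mono)
    then have "th om i / d <= \<bar>R\<bar> / d" "- (\<bar>R\<bar> / d) <= th om i / d" by linarith+
    then have "\<lfloor>th om i / d\<rfloor> <= K" "- K <= \<lfloor>th om i / d\<rfloor>" unfolding K_def by linarith+
    then show ?thesis using i by (simp add: q_def)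
    qed
    then have "q : G" by (auto simp: G_def q_def)
    moreover have "om : A q" using w sets.sets_into_space[OF D] by (auto simp: A_def q_def)
    ultimately show False using w by (auto simp: B_def)
   qed
  qed
  then have "prob (D - B) <= prob (\<Union>i\<in>J2. D Int {om : space M. \<bar>th om i\<bar> > R})"
   using J2 by (intro finite_measure_mono) auto
  also have "... <= T2" unfolding T2_def using J2 by (intro measure_UNION_le) auto
  finally have DB: "prob (D - B) <= T2" .
  have close: "(\<integral>om. indicator D om * \<bar>\<Psi> (v om) - \<Psi> (v' om)\<bar> \<partial>M) <= e + 2 * C * (T1 + T2)"
  proof -
   have zz: "ALL om i. i \<notin> J1 Un J2 --> v om i = 0 & v' om i = 0"
    using z1 z2 by (auto simp: v_def v'_def t_def)
   have "(\<integral>om. indicator D om * \<bar>\<Psi> (v om) - \<Psi> (v' om)\<bar> \<partial>M) <= e + 2 * C * (\<Sum>i\<in>J1 Un J2.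
    prob (D Int {om : space M. \<bar>v om i\<bar> > R}) + prob (D Int {om : space M. \<bar>v om i - v' om i\<bar> > d}))"
    by (rule dd) (use vm zz prob_space_axioms D in auto)
   also have "(\<Sum>i\<in>J1 Un J2. prob (D Int {om : space M. \<bar>v om i\<bar> > R}) + prob (D Int {om : space M. \<bar>v om i - v' om i\<bar> > d}))
    = (\<Sum>i\<in>J1 Un J2. prob (D Int {om : space M. \<bar>v om i\<bar> > R}))"
   proof (rule sum.cong[OF refl])
    fix i
    have "{om : space M. \<bar>v om i - v' om i\<bar> > d} = {}" using tclose[of _ i] by (auto simp: v_def v'_def not_less)
    then show "prob (D Int {om : space M. \<bar>v om i\<bar> > R}) + prob (D Int {om : space M. \<bar>v om i - v' om i\<bar> > d}) = prob (D Int {om : space M. \<bar>v om i\<bar> > R})"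
    by (simp only: Int_empty_right measure_empty add_0_right)
   qed
   also have "... = (\<Sum>i\<in>J1. prob (D Int {om : space M. \<bar>v om i\<bar> > R})) + (\<Sum>i\<in>J2. prob (D Int {om : space M. \<bar>v om i\<bar> > R}))"
    by (rule sum.union_disjoint[OF J1 J2 J12])
   also have "(\<Sum>i\<in>J1. prob (D Int {om : space M. \<bar>v om i\<bar> > R})) = T1"
    unfolding T1_def
   proof (rule sum.cong[OF refl])
    fix i assume "i : J1"
    then have "i \<notin> J2" using J12 by auto
    then show "prob (D Int {om : space M. \<bar>v om i\<bar> > R}) = prob (D Int {om : space M. \<bar>\<xi> om i\<bar> > R})"
    using z2 by (simp add: v_def)
   qed
   also have "(\<Sum>i\<in>J2. prob (D Int {om : space M. \<bar>v om i\<bar> > R})) = T2"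
    unfolding T2_def
   proof (rule sum.cong[OF refl])
    fix i assume "i : J2"
    then have "i \<notin> J1" using J12 by auto
    then show "prob (D Int {om : space M. \<bar>v om i\<bar> > R}) = prob (D Int {om : space M. \<bar>th om i\<bar> > R})"
    using z1 by (simp add: v_def)
   qed
   finally show ?thesis .
  qed
  have "(\<integral>om. indicator D om * \<Psi> (v om) \<partial>M) - (\<integral>om. indicator B om * \<Psi> (v' om) \<partial>M)
   = (\<integral>om. indicator D om * \<Psi> (v om) - indicator B om * \<Psi> (v' om) \<partial>M)"
   using bd by (intro Bochner_Integration.integral_diff[symmetric] ib[of _ _ C]) auto
  also have "\<bar>...\<bar> <= (\<integral>om. indicator D om * \<bar>\<Psi> (v om) - \<Psi> (v' om)\<bar> + indicator (D - B) om * C \<partial>M)"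
  proof (rule abs_integral_le)
   show "integrable M (%om. indicator D om * \<Psi> (v om) - indicator B om * \<Psi> (v' om))"
    using bd by (intro Bochner_Integration.integrable_diff ib[of _ _ C]) auto
   have "\<bar>\<Psi> x - \<Psi> y\<bar> <= 2 * C" for x y using bd[of x] bd[of y] by linarith
   then show "integrable M (%om. indicator D om * \<bar>\<Psi> (v om) - \<Psi> (v' om)\<bar> + indicator (D - B) om * C)"
    by (intro Bochner_Integration.integrable_add ib[of _ _ "2*C"] ib[of _ _ C]) (use C0 in auto)
   fix om
   have "\<bar>\<Psi> (v om)\<bar> <= \<bar>\<Psi> (v om) - \<Psi> (v' om)\<bar> + C" using bd[of "v om"] by linarith
   then show "\<bar>indicator D om * \<Psi> (v om) - indicator B om * \<Psi> (v' om)\<bar>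
    <= indicator D om * \<bar>\<Psi> (v om) - \<Psi> (v' om)\<bar> + indicator (D - B) om * C"
    using BD by (auto simp: indicator_def)
  qed
  also have "... = (\<integral>om. indicator D om * \<bar>\<Psi> (v om) - \<Psi> (v' om)\<bar> \<partial>M) + prob (D - B) * C"
  proof (subst Bochner_Integration.integral_add)
   have "\<bar>\<Psi> x - \<Psi> y\<bar> <= 2 * C" for x y using bd[of x] bd[of y] by linarith
   then show "integrable M (%om. indicator D om * \<bar>\<Psi> (v om) - \<Psi> (v' om)\<bar>)" by (intro ib[of _ _ "2*C"]) auto
   show "integrable M (%om. indicator (D - B) om * C)" by (intro ib[of _ _ C]) (use C0 in auto)
  qed (simp add: sets.Int_space_eq2)
  also have "... <= e + 2 * C * (T1 + T2) + T2 * C" using close DB C0 by (intro add_mono mult_right_mono) auto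
  also have "... <= e + 3 * C * (T1 + T2)"
  proof -
   have "0 <= C * T1" unfolding T1_def using C0 by (intro mult_nonneg_nonneg sum_nonneg) auto
   then show ?thesis by (simp add: algebra_simps)
  qed
  finally show "\<bar>(\<integral>om. indicator D om * \<Psi> (%i. \<xi> om i + th om i) \<partial>M)
   - (\<Sum>q\<in>G. \<integral>om. indicator ({om : space M. \<forall>i\<in>J2. \<lfloor>th om i / d\<rfloor> = q i} Int D) om * \<Psi> (%i. \<xi> om i + d * of_int (q i)) \<partial>M)\<bar>
  <= e + 3 * C * ((\<Sum>i\<in>J1. measure M (D Int {om : space M. \<bar>\<xi> om i\<bar> > R})) + (\<Sum>i\<in>J2. measure M (D Int {om : space M. \<bar>th om i\<bar> > R})))"
   using s1 by (simp add: v_def A_def T1_def T2_def)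
 qed
qed


text \<open>Freeze \<open>th\<close> to finitely many values: on each of the corresponding events mixing applies with a function of
\<open>\<xi> n\<close> alone, and the discretisation error is uniform in \<open>n\<close> by tightness.\<close>

lemma stable_from_mixing:
 fixes \<xi> :: "nat => 'w => 'i::countable => real" and th :: "'w => 'i => real" and \<eta> :: "'v => 'i => real"
  and \<Psi> :: "('i => real) => real"
 assumes M: "prob_space M" and Q: "prob_space Q"
  and J: "finite J1" "finite J2" "J1 Int J2 = {}"
  and xm: "\<And>n i. (%om. \<xi> n om i) : borel_measurable M" and tm: "\<And>i. (%om. th om i) : borel_measurable M"
  and hm: "\<And>i. (%om. \<eta> om i) : borel_measurable Q"
  and x0: "\<And>n om i. i \<notin> J1 ==> \<xi> n om i = 0" and h0: "\<And>om i. i \<notin> J1 ==> \<eta> om i = 0"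
  and t0: "\<And>om i. i \<notin> J2 ==> th om i = 0"
  and D: "D : sets M"
  and tight: "\<And>e. e > 0 ==> EX R0. \<forall>R\<ge>R0. ALL n. \<forall>i\<in>J1. measure M (D Int {om : space M. \<bar>\<xi> n om i\<bar> > R}) <= e"
  and mix: "\<And>A (ph :: ('i => real) => real) C. A : sets M ==> continuous_on UNIV ph ==> (\<And>x. \<bar>ph x\<bar> <= C) ==>
   (%n. \<integral>om. indicator (A Int D) om * ph (\<xi> n om) \<partial>M) ----> measure M (A Int D) * (\<integral>om. ph (\<eta> om) \<partial>Q)"
  and cont: "continuous_on UNIV \<Psi>" and bd: "\<And>x. \<bar>\<Psi> x\<bar> <= C"
 shows "(%n. \<integral>om. indicator D om * \<Psi> (%i. \<xi> n om i + th om i) \<partial>M) ---->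
  (\<integral>z. indicator D (fst z) * \<Psi> (%i. \<eta> (snd z) i + th (fst z) i) \<partial>(M \<Otimes>\<^sub>M Q))"
proof (rule LIMSEQ_I)
 interpret M: prob_space M by fact
 interpret Q: prob_space Q by fact
 interpret MQ: pair_prob_space M Q ..
 fix e :: real assume e: "e > 0"
 have C0: "C >= 0" using bd[of undefined] by linarith
 define N where "N = real (card J1 + card J2) + 1"
 have N: "N > 0" "N >= 1" by (auto simp: N_def)
 define K where "K = (C + 1) * N"
 have K: "K > 0" using C0 N by (simp add: K_def)
 define \<delta> where "\<delta> = e / (24 * K)"
 have \<delta>: "\<delta> > 0" using e K by (simp add: \<delta>_def)
 have [measurable]: "(%om. \<xi> n om i) : borel_measurable M" "(%om. th om i) : borel_measurable M"
  "(%om. \<eta> om i) : borel_measurable Q" "D : sets M" for n i using xm tm hm D by auto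
 obtain R0 where R0: "\<And>R n i. R >= R0 ==> i : J1 ==> M.prob (D Int {om : space M. \<bar>\<xi> n om i\<bar> > R}) <= \<delta>"
  using tight[OF \<delta>] by metis
 have "ALL i. EX R. M.prob {om : space M. \<bar>th om i\<bar> > R} < \<delta>" using tail_tendsto_0[OF M tm \<delta>] by auto
 then obtain R1 where R1: "\<And>i. M.prob {om : space M. \<bar>th om i\<bar> > R1 i} < \<delta>" by metis
 have "ALL i. EX R. Q.prob {om : space Q. \<bar>\<eta> om i\<bar> > R} < \<delta>" using tail_tendsto_0[OF Q hm \<delta>] by auto
 then obtain R2 where R2: "\<And>i. Q.prob {om : space Q. \<bar>\<eta> om i\<bar> > R2 i} < \<delta>" by metis
 define R where "R = \<bar>R0\<bar> + (\<Sum>i\<in>J2. \<bar>R1 i\<bar>) + (\<Sum>i\<in>J1. \<bar>R2 i\<bar>)"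
 have RR0: "R >= R0" unfolding R_def by (intro add_increasing2 sum_nonneg) auto
 have RR1: "R >= R1 i" if "i : J2" for i
 proof -
  have "\<bar>R1 i\<bar> <= (\<Sum>i\<in>J2. \<bar>R1 i\<bar>)" using that J by (intro member_le_sum) auto
  moreover have "0 <= (\<Sum>i\<in>J1. \<bar>R2 i\<bar>)" by (intro sum_nonneg) auto
  ultimately show ?thesis unfolding R_def by linarith
 qed
 have RR2: "R >= R2 i" if "i : J1" for i
 proof -
  have "\<bar>R2 i\<bar> <= (\<Sum>i\<in>J1. \<bar>R2 i\<bar>)" using that J by (intro member_le_sum) auto
  moreover have "0 <= (\<Sum>i\<in>J2. \<bar>R1 i\<bar>)" by (intro sum_nonneg) auto
  ultimately show ?thesis unfolding R_def by linarith
 qed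
 \<comment> \<open>One discretisation has to serve the two spaces, hence the product space for both.\<close>
 have e8: "e / 8 > 0" using e by simp
 obtain d G where G: "finite G" and dG: "\<And>(N :: ('w \<times> 'v) measure) D (\<xi> :: 'w \<times> 'v => 'i => real) (th :: 'w \<times> 'v => 'i => real).
  prob_space N ==> D : sets N ==>
  (ALL i. (%om. \<xi> om i) : borel_measurable N) ==> (ALL i. (%om. th om i) : borel_measurable N) ==>
  (ALL om i. i \<notin> J1 --> \<xi> om i = 0) ==> (ALL om i. i \<notin> J2 --> th om i = 0) ==>
  \<bar>(\<integral>om. indicator D om * \<Psi> (%i. \<xi> om i + th om i) \<partial>N)
   - (\<Sum>q\<in>G. \<integral>om. indicator ({om : space N. \<forall>i\<in>J2. \<lfloor>th om i / d\<rfloor> = q i} Int D) om * \<Psi> (%i. \<xi> om i + d * of_int (q i)) \<partial>N)\<bar>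
  <= e / 8 + 3 * C * ((\<Sum>i\<in>J1. measure N (D Int {om : space N. \<bar>\<xi> om i\<bar> > R})) + (\<Sum>i\<in>J2. measure N (D Int {om : space N. \<bar>th om i\<bar> > R})))"
  using discretisation_error[OF cont bd e8 J, of R] by blast
 define A where "A q = {om : space M. \<forall>i\<in>J2. \<lfloor>th om i / d\<rfloor> = q i}" for q
 have Am [measurable]: "A q : sets M" for q
  unfolding A_def by (rule sets.sets_Collect_finite_All[OF _ J(2)]) measurable
 have total: "e / 8 + 3 * C * (a + b) <= e / 4" if ab: "a <= real (card J1) * \<delta>" "b <= real (card J2) * \<delta>" for a b
 proof -
  have "3 * C * (a + b) <= 3 * C * (N * \<delta>)"
   using ab \<delta> C0 by (intro mult_left_mono) (auto simp: N_def algebra_simps)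
  also have "... <= 3 * (C + 1) * (N * \<delta>)" using N \<delta> by (intro mult_right_mono) auto
  also have "... = 3 * K * \<delta>" by (simp add: K_def)
  also have "... = e / 8" using K by (simp add: \<delta>_def)
  finally show ?thesis by simp
 qed
 have [measurable]: "fst : M \<Otimes>\<^sub>M Q \<rightarrow>\<^sub>M M" "snd : M \<Otimes>\<^sub>M Q \<rightarrow>\<^sub>M Q" by measurable
 have times: "measure (M \<Otimes>\<^sub>M Q) (X \<times> Y) = M.prob X * Q.prob Y" if "X : sets M" "Y : sets Q" for X Y
  using that by (simp add: measure_def Q.emeasure_pair_measure_Times enn2real_mult)
 define D' where "D' = D \<times> space Q"
 have D'm: "D' : sets (M \<Otimes>\<^sub>M Q)" unfolding D'_def by auto
 have cyl: "D' Int {z : space (M \<Otimes>\<^sub>M Q). p (fst z)} = (D Int {om : space M. p om}) \<times> space Q" for p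
  using sets.sets_into_space[OF D] by (auto simp: D'_def space_pair_measure)
 have intf: "(\<integral>z. indicator (X \<times> space Q) z * f (fst z) \<partial>(M \<Otimes>\<^sub>M Q)) = (\<integral>om. indicator X om * f om \<partial>M)"
  if f: "f : borel_measurable M" and fb: "\<And>om. \<bar>f om\<bar> <= C" and X: "X : sets M" for f :: "'w => real" and X
 proof -
  have [measurable]: "f : borel_measurable M" "X : sets M" using f X .
  have "integrable (M \<Otimes>\<^sub>M Q) (%(x, y). indicator X x * f x)"
   using fb C0 by (intro MQ.integrable_const_bound[where B=C]) (auto simp: indicator_def)
  from MQ.integral_fst[OF this] have "(\<integral>z. indicator X (fst z) * f (fst z) \<partial>(M \<Otimes>\<^sub>M Q)) = (\<integral>om. indicator X om * f om \<partial>M)"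
   by (simp add: case_prod_beta' Q.prob_space)
  moreover have "(\<integral>z. indicator (X \<times> space Q) z * f (fst z) \<partial>(M \<Otimes>\<^sub>M Q)) = (\<integral>z. indicator X (fst z) * f (fst z) \<partial>(M \<Otimes>\<^sub>M Q))"
   by (rule Bochner_Integration.integral_cong) (auto simp: indicator_def space_pair_measure)
  ultimately show ?thesis by simp
 qed
 have AD': "{z : space (M \<Otimes>\<^sub>M Q). \<forall>i\<in>J2. \<lfloor>th (fst z) i / d\<rfloor> = q i} Int D' = (A q Int D) \<times> space Q" for q
  using sets.sets_into_space[OF D] by (auto simp: A_def D'_def space_pair_measure)
 have vec: "(%om. \<Psi> (v om)) : borel_measurable N" if "\<And>i. (%om. v om i) : borel_measurable N" for v and N :: "'z measure"
  by (rule borel_measurable_continuous_vector[OF cont that])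
 define a where "a n = (\<integral>om. indicator D om * \<Psi> (%i. \<xi> n om i + th om i) \<partial>M)" for n
 define b where "b n = (\<Sum>q\<in>G. \<integral>om. indicator (A q Int D) om * \<Psi> (%i. \<xi> n om i + d * of_int (q i)) \<partial>M)" for n
 define a0 where "a0 = (\<integral>z. indicator D (fst z) * \<Psi> (%i. \<eta> (snd z) i + th (fst z) i) \<partial>(M \<Otimes>\<^sub>M Q))"
 define b0 where "b0 = (\<Sum>q\<in>G. M.prob (A q Int D) * (\<integral>om. \<Psi> (%i. \<eta> om i + d * of_int (q i)) \<partial>Q))"
 have ab: "\<bar>a n - b n\<bar> <= e / 4" for n
 proof -
  let ?x = "%z i. \<xi> n (fst z) i" and ?t = "%z i. th (fst z) i"
  have "\<bar>(\<integral>z. indicator D' z * \<Psi> (%i. ?x z i + ?t z i) \<partial>(M \<Otimes>\<^sub>M Q))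
   - (\<Sum>q\<in>G. \<integral>z. indicator ({z : space (M \<Otimes>\<^sub>M Q). \<forall>i\<in>J2. \<lfloor>?t z i / d\<rfloor> = q i} Int D') z * \<Psi> (%i. ?x z i + d * of_int (q i)) \<partial>(M \<Otimes>\<^sub>M Q))\<bar>
  <= e / 8 + 3 * C * ((\<Sum>i\<in>J1. measure (M \<Otimes>\<^sub>M Q) (D' Int {z : space (M \<Otimes>\<^sub>M Q). \<bar>?x z i\<bar> > R}))
    + (\<Sum>i\<in>J2. measure (M \<Otimes>\<^sub>M Q) (D' Int {z : space (M \<Otimes>\<^sub>M Q). \<bar>?t z i\<bar> > R})))"
   by (rule dG) (use x0 t0 D'm MQ.prob_space_axioms in auto)
  also have "... <= e / 4"
  proof (rule total)
   show "(\<Sum>i\<in>J1. measure (M \<Otimes>\<^sub>M Q) (D' Int {z : space (M \<Otimes>\<^sub>M Q). \<bar>?x z i\<bar> > R})) <= real (card J1) * \<delta>"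
   proof (rule sum_bounded_above)
    fix i assume "i : J1"
    then show "measure (M \<Otimes>\<^sub>M Q) (D' Int {z : space (M \<Otimes>\<^sub>M Q). \<bar>?x z i\<bar> > R}) <= \<delta>"
    unfolding cyl[of "%om. \<bar>\<xi> n om i\<bar> > R"] using R0[OF RR0, of i n] by (subst times) (auto simp: Q.prob_space)
   qed
   show "(\<Sum>i\<in>J2. measure (M \<Otimes>\<^sub>M Q) (D' Int {z : space (M \<Otimes>\<^sub>M Q). \<bar>?t z i\<bar> > R})) <= real (card J2) * \<delta>"
   proof (rule sum_bounded_above)
    fix i assume i: "i : J2"
    have "M.prob (D Int {om : space M. \<bar>th om i\<bar> > R}) <= M.prob {om : space M. \<bar>th om i\<bar> > R1 i}"
    using RR1[OF i] by (intro M.finite_measure_mono) auto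
    then show "measure (M \<Otimes>\<^sub>M Q) (D' Int {z : space (M \<Otimes>\<^sub>M Q). \<bar>?t z i\<bar> > R}) <= \<delta>"
    unfolding cyl[of "%om. \<bar>th om i\<bar> > R"] using R1[of i] by (subst times) (auto simp: Q.prob_space)
   qed
  qed
  finally have *: "\<bar>(\<integral>z. indicator (D \<times> space Q) z * \<Psi> (%i. ?x z i + ?t z i) \<partial>(M \<Otimes>\<^sub>M Q))
   - (\<Sum>q\<in>G. \<integral>z. indicator ((A q Int D) \<times> space Q) z * \<Psi> (%i. ?x z i + d * of_int (q i)) \<partial>(M \<Otimes>\<^sub>M Q))\<bar> <= e / 4"
   unfolding AD' unfolding D'_def .
  have 1: "(\<integral>z. indicator (D \<times> space Q) z * \<Psi> (%i. ?x z i + ?t z i) \<partial>(M \<Otimes>\<^sub>M Q)) = a n"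
   unfolding a_def by (rule intf[of "%om. \<Psi> (%i. \<xi> n om i + th om i)"]) (use bd in \<open>auto intro!: vec\<close>)
  have 2: "(\<integral>z. indicator ((A q Int D) \<times> space Q) z * \<Psi> (%i. ?x z i + d * of_int (q i)) \<partial>(M \<Otimes>\<^sub>M Q))
   = (\<integral>om. indicator (A q Int D) om * \<Psi> (%i. \<xi> n om i + d * of_int (q i)) \<partial>M)" for q
   by (rule intf[of "%om. \<Psi> (%i. \<xi> n om i + d * of_int (q i))"]) (use bd in \<open>auto intro!: vec\<close>)
  show ?thesis using * unfolding 1 2 b_def .
 qed
 have ab0: "\<bar>a0 - b0\<bar> <= e / 4"
 proof -
  let ?x = "%z i. \<eta> (snd z) i" and ?t = "%z i. th (fst z) i"
  have "\<bar>(\<integral>z. indicator D' z * \<Psi> (%i. ?x z i + ?t z i) \<partial>(M \<Otimes>\<^sub>M Q))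
   - (\<Sum>q\<in>G. \<integral>z. indicator ({z : space (M \<Otimes>\<^sub>M Q). \<forall>i\<in>J2. \<lfloor>?t z i / d\<rfloor> = q i} Int D') z * \<Psi> (%i. ?x z i + d * of_int (q i)) \<partial>(M \<Otimes>\<^sub>M Q))\<bar>
  <= e / 8 + 3 * C * ((\<Sum>i\<in>J1. measure (M \<Otimes>\<^sub>M Q) (D' Int {z : space (M \<Otimes>\<^sub>M Q). \<bar>?x z i\<bar> > R}))
    + (\<Sum>i\<in>J2. measure (M \<Otimes>\<^sub>M Q) (D' Int {z : space (M \<Otimes>\<^sub>M Q). \<bar>?t z i\<bar> > R})))"
   by (rule dG) (use h0 t0 D'm MQ.prob_space_axioms in auto)
  also have "... <= e / 4"
  proof (rule total)
   show "(\<Sum>i\<in>J1. measure (M \<Otimes>\<^sub>M Q) (D' Int {z : space (M \<Otimes>\<^sub>M Q). \<bar>?x z i\<bar> > R})) <= real (card J1) * \<delta>"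
   proof (rule sum_bounded_above)
    fix i assume i: "i : J1"
    have "measure (M \<Otimes>\<^sub>M Q) (D' Int {z : space (M \<Otimes>\<^sub>M Q). \<bar>?x z i\<bar> > R})
    <= measure (M \<Otimes>\<^sub>M Q) (space M \<times> {om : space Q. \<bar>\<eta> om i\<bar> > R2 i})"
    using RR2[OF i] by (intro MQ.finite_measure_mono) (auto simp: space_pair_measure)
    also have "... <= \<delta>" using R2[of i] by (subst times) (auto simp: M.prob_space)
    finally show "measure (M \<Otimes>\<^sub>M Q) (D' Int {z : space (M \<Otimes>\<^sub>M Q). \<bar>?x z i\<bar> > R}) <= \<delta>" .
   qed
   show "(\<Sum>i\<in>J2. measure (M \<Otimes>\<^sub>M Q) (D' Int {z : space (M \<Otimes>\<^sub>M Q). \<bar>?t z i\<bar> > R})) <= real (card J2) * \<delta>"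
   proof (rule sum_bounded_above)
    fix i assume i: "i : J2"
    have "M.prob (D Int {om : space M. \<bar>th om i\<bar> > R}) <= M.prob {om : space M. \<bar>th om i\<bar> > R1 i}"
    using RR1[OF i] by (intro M.finite_measure_mono) auto
    then show "measure (M \<Otimes>\<^sub>M Q) (D' Int {z : space (M \<Otimes>\<^sub>M Q). \<bar>?t z i\<bar> > R}) <= \<delta>"
    unfolding cyl[of "%om. \<bar>th om i\<bar> > R"] using R1[of i] by (subst times) (auto simp: Q.prob_space)
   qed
  qed
  finally have *: "\<bar>(\<integral>z. indicator D' z * \<Psi> (%i. ?x z i + ?t z i) \<partial>(M \<Otimes>\<^sub>M Q))
   - (\<Sum>q\<in>G. \<integral>z. indicator ((A q Int D) \<times> space Q) z * \<Psi> (%i. ?x z i + d * of_int (q i)) \<partial>(M \<Otimes>\<^sub>M Q))\<bar> <= e / 4"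
   unfolding AD' .
  have 1: "(\<integral>z. indicator D' z * \<Psi> (%i. ?x z i + ?t z i) \<partial>(M \<Otimes>\<^sub>M Q)) = a0"
   unfolding a0_def by (rule Bochner_Integration.integral_cong) (auto simp: D'_def indicator_def space_pair_measure)
  have 2: "(\<integral>z. indicator ((A q Int D) \<times> space Q) z * \<Psi> (%i. ?x z i + d * of_int (q i)) \<partial>(M \<Otimes>\<^sub>M Q))
   = M.prob (A q Int D) * (\<integral>om. \<Psi> (%i. \<eta> om i + d * of_int (q i)) \<partial>Q)" for q
  proof -
   have [measurable]: "(%om. \<Psi> (%i. \<eta> om i + d * of_int (q i))) : borel_measurable Q" by (rule vec) measurable
   have "integrable (M \<Otimes>\<^sub>M Q) (%(x, y). indicator (A q Int D) x * \<Psi> (%i. \<eta> y i + d * of_int (q i)))"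
    using bd C0 by (intro MQ.integrable_const_bound[where B=C]) (auto simp: indicator_def)
   from MQ.integral_fst[OF this]
   have "(\<integral>z. indicator (A q Int D) (fst z) * \<Psi> (%i. ?x z i + d * of_int (q i)) \<partial>(M \<Otimes>\<^sub>M Q))
    = M.prob (A q Int D) * (\<integral>om. \<Psi> (%i. \<eta> om i + d * of_int (q i)) \<partial>Q)"
    by (simp add: case_prod_beta' sets.Int_space_eq2)
   moreover have "(\<integral>z. indicator ((A q Int D) \<times> space Q) z * \<Psi> (%i. ?x z i + d * of_int (q i)) \<partial>(M \<Otimes>\<^sub>M Q))
    = (\<integral>z. indicator (A q Int D) (fst z) * \<Psi> (%i. ?x z i + d * of_int (q i)) \<partial>(M \<Otimes>\<^sub>M Q))"
    by (rule Bochner_Integration.integral_cong) (auto simp: indicator_def space_pair_measure)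
   ultimately show ?thesis by simp
  qed
  show ?thesis using * unfolding 1 2 b0_def .
 qed
 have "b ----> b0"
  unfolding b_def b0_def
 proof (rule tendsto_sum)
  fix q assume "q : G"
  have "continuous_on UNIV (%x. \<Psi> (%i. x i + d * of_int (q i)))"
  proof (rule continuous_on_compose2[OF cont])
   show "continuous_on UNIV (%x i. x i + d * of_int (q i))"
    by (intro continuous_on_coordinatewise_then_product continuous_intros continuous_on_product_coordinates)
  qed auto
  from mix[OF Am this, of C q] bd
  show "(%n. \<integral>om. indicator (A q Int D) om * \<Psi> (%i. \<xi> n om i + d * of_int (q i)) \<partial>M)
   ----> M.prob (A q Int D) * (\<integral>om. \<Psi> (%i. \<eta> om i + d * of_int (q i)) \<partial>Q)" by simp
 qed
 from LIMSEQ_D[OF this, of "e/4"] e obtain n0 where n0: "\<And>n. n >= n0 ==> \<bar>b n - b0\<bar> < e / 4" by auto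
 have "\<bar>a n - a0\<bar> < e" if "n >= n0" for n using ab[of n] ab0 n0[OF that] e by linarith
 then show "EX n0. \<forall>n\<ge>n0. norm (a n - a0) < e" unfolding real_norm_def by blast
qed

section \<open>Brownian increments next to the jump times\<close>

definition grid_below :: "nat => real => real" where "grid_below n t = (of_int \<lceil>real n * t\<rceil> - 1) / real n"
definition grid_above :: "nat => real => real" where "grid_above n t = of_int \<lceil>real n * t\<rceil> / real n"

lemma grid_measurable [measurable]:
 "grid_below n : borel_measurable borel" "grid_above n : borel_measurable borel"
 unfolding grid_below_def grid_above_def by measurable

lemma grid_bounds:
 assumes "n >= 1"
 shows "grid_below n t < t" "t <= grid_above n t" "t - 1 / real n <= grid_below n t" "grid_above n t < t + 1 / real n"
  "grid_above n t = grid_below n t + 1 / real n"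
proof -
 have n: "real n > 0" using assms by simp
 have c: "real n * t <= of_int \<lceil>real n * t\<rceil>" "of_int \<lceil>real n * t\<rceil> < real n * t + 1" by linarith+
 show "grid_below n t < t" "t <= grid_above n t"
  unfolding grid_below_def grid_above_def using n c
  by (simp_all add: pos_divide_less_eq pos_le_divide_eq mult.commute)
 have e: "t - 1 / real n = (real n * t - 1) / real n" "t + 1 / real n = (real n * t + 1) / real n"
  using n by (simp_all add: field_simps)
 show "t - 1 / real n <= grid_below n t" "grid_above n t < t + 1 / real n"
  unfolding grid_below_def grid_above_def e using n c by (simp_all add: divide_right_mono divide_strict_right_mono)
 show "grid_above n t = grid_below n t + 1 / real n"
  unfolding grid_below_def grid_above_def by (simp add: diff_divide_distrib)
qed

lemma grid_unit:
 assumes "n >= 1" "0 < t" "t < 1"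
 shows "0 <= grid_below n t" "grid_above n t <= 1"
proof -
 have n: "real n > 0" using assms by simp
 have "1 <= \<lceil>real n * t\<rceil>" using assms by (simp add: one_le_ceiling)
 then show "0 <= grid_below n t" unfolding grid_below_def using n by simp
 have "\<lceil>real n * t\<rceil> <= int n" using assms by (simp add: ceiling_le_iff)
 then have "of_int \<lceil>real n * t\<rceil> <= real n" by (metis of_int_le_iff of_int_of_nat_eq)
 then show "grid_above n t <= 1" unfolding grid_above_def using n by simp
qed

lemma grid_frc:
 assumes "n >= 1"
 shows "real n * (t - grid_below n t) = frc (real n * t)" "real n * (grid_above n t - t) = 1 - frc (real n * t)"
 using assms by (auto simp: grid_below_def grid_above_def frc_def field_simps)

definition left_end :: "nat => (nat => real) => nat \<times> nat => real" where
 "left_end n th j = (if fst j = 0 then grid_below n (th (snd j)) else th (snd j))"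
definition right_end :: "nat => (nat => real) => nat \<times> nat => real" where
 "right_end n th j = (if fst j = 0 then th (snd j) else grid_above n (th (snd j)))"
text \<open>Removing a piece of length \<open>1/n\<^sup>2\<close> next to the jump time makes the intervals for \<open>n\<close> disjoint from those for
\<open>m > n\<^sup>2\<close>, at a negligible cost after multiplication by \<open>sqrt n\<close>.\<close>

definition left_trim :: "nat => (nat => real) => nat \<times> nat => real" where
 "left_trim n th j = (if fst j = 0 then grid_below n (th (snd j))
  else min (grid_above n (th (snd j))) (th (snd j) + 1 / (real n)\<^sup>2))"
definition right_trim :: "nat => (nat => real) => nat \<times> nat => real" where
 "right_trim n th j = (if fst j = 0 then max (grid_below n (th (snd j))) (th (snd j) - 1 / (real n)\<^sup>2)
  else grid_above n (th (snd j)))"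

text \<open>The index \<open>(0, k)\<close> stands for the interval before the jump \<open>k\<close>, and \<open>(1, k)\<close> for the one after it.\<close>

definition sides :: "nat => (nat \<times> nat) set" where "sides kp = {0, 1} \<times> {..<kp}"

lemma finite_sides [simp]: "finite (sides kp)" by (simp add: sides_def)

definition separated :: "nat => nat => (nat => real) => bool" where
 "separated n kp th \<longleftrightarrow> (ALL k<kp. 0 < th k & th k < 1) & (ALL i<kp. ALL k<kp. i ~= k --> \<bar>th i - th k\<bar> > 2 / real n)"

lemma ends_unit:
 assumes "n >= 1" "separated n kp th" "j : sides kp"
 shows "0 <= left_end n th j & left_end n th j <= right_end n th j & right_end n th j <= 1"
  "0 <= left_trim n th j & left_trim n th j <= right_trim n th j & right_trim n th j <= 1"
proof -
 define p where "p = 1 / (real n)\<^sup>2"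
 have t: "0 < th (snd j)" "th (snd j) < 1" using assms by (auto simp: separated_def sides_def)
 have p: "0 <= p" by (simp add: p_def)
 note g = grid_bounds(1,2)[OF assms(1), of "th (snd j)"] grid_unit[OF assms(1) t] t p
 show "0 <= left_end n th j & left_end n th j <= right_end n th j & right_end n th j <= 1"
  using g unfolding left_end_def right_end_def by simp
 show "0 <= left_trim n th j & left_trim n th j <= right_trim n th j & right_trim n th j <= 1"
  using g unfolding left_trim_def right_trim_def p_def[symmetric] by (cases "fst j = 0") auto
qed

lemma ends_near:
 assumes n: "n >= 1" and x: "x : {left_end n th j<..right_end n th j}"
 shows "\<bar>x - th (snd j)\<bar> < 1 / real n"
proof -
 define p where "p = 1 / real n"
 have p: "p > 0" using n by (simp add: p_def)
 note g = grid_bounds(1-4)[OF n, of "th (snd j)", folded p_def] p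
 show ?thesis unfolding p_def[symmetric]
  using x g by (cases "fst j = 0") (simp_all add: left_end_def right_end_def)
qed

lemma trim_near:
 assumes n: "n >= 1" and x: "x : {left_trim n th j<..right_trim n th j}"
 shows "\<bar>x - th (snd j)\<bar> < 1 / real n" "1 / (real n)\<^sup>2 <= \<bar>x - th (snd j)\<bar>"
proof -
 define p where "p = 1 / real n"
 define q where "q = 1 / (real n)\<^sup>2"
 have p: "p > 0" "q > 0" using n by (simp_all add: p_def q_def)
 note g = grid_bounds(1-4)[OF n, of "th (snd j)", folded p_def] p
 have "\<bar>x - th (snd j)\<bar> < p & q <= \<bar>x - th (snd j)\<bar>"
  using x g by (cases "fst j = 0") (auto simp: left_trim_def right_trim_def q_def[symmetric])
 then show "\<bar>x - th (snd j)\<bar> < 1 / real n" "1 / (real n)\<^sup>2 <= \<bar>x - th (snd j)\<bar>"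
  by (simp_all add: p_def q_def)
qed

lemma ends_disjoint:
 assumes n: "n >= 1" and s: "separated n kp th" and ij: "i : sides kp" "j : sides kp" "i ~= j"
 shows "{left_end n th i<..right_end n th i} Int {left_end n th j<..right_end n th j} = {}"
proof (cases "snd i = snd j")
 case True
 then have "fst i ~= fst j" using ij by (auto simp: prod_eq_iff)
 moreover have "fst i : {0, 1}" "fst j : {0, 1}" using ij by (auto simp: sides_def)
 ultimately show ?thesis using True by (auto simp: left_end_def right_end_def)
next
 case False
 have sep: "\<bar>th (snd i) - th (snd j)\<bar> > 2 / real n" using s ij False by (auto simp: separated_def sides_def)
 have "2 / real n = 1 / real n + 1 / real n" by simp
 then have "False" if "\<bar>x - th (snd i)\<bar> < 1 / real n" "\<bar>x - th (snd j)\<bar> < 1 / real n" for x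
  using that sep by linarith
 then show ?thesis using ends_near[OF n, of _ th i] ends_near[OF n, of _ th j] by (intro equals0I) (metis IntE)
qed

lemma trim_disjoint:
 assumes n: "n >= 1" and m: "m > n\<^sup>2" and s: "separated n kp th" and ij: "i : sides kp" "j : sides kp"
 shows "{left_trim n th i<..right_trim n th i} Int {left_trim m th j<..right_trim m th j} = {}"
proof (rule equals0I)
 fix x assume x: "x : {left_trim n th i<..right_trim n th i} Int {left_trim m th j<..right_trim m th j}"
 have "n <= n\<^sup>2" using n by (simp add: power2_eq_square)
 then have m1: "m >= 1" "n <= m" using n m by auto
 have "1 / real m < 1 / real (n\<^sup>2)" using m n by (intro divide_strict_left_mono) auto
 then have 1: "1 / real m < 1 / (real n)\<^sup>2" by simp
 have 2: "1 / real m <= 1 / real n" using m1 n by (intro divide_left_mono) auto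
 have near: "\<bar>x - th (snd j)\<bar> < 1 / real m" using trim_near(1)[OF m1(1)] x by auto
 have far: "1 / (real n)\<^sup>2 <= \<bar>x - th (snd i)\<bar>" "\<bar>x - th (snd i)\<bar> < 1 / real n" using trim_near[OF n] x by auto
 show False
 proof (cases "snd i = snd j")
  case True
  then show ?thesis using near far 1 by simp
 next
  case False
  then have "\<bar>th (snd i) - th (snd j)\<bar> > 2 / real n" using s ij by (auto simp: separated_def sides_def)
  moreover have "2 / real n = 1 / real n + 1 / real n" by simp
  ultimately show ?thesis using far near 2 by linarith
 qed
qed

lemma (in prob_space) indep_vars_reindex:
 assumes "indep_vars N X (h ` I)" "inj_on h I"
 shows "indep_vars (%i. N (h i)) (%i. X (h i)) I"
 unfolding indep_vars_def2
proof (intro conjI ballI)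
 fix i assume "i : I"
 then show "X (h i) : M \<rightarrow>\<^sub>M N (h i)" using assms by (auto simp: indep_vars_def2)
next
 let ?F = "%i. {X i -` A Int space M |A. A : sets (N i)}"
 have F: "indep_sets ?F (h ` I)" using assms by (simp add: indep_vars_def2)
 show "indep_sets (%i. ?F (h i)) I"
 proof (rule indep_setsI)
  show "?F (h i) \<subseteq> events" if "i : I" for i using F that by (auto simp: indep_sets_def)
  fix A J assume J: "J ~= {}" "J \<subseteq> I" "finite J" "\<forall>j\<in>J. A j : ?F (h j)"
  have inj: "inj_on h J" using assms(2) J(2) by (rule inj_on_subset)
  have g: "the_inv_into J h (h j) = j" if "j : J" for j using inj that by (rule the_inv_into_f_f)
  have "prob (\<Inter>i\<in>h ` J. A (the_inv_into J h i)) = (\<Prod>i\<in>h ` J. prob (A (the_inv_into J h i)))"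
   using F J g by (intro indep_setsD[OF F]) auto
  moreover have "(\<Inter>i\<in>h ` J. A (the_inv_into J h i)) = (\<Inter>j\<in>J. A j)" using g by auto
  moreover have "(\<Prod>i\<in>h ` J. prob (A (the_inv_into J h i))) = (\<Prod>j\<in>J. prob (A j))"
   using inj g by (simp add: prod.reindex)
  ultimately show "prob (\<Inter>j\<in>J. A j) = (\<Prod>j\<in>J. prob (A j))" by simp
 qed
qed

lemma torus_eq_density:
 assumes "finite I"
 shows "torus I = density (PiM I (%_. lborel)) (indicator (Pi\<^sub>E I (%_. {0..1})))"
proof -
 interpret u: product_prob_space "%_. unif" I by (rule product_prob_spaceI) (rule prob_space_unif)
 interpret l: product_sigma_finite "%_. lborel :: real measure" by standard
 have cube: "Pi\<^sub>E I (%_. {0..1::real}) : sets (PiM I (%_. lborel))"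
  by (rule sets_PiM_I_finite[OF assms]) simp
 show ?thesis
 proof (rule u.PiM_eqI[OF assms, symmetric])
  show "sets (density (PiM I (%_. lborel)) (indicator (Pi\<^sub>E I (%_. {0..1})))) = sets (torus I)"
   by (auto intro!: sets_PiM_cong)
  fix A assume A: "\<And>i. i : I ==> A i : sets unif"
  have "Pi\<^sub>E I A : sets (PiM I (%_. lborel))" using A by (intro sets_PiM_I_finite[OF assms]) auto
  then have "emeasure (density (PiM I (%_. lborel)) (indicator (Pi\<^sub>E I (%_. {0..1})))) (Pi\<^sub>E I A)
   = emeasure (PiM I (%_. lborel)) (Pi\<^sub>E I (%_. {0..1}) Int Pi\<^sub>E I A)"
   using cube by (subst emeasure_density) (auto simp: indicator_inter_arith[symmetric] mult.commute Int_commute)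
  also have "Pi\<^sub>E I (%_. {0..1}) Int Pi\<^sub>E I A = Pi\<^sub>E I (%i. {0..1} Int A i)" by (rule PiE_Int)
  also have "emeasure (PiM I (%_. lborel)) ... = (\<Prod>i\<in>I. emeasure lborel ({0..1} Int A i))"
   using A by (intro l.emeasure_PiM[OF assms]) auto
  also have "... = (\<Prod>i\<in>I. emeasure unif (A i))"
   using A by (intro prod.cong refl) (simp add: emeasure_uniform_measure divide_ennreal_def)
  finally show "emeasure (density (PiM I (%_. lborel)) (indicator (Pi\<^sub>E I (%_. {0..1})))) (Pi\<^sub>E I A)
   = (\<Prod>i\<in>I. emeasure unif (A i))" .
 qed
qed

text \<open>The Brownian motion \<open>w\<close> stands for a jointly measurable version of \<open>W\<close>, which can be evaluated at random times.\<close>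

locale mix_model = jump_model M1 M2 W T \<Lambda>
 for M1 :: "'a measure" and M2 :: "'b measure" and W T \<Lambda> +
 fixes w :: "real => 'a => real" and M' :: "'e measure" and U Nm Np :: "nat => 'e => real"
 assumes wbm: "standard_brownian_motion M1 w"
  and wj: "(%(t, x). w t x) : borel_measurable (borel \<Otimes>\<^sub>M M1)"
  and ext: "extension_variables M' U Nm Np"
  and density: "jump_times_cond_density M2 T"
begin

sublocale M': prob_space M' using ext by (simp add: extension_variables_def)

abbreviation "P0 \<equiv> M1 \<Otimes>\<^sub>M M2"

lemma num_jumps_measurable [measurable]: "num_jumps T : measurable M2 (count_space UNIV)"
 unfolding num_jumps_def[abs_def] by (rule measurable_card) measurable

lemma w_measurable [measurable]: "w t : borel_measurable M1"
 using measurable_Pair_compose_split[OF wj, of "%_. t" M1 "%x. x"] by simp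

lemma w_at_measurable [measurable (raw)]:
 assumes "S : borel_measurable N" "x : N \<rightarrow>\<^sub>M M1"
 shows "(%om. w (S om) (x om)) : borel_measurable N"
 using measurable_Pair_compose_split[OF wj assms] by simp

lemma ends_measurable [measurable]:
 "(%x. left_end n (%k. T k x) j) : borel_measurable M2" "(%x. right_end n (%k. T k x) j) : borel_measurable M2"
 "(%x. left_trim n (%k. T k x) j) : borel_measurable M2" "(%x. right_trim n (%k. T k x) j) : borel_measurable M2"
 unfolding left_end_def right_end_def left_trim_def right_trim_def by measurable

definition vec :: "nat => nat => (nat \<times> nat => real) => (nat \<times> nat => real) => 'a => nat \<times> nat => real" where
 "vec n kp l r x j = (if j : sides kp then sqrt (real n) * (w (r j) x - w (l j) x) else 0)"

definition xi :: "nat => nat => 'a \<times> 'b => nat \<times> nat => real" where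
 "xi n kp om = vec n kp (left_end n (%k. T k (snd om))) (right_end n (%k. T k (snd om))) (fst om)"
definition xit :: "nat => nat => 'a \<times> 'b => nat \<times> nat => real" where
 "xit n kp om = vec n kp (left_trim n (%k. T k (snd om))) (right_trim n (%k. T k (snd om))) (fst om)"

lemma xi_measurable [measurable]: "(%om. xi n kp om j) : borel_measurable P0" "(%om. xit n kp om j) : borel_measurable P0"
 unfolding xi_def xit_def vec_def by measurable

definition lim_vec :: "nat => (nat => real) => 'e => nat \<times> nat => real" where
 "lim_vec kp v y j = (if j : sides kp then
  (if fst j = 0 then sqrt (v (snd j)) * Nm (snd j) y else sqrt (1 - v (snd j)) * Np (snd j) y) else 0)"

lemma ext_indep: "M'.indep_vars (%_. borel) (case_sum U (case_sum Nm Np)) UNIV"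
 using ext by (simp add: extension_variables_def)

lemma U_measurable [measurable]: "U k : borel_measurable M'" "Nm k : borel_measurable M'" "Np k : borel_measurable M'"
proof -
 have "M'.indep_vars (%_. borel) (case_sum U (case_sum Nm Np)) UNIV" using ext by (simp add: extension_variables_def)
 then have m: "case_sum U (case_sum Nm Np) i : borel_measurable M'" for i by (simp add: M'.indep_vars_def2)
 show "U k : borel_measurable M'" "Nm k : borel_measurable M'" "Np k : borel_measurable M'"
  using m[of "Inl k"] m[of "Inr (Inl k)"] m[of "Inr (Inr k)"] by auto
qed

text \<open>Both vectors are independent with the same Gaussian marginals.\<close>

lemma expectation_increments_eq:
 assumes n: "n >= 1" and s: "separated n kp th"
  and cont: "continuous_on UNIV (ph :: (nat \<times> nat => real) => real)"
 shows "(\<integral>x. ph (vec n kp (left_end n th) (right_end n th) x) \<partial>M1)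
  = (\<integral>y. ph (lim_vec kp (%k. frc (real n * th k)) y) \<partial>M')"
proof (cases "sides kp = {}")
 case True
 then show ?thesis by (simp add: vec_def lim_vec_def[abs_def] vec_def[abs_def] M1.prob_space M'.prob_space)
next
 case False
 define c where "c j = (if fst j = 0 then sqrt (frc (real n * th (snd j))) else sqrt (1 - frc (real n * th (snd j))))" for j :: "nat \<times> nat"
 define h :: "nat \<times> nat => nat + nat + nat" where "h j = (if fst j = 0 then Inr (Inl (snd j)) else Inr (Inr (snd j)))" for j
 define g where "g j = case_sum U (case_sum Nm Np) (h j)" for j
 define X where "X j x = sqrt (real n) * (w (right_end n th j) x - w (left_end n th j) x)" for j x
 define Y where "Y j y = c j * g j y" for j y
 let ?J = "sides kp"
 have [measurable]: "X j : borel_measurable M1" for j unfolding X_def by measurable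
 have gm [measurable]: "g j : borel_measurable M'" for j unfolding g_def h_def by simp
 have [measurable]: "Y j : borel_measurable M'" for j unfolding Y_def by measurable
 have indX: "M1.indep_vars (%_. borel) X ?J"
 proof -
  have "M1.indep_vars (%_. borel) (%j x. w (right_end n th j) x - w (left_end n th j) x) ?J"
   by (rule bm_indep_increments[OF wbm]) (use ends_unit(1)[OF n s] ends_disjoint[OF n s] in auto)
  then have "M1.indep_vars (%_. borel) (%j x. sqrt (real n) * (w (right_end n th j) x - w (left_end n th j) x)) ?J"
   by (rule M1.indep_vars_compose2) auto
  then show ?thesis by (simp add: X_def[abs_def])
 qed
 have inj: "inj_on h ?J" by (auto simp: inj_on_def h_def sides_def)
 have "M'.indep_vars (%_. borel) (case_sum U (case_sum Nm Np)) (h ` ?J)"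
  by (rule M'.indep_vars_subset[OF ext_indep]) simp
 from M'.indep_vars_reindex[OF this inj] have "M'.indep_vars (%_. borel) g ?J" by (simp add: g_def[abs_def])
 then have indY: "M'.indep_vars (%_. borel) Y ?J"
  unfolding Y_def by (rule M'.indep_vars_compose2) auto
 have dX: "distr M1 borel (X j) = distr gauss borel (%x. c j * x)" if j: "j : ?J" for j
 proof -
  have u: "0 <= left_end n th j" "left_end n th j <= right_end n th j" "right_end n th j <= 1"
   using ends_unit(1)[OF n s j] by auto
  have "real n * (right_end n th j - left_end n th j) = (if fst j = 0 then frc (real n * th (snd j)) else 1 - frc (real n * th (snd j)))"
   using grid_frc[OF n] by (simp add: right_end_def left_end_def)
  then have cj: "sqrt (real n) * sqrt (right_end n th j - left_end n th j) = c j"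
   unfolding real_sqrt_mult[symmetric] by (simp add: c_def)
  have "distr M1 borel (X j) = distr (distr M1 borel (%x. w (right_end n th j) x - w (left_end n th j) x)) borel (%z. sqrt (real n) * z)"
   by (subst distr_distr) (auto simp: X_def[abs_def] o_def)
  also have "... = distr gauss borel (%x. c j * x)"
   unfolding bm_increment_distr[OF wbm u] by (subst distr_distr) (auto simp: o_def cj mult.assoc[symmetric])
  finally show ?thesis .
 qed
 have dY: "distr M' borel (Y j) = distr gauss borel (%x. c j * x)" for j
 proof -
  have "distributed M' lborel (g j) std_normal_density"
   using ext by (auto simp: g_def h_def extension_variables_def)
  then have "distr M' lborel (g j) = gauss" by (simp add: distributed_def)
  moreover have "distr M' lborel (g j) = distr M' borel (g j)" by (rule distr_cong) auto
  ultimately have d: "distr M' borel (g j) = gauss" by simp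
  have "distr M' borel (Y j) = distr (distr M' borel (g j)) borel (%z. c j * z)"
   by (subst distr_distr) (auto simp: Y_def[abs_def] o_def)
  then show ?thesis unfolding d .
 qed
 have law: "distr M1 (PiM ?J (%_. borel)) (%x. \<lambda>j\<in>?J. X j x) = distr M' (PiM ?J (%_. borel)) (%y. \<lambda>j\<in>?J. Y j y)"
 proof -
  have "distr M1 (PiM ?J (%_. borel)) (%x. \<lambda>j\<in>?J. X j x) = PiM ?J (%j. distr M1 borel (X j))"
   using indX by (subst (asm) M1.indep_vars_iff_distr_eq_PiM'[OF False]) auto
  also have "... = PiM ?J (%j. distr M' borel (Y j))" by (rule PiM_cong) (use dX dY in auto)
  also have "... = distr M' (PiM ?J (%_. borel)) (%y. \<lambda>j\<in>?J. Y j y)"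
   using indY by (subst (asm) M'.indep_vars_iff_distr_eq_PiM'[OF False]) auto
  finally show ?thesis .
 qed
 define f where "f z = ph (%j. if j : ?J then z j else 0)" for z
 have fm: "f : borel_measurable (PiM ?J (%_. borel))"
  unfolding f_def
 proof (rule borel_measurable_continuous_vector[OF cont])
  fix i show "(%z. if i : ?J then z i else 0) : borel_measurable (PiM ?J (%_. borel :: real measure))"
   by (cases "i : ?J") auto
 qed
 have "(\<integral>x. ph (vec n kp (left_end n th) (right_end n th) x) \<partial>M1) = (\<integral>x. f (\<lambda>j\<in>?J. X j x) \<partial>M1)"
  by (intro Bochner_Integration.integral_cong refl) (auto simp: f_def vec_def X_def intro!: arg_cong[where f=ph])
 also have "... = (\<integral>z. f z \<partial>distr M1 (PiM ?J (%_. borel)) (%x. \<lambda>j\<in>?J. X j x))"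
  by (rule integral_distr[symmetric, OF _ fm]) measurable
 also have "... = (\<integral>y. f (\<lambda>j\<in>?J. Y j y) \<partial>M')"
  unfolding law by (rule integral_distr[OF _ fm]) measurable
 also have "... = (\<integral>y. ph (lim_vec kp (%k. frc (real n * th k)) y) \<partial>M')"
  by (intro Bochner_Integration.integral_cong refl)
   (auto simp: f_def lim_vec_def Y_def g_def h_def c_def intro!: arg_cong[where f=ph])
 finally show ?thesis .
qed

text \<open>The limiting expectation as a function of the values of the uniform variables.\<close>

definition profile :: "((nat \<times> nat => real) => real) => nat => (nat => real) => real" where
 "profile ph kp v = (\<integral>y. ph (lim_vec kp v y) \<partial>M')"

lemma profile_cong: "(\<And>k. k < kp ==> v k = v' k) ==> profile ph kp v = profile ph kp v'"
 unfolding profile_def by (intro Bochner_Integration.integral_cong refl arg_cong[where f=ph]) (auto simp: lim_vec_def sides_def)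

lemma profile_measurable:
 assumes cont: "continuous_on UNIV ph"
 shows "profile ph kp : borel_measurable (PiM {..<kp} (%_. borel))"
proof -
 have "(%z. ph (lim_vec kp (fst z) (snd z))) : borel_measurable (PiM {..<kp} (%_. borel) \<Otimes>\<^sub>M M')"
 proof (rule borel_measurable_continuous_vector[OF cont])
  fix j
  have [measurable]: "(%v. v (snd j)) : borel_measurable (PiM {..<kp} (%_. borel :: real measure))" if "j : sides kp"
   using that by (intro measurable_component_singleton) (auto simp: sides_def)
  show "(%z. lim_vec kp (fst z) (snd z) j) : borel_measurable (PiM {..<kp} (%_. borel) \<Otimes>\<^sub>M M')"
   unfolding lim_vec_def by (cases "j : sides kp"; cases "fst j = 0") simp_all
 qed
 then show ?thesis unfolding profile_def[abs_def]
  by (intro M'.borel_measurable_lebesgue_integral) (simp add: case_prod_beta')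
qed

lemma profile_bound: "(\<And>x. \<bar>ph x\<bar> <= C) ==> continuous_on UNIV ph ==> \<bar>profile ph kp v\<bar> <= C"
proof -
 assume b: "\<And>x. \<bar>ph x\<bar> <= C" and cont: "continuous_on UNIV ph"
 have [measurable]: "(%y. ph (lim_vec kp v y)) : borel_measurable M'"
  by (rule borel_measurable_continuous_vector[OF cont]) (simp add: lim_vec_def)
 have "integrable M' (%y. ph (lim_vec kp v y))" using b by (intro M'.integrable_const_bound[where B=C]) auto
 then have "\<bar>profile ph kp v\<bar> <= (\<integral>y. C \<partial>M')" unfolding profile_def
  using b by (intro abs_integral_le) auto
 then show ?thesis by (simp add: M'.prob_space)
qed

lemma distr_U_torus: "distr M' (PiM {..<kp} (%_. borel)) (%y. \<lambda>k\<in>{..<kp}. U k y) = torus {..<kp}"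
proof (cases "kp = 0")
 case True
 show ?thesis
 proof (rule measure_eqI)
  fix A assume "A : sets (distr M' (PiM {..<kp} (%_. borel)) (%y. \<lambda>k\<in>{..<kp}. U k y))"
  then have A: "A : {{}, {%_. undefined}}" using True by (simp add: sets_PiM_empty)
  then show "emeasure (distr M' (PiM {..<kp} (%_. borel)) (%y. \<lambda>k\<in>{..<kp}. U k y)) A = emeasure (torus {..<kp}) A"
   using True by (auto simp: emeasure_distr sets_PiM_empty M'.emeasure_space_1 restrict_def vimage_def)
 qed (simp add: sets_torus)
next
 case False
 then have ne: "{..<kp} ~= {}" by auto
 have "M'.indep_vars (%_. borel) (case_sum U (case_sum Nm Np)) (Inl ` {..<kp})"
  by (rule M'.indep_vars_subset[OF ext_indep]) simp
 from M'.indep_vars_reindex[OF this] have "M'.indep_vars (%_. borel) U {..<kp}" by simp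
 then have "distr M' (PiM {..<kp} (%_. borel)) (%y. \<lambda>k\<in>{..<kp}. U k y) = PiM {..<kp} (%k. distr M' borel (U k))"
  by (subst (asm) M'.indep_vars_iff_distr_eq_PiM'[OF ne]) auto
 also have "... = torus {..<kp}"
 proof (rule PiM_cong[OF refl])
  fix k
  have "distr M' lborel (U k) = distr M' borel (U k)" by (rule distr_cong) auto
  then show "distr M' borel (U k) = unif" using ext by (simp add: extension_variables_def)
 qed
 finally show ?thesis .
qed

lemma integral_profile:
 assumes cont: "continuous_on UNIV ph" and b: "\<And>x. \<bar>ph x\<bar> <= C"
 shows "(\<integral>v. profile ph kp v \<partial>torus {..<kp}) = (\<integral>y. ph (lim_vec kp (%k. U k y) y) \<partial>M')"
proof -
 let ?X = "case_sum U (case_sum Nm Np)"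
 define A :: "(nat + nat + nat) set" where "A = range Inl"
 define B :: "(nat + nat + nat) set" where "B = range Inr"
 have "M'.indep_vars (%_. borel) ?X UNIV" using ext by (simp add: extension_variables_def)
 then have ind: "M'.indep_var (PiM A (%_. borel)) (%y. \<lambda>i\<in>A. ?X i y) (PiM B (%_. borel)) (%y. \<lambda>i\<in>B. ?X i y)"
  by (rule M'.indep_var_restrict) (auto simp: A_def B_def)
 let ?PA = "PiM A (%_. borel :: real measure)" and ?PB = "PiM B (%_. borel :: real measure)"
 let ?XA = "%y. \<lambda>i\<in>A. ?X i y" and ?XB = "%y. \<lambda>i\<in>B. ?X i y"
 have mA [measurable]: "?XA : M' \<rightarrow>\<^sub>M ?PA" and mB [measurable]: "?XB : M' \<rightarrow>\<^sub>M ?PB"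
  using M'.indep_var_rv1[OF ind] M'.indep_var_rv2[OF ind] by auto
 interpret a: prob_space "distr M' ?PA ?XA" by (rule M'.prob_space_distr) simp
 interpret b: prob_space "distr M' ?PB ?XB" by (rule M'.prob_space_distr) simp
 interpret ab: pair_prob_space "distr M' ?PA ?XA" "distr M' ?PB ?XB" ..
 define q where "q x z j = (if j : sides kp then (if fst j = 0 then sqrt (x (Inl (snd j))) * z (Inr (Inl (snd j)))
  else sqrt (1 - x (Inl (snd j))) * z (Inr (Inr (snd j)))) else 0)" for x z :: "nat + nat + nat => real" and j :: "nat \<times> nat"
 have comp [measurable]: "(%x. x (Inl k)) : borel_measurable ?PA" "(%x. x (Inr k')) : borel_measurable ?PB" for k k'
  by (rule measurable_component_singleton, simp add: A_def B_def)+
 have qm [measurable]: "(%p. ph (q (fst p) (snd p))) : borel_measurable (?PA \<Otimes>\<^sub>M ?PB)"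
  by (rule borel_measurable_continuous_vector[OF cont]) (simp add: q_def)
 have joint: "distr M' ?PA ?XA \<Otimes>\<^sub>M distr M' ?PB ?XB = distr M' (?PA \<Otimes>\<^sub>M ?PB) (%y. (?XA y, ?XB y))"
  using ind by (simp add: M'.indep_var_distribution_eq)
 have lv: "lim_vec kp (%k. x (Inl k)) y = q x (?XB y)" for x y
  by (auto simp: lim_vec_def q_def B_def fun_eq_iff)
 have "(\<integral>y. ph (lim_vec kp (%k. U k y) y) \<partial>M') = (\<integral>y. ph (q (?XA y) (?XB y)) \<partial>M')"
  by (intro Bochner_Integration.integral_cong refl arg_cong[where f=ph]) (auto simp: lim_vec_def q_def A_def B_def)
 also have "... = (\<integral>p. ph (q (fst p) (snd p)) \<partial>distr M' (?PA \<Otimes>\<^sub>M ?PB) (%y. (?XA y, ?XB y)))"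
  by (subst integral_distr) auto
 also have "... = (\<integral>p. ph (q (fst p) (snd p)) \<partial>(distr M' ?PA ?XA \<Otimes>\<^sub>M distr M' ?PB ?XB))" by (simp only: joint)
 also have "... = (\<integral>x. (\<integral>z. ph (q x z) \<partial>distr M' ?PB ?XB) \<partial>distr M' ?PA ?XA)"
 proof -
  have "integrable (distr M' ?PA ?XA \<Otimes>\<^sub>M distr M' ?PB ?XB) (%(x, z). ph (q x z))"
   using b qm by (intro ab.integrable_const_bound[where B=C])
    (auto simp: case_prod_beta' cong: measurable_cong_sets sets_pair_measure_cong)
  from ab.integral_fst[OF this] show ?thesis by (simp add: case_prod_beta')
 qed
 also have "... = (\<integral>x. profile ph kp (%k. x (Inl k)) \<partial>distr M' ?PA ?XA)"
 proof (rule Bochner_Integration.integral_cong[OF refl])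
  fix x assume "x : space (distr M' ?PA ?XA)"
  then have xA: "x : space ?PA" by simp
  have "(%z. ph (q x z)) : borel_measurable ?PB"
   using measurable_compose[OF measurable_Pair1'[OF xA] qm] by simp
  then have "(\<integral>z. ph (q x z) \<partial>distr M' ?PB ?XB) = (\<integral>y. ph (q x (?XB y)) \<partial>M')" by (intro integral_distr) auto
  then show "(\<integral>z. ph (q x z) \<partial>distr M' ?PB ?XB) = profile ph kp (%k. x (Inl k))"
   unfolding profile_def lv .
 qed
 also have "... = (\<integral>x. profile ph kp (\<lambda>k\<in>{..<kp}. x (Inl k)) \<partial>distr M' ?PA ?XA)"
  by (intro Bochner_Integration.integral_cong refl profile_cong) auto
 also have "... = (\<integral>y. profile ph kp (\<lambda>k\<in>{..<kp}. ?XA y (Inl k)) \<partial>M')"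
 proof (rule integral_distr[OF mA])
  have "(%x. \<lambda>k\<in>{..<kp}. x (Inl k)) : ?PA \<rightarrow>\<^sub>M PiM {..<kp} (%_. borel)" by (rule measurable_restrict) measurable
  then show "(%x. profile ph kp (\<lambda>k\<in>{..<kp}. x (Inl k))) : borel_measurable ?PA"
   by (rule measurable_compose[OF _ profile_measurable[OF cont]])
 qed
 also have "... = (\<integral>y. profile ph kp (\<lambda>k\<in>{..<kp}. U k y) \<partial>M')"
  by (intro Bochner_Integration.integral_cong refl profile_cong) (auto simp: A_def)
 also have "... = (\<integral>v. profile ph kp v \<partial>distr M' (PiM {..<kp} (%_. borel)) (%y. \<lambda>k\<in>{..<kp}. U k y))"
  by (rule integral_distr[symmetric, OF _ profile_measurable[OF cont]]) measurable
 finally show ?thesis by (simp only: distr_U_torus)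
qed

end

context mix_model
begin

lemma increment_chebyshev:
 assumes S [measurable]: "S : borel_measurable M2" and R [measurable]: "R : borel_measurable M2"
  and E [measurable]: "E : sets M2" and d: "d >= 0" and r: "r > 0"
  and SR: "\<And>x. x : E ==> 0 <= S x & S x <= R x & R x <= 1 & R x - S x <= d"
 shows "measure P0 {om : space P0. snd om : E & \<bar>w (R (snd om)) (fst om) - w (S (snd om)) (fst om)\<bar> > r} <= d / r\<^sup>2"
proof -
 let ?X = "{om : space P0. snd om : E & \<bar>w (R (snd om)) (fst om) - w (S (snd om)) (fst om)\<bar> > r}"
 have X: "?X : sets P0" by measurable
 have "emeasure P0 ?X = (\<integral>\<^sup>+y. emeasure M1 ((%x. (x, y)) -` ?X) \<partial>M2)"
  by (rule M12.emeasure_pair_measure_alt2[OF X])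
 also have "... <= (\<integral>\<^sup>+y. ennreal (d / r\<^sup>2) \<partial>M2)"
 proof (rule nn_integral_mono)
  fix y assume y: "y : space M2"
  show "emeasure M1 ((%x. (x, y)) -` ?X) <= ennreal (d / r\<^sup>2)"
  proof (cases "y : E")
   case True
   have "(%x. (x, y)) -` ?X = {x : space M1. \<bar>w (R y) x - w (S y) x\<bar> > r}"
    using True y by (auto simp: space_pair_measure)
   then have "emeasure M1 ((%x. (x, y)) -` ?X) = ennreal (M1.prob {x : space M1. \<bar>w (R y) x - w (S y) x\<bar> > r})"
    by (simp add: M1.emeasure_eq_measure)
   also have "... <= ennreal ((R y - S y) / r\<^sup>2)"
    using SR[OF True] r by (intro ennreal_leI bm_increment_chebyshev[OF wbm]) auto
   also have "... <= ennreal (d / r\<^sup>2)" using SR[OF True] by (intro ennreal_leI divide_right_mono) auto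
   finally show ?thesis .
  qed simp
 qed
 also have "... = ennreal (d / r\<^sup>2)" by (simp add: M2.emeasure_space_1)
 finally show ?thesis using d by (simp add: M12.emeasure_eq_measure)
qed

definition sep_set :: "nat => nat => 'b set" where
 "sep_set n kp = {x : space M2. num_jumps T x = kp & separated n kp (%k. T k x)}"

lemma sep_set_measurable [measurable]: "sep_set n kp : sets M2"
proof -
 have 1: "{x : space M2. num_jumps T x = kp} : sets M2" by measurable
 have 2: "{x : space M2. \<forall>k\<in>{..<kp}. 0 < T k x & T k x < 1} : sets M2"
 proof (rule sets.sets_Collect_finite_All)
  fix k show "{x : space M2. 0 < T k x & T k x < 1} : sets M2" by measurable
 qed simp
 have 3: "{x : space M2. \<forall>p\<in>{..<kp} \<times> {..<kp}. fst p ~= snd p --> \<bar>T (fst p) x - T (snd p) x\<bar> > 2 / real n} : sets M2"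
 proof (rule sets.sets_Collect_finite_All)
  fix p :: "nat \<times> nat"
  show "{x : space M2. fst p ~= snd p --> \<bar>T (fst p) x - T (snd p) x\<bar> > 2 / real n} : sets M2" by measurable
 qed simp
 have "sep_set n kp = {x : space M2. num_jumps T x = kp} Int ({x : space M2. \<forall>k\<in>{..<kp}. 0 < T k x & T k x < 1}
  Int {x : space M2. \<forall>p\<in>{..<kp} \<times> {..<kp}. fst p ~= snd p --> \<bar>T (fst p) x - T (snd p) x\<bar> > 2 / real n})"
  unfolding sep_set_def separated_def by force
 also have "... : sets M2" by (intro sets.Int 1 2 3)
 finally show ?thesis .
qed

lemma phi_measurable:
 assumes cont: "continuous_on UNIV (ph :: (nat \<times> nat => real) => real)"
 shows "(%om. ph (xi n kp om)) : borel_measurable P0" "(%om. ph (xit n kp om)) : borel_measurable P0"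
 by (rule borel_measurable_continuous_vector[OF cont], rule xi_measurable)+

lemma xi_tail:
 assumes n: "n >= 1" and R: "R > 0" and j: "j : sides kp"
 shows "measure P0 {om : space P0. snd om : sep_set n kp & \<bar>xi n kp om j\<bar> > R} <= 1 / R\<^sup>2"
proof -
 have sn: "sqrt (real n) > 0" using n by simp
 have "{om : space P0. snd om : sep_set n kp & \<bar>xi n kp om j\<bar> > R}
  = {om : space P0. snd om : sep_set n kp & \<bar>w (right_end n (%k. T k (snd om)) j) (fst om) - w (left_end n (%k. T k (snd om)) j) (fst om)\<bar> > R / sqrt (real n)}"
  using j sn by (auto simp: xi_def vec_def abs_mult pos_divide_less_eq mult.commute)
 also have "measure P0 ... <= (1 / real n) / (R / sqrt (real n))\<^sup>2"
 proof (rule increment_chebyshev)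
  fix x assume x: "x : sep_set n kp"
  have "right_end n (%k. T k x) j - left_end n (%k. T k x) j <= 1 / real n"
   using grid_bounds[OF n, of "T (snd j) x"] by (auto simp: right_end_def left_end_def)
  then show "0 <= left_end n (%k. T k x) j & left_end n (%k. T k x) j <= right_end n (%k. T k x) j
   & right_end n (%k. T k x) j <= 1 & right_end n (%k. T k x) j - left_end n (%k. T k x) j <= 1 / real n"
   using ends_unit(1)[OF n _ j] x by (auto simp: sep_set_def)
 qed (use R sn in auto)
 also have "... = 1 / R\<^sup>2" using n R by (simp add: power_divide)
 finally show ?thesis .
qed

lemma xi_trim_close:
 assumes n: "n >= 1" and d: "d > 0" and j: "j : sides kp"
 shows "measure P0 {om : space P0. snd om : sep_set n kp & \<bar>xi n kp om j - xit n kp om j\<bar> > d} <= 1 / (real n * d\<^sup>2)"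
proof -
 have sn: "sqrt (real n) > 0" using n by simp
 define l where "l x = (if fst j = 0 then right_trim n (%k. T k x) j else left_end n (%k. T k x) j)" for x
 define r where "r x = (if fst j = 0 then right_end n (%k. T k x) j else left_trim n (%k. T k x) j)" for x
 have [measurable]: "l : borel_measurable M2" "r : borel_measurable M2" unfolding l_def r_def by measurable
 have eq: "xi n kp om j - xit n kp om j = sqrt (real n) * (w (r (snd om)) (fst om) - w (l (snd om)) (fst om))" for om
  using j by (auto simp: xi_def xit_def vec_def l_def r_def left_end_def right_end_def left_trim_def right_trim_def algebra_simps)
 have "{om : space P0. snd om : sep_set n kp & \<bar>xi n kp om j - xit n kp om j\<bar> > d}
  = {om : space P0. snd om : sep_set n kp & \<bar>w (r (snd om)) (fst om) - w (l (snd om)) (fst om)\<bar> > d / sqrt (real n)}"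
  unfolding eq using sn by (auto simp: abs_mult pos_divide_less_eq mult.commute)
 also have "measure P0 ... <= (1 / (real n)\<^sup>2) / (d / sqrt (real n))\<^sup>2"
 proof (rule increment_chebyshev)
  fix x assume x: "x : sep_set n kp"
  define p where "p = 1 / (real n)\<^sup>2"
  have p: "p >= 0" by (simp add: p_def)
  have s: "separated n kp (%k. T k x)" using x by (simp add: sep_set_def)
  note u = ends_unit[OF n s j] grid_bounds(1,2)[OF n, of "T (snd j) x"] p
  show "0 <= l x & l x <= r x & r x <= 1 & r x - l x <= 1 / (real n)\<^sup>2"
   using u unfolding p_def[symmetric]
   by (cases "fst j = 0") (auto simp: l_def r_def left_end_def right_end_def left_trim_def right_trim_def p_def[symmetric])
 qed (use d sn in auto)
 also have "... = 1 / (real n * d\<^sup>2)" using n d by (simp add: power_divide power2_eq_square)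
 finally show ?thesis .
qed

lemma trimming_negligible:
 assumes cont: "continuous_on UNIV (ph :: (nat \<times> nat => real) => real)" and b: "\<And>x. \<bar>ph x\<bar> <= C"
 shows "(%n. \<integral>om. indicator (space M1 \<times> sep_set n kp) om * \<bar>ph (xi n kp om) - ph (xit n kp om)\<bar> \<partial>P0) ----> 0"
proof (rule LIMSEQ_I)
 fix e :: real assume e: "e > 0"
 have C0: "C >= 0" using b[of undefined] by linarith
 define N where "N = real (card (sides kp))"
 define K where "K = 2 * C * N + 1"
 have K: "K > 0" "2 * C * N <= K" using C0 by (auto simp: K_def N_def add_nonneg_pos)
 define R where "R = sqrt (4 * K / e)"
 have R: "R > 0" "1 / R\<^sup>2 = e / (4 * K)" using K e by (auto simp: R_def)
 have e3: "e / 3 > 0" using e by simp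
 obtain d where d: "d > 0" and dd: "\<And>D n. D : sets P0 ==>
  (\<integral>om. indicator D om * \<bar>ph (xi n kp om) - ph (xit n kp om)\<bar> \<partial>P0) <= e / 3 + 2 * C * (\<Sum>j\<in>sides kp.
    measure P0 (D Int {om : space P0. \<bar>xi n kp om j\<bar> > R}) + measure P0 (D Int {om : space P0. \<bar>xi n kp om j - xit n kp om j\<bar> > d}))"
 proof -
  from continuous_vector_L1_close[OF cont b e3 finite_sides, of kp R]
  obtain d where d: "d > 0" and dd: "\<forall>(M :: ('a \<times> 'b) measure) D (v :: 'a \<times> 'b => nat \<times> nat => real) v'. prob_space M --> D : sets M -->
  (ALL i. (%om. v om i) : borel_measurable M) --> (ALL i. (%om. v' om i) : borel_measurable M) -->
  (ALL om i. i \<notin> sides kp --> v om i = 0 & v' om i = 0) -->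
  (\<integral>om. indicator D om * \<bar>ph (v om) - ph (v' om)\<bar> \<partial>M) <= e / 3 + 2 * C * (\<Sum>i\<in>sides kp.
    measure M (D Int {om : space M. \<bar>v om i\<bar> > R}) + measure M (D Int {om : space M. \<bar>v om i - v' om i\<bar> > d}))"
   by (elim exE conjE)
  have "(\<integral>om. indicator D om * \<bar>ph (xi n kp om) - ph (xit n kp om)\<bar> \<partial>P0) <= e / 3 + 2 * C * (\<Sum>j\<in>sides kp.
    measure P0 (D Int {om : space P0. \<bar>xi n kp om j\<bar> > R}) + measure P0 (D Int {om : space P0. \<bar>xi n kp om j - xit n kp om j\<bar> > d}))"
   if "D : sets P0" for D n
   by (rule dd[rule_format]) (use that M12.prob_space_axioms in \<open>auto simp: xi_def xit_def vec_def\<close>)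
  with d show ?thesis by (rule that)
 qed
 have "(%n. 2 * C * (N * (1 / (real n * d\<^sup>2)))) ----> 2 * C * (N * 0)"
  using d by (intro tendsto_intros) real_asymp
 then have "eventually (%n. 2 * C * (N * (1 / (real n * d\<^sup>2))) < e / 3) sequentially" using e by (intro order_tendstoD(2)) auto
 then obtain n0 where n0: "\<And>n. n >= n0 ==> 2 * C * (N * (1 / (real n * d\<^sup>2))) < e / 3"
  unfolding eventually_sequentially by metis
 have "(\<integral>om. indicator (space M1 \<times> sep_set n kp) om * \<bar>ph (xi n kp om) - ph (xit n kp om)\<bar> \<partial>P0) < e" if n: "n >= max 1 n0" for n
 proof -
  have n1: "n >= 1" "n >= n0" using n by auto
  let ?D = "space M1 \<times> sep_set n kp"
  have D: "?D : sets P0" by auto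
  have cyl: "?D Int {om : space P0. p om} = {om : space P0. snd om : sep_set n kp & p om}" for p
   by (auto simp: space_pair_measure)
  have "(\<Sum>j\<in>sides kp. measure P0 (?D Int {om : space P0. \<bar>xi n kp om j\<bar> > R}) + measure P0 (?D Int {om : space P0. \<bar>xi n kp om j - xit n kp om j\<bar> > d}))
   <= N * (1 / R\<^sup>2 + 1 / (real n * d\<^sup>2))"
   unfolding N_def cyl by (intro sum_bounded_above add_mono xi_tail xi_trim_close n1 R d)
  then have "2 * C * (\<Sum>j\<in>sides kp. measure P0 (?D Int {om : space P0. \<bar>xi n kp om j\<bar> > R}) + measure P0 (?D Int {om : space P0. \<bar>xi n kp om j - xit n kp om j\<bar> > d}))
   <= 2 * C * (N * (1 / R\<^sup>2 + 1 / (real n * d\<^sup>2)))" using C0 by (intro mult_left_mono) auto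
  also have "... = 2 * C * N * (e / (4 * K)) + 2 * C * (N * (1 / (real n * d\<^sup>2)))" unfolding R(2) by (simp add: algebra_simps)
  also have "2 * C * N * (e / (4 * K)) <= K * (e / (4 * K))" using K e by (intro mult_right_mono) auto
  also have "K * (e / (4 * K)) = e / 4" using K by simp
  finally show ?thesis using dd[OF D, of n] n0[OF n1(2)] e by linarith
 qed
 moreover have "0 <= (\<integral>om. indicator (space M1 \<times> sep_set n kp) om * \<bar>ph (xi n kp om) - ph (xit n kp om)\<bar> \<partial>P0)" for n
  by (intro integral_nonneg_AE) auto
 ultimately show "EX n0. \<forall>n\<ge>n0. norm ((\<integral>om. indicator (space M1 \<times> sep_set n kp) om * \<bar>ph (xi n kp om) - ph (xit n kp om)\<bar> \<partial>P0) - 0) < e"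
  by (intro exI[of _ "max 1 n0"]) simp
qed

definition trim_mean :: "((nat \<times> nat => real) => real) => nat => nat => 'b => real" where
 "trim_mean ph n kp y = (\<integral>x. ph (xit n kp (x, y)) \<partial>M1)"

definition trim_dev :: "((nat \<times> nat => real) => real) => nat => nat => 'a \<times> 'b => real" where
 "trim_dev ph n kp om = indicator (sep_set n kp) (snd om) * (ph (xit n kp om) - trim_mean ph n kp (snd om))"

lemma mean_measurable:
 assumes "(%om. f om) : borel_measurable P0"
 shows "(%y. \<integral>x. (f (x, y) :: real) \<partial>M1) : borel_measurable M2"
proof -
 have "(%(y, x). f (x, y)) : borel_measurable (M2 \<Otimes>\<^sub>M M1)"
  using measurable_compose[OF measurable_pair_swap' assms] by (simp add: case_prod_beta')
 then show ?thesis by (intro M1.borel_measurable_lebesgue_integral) (simp add: case_prod_beta')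
qed

lemma trim_mean_measurable:
 assumes cont: "continuous_on UNIV ph"
 shows "trim_mean ph n kp : borel_measurable M2"
 unfolding trim_mean_def[abs_def] by (rule mean_measurable) (rule phi_measurable(2)[OF cont])

lemma section_measurable:
 assumes f: "f : borel_measurable P0" and y: "y : space M2"
 shows "(%x. f (x, y) :: real) : borel_measurable M1"
 using measurable_compose[OF measurable_Pair2'[OF y] f] by simp

lemma trim_mean_bound:
 assumes cont: "continuous_on UNIV ph" and b: "\<And>x. \<bar>ph x\<bar> <= C" and y: "y : space M2"
 shows "\<bar>trim_mean ph n kp y\<bar> <= C"
proof -
 have "integrable M1 (%x. ph (xit n kp (x, y)))"
  using b section_measurable[OF phi_measurable(2)[OF cont] y] by (intro M1.integrable_const_bound[where B=C]) auto
 then have "\<bar>trim_mean ph n kp y\<bar> <= (\<integral>x. C \<partial>M1)" unfolding trim_mean_def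
  using b by (intro abs_integral_le) auto
 then show ?thesis by (simp add: M1.prob_space)
qed

text \<open>Given the jump times the two factors are independent, since the trimmed intervals are disjoint, and
each is centred.\<close>

lemma trim_dev_orthogonal:
 assumes cont: "continuous_on UNIV ph" and b: "\<And>x. \<bar>ph x\<bar> <= C" and n: "n >= 1" and m: "m > n\<^sup>2"
 shows "(\<integral>om. trim_dev ph n kp om * trim_dev ph m kp om \<partial>P0) = 0"
proof -
 have C0: "C >= 0" using b[of undefined] by linarith
 have [measurable]: "trim_mean ph k kp : borel_measurable M2" "(%om. ph (xit k kp om)) : borel_measurable P0" for k
  using trim_mean_measurable[OF cont] phi_measurable[OF cont] by auto
 have tb: "\<bar>trim_dev ph k kp om\<bar> <= 2 * C" if "om : space P0" for k om
  using b[of "xit k kp om"] trim_mean_bound[OF cont b, of "snd om" k kp] that C0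
  by (auto simp: trim_dev_def indicator_def space_pair_measure abs_le_iff)
 have [measurable]: "trim_dev ph k kp : borel_measurable P0" for k unfolding trim_dev_def by measurable
 have i: "integrable P0 (%(x, y). trim_dev ph n kp (x, y) * trim_dev ph m kp (x, y))"
 proof (rule M12.integrable_const_bound[where B="(2 * C) * (2 * C)"])
  show "AE z in P0. norm (case z of (x, y) => trim_dev ph n kp (x, y) * trim_dev ph m kp (x, y)) <= (2 * C) * (2 * C)"
  proof (rule AE_I2)
   fix z assume z: "z : space P0"
   have "\<bar>trim_dev ph n kp z\<bar> * \<bar>trim_dev ph m kp z\<bar> <= (2 * C) * (2 * C)"
    by (rule mult_mono[OF tb[OF z] tb[OF z]]) (use C0 in auto)
   then show "norm (case z of (x, y) => trim_dev ph n kp (x, y) * trim_dev ph m kp (x, y)) <= (2 * C) * (2 * C)"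
    by (simp only: case_prod_beta' prod.collapse real_norm_def abs_mult)
  qed
 qed simp
 have nm: "n <= m" "m >= 1"
 proof -
  have "n <= n\<^sup>2" using n by (simp add: power2_eq_square)
  then show "n <= m" "m >= 1" using n m by auto
 qed
 have inner: "(\<integral>x. trim_dev ph n kp (x, y) * trim_dev ph m kp (x, y) \<partial>M1) = 0" if y: "y : space M2" for y
 proof (cases "y : sep_set n kp & y : sep_set m kp")
  case False
  then show ?thesis by (auto simp: trim_dev_def)
 next
  case True
  define th where "th k = T k y" for k
  have sn: "separated n kp th" and sm: "separated m kp th" using True by (auto simp: sep_set_def th_def[abs_def])
  define u where "u j = (if fst j then left_trim n th (snd j) else left_trim m th (snd j))" for j :: "bool \<times> nat \<times> nat"
  define v where "v j = (if fst j then right_trim n th (snd j) else right_trim m th (snd j))" for j :: "bool \<times> nat \<times> nat"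
  define J1 where "J1 = {True} \<times> sides kp"
  define J2 where "J2 = {False} \<times> sides kp"
  have ind: "M1.indep_var (PiM J1 (%_. borel)) (%x. \<lambda>j\<in>J1. w (v j) x - w (u j) x)
    (PiM J2 (%_. borel)) (%x. \<lambda>j\<in>J2. w (v j) x - w (u j) x)"
  proof (rule bm_indep_two_blocks[OF wbm])
   fix j assume "j : J1 Un J2"
   then show "0 <= u j & u j <= v j & v j <= 1"
    using ends_unit(2)[OF n sn] ends_unit(2)[OF nm(2) sm] by (auto simp: J1_def J2_def u_def v_def)
  next
   fix i j assume "i : J1" "j : J2"
   then show "{u i<..v i} Int {u j<..v j} = {}"
    using trim_disjoint[OF n m sn, of "snd i" "snd j"] by (auto simp: J1_def J2_def u_def v_def)
  qed (auto simp: J1_def J2_def)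
  define g where "g k c f = ph (%j. if j : sides kp then sqrt (real k) * f (c, j) else 0)"
   for k :: nat and c :: bool and f :: "bool \<times> nat \<times> nat => real"
  have gm: "g k c : borel_measurable (PiM ({c} \<times> sides kp) (%_. borel))" for k c
   unfolding g_def
  proof (rule borel_measurable_continuous_vector[OF cont])
   fix j show "(%f. if j : sides kp then sqrt (real k) * f (c, j) else 0) : borel_measurable (PiM ({c} \<times> sides kp) (%_. borel :: real measure))"
    by (cases "j : sides kp") auto
  qed
  have ind2: "M1.indep_var borel (g n True \<circ> (%x. \<lambda>j\<in>J1. w (v j) x - w (u j) x))
    borel (g m False \<circ> (%x. \<lambda>j\<in>J2. w (v j) x - w (u j) x))"
   by (rule M1.indep_var_compose[OF ind]) (use gm in \<open>auto simp: J1_def J2_def\<close>)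
  have e1: "g n True \<circ> (%x. \<lambda>j\<in>J1. w (v j) x - w (u j) x) = (%x. ph (xit n kp (x, y)))"
   unfolding g_def o_def by (rule HOL.ext, rule arg_cong[where f=ph], rule HOL.ext) (auto simp: xit_def vec_def J1_def u_def v_def th_def[abs_def])
  have e2: "g m False \<circ> (%x. \<lambda>j\<in>J2. w (v j) x - w (u j) x) = (%x. ph (xit m kp (x, y)))"
   unfolding g_def o_def by (rule HOL.ext, rule arg_cong[where f=ph], rule HOL.ext) (auto simp: xit_def vec_def J2_def u_def v_def th_def[abs_def])
  have ik: "integrable M1 (%x. ph (xit k kp (x, y)))" for k
   using b section_measurable[OF phi_measurable(2)[OF cont] y] by (intro M1.integrable_const_bound[where B=C]) auto
  let ?a = "%x. ph (xit n kp (x, y))" and ?b = "%x. ph (xit m kp (x, y))"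
  have prod: "(\<integral>x. ?a x * ?b x \<partial>M1) = (\<integral>x. ?a x \<partial>M1) * (\<integral>x. ?b x \<partial>M1)" and ip: "integrable M1 (%x. ?a x * ?b x)"
   using M1.indep_var_lebesgue_integral[OF ind2[unfolded e1 e2] ik ik] M1.indep_var_integrable[OF ind2[unfolded e1 e2] ik ik] by auto
  have "(\<integral>x. trim_dev ph n kp (x, y) * trim_dev ph m kp (x, y) \<partial>M1)
   = (\<integral>x. ?a x * ?b x - trim_mean ph n kp y * ?b x - trim_mean ph m kp y * ?a x + trim_mean ph n kp y * trim_mean ph m kp y \<partial>M1)"
   using True by (intro Bochner_Integration.integral_cong refl) (simp add: trim_dev_def algebra_simps)
  also have "... = (\<integral>x. ?a x * ?b x \<partial>M1) - trim_mean ph n kp y * (\<integral>x. ?b x \<partial>M1) - trim_mean ph m kp y * (\<integral>x. ?a x \<partial>M1)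
    + trim_mean ph n kp y * trim_mean ph m kp y"
   using ip ik by (simp add: M1.prob_space)
  also have "... = 0" unfolding prod by (simp add: trim_mean_def)
  finally show ?thesis .
 qed
 have "(\<integral>om. trim_dev ph n kp om * trim_dev ph m kp om \<partial>P0) = (\<integral>y. (\<integral>x. trim_dev ph n kp (x, y) * trim_dev ph m kp (x, y) \<partial>M1) \<partial>M2)"
  using M12.integral_snd[OF i] by (simp add: case_prod_beta')
 also have "... = (\<integral>y. 0 \<partial>M2)" by (rule Bochner_Integration.integral_cong[OF refl]) (rule inner)
 finally show ?thesis by simp
qed

lemma trim_dev_weakly_null:
 assumes cont: "continuous_on UNIV ph" and b: "\<And>x. \<bar>ph x\<bar> <= C" and A [measurable]: "A : sets P0"
 shows "(%n. \<integral>om. indicator A om * trim_dev ph n kp om \<partial>P0) ----> 0"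
proof -
 have C0: "C >= 0" using b[of undefined] by linarith
 have [measurable]: "trim_mean ph k kp : borel_measurable M2" "(%om. ph (xit k kp om)) : borel_measurable P0" for k
  using trim_mean_measurable[OF cont] phi_measurable[OF cont] by auto
 have tb: "\<bar>trim_dev ph k kp om\<bar> <= 2 * C" if "om : space P0" for k om
  using b[of "xit k kp om"] trim_mean_bound[OF cont b, of "snd om" k kp] that C0
  by (auto simp: trim_dev_def indicator_def space_pair_measure abs_le_iff)
 have "(%n. \<integral>om. indicator A om * trim_dev ph (Suc n) kp om \<partial>P0) ----> 0"
 proof (rule renyi_weakly_null[where C="2 * C" and B=1])
  show "prob_space P0" by (rule M12.prob_space_axioms)
  show "trim_dev ph (Suc n) kp : borel_measurable P0" for n unfolding trim_dev_def by measurable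
  show "EX N. \<forall>m\<ge>N. (\<integral>om. trim_dev ph (Suc n) kp om * trim_dev ph (Suc m) kp om \<partial>P0) = 0" for n
   by (intro exI[of _ "(Suc n)\<^sup>2"] allI impI trim_dev_orthogonal[OF cont b]) auto
 qed (use tb in \<open>auto simp: indicator_def\<close>)
 then show ?thesis by (rule LIMSEQ_imp_Suc)
qed

text \<open>The restriction to an arbitrary event leaves the law of the jump times absolutely continuous: its density \<open>p\<close>
is a Radon-Nikodym derivative and carries all information about the event.\<close>

lemma jump_density:
 assumes A [measurable]: "A : sets P0" and pos: "M2.prob {x : space M2. num_jumps T x = kp} > 0"
 shows "EX p. integrable (torus {..<kp}) p & (ALL g c. g : borel_measurable (PiM {..<kp} (%_. borel)) --> (ALL x. \<bar>g x\<bar> <= c) -->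
  (\<integral>om. indicator (A Int space M1 \<times> {x : space M2. num_jumps T x = kp}) om * g (\<lambda>k\<in>{..<kp}. T k (snd om)) \<partial>P0)
   = (\<integral>t. p t * (g t :: real) \<partial>torus {..<kp}))"
proof -
 define D where "D = {x : space M2. num_jumps T x = kp}"
 have [measurable]: "D : sets M2" unfolding D_def by measurable
 define B where "B = A Int space M1 \<times> D"
 have [measurable]: "B : sets P0" unfolding B_def by measurable
 let ?B = "PiM {..<kp} (%_. borel :: real measure)"
 define V where "V x = (\<lambda>k\<in>{..<kp}. T k x)" for x
 have V [measurable]: "V : M2 \<rightarrow>\<^sub>M ?B" unfolding V_def by (rule measurable_restrict) simp
 define \<mu> where "\<mu> = distr (density P0 (indicator B)) ?B (%om. V (snd om))"
 have mV: "(%om. V (snd om)) : density P0 (indicator B) \<rightarrow>\<^sub>M ?B" by measurable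
 have \<mu>: "emeasure \<mu> N = emeasure P0 (B Int {om : space P0. V (snd om) : N})" if "N : sets ?B" for N
 proof -
  have S: "{om : space P0. V (snd om) : N} : sets P0" using that by measurable
  have "emeasure \<mu> N = emeasure (density P0 (indicator B)) {om : space P0. V (snd om) : N}"
   unfolding \<mu>_def using that by (subst emeasure_distr[OF mV]) (auto intro!: arg_cong2[where f=emeasure])
  also have "... = emeasure P0 (B Int {om : space P0. V (snd om) : N})"
   using S by (subst emeasure_density) (auto simp: indicator_inter_arith[symmetric])
  finally show ?thesis .
 qed
 have setsL: "sets (PiM {..<kp} (%_. lborel :: real measure)) = sets ?B" by (rule sets_PiM_cong) auto
 have ac: "absolutely_continuous (torus {..<kp}) \<mu>"
  unfolding absolutely_continuous_def
 proof
  fix N assume N: "N : null_sets (torus {..<kp})"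
  then have Ns: "N : sets ?B" by (auto simp: sets_torus)
  have NsL: "N : sets (PiM {..<kp} (%_. lborel :: real measure))" using Ns setsL by simp
  let ?cube = "Pi\<^sub>E {..<kp} (%_. {0..1::real})"
  have cube: "?cube : sets (PiM {..<kp} (%_. lborel))" by (rule sets_PiM_I_finite) auto
  have "emeasure (torus {..<kp}) N = 0" using N by auto
  then have "emeasure (PiM {..<kp} (%_. lborel)) (?cube Int N) = 0"
   unfolding torus_eq_density[OF finite_lessThan] using cube NsL
   by (subst (asm) emeasure_density) (auto simp: indicator_inter_arith[symmetric])
  then have null: "?cube Int N : null_sets (PiM {..<kp} (%_. lborel))" using cube NsL by auto
  obtain f where f: "distributed (uniform_measure M2 D) (PiM {..<kp} (%_. lborel)) V f"
   using density pos unfolding jump_times_cond_density_def D_def V_def by blast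
  have "emeasure (distr (uniform_measure M2 D) (PiM {..<kp} (%_. lborel)) V) (?cube Int N)
   = emeasure (density (PiM {..<kp} (%_. lborel)) f) (?cube Int N)" using f by (simp add: distributed_def)
  also have "... = 0"
  proof -
   have "?cube Int N : null_sets (density (PiM {..<kp} (%_. lborel)) f)"
    using null f absolutely_continuousI_density[of f "PiM {..<kp} (%_. lborel)"]
    by (auto simp: distributed_def absolutely_continuous_def)
   then show ?thesis by auto
  qed
  finally have z: "emeasure (distr (uniform_measure M2 D) (PiM {..<kp} (%_. lborel)) V) (?cube Int N) = 0" .
  have VL: "V : uniform_measure M2 D \<rightarrow>\<^sub>M PiM {..<kp} (%_. lborel)"
   using V by (simp cong: measurable_cong_sets[OF _ setsL])
  have S: "{x : space M2. V x : ?cube Int N} : sets M2"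
   using measurable_sets[OF V, of "?cube Int N"] cube NsL setsL by (simp add: vimage_def Int_def conj_commute)
  have "emeasure (uniform_measure M2 D) {x : space M2. V x : ?cube Int N} = 0"
   using z cube NsL by (subst (asm) emeasure_distr[OF VL]) (auto simp: vimage_def Int_def conj_commute)
  then have "emeasure M2 (D Int {x : space M2. V x : ?cube Int N}) = 0"
   using S pos by (subst (asm) emeasure_uniform_measure) (auto simp: M2.emeasure_eq_measure D_def divide_eq_0_iff ennreal_divide_eq_0_iff)
  moreover have "AE x in M2. x : D & V x : N --> x : D Int {x : space M2. V x : ?cube Int N}"
  proof -
   have "AE x in M2. (ALL k<num_jumps T x. 0 < T k x & T k x < 1) & (ALL k. Suc k < num_jumps T x --> T k x < T (Suc k) x)"
    using jt unfolding jump_times_def by blast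
   then show ?thesis by eventually_elim (auto simp: D_def V_def less_imp_le)
  qed
  ultimately have "AE x in M2. \<not> (x : D & V x : N)"
   using S AE_not_in[of "D Int {x : space M2. V x : ?cube Int N}" M2] by (auto simp: null_sets_def)
  then have "AE om in P. \<not> (snd om : D & V (snd om) : N)" by (rule AE_P_snd)
  then have "AE om in P0. \<not> (snd om : D & V (snd om) : N)" unfolding model_measure_def by (simp add: AE_completion_iff)
  then have "AE om in P0. om \<notin> B Int {om : space P0. V (snd om) : N}" by eventually_elim (auto simp: B_def)
  moreover have "B Int {om : space P0. V (snd om) : N} : sets P0" using Ns by measurable
  ultimately have "emeasure P0 (B Int {om : space P0. V (snd om) : N}) = 0"
   by (simp add: AE_iff_null_sets null_setsD1)
  then have "emeasure \<mu> N = 0" using \<mu>[OF Ns] by simp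
  then show "N : null_sets \<mu>" using Ns by (auto simp: \<mu>_def)
 qed
 interpret torus: prob_space "torus {..<kp}" by (rule prob_space_torus)
 have "sets \<mu> = sets (torus {..<kp})" by (simp add: \<mu>_def sets_torus)
 from torus.Radon_Nikodym[OF ac this] obtain f where f: "f : borel_measurable (torus {..<kp})" "density (torus {..<kp}) f = \<mu>"
  by auto
 have total: "(\<integral>\<^sup>+t. f t \<partial>torus {..<kp}) <= 1"
 proof -
  have "(\<integral>\<^sup>+t. f t \<partial>torus {..<kp}) = (\<integral>\<^sup>+t. f t * indicator (space (torus {..<kp})) t \<partial>torus {..<kp})"
   by (rule nn_integral_cong) auto
  also have "... = emeasure \<mu> (space (torus {..<kp}))"
   unfolding f(2)[symmetric] by (rule emeasure_density[symmetric, OF f(1)]) auto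
  also have "... <= 1"
  proof -
   have "space (torus {..<kp}) : sets ?B" using sets.top[of "torus {..<kp}"] by (simp add: sets_torus)
   then show ?thesis by (simp add: \<mu> M12.measure_le_1 M12.emeasure_eq_measure)
  qed
  finally show ?thesis .
 qed
 have fin: "AE t in torus {..<kp}. f t ~= \<infinity>"
  using total f(1) by (intro nn_integral_PInf_AE) (auto simp: top_unique)
 define p where "p t = enn2real (f t)" for t
 have pm [measurable]: "p : borel_measurable (torus {..<kp})" unfolding p_def using f(1) by measurable
 have pf: "AE t in torus {..<kp}. f t = ennreal (p t)"
  using fin by eventually_elim (simp add: p_def less_top)
 have ip: "integrable (torus {..<kp}) p"
 proof (rule integrableI_bounded)
  have "(\<integral>\<^sup>+t. ennreal (norm (p t)) \<partial>torus {..<kp}) = (\<integral>\<^sup>+t. f t \<partial>torus {..<kp})"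
   using pf by (intro nn_integral_cong_AE) (auto simp: p_def elim!: eventually_mono)
  then show "(\<integral>\<^sup>+t. ennreal (norm (p t)) \<partial>torus {..<kp}) < \<infinity>" using total by (simp add: le_less_trans)
 qed simp
 have \<mu>p: "\<mu> = density (torus {..<kp}) (%t. ennreal (p t))"
  unfolding f(2)[symmetric] using pf f(1) by (intro density_cong) auto
 show ?thesis
 proof (intro exI[of _ p] conjI allI impI ip)
  fix g :: "(nat => real) => real" and c assume g: "g : borel_measurable ?B" and gb: "ALL x. \<bar>g x\<bar> <= c"
  have [measurable]: "g : borel_measurable (torus {..<kp})" using g by (simp cong: measurable_cong_sets[OF sets_torus refl])
  have [measurable]: "(%om. g (V (snd om))) : borel_measurable P0" by (rule measurable_compose[OF _ g]) measurable
  have "(\<integral>om. indicator B om * g (V (snd om)) \<partial>P0) = (\<integral>om. g (V (snd om)) \<partial>density P0 (%om. ennreal (indicator B om)))"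
   by (subst integral_density) auto
  also have "density P0 (%om. ennreal (indicator B om)) = density P0 (indicator B)" by (simp add: ennreal_indicator)
  also have "(\<integral>om. g (V (snd om)) \<partial>density P0 (indicator B)) = (\<integral>t. g t \<partial>\<mu>)"
   unfolding \<mu>_def by (rule integral_distr[symmetric, OF mV g])
  also have "... = (\<integral>t. p t * g t \<partial>torus {..<kp})"
   unfolding \<mu>p by (subst integral_density) (auto simp: p_def)
  finally show "(\<integral>om. indicator (A Int space M1 \<times> {x : space M2. num_jumps T x = kp}) om * g (\<lambda>k\<in>{..<kp}. T k (snd om)) \<partial>P0)
   = (\<integral>t. p t * g t \<partial>torus {..<kp})" unfolding B_def D_def V_def .
 qed
qed

end

section \<open>The threshold estimator as a function of the path\<close>

lemma strictly_increasing_times: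
 assumes "ALL k. Suc k < kp --> th k < (th (Suc k) :: real)" "i < k" "k < kp"
 shows "th i < th k"
 using assms(2,3)
proof (induction k)
 case (Suc k)
 then have "th k < th (Suc k)" using assms(1) by auto
 then show ?case using Suc by (cases "i = k") auto
qed simp

lemma eventually_separated_times:
 assumes unit: "ALL k<kp. 0 < th k & th k < 1" and inc: "ALL k. Suc k < kp --> th k < th (Suc k)"
 shows "eventually (%n. separated n kp th) sequentially"
proof -
 note lt = strictly_increasing_times[OF inc]
 have ne: "\<bar>th i - th k\<bar> > 0" if "i < kp" "k < kp" "i ~= k" for i k
  using lt[of i k] lt[of k i] that by (cases "i < k") auto
 have ev: "\<forall>\<^sub>F n in sequentially. \<forall>p\<in>{p\<in>{..<kp} \<times> {..<kp}. fst p ~= snd p}. 2 / real n < \<bar>th (fst p) - th (snd p)\<bar>"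
 proof (rule eventually_ball_finite, simp, rule ballI)
  fix p assume p: "p : {p\<in>{..<kp} \<times> {..<kp}. fst p ~= snd p}"
  have "(%n. 2 / real n) ----> 0" by real_asymp
  then show "\<forall>\<^sub>F n in sequentially. 2 / real n < \<bar>th (fst p) - th (snd p)\<bar>"
   by (rule order_tendstoD(2)) (use ne[of "fst p" "snd p"] p in auto)
 qed
 then show ?thesis
 proof eventually_elim
  case (elim n)
  have "ALL i<kp. ALL k<kp. i ~= k --> \<bar>th i - th k\<bar> > 2 / real n" using elim by auto
  then show ?case using unit by (simp add: separated_def)
 qed
qed

definition exceedances :: "real => nat => (real => real) => nat set" where
 "exceedances u n x = {i. i < n & \<bar>increment n x i\<bar> >= u}"

lemma finite_exceedances [simp]: "finite (exceedances u n x)"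
 by (rule finite_subset[of _ "{..<n}"]) (auto simp: exceedances_def)

text \<open>The recursively defined indices enumerate the exceedance set in increasing order.\<close>

lemma thr_index_eq:
 "thr_index u n x k = (if k < card (exceedances u n x) then enat (sorted_list_of_set (exceedances u n x) ! k) else \<infinity>)"
proof (induction k)
 case 0
 let ?S = "exceedances u n x" let ?l = "sorted_list_of_set ?S"
 have e: "{enat i | i. i < n & \<bar>increment n x i\<bar> >= u} = enat ` ?S" by (auto simp: exceedances_def)
 show ?case
 proof (cases "?S = {}")
  case True
  then show ?thesis unfolding thr_index.simps e by (simp add: top_enat_def)
 next
  case False
  then have c: "card ?S > 0" by (simp add: card_gt_0_iff)
  have "Inf (enat ` ?S) = enat (?l ! 0)"
  proof (rule cInf_eq_minimum)
   have "?l ! 0 : set ?l" using c by (intro nth_mem) simp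
   then show "enat (?l ! 0) : enat ` ?S" by simp
   fix y assume "y : enat ` ?S"
   then obtain j where j: "j < length ?l" "y = enat (?l ! j)" by (metis finite_exceedances imageE in_set_conv_nth set_sorted_list_of_set)
   then show "enat (?l ! 0) <= y" using sorted_nth_mono[OF sorted_sorted_list_of_set, of 0 j ?S] by simp
  qed
  then show ?thesis unfolding thr_index.simps e using c by simp
 qed
next
 case (Suc k)
 let ?S = "exceedances u n x" let ?l = "sorted_list_of_set ?S"
 have len: "length ?l = card ?S" by simp
 have lt: "?l ! i < ?l ! j" if "i < j" "j < card ?S" for i j
  using strict_sorted_list_of_set[of ?S] that len by (simp add: sorted_wrt_nth_less)
 let ?X = "{enat i | i. thr_index u n x k < enat i & i < n & \<bar>increment n x i\<bar> >= u}"
 have e: "?X = {enat i | i. thr_index u n x k < enat i & i : ?S}" by (auto simp: exceedances_def)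
 show ?case
 proof (cases "Suc k < card ?S")
  case True
  then have t: "thr_index u n x k = enat (?l ! k)" using Suc by simp
  have e': "?X = enat ` {i : ?S. ?l ! k < i}" using t by (auto simp: exceedances_def)
  have "Inf ?X = enat (?l ! Suc k)" unfolding e'
  proof (rule cInf_eq_minimum)
   have "?l ! Suc k : set ?l" using True len by (intro nth_mem) simp
   then have "?l ! Suc k : ?S" by simp
   then show "enat (?l ! Suc k) : enat ` {i : ?S. ?l ! k < i}" using lt[of k "Suc k"] True by auto
   fix y assume "y : enat ` {i : ?S. ?l ! k < i}"
   then obtain i where i: "y = enat i" "?l ! k < i" "i : ?S" by auto
   then obtain j where j: "j < card ?S" "i = ?l ! j" by (metis finite_exceedances in_set_conv_nth len set_sorted_list_of_set)
   have "k < j" using i j lt[of j k] True by (metis Suc_lessD linorder_neqE_nat order_less_asym order_less_irrefl)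
   then show "enat (?l ! Suc k) <= y" using i j lt[of "Suc k" j] by (cases "j = Suc k") auto
  qed
  then show ?thesis using True by simp
 next
  case False
  have "?X = {}"
  proof (rule equals0I)
   fix y assume "y : ?X"
   then obtain i where i: "thr_index u n x k < enat i" "i < n" "u <= \<bar>increment n x i\<bar>" by blast
   then have iS: "i : ?S" by (simp add: exceedances_def)
   have k: "k < card ?S" and t: "thr_index u n x k = enat (?l ! k)" using i(1) Suc by (auto split: if_splits)
   obtain j where j: "j < card ?S" "i = ?l ! j" using iS by (metis finite_exceedances in_set_conv_nth len set_sorted_list_of_set)
   have "?l ! k < ?l ! j" using i(1) unfolding t j(2) by simp
   moreover have "j <= k" using False j by simp
   ultimately show False using lt[of j k] k by (cases "j = k") auto
  qed
  then have "thr_index u n x (Suc k) = \<infinity>" by (simp only: thr_index.simps Inf_empty top_enat_def)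
  then show ?thesis using False by simp
 qed
qed

lemma num_exceed_eq: "num_exceed u n x = card (exceedances u n x)"
proof -
 have e: "{Suc k | k. thr_index u n x k < \<infinity>} = Suc ` {..<card (exceedances u n x)}"
  by (auto simp: thr_index_eq split: if_splits)
 show ?thesis
 proof (cases "card (exceedances u n x)")
  case 0
  then show ?thesis unfolding num_exceed_def e by simp
 next
  case (Suc m)
  then show ?thesis unfolding num_exceed_def e by (intro cSup_eq_maximum) auto
 qed
qed

lemma jump_estimator_eq:
 "jump_estimator u n x k = (if k < card (exceedances u n x)
  then increment n x (sorted_list_of_set (exceedances u n x) ! k) else 0)"
 by (simp add: jump_estimator_def num_exceed_eq thr_index_eq)

lemma jump_estimator_of_exceedances:
 assumes E: "exceedances u n x = i ` {..<kp}" and i: "\<And>j k. j < k ==> k < kp ==> i j < i k"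
 shows "jump_estimator u n x k = (if k < kp then increment n x (i k) else 0)"
proof -
 have s: "sorted_wrt (<) (map i [0..<kp])" using i by (auto simp: sorted_wrt_iff_nth_less)
 have l: "sorted_list_of_set (exceedances u n x) = map i [0..<kp]"
  unfolding E using s strict_sorted_equal[OF s, of "sorted_list_of_set (i ` {..<kp})"] by (simp add: atLeast0LessThan)
 then have "card (exceedances u n x) = kp" by (metis length_map length_sorted_list_of_set length_upt minus_nat.diff_0)
 then show ?thesis unfolding jump_estimator_eq l by simp
qed

lemma jump_estimator_measurable:
 assumes X: "\<And>t. t : {0..1} ==> X t : borel_measurable M"
 shows "(%om. jump_estimator u n (%t. X t om) k) : borel_measurable M"
proof -
 have inc: "(%om. increment n (%t. X t om) i) : borel_measurable M" if "i < n" for i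
  unfolding increment_def using that by (intro borel_measurable_diff X) auto
 define E where "E om = exceedances u n (%t. X t om)" for om
 have Es: "E om \<subseteq> {..<n}" for om by (auto simp: E_def exceedances_def)
 have Em: "E : M \<rightarrow>\<^sub>M count_space (Pow {..<n})"
 proof (rule measurable_count_space_eq_countable[THEN iffD2])
  show "countable (Pow {..<n})" by (simp add: countable_finite)
  have "E -` {S} Int space M : sets M" if S: "S : Pow {..<n}" for S
  proof -
   have "E -` {S} Int space M = {om : space M. \<forall>i\<in>{..<n}. (\<bar>increment n (%t. X t om) i\<bar> >= u) = (i : S)}"
   proof -
    have "(E om = S) = (\<forall>i\<in>{..<n}. (\<bar>increment n (%t. X t om) i\<bar> >= u) = (i : S))" for om
    unfolding set_eq_iff E_def exceedances_def mem_Collect_eq using S by (metis PowD lessThan_iff subsetD)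
    then show ?thesis by blast
   qed
   also have "... : sets M"
   proof (rule sets.sets_Collect_finite_All)
    fix i assume "i : {..<n}"
    then have [measurable]: "(%om. increment n (%t. X t om) i) : borel_measurable M" by (intro inc) simp
    show "{om : space M. (\<bar>increment n (%t. X t om) i\<bar> >= u) = (i : S)} : sets M" by measurable
   qed simp
   finally show ?thesis .
  qed
  then show "E : space M \<rightarrow> Pow {..<n} & (\<forall>a\<in>Pow {..<n}. E -` {a} Int space M : sets M)" using Es by auto
 qed
 have "(%om. if k < card (E om) then increment n (%t. X t om) (sorted_list_of_set (E om) ! k) else 0) : borel_measurable M"
 proof (rule measurable_compose_countable'[OF _ Em])
  fix S assume S: "S : Pow {..<n}"
  then have fS: "finite S" using finite_subset by auto
  show "(%om. if k < card S then increment n (%t. X t om) (sorted_list_of_set S ! k) else 0) : borel_measurable M"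
  proof (cases "k < card S")
   case True
   then have "sorted_list_of_set S ! k : set (sorted_list_of_set S)" by (intro nth_mem) simp
   then have "sorted_list_of_set S ! k < n" using S fS by auto
   then show ?thesis using True by (simp only: if_True, intro inc)
  qed simp
 qed (simp add: countable_finite)
 then show ?thesis unfolding jump_estimator_eq E_def .
qed

text \<open>Compactness: near every time one-sided limits bound the path on both sides.\<close>

lemma cadlag_bounded:
 assumes c: "cadlag_on_unit x"
 shows "EX B. \<forall>t\<in>{0..1}. \<bar>x t\<bar> <= B"
proof -
 have "EX U B. open U & t : U & (\<forall>s\<in>U Int {0..1}. \<bar>x s\<bar> <= B)" if t: "t : {0..1}" for t
 proof -
  have "\<exists>r>t. EX B. ALL s. t < s --> s < r --> s <= 1 --> \<bar>x s\<bar> <= B"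
  proof (cases "t < 1")
   case True
   then have "((%s. \<bar>x s\<bar>) \<longlongrightarrow> \<bar>x t\<bar>) (at_right t)" using c t
    by (intro tendsto_intros) (auto simp: cadlag_on_unit_def continuous_within)
   then have "eventually (%s. \<bar>x s\<bar> < \<bar>x t\<bar> + 1) (at_right t)" by (rule order_tendstoD) simp
   then obtain r where "r > t" "\<And>s. t < s ==> s < r ==> \<bar>x s\<bar> < \<bar>x t\<bar> + 1" unfolding eventually_at_right_field by metis
   then show ?thesis by (intro exI[of _ r] conjI exI[of _ "\<bar>x t\<bar> + 1"]) (auto simp: less_imp_le)
  next
   case False
   then show ?thesis using t by (intro exI[of _ "t + 1"]) auto
  qed
  then obtain r B1 where r: "r > t" "\<And>s. t < s ==> s < r ==> s <= 1 ==> \<bar>x s\<bar> <= B1" by metis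
  have "EX l<t. EX B. ALL s. l < s --> s < t --> 0 <= s --> \<bar>x s\<bar> <= B"
  proof (cases "t > 0")
   case True
   then obtain y where "(x \<longlongrightarrow> y) (at_left t)" using c t unfolding cadlag_on_unit_def by (metis atLeastAtMost_iff greaterThanAtMost_iff)
   then have "((%s. \<bar>x s\<bar>) \<longlongrightarrow> \<bar>y\<bar>) (at_left t)" by (intro tendsto_intros)
   then have "eventually (%s. \<bar>x s\<bar> < \<bar>y\<bar> + 1) (at_left t)" by (rule order_tendstoD) simp
   then obtain l where "l < t" "\<And>s. l < s ==> s < t ==> \<bar>x s\<bar> < \<bar>y\<bar> + 1" unfolding eventually_at_left_field by metis
   then show ?thesis by (intro exI[of _ l] conjI exI[of _ "\<bar>y\<bar> + 1"]) (auto simp: less_imp_le)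
  next
   case False
   then show ?thesis using t by (intro exI[of _ "t - 1"]) auto
  qed
  then obtain l B2 where l: "l < t" "\<And>s. l < s ==> s < t ==> 0 <= s ==> \<bar>x s\<bar> <= B2" by metis
  have "\<bar>x s\<bar> <= max (max B1 B2) \<bar>x t\<bar>" if "s : {l<..<r} Int {0..1}" for s
   using that l(2)[of s] r(2)[of s] by (cases s t rule: linorder_cases) auto
  then show ?thesis using l r by (intro exI[of _ "{l<..<r}"] exI[of _ "max (max B1 B2) \<bar>x t\<bar>"]) auto
 qed
 then obtain U B where U: "\<And>t. t : {0..1} ==> open (U t) & t : U t & (\<forall>s\<in>U t Int {0..1}. \<bar>x s\<bar> <= B t)" by metis
 have cmp: "compact {0..1::real}" by simp
 obtain C where C: "C \<subseteq> {0..1}" "finite C" "{0..1} \<subseteq> (\<Union>c\<in>C. U c)"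
  by (rule compactE_image[OF cmp, of "{0..1}" U]) (use U in auto)
 have "\<bar>x t\<bar> <= (\<Sum>c\<in>C. \<bar>B c\<bar>)" if t: "t : {0..1}" for t
 proof -
  obtain c where cc: "c : C" "t : U c" using C t by auto
  then have "\<bar>x t\<bar> <= B c" using U[of c] C t by auto
  also have "... <= \<bar>B c\<bar>" by simp
  also have "... <= (\<Sum>c\<in>C. \<bar>B c\<bar>)" using cc C by (intro member_le_sum) auto
  finally show ?thesis .
 qed
 then show ?thesis by blast
qed

lemma clamp01_eq: "t : {0..1} ==> clamp01 t = t" by auto
lemma clamp01_in: "clamp01 t : {0..1}" by auto

lemma clamp01_right_continuous:
 assumes rc: "\<And>t. 0 <= t ==> t < 1 ==> continuous (at_right t) g"
 shows "continuous (at_right t) (%t. g (clamp01 t) :: real)"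
proof -
 consider "t < 0" | "0 <= t" "t < 1" | "t >= 1" by linarith
 then show ?thesis
 proof cases
  case 1
  have "eventually (%s. g (clamp01 s) = g (clamp01 t)) (at_right t)"
   unfolding eventually_at_right_field by (rule exI[of _ 0]) (use 1 in auto)
  then show ?thesis unfolding continuous_within by (rule tendsto_eventually)
 next
  case 2
  have "eventually (%s. g s = g (clamp01 s)) (at_right t)"
   unfolding eventually_at_right_field by (rule exI[of _ 1]) (use 2 in auto)
  moreover have "(g \<longlongrightarrow> g (clamp01 t)) (at_right t)" using rc[OF 2] 2 by (simp add: continuous_within)
  ultimately show ?thesis unfolding continuous_within by (rule Lim_transform_eventually[rotated])
 next
  case 3
  have "eventually (%s. g (clamp01 s) = g (clamp01 t)) (at_right t)"
   unfolding eventually_at_right_field by (rule exI[of _ "t + 1"]) (use 3 in auto)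
  then show ?thesis unfolding continuous_within by (rule tendsto_eventually)
 qed
qed

lemma tendsto_along_path:
 fixes f :: "real => real => real"
 assumes f: "continuous_on ({0..1} \<times> UNIV) (%(t, x). f t x)" and t: "t : {0..1}"
  and F: "eventually (%s. h s : {0..1}) F" and h: "(h \<longlongrightarrow> t) F" and y: "(y \<longlongrightarrow> z) F"
 shows "((%s. f (h s) (y s)) \<longlongrightarrow> f t z) F"
proof -
 have "((%s. (%(t, x). f t x) (h s, y s)) \<longlongrightarrow> (%(t, x). f t x) (t, z)) F"
  by (rule continuous_on_tendsto_compose[OF f]) (use t F h y in \<open>auto intro!: tendsto_Pair elim: eventually_mono\<close>)
 then show ?thesis by simp
qed

lemma cadlag_left_limit:
 assumes "cadlag_on_unit x" "0 < t" "t <= 1"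
 shows "(x \<longlongrightarrow> left_lim x t) (at_left t)"
proof -
 obtain l where l: "(x \<longlongrightarrow> l) (at_left t)" using assms unfolding cadlag_on_unit_def by (metis greaterThanAtMost_iff)
 then have "left_lim x t = l" unfolding left_lim_def by (intro tendsto_Lim) auto
 then show ?thesis using l by simp
qed

lemma cadlag_right_limit:
 assumes "cadlag_on_unit x" "0 <= t" "t < 1"
 shows "(x \<longlongrightarrow> x t) (at_right t)"
 using assms by (auto simp: cadlag_on_unit_def continuous_within)

lemma path_coefficient_right_continuous:
 assumes cad: "cadlag_on_unit x" and f: "continuous_on ({0..1} \<times> UNIV) (%(t, x). f t x)" and t: "0 <= t" "t < 1"
 shows "continuous (at_right t) (%s. f s (x s) :: real)"
 unfolding continuous_within
proof (rule tendsto_along_path[OF f])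
 show "eventually (%s. s : {0..1}) (at_right t)"
  unfolding eventually_at_right_field using t by (intro exI[of _ 1]) auto
qed (use t cadlag_right_limit[OF cad] in auto)

lemma path_coefficient_bounded:
 assumes cad: "cadlag_on_unit x" and f: "continuous_on ({0..1} \<times> UNIV) (%(t, x). f t x)"
 shows "\<exists>B\<ge>0. \<forall>t\<in>{0..1}. \<bar>f t (x t) :: real\<bar> <= B"
proof -
 obtain A where A: "\<forall>t\<in>{0..1}. \<bar>x t\<bar> <= A" using cadlag_bounded[OF cad] by blast
 have "compact ((%(t, x). f t x) ` ({0..1} \<times> {-A..A}))"
  by (intro compact_continuous_image continuous_on_subset[OF f] compact_Times) auto
 then have "bounded ((%(t, x). f t x) ` ({0..1} \<times> {-A..A}))" by (rule compact_imp_bounded)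
 then obtain B where B: "\<And>y. y : (%(t, x). f t x) ` ({0..1} \<times> {-A..A}) ==> norm y <= B" unfolding bounded_iff by blast
 have "\<bar>f t (x t)\<bar> <= B" if "t : {0..1}" for t
 proof -
  have "(%(t, x). f t x) (t, x t) : (%(t, x). f t x) ` ({0..1} \<times> {-A..A})"
   using bspec[OF A that] that by (intro imageI) (auto simp: abs_le_iff)
  from B[OF this] show ?thesis by simp
 qed
 then have "\<forall>t\<in>{0..1}. \<bar>f t (x t)\<bar> <= max 0 B" by (auto simp: le_max_iff_disj)
 then show ?thesis by (intro exI[of _ "max 0 B"]) auto
qed

context mix_model
begin

section \<open>Mixing of the normalised increments\<close>

definition jump_set :: "nat => 'b set" where
 "jump_set kp = {x : space M2. num_jumps T x = kp}"

lemma jump_set_measurable [measurable]: "jump_set kp : sets M2"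
 unfolding jump_set_def by measurable

lemma sep_set_subset: "sep_set n kp \<subseteq> jump_set kp"
 by (auto simp: sep_set_def jump_set_def)

lemma eventually_separated:
 "AE x in M2. x : jump_set kp --> eventually (%n. x : sep_set n kp) sequentially"
proof -
 have "AE x in M2. (ALL k<num_jumps T x. 0 < T k x & T k x < 1) & (ALL k. Suc k < num_jumps T x --> T k x < T (Suc k) x)"
  using jt unfolding jump_times_def by blast
 then show ?thesis
 proof eventually_elim
  case (elim x)
  show ?case
  proof
   assume x: "x : jump_set kp"
   then have K: "num_jumps T x = kp" by (simp add: jump_set_def)
   have "eventually (%n. separated n kp (%k. T k x)) sequentially"
    using elim K by (intro eventually_separated_times) auto
   then show "eventually (%n. x : sep_set n kp) sequentially"
    by eventually_elim (use x K in \<open>auto simp: sep_set_def jump_set_def\<close>)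
  qed
 qed
qed

lemma not_separated_tendsto_0: "(%n. measure P0 (space M1 \<times> (jump_set kp - sep_set n kp))) ----> 0"
proof -
 have "(%n. M2.prob (jump_set kp - sep_set n kp)) ----> 0"
 proof (rule measure_tendsto_0_of_eventually[where D="%_. {}"])
  show "finite_measure M2" by (rule M2.finite_measure)
  show "AE x in M2. \<forall>\<^sub>F n in sequentially. x : jump_set kp - sep_set n kp --> x : {}"
   using eventually_separated[of kp]
  proof eventually_elim
   case (elim x)
   show ?case
   proof (cases "x : jump_set kp")
    case True
    with elim have "eventually (%n. x : sep_set n kp) sequentially" by simp
    then show ?thesis by eventually_elim auto
   qed simp
  qed
 qed auto
 moreover have "measure P0 (space M1 \<times> B) = M2.prob B" if "B : sets M2" for B
 proof -
  have "emeasure P0 (space M1 \<times> B) = emeasure M2 B"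
   using M2.emeasure_pair_measure_Times[of "space M1" M1 B] that by (simp add: M1.emeasure_space_1)
  then show ?thesis unfolding measure_def by (rule arg_cong)
 qed
 ultimately show ?thesis by simp
qed

text \<open>Killed where two jump times are too close for the grid, an event of vanishing probability, so that the tail
bound below holds for all \<open>n\<close>.\<close>

definition xis :: "nat => nat => 'a \<times> 'b => nat \<times> nat => real" where
 "xis n kp om j = (if snd om : sep_set n kp then xi n kp om j else 0)"

lemma xis_measurable [measurable]: "(%om. xis n kp om j) : borel_measurable P0"
 unfolding xis_def by measurable

lemma xis_tail:
 assumes R: "R > 0" and j: "j : sides kp"
 shows "measure P0 {om : space P0. \<bar>xis n kp om j\<bar> > R} <= 1 / R\<^sup>2"
proof (cases "n = 0")
 case True
 then have e: "{om : space P0. \<bar>xis n kp om j\<bar> > R} = {}" using R by (auto simp: xis_def xi_def vec_def)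
 show ?thesis unfolding e by simp
next
 case False
 then have e: "{om : space P0. \<bar>xis n kp om j\<bar> > R} = {om : space P0. snd om : sep_set n kp & \<bar>xi n kp om j\<bar> > R}"
  using R by (auto simp: xis_def)
 show ?thesis unfolding e using xi_tail[of n R j kp] False R j by simp
qed

lemma profile_equidistribution:
 fixes kp :: nat
 assumes cont: "continuous_on UNIV ph" and b: "\<And>x. \<bar>ph x\<bar> <= C" and A [measurable]: "A : sets P0"
 defines "B \<equiv> A Int space M1 \<times> jump_set kp"
 shows "(%n. \<integral>om. indicator B om * profile ph kp (\<lambda>k\<in>{..<kp}. frc (real n * T k (snd om))) \<partial>P0)
  ----> measure P0 B * (\<integral>y. ph (lim_vec kp (%k. U k y) y) \<partial>M')"
proof -
 have B [measurable]: "B : sets P0" unfolding B_def by measurable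
 have pb: "\<bar>profile ph kp v\<bar> <= C" for v by (rule profile_bound[OF b cont])
 show ?thesis
 proof (cases "M2.prob (jump_set kp) > 0")
  case True
  from jump_density[OF A True[unfolded jump_set_def]] obtain p where p: "integrable (torus {..<kp}) p"
   and pg: "\<And>g c. g : borel_measurable (PiM {..<kp} (%_. borel)) ==> (ALL x. \<bar>g x\<bar> <= c) ==>
    (\<integral>om. indicator B om * g (\<lambda>k\<in>{..<kp}. T k (snd om)) \<partial>P0) = (\<integral>t. p t * (g t :: real) \<partial>torus {..<kp})"
   unfolding B_def jump_set_def by blast
  have "(\<integral>om. indicator B om * (1::real) \<partial>P0) = (\<integral>t. p t * 1 \<partial>torus {..<kp})"
   by (rule pg[of "%_. 1" 1]) auto
  then have tot: "(\<integral>t. p t \<partial>torus {..<kp}) = measure P0 B" by simp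
  have "(\<integral>om. indicator B om * profile ph kp (\<lambda>k\<in>{..<kp}. frc (real n * T k (snd om))) \<partial>P0)
   = (\<integral>t. p t * profile ph kp (\<lambda>k\<in>{..<kp}. frc (real n * t k)) \<partial>torus {..<kp})" for n
  proof -
   have frm [measurable]: "frc : borel_measurable borel" unfolding frc_def[abs_def] by measurable
   have "(%t. \<lambda>k\<in>{..<kp}. frc (real n * t k)) : PiM {..<kp} (%_. borel) \<rightarrow>\<^sub>M PiM {..<kp} (%_. borel)"
    by (rule measurable_restrict) measurable
   then have m: "(%t. profile ph kp (\<lambda>k\<in>{..<kp}. frc (real n * t k))) : borel_measurable (PiM {..<kp} (%_. borel))"
    by (rule measurable_compose[OF _ profile_measurable[OF cont]])
   have e: "profile ph kp (\<lambda>k\<in>{..<kp}. frc (real n * T k (snd om)))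
    = profile ph kp (\<lambda>k\<in>{..<kp}. frc (real n * (\<lambda>k\<in>{..<kp}. T k (snd om)) k))" for om
    by (rule profile_cong) simp
   show ?thesis unfolding e by (rule pg[OF m, of C]) (use pb in simp)
  qed
  then show ?thesis
   using torus_equidistribution[OF finite_lessThan profile_measurable[OF cont, of kp] pb p]
   unfolding tot integral_profile[OF cont b] by simp
 next
  case False
  then have z: "M2.prob (jump_set kp) = 0" by (simp add: zero_less_measure_iff)
  have "emeasure P0 (space M1 \<times> jump_set kp) = 0"
   using M2.emeasure_pair_measure_Times[of "space M1" M1 "jump_set kp"] z by (simp add: M2.emeasure_eq_measure)
  then have "space M1 \<times> jump_set kp : null_sets P0" by (intro null_setsI) auto
  then have N: "B : null_sets P0" using B by (rule null_sets_subset) (auto simp: B_def)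
  have "(\<integral>om. indicator B om * profile ph kp (\<lambda>k\<in>{..<kp}. frc (real n * T k (snd om))) \<partial>P0) = (\<integral>om. 0 \<partial>P0)" for n
  proof (rule integral_eq_zero_AE[of _ P0, THEN trans])
   show "AE om in P0. indicator B om * profile ph kp (\<lambda>k\<in>{..<kp}. frc (real n * T k (snd om))) = 0"
    using AE_not_in[OF N] by eventually_elim simp
  qed simp
  moreover have "measure P0 B = 0" using N by (simp add: null_sets_def measure_def)
  ultimately show ?thesis by simp
 qed
qed

lemma mean_profile_error:
 fixes kp :: nat
 assumes cont: "continuous_on UNIV ph" and b: "\<And>x. \<bar>ph x\<bar> <= C" and n: "n >= 1"
 defines "G \<equiv> %y. indicator (sep_set n kp) y * \<bar>trim_mean ph n kp y - profile ph kp (\<lambda>k\<in>{..<kp}. frc (real n * T k y))\<bar>"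
 shows "G : borel_measurable M2"
  "(\<integral>om. G (snd om) \<partial>P0) <= (\<integral>om. indicator (space M1 \<times> sep_set n kp) om * \<bar>ph (xi n kp om) - ph (xit n kp om)\<bar> \<partial>P0)"
proof -
 have C0: "C >= 0" using b[of undefined] by linarith
 have [measurable]: "trim_mean ph n kp : borel_measurable M2" by (rule trim_mean_measurable[OF cont])
 have fm: "(%om. ph (xi n kp om)) : borel_measurable P0" "(%om. ph (xit n kp om)) : borel_measurable P0"
  using phi_measurable[OF cont] by auto
 note [measurable] = fm
 have frm [measurable]: "frc : borel_measurable borel" unfolding frc_def[abs_def] by measurable
 have pm [measurable]: "(%y. profile ph kp (\<lambda>k\<in>{..<kp}. frc (real n * T k y))) : borel_measurable M2"
  by (rule measurable_compose[OF _ profile_measurable[OF cont]]) (rule measurable_restrict, measurable)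
 show G [measurable]: "G : borel_measurable M2" unfolding G_def by measurable
 define h where "h om = indicator (space M1 \<times> sep_set n kp) om * \<bar>ph (xi n kp om) - ph (xit n kp om)\<bar>" for om
 have hm [measurable]: "h : borel_measurable P0" unfolding h_def by measurable
 have hb: "\<bar>h om\<bar> <= 2 * C" for om
  using b[of "xi n kp om"] b[of "xit n kp om"] C0 by (auto simp: h_def indicator_def)
 have hi: "integrable P0 h" using hb by (intro M12.integrable_const_bound[where B="2 * C"]) auto
 have hi1: "integrable M1 (%x. h (x, y))" if "y : space M2" for y
  using hb section_measurable[OF hm that] by (intro M1.integrable_const_bound[where B="2 * C"]) auto
 have le: "G y <= (\<integral>x. h (x, y) \<partial>M1)" if y: "y : space M2" for y
 proof (cases "y : sep_set n kp")
  case True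
  then have s: "separated n kp (%k. T k y)" by (simp add: sep_set_def)
  have i: "integrable M1 (%x. ph (xi n kp (x, y)))" "integrable M1 (%x. ph (xit n kp (x, y)))"
   using b section_measurable[OF fm(1) y] section_measurable[OF fm(2) y] by (auto intro!: M1.integrable_const_bound[where B=C])
  have "profile ph kp (\<lambda>k\<in>{..<kp}. frc (real n * T k y)) = profile ph kp (%k. frc (real n * T k y))"
   by (rule profile_cong) simp
  also have "... = (\<integral>x. ph (xi n kp (x, y)) \<partial>M1)"
   unfolding profile_def xi_def using expectation_increments_eq[OF n s cont] by simp
  finally have "G y = \<bar>\<integral>x. ph (xit n kp (x, y)) - ph (xi n kp (x, y)) \<partial>M1\<bar>"
   using True i by (simp add: G_def trim_mean_def)
  also have "... <= (\<integral>x. h (x, y) \<partial>M1)"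
   using True y by (intro abs_integral_le[OF _ hi1[OF y]] Bochner_Integration.integrable_diff i) (auto simp: h_def abs_minus_commute indicator_def)
  finally show ?thesis .
 next
  case False
  then show ?thesis by (auto simp: G_def h_def)
 qed
 have Gi: "integrable M2 G"
 proof (rule M2.integrable_const_bound[where B="2 * C"])
  have "\<bar>G y\<bar> <= 2 * C" if y: "y : space M2" for y
   using trim_mean_bound[OF cont b y, of n kp] profile_bound[OF b cont, of kp "\<lambda>k\<in>{..<kp}. frc (real n * T k y)"] C0
   by (auto simp: G_def indicator_def)
  then show "AE y in M2. norm (G y) <= 2 * C" by auto
 qed simp
 have Gi0: "integrable P0 (%(x, y). G y)"
 proof (rule M12.integrable_const_bound[where B="2 * C"])
  have "\<bar>G y\<bar> <= 2 * C" if y: "y : space M2" for y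
   using trim_mean_bound[OF cont b y, of n kp] profile_bound[OF b cont, of kp "\<lambda>k\<in>{..<kp}. frc (real n * T k y)"] C0
   by (auto simp: G_def indicator_def)
  then show "AE z in P0. norm (case z of (x, y) => G y) <= 2 * C" by (auto simp: space_pair_measure)
 qed measurable
 have "(\<integral>om. G (snd om) \<partial>P0) = (\<integral>y. (\<integral>x. G y \<partial>M1) \<partial>M2)"
  using M12.integral_snd[OF Gi0] by (simp add: case_prod_beta')
 also have "... = (\<integral>y. G y \<partial>M2)" by (simp add: M1.prob_space)
 also have "... <= (\<integral>y. (\<integral>x. h (x, y) \<partial>M1) \<partial>M2)"
  using hi by (intro integral_mono_AE Gi M12.integrable_snd AE_I2 le) (auto simp: case_prod_beta')
 also have "... = (\<integral>om. h om \<partial>P0)" using M12.integral_snd[of "%x y. h (x, y)"] hi by (simp add: case_prod_beta')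
 finally show "(\<integral>om. G (snd om) \<partial>P0) <= (\<integral>om. indicator (space M1 \<times> sep_set n kp) om * \<bar>ph (xi n kp om) - ph (xit n kp om)\<bar> \<partial>P0)"
  by (simp add: h_def)
qed

text \<open>The integrand is replaced successively by its trimmed version, by the conditional mean of the latter given
the jump times (the difference is weakly null), and by the profile at the fractional parts, to which
equidistribution applies.\<close>

theorem increments_mixing:
 fixes kp :: nat
 assumes cont: "continuous_on UNIV ph" and b: "\<And>x. \<bar>ph x\<bar> <= C" and A [measurable]: "A : sets P0"
 defines "B \<equiv> A Int space M1 \<times> jump_set kp"
 shows "(%n. \<integral>om. indicator B om * ph (xis n kp om) \<partial>P0)
  ----> measure P0 B * (\<integral>y. ph (lim_vec kp (%k. U k y) y) \<partial>M')"
proof -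
 have C0: "C >= 0" using b[of undefined] by linarith
 have B [measurable]: "B : sets P0" unfolding B_def by measurable
 let ?p = "%n om. profile ph kp (\<lambda>k\<in>{..<kp}. frc (real n * T k (snd om)))"
 define q where "q n = (\<integral>om. indicator B om * ?p n om \<partial>P0)" for n
 define d where "d n = (\<integral>om. indicator A om * trim_dev ph n kp om \<partial>P0)" for n
 define f where "f n = (\<integral>om. indicator B om * ph (xis n kp om) \<partial>P0)" for n
 define G where "G n y = indicator (sep_set n kp) y * \<bar>trim_mean ph n kp y - profile ph kp (\<lambda>k\<in>{..<kp}. frc (real n * T k y))\<bar>" for n y
 define H where "H n om = indicator (space M1 \<times> sep_set n kp) om * \<bar>ph (xi n kp om) - ph (xit n kp om)\<bar>" for n om
 define N where "N n = space M1 \<times> (jump_set kp - sep_set n kp)" for n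
 have N [measurable]: "N n : sets P0" for n unfolding N_def by measurable
 define r where "r n = 2 * (\<integral>om. H n om \<partial>P0) + 2 * C * measure P0 (N n)" for n
 have bound: "\<bar>f n - d n - q n\<bar> <= r n" if n: "n >= 1" for n
 proof -
  have Gm [measurable]: "G n : borel_measurable M2" and G: "(\<integral>om. G n (snd om) \<partial>P0) <= (\<integral>om. H n om \<partial>P0)"
   using mean_profile_error[OF cont b n, of kp] unfolding G_def[abs_def] H_def by auto
  have [measurable]: "trim_mean ph n kp : borel_measurable M2" by (rule trim_mean_measurable[OF cont])
  have [measurable]: "(%om. ph (xi n kp om)) : borel_measurable P0" "(%om. ph (xit n kp om)) : borel_measurable P0"
   using phi_measurable[OF cont] by auto
  have [measurable]: "(%om. ph (xis n kp om)) : borel_measurable P0"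
   by (rule borel_measurable_continuous_vector[OF cont]) simp
  have frm [measurable]: "frc : borel_measurable borel" unfolding frc_def[abs_def] by measurable
  have [measurable]: "?p n : borel_measurable P0"
   by (rule measurable_compose[OF _ profile_measurable[OF cont]]) (rule measurable_restrict, measurable)
  have [measurable]: "trim_dev ph n kp : borel_measurable P0" unfolding trim_dev_def by measurable
  have [measurable]: "H n : borel_measurable P0" unfolding H_def by measurable
  have pb: "\<bar>profile ph kp v\<bar> <= C" for v by (rule profile_bound[OF b cont])
  have tb: "\<bar>trim_mean ph n kp y\<bar> <= C" if "y : space M2" for y by (rule trim_mean_bound[OF cont b that])
  have i1: "integrable P0 (%om. indicator B om * ph (xis n kp om))"
   using b C0 by (intro M12.integrable_const_bound[where B=C]) (auto simp: indicator_def)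
  have i2: "integrable P0 (%om. indicator A om * trim_dev ph n kp om)"
  proof (rule M12.integrable_const_bound[where B="2 * C"])
   have "\<bar>indicator A om * trim_dev ph n kp om\<bar> <= 2 * C" if "om : space P0" for om
    using tb[of "snd om"] b[of "xit n kp om"] that C0 by (auto simp: trim_dev_def indicator_def space_pair_measure)
   then show "AE om in P0. norm (indicator A om * trim_dev ph n kp om) <= 2 * C" by auto
  qed simp
  have i3: "integrable P0 (%om. indicator B om * ?p n om)"
   using pb C0 by (intro M12.integrable_const_bound[where B=C]) (auto simp: indicator_def)
  have iH: "integrable P0 (H n)"
  proof (rule M12.integrable_const_bound[where B="2 * C"])
   have "\<bar>H n om\<bar> <= 2 * C" for om using b[of "xi n kp om"] b[of "xit n kp om"] C0 by (auto simp: H_def indicator_def)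
   then show "AE om in P0. norm (H n om) <= 2 * C" by auto
  qed simp
  have iG: "integrable P0 (%om. G n (snd om))"
  proof (rule M12.integrable_const_bound[where B="2 * C"])
   have "\<bar>G n y\<bar> <= 2 * C" if "y : space M2" for y
    using tb[OF that] pb[of "\<lambda>k\<in>{..<kp}. frc (real n * T k y)"] C0 by (auto simp: G_def indicator_def)
   then show "AE om in P0. norm (G n (snd om)) <= 2 * C" by (auto simp: space_pair_measure)
  qed measurable
  have iN: "integrable P0 (%om. 2 * C * indicator (N n) om)" by (intro integrable_mult_right) (auto simp: M12.emeasure_eq_measure)
  have "\<bar>f n - d n - q n\<bar> = \<bar>\<integral>om. indicator B om * ph (xis n kp om) - indicator A om * trim_dev ph n kp om - indicator B om * ?p n om \<partial>P0\<bar>"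
   unfolding f_def d_def q_def using i1 i2 i3 by simp
  also have "... <= (\<integral>om. H n om + G n (snd om) + 2 * C * indicator (N n) om \<partial>P0)"
  proof (rule abs_integral_le)
   show "integrable P0 (%om. indicator B om * ph (xis n kp om) - indicator A om * trim_dev ph n kp om - indicator B om * ?p n om)"
    by (intro Bochner_Integration.integrable_diff i1 i2 i3)
   show "integrable P0 (%om. H n om + G n (snd om) + 2 * C * indicator (N n) om)"
    by (intro Bochner_Integration.integrable_add iH iG iN)
   fix om assume w: "om : space P0"
   show "\<bar>indicator B om * ph (xis n kp om) - indicator A om * trim_dev ph n kp om - indicator B om * ?p n om\<bar> <= H n om + G n (snd om) + 2 * C * indicator (N n) om"
   proof (cases "snd om : sep_set n kp")
    case True
    have x: "xis n kp om = xi n kp om" using True by (auto simp: xis_def fun_eq_iff)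
    have "om : B \<longleftrightarrow> om : A" using True w sep_set_subset[of n kp] by (auto simp: B_def space_pair_measure mem_Times_iff)
    then show ?thesis using True w
    by (auto simp: x H_def G_def trim_dev_def indicator_def N_def space_pair_measure)
   next
    case False
    then have t0: "trim_dev ph n kp om = 0" and hg: "0 <= H n om" "0 <= G n (snd om)"
    by (auto simp: trim_dev_def H_def G_def)
    show ?thesis
    proof (cases "om : B")
    case True
    then have "om : N n" using False w by (auto simp: B_def N_def)
    then show ?thesis using True hg t0 b[of "xis n kp om"] pb[of "\<lambda>k\<in>{..<kp}. frc (real n * T k (snd om))"] by simp
    next
    case False
    then show ?thesis using hg t0 C0 by (simp add: indicator_def)
    qed
   qed
  qed
  also have "... = (\<integral>om. H n om \<partial>P0) + (\<integral>om. G n (snd om) \<partial>P0) + 2 * C * measure P0 (N n)"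
   using iH iG iN by simp
  also have "... <= r n" using G by (simp add: r_def)
  finally show ?thesis .
 qed
 have "r ----> 2 * 0 + 2 * C * 0"
  unfolding r_def[abs_def] H_def N_def by (intro tendsto_intros trimming_negligible[OF cont b] not_separated_tendsto_0)
 then have r0: "r ----> 0" by simp
 have fdq: "(%n. f n - d n - q n) ----> 0"
  by (rule Lim_null_comparison[OF _ r0]) (use bound in \<open>auto simp: eventually_sequentially intro!: exI[of _ 1]\<close>)
 have "d ----> 0" unfolding d_def[abs_def] by (rule trim_dev_weakly_null[OF cont b A])
 moreover have "q ----> measure P0 B * (\<integral>y. ph (lim_vec kp (%k. U k y) y) \<partial>M')"
  unfolding q_def[abs_def] B_def by (rule profile_equidistribution[OF cont b A])
 ultimately have "(%n. (f n - d n - q n) + d n + q n) ----> 0 + 0 + measure P0 B * (\<integral>y. ph (lim_vec kp (%k. U k y) y) \<partial>M')"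
  by (intro tendsto_add fdq)
 then show ?thesis by (simp add: f_def[abs_def])
qed

end

section \<open>Expansion of the estimator along a path\<close>

text \<open>A single path of the solution, with finitely many ordered jumps inside \<open>(0, 1)\<close>.\<close>

locale jump_path =
 fixes x I :: "real => real" and b :: "real => real => real" and th J :: "nat => real" and K :: nat and x0 :: real
 assumes cad: "cadlag_on_unit x"
  and bc: "continuous_on ({0..1} \<times> UNIV) (%(t, x). b t x)"
  and Ic: "continuous_on {0..1} I"
  and idx: "{k. th k <= 1} = {..<K}"
  and unit: "ALL k<K. 0 < th k & th k < 1"
  and incr: "ALL k. Suc k < K --> th k < th (Suc k)"
  and sde: "\<And>t. t : {0..1} ==> x t = x0 + (LINT s:{0..t}|lborel. b s (x s)) + I t + (\<Sum>k | th k <= t. J k)"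
begin

lemma path_composition_measurable:
 assumes f: "continuous_on ({0..1} \<times> UNIV) (%(t, x). f t x)"
 shows "(%s. f (clamp01 s) (x (clamp01 s)) :: real) : borel_measurable borel"
proof -
 have "(%(t, om). f (clamp01 t) (x (clamp01 t))) : borel_measurable (borel \<Otimes>\<^sub>M count_space {()})"
  by (rule joint_measurable_right_continuous) (use clamp01_right_continuous[OF path_coefficient_right_continuous[OF cad f]] in auto)
 from measurable_Pair_compose_split[OF this measurable_ident, of "%_. ()"] show ?thesis by simp
qed

lemma drift_bound: "\<exists>B\<ge>0. ALL l r. 0 <= l --> l <= r --> r <= 1 -->
 \<bar>(LINT s:{0..r}|lborel. b s (x s)) - (LINT s:{0..l}|lborel. b s (x s))\<bar> <= B * (r - l)"
proof -
 obtain B where B: "B >= 0" "\<And>t. t : {0..1} ==> \<bar>b t (x t)\<bar> <= B" using path_coefficient_bounded[OF cad bc] by blast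
 have si: "set_integrable lborel A (%s. b s (x s))" if A: "A \<subseteq> {0..1}" "A : sets lborel" for A
 proof -
  have "integrable lborel (%s. indicator {0..1::real} s * B :: real)" by (intro integrable_mult_left integrable_real_indicator) auto
  then have "integrable lborel (%s. indicator A s * b (clamp01 s) (x (clamp01 s)))"
  proof (rule Bochner_Integration.integrable_bound)
   show "(%s. indicator A s * b (clamp01 s) (x (clamp01 s))) : borel_measurable lborel"
    using path_composition_measurable[OF bc] A(2) by measurable
   show "AE s in lborel. norm (indicator A s * b (clamp01 s) (x (clamp01 s))) <= norm (indicator {0..1} s * B)"
   proof (rule AE_I2)
    fix s :: real
    show "norm (indicator A s * b (clamp01 s) (x (clamp01 s))) <= norm (indicator {0..1} s * B)"
    proof (cases "s : A")
    case True
    then have "s : {0..1}" using A by auto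
    then show ?thesis using B(1) B(2)[of s] True by (simp add: clamp01_eq)
    qed simp
   qed
  qed
  moreover have "indicator A s * b (clamp01 s) (x (clamp01 s)) = indicator A s *\<^sub>R b s (x s)" for s
   using A clamp01_eq[of s] by (cases "s : A") auto
  ultimately show ?thesis unfolding set_integrable_def by simp
 qed
 have "\<bar>(LINT s:{0..r}|lborel. b s (x s)) - (LINT s:{0..l}|lborel. b s (x s))\<bar> <= B * (r - l)"
  if lr: "0 <= l" "l <= r" "r <= 1" for l r
 proof -
  have "{0..r} = {0..l} Un {l<..r}" using lr by auto
  then have "(LINT s:{0..r}|lborel. b s (x s)) = (LINT s:{0..l}|lborel. b s (x s)) + (LINT s:{l<..r}|lborel. b s (x s))"
   using lr by (simp only:) (intro set_integral_Un si; auto)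
  moreover have "\<bar>LINT s:{l<..r}|lborel. b s (x s)\<bar> <= (\<integral>s. indicator {l<..r} s * B \<partial>lborel)"
   unfolding set_lebesgue_integral_def
  proof (rule abs_integral_le)
   show "integrable lborel (%s. indicator {l<..r} s *\<^sub>R b s (x s))"
   proof -
    have "{l<..r} \<subseteq> {0..1}" using lr by auto
    from si[OF this] show ?thesis unfolding set_integrable_def by simp
   qed
   show "integrable lborel (%s. indicator {l<..r} s * B :: real)"
    using lr by (intro integrable_mult_left integrable_real_indicator) auto
   show "\<bar>indicator {l<..r} s *\<^sub>R b s (x s)\<bar> <= indicator {l<..r} s * B" for s
    using B(2)[of s] lr by (auto simp: indicator_def)
  qed
  moreover have "(\<integral>s. indicator {l<..r} s * B \<partial>lborel) = B * (r - l)" using lr by simp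
  ultimately show ?thesis by linarith
 qed
 with B(1) show ?thesis by blast
qed

definition drift_const :: real where
 "drift_const = (SOME B. B >= 0 & (ALL l r. 0 <= l --> l <= r --> r <= 1 -->
 \<bar>(LINT s:{0..r}|lborel. b s (x s)) - (LINT s:{0..l}|lborel. b s (x s))\<bar> <= B * (r - l)))"

lemma drift_const: "drift_const >= 0" "0 <= l ==> l <= r ==> r <= 1 ==>
 \<bar>(LINT s:{0..r}|lborel. b s (x s)) - (LINT s:{0..l}|lborel. b s (x s))\<bar> <= drift_const * (r - l)"
proof -
 have "drift_const >= 0 & (ALL l r. 0 <= l --> l <= r --> r <= 1 -->
 \<bar>(LINT s:{0..r}|lborel. b s (x s)) - (LINT s:{0..l}|lborel. b s (x s))\<bar> <= drift_const * (r - l))"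
  unfolding drift_const_def by (rule someI_ex) (rule drift_bound)
 then show "drift_const >= 0" "0 <= l ==> l <= r ==> r <= 1 ==>
 \<bar>(LINT s:{0..r}|lborel. b s (x s)) - (LINT s:{0..l}|lborel. b s (x s))\<bar> <= drift_const * (r - l)" by blast+
qed

lemma increment_expansion:
 assumes lr: "0 <= l" "l <= r" "r <= 1"
 shows "\<bar>(x r - x l) - (I r - I l) - (\<Sum>k | l < th k & th k <= r. J k)\<bar> <= drift_const * (r - l)"
proof -
 have fin: "finite {k. th k <= t}" if "t <= 1" for t
 proof (rule finite_subset[of _ "{k. th k <= 1}"])
  show "{k. th k <= t} \<subseteq> {k. th k <= 1}" using that by auto
  show "finite {k. th k <= 1}" unfolding idx by simp
 qed
 have "{k. th k <= r} = {k. th k <= l} Un {k. l < th k & th k <= r}" using lr by auto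
 then have "(\<Sum>k | th k <= r. J k) = (\<Sum>k | th k <= l. J k) + (\<Sum>k | l < th k & th k <= r. J k)"
  using fin[of l] fin[of r] lr by (simp only:) (rule sum.union_disjoint; auto intro: finite_subset[of _ "{k. th k <= r}"])
 then have "(x r - x l) - (I r - I l) - (\<Sum>k | l < th k & th k <= r. J k)
  = (LINT s:{0..r}|lborel. b s (x s)) - (LINT s:{0..l}|lborel. b s (x s))"
  using sde[of r] sde[of l] lr by simp
 then show ?thesis using drift_const(2)[OF lr] by simp
qed

text \<open>The equation identifies the jump of the path, because drift and stochastic integral are continuous.\<close>

lemma jump_at:
 assumes k: "k < K"
 shows "x (th k) - left_lim x (th k) = J k"
proof -
 have u: "0 < th k" "th k < 1" using unit k by auto
 have sep: "\<forall>\<^sub>F n in sequentially. separated n K th" by (rule eventually_separated_times[OF unit incr])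
 then obtain n where n: "n >= 1" "separated n K th" unfolding eventually_sequentially by (metis nat_le_linear)
 let ?F = "at_left (th k)"
 have ev: "\<forall>\<^sub>F l in ?F. \<bar>(x (th k) - x l) - J k\<bar> <= \<bar>I (th k) - I l\<bar> + drift_const * (th k - l)"
  unfolding eventually_at_left_field
 proof (intro exI[of _ "max 0 (th k - 1 / real n)"] conjI allI impI)
  show "max 0 (th k - 1 / real n) < th k" using u n by simp
  fix l assume l: "max 0 (th k - 1 / real n) < l" "l < th k"
  have "{j. l < th j & th j <= th k} = {k}"
  proof -
   have "j = k" if j: "l < th j" "th j <= th k" for j
   proof (rule ccontr)
    assume ne: "j ~= k"
    have "j : {k. th k <= 1}" using j u by simp
    then have "j < K" unfolding idx by simp
    then have "\<bar>th j - th k\<bar> > 2 / real n" using n(2) k ne by (auto simp: separated_def)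
    moreover have "2 / real n = 1 / real n + 1 / real n" "1 / real n > 0" using n by simp_all
    ultimately show False using l j by linarith
   qed
   then show ?thesis using l by auto
  qed
  then show "\<bar>(x (th k) - x l) - J k\<bar> <= \<bar>I (th k) - I l\<bar> + drift_const * (th k - l)"
   using increment_expansion[of l "th k"] l u by simp
 qed
 have Il: "(I \<longlongrightarrow> I (th k)) ?F"
 proof -
  have "(I \<longlongrightarrow> I (th k)) (at (th k))" using Ic u
   by (metis atLeastAtMost_iff continuous_on_interior continuous_within greaterThanLessThan_iff interior_atLeastAtMost_real isCont_def)
  then show ?thesis by (rule tendsto_within_subset) simp
 qed
 have "((%l. \<bar>I (th k) - I l\<bar> + drift_const * (th k - l)) \<longlongrightarrow> \<bar>I (th k) - I (th k)\<bar> + drift_const * (th k - th k)) ?F"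
  by (intro tendsto_intros Il)
 then have "((%l. \<bar>I (th k) - I l\<bar> + drift_const * (th k - l)) \<longlongrightarrow> 0) ?F" by simp
 then have "((%l. (x (th k) - x l) - J k) \<longlongrightarrow> 0) ?F"
  by (rule Lim_null_comparison[rotated]) (use ev in simp)
 moreover have "((%l. (x (th k) - x l) - J k) \<longlongrightarrow> (x (th k) - left_lim x (th k)) - J k) ?F"
  using u by (intro tendsto_intros cadlag_left_limit[OF cad]) auto
 ultimately have "0 = (x (th k) - left_lim x (th k)) - J k" by (intro tendsto_unique) auto
 then show ?thesis by simp
qed

lemma estimator_expansion:
 fixes u :: "nat => real"
 assumes nz: "ALL k<K. J k ~= 0"
  and u: "\<And>n. n >= 1 ==> u n > 0" and u0: "u ----> 0" and nu: "(%n. 1 / (real n * u n)) ----> 0"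
 shows "eventually (%n. (ALL i<n. \<bar>I (real (i + 1) / real n) - I (real i / real n)\<bar> <= u n / 2) -->
  (\<forall>k\<ge>K. jump_estimator (u n) n x k = 0) &
  (ALL k<K. \<bar>jump_estimator (u n) n x k - J k - (I (th k) - I (grid_below n (th k))) - (I (grid_above n (th k)) - I (th k))\<bar>
    <= drift_const / real n)) sequentially"
proof -
 \<comment> \<open>The factor 2 leaves room for \<open>u n / 2\<close> from the stochastic integral and \<open>u n / 4\<close> from the drift.\<close>
 have "\<forall>\<^sub>F n in sequentially. \<forall>k\<in>{..<K}. 2 * u n < \<bar>J k\<bar>"
 proof (rule eventually_ball_finite, simp, rule ballI)
  fix k assume k: "k : {..<K}"
  have "(%n. 2 * u n) ----> 2 * 0" by (intro tendsto_intros u0)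
  then show "\<forall>\<^sub>F n in sequentially. 2 * u n < \<bar>J k\<bar>" by (rule order_tendstoD(2)) (use nz k in auto)
 qed
 moreover have "\<forall>\<^sub>F n in sequentially. drift_const / real n <= u n / 4"
 proof -
  have "(%n. drift_const * (1 / (real n * u n))) ----> drift_const * 0" by (intro tendsto_intros nu)
  then have "\<forall>\<^sub>F n in sequentially. drift_const * (1 / (real n * u n)) < 1 / 4" by (rule order_tendstoD(2)) simp
  with eventually_ge_at_top[of 1] show ?thesis
  proof eventually_elim
   case (elim n)
   have "u n > 0" "real n > 0" using u[of n] elim by auto
   then show ?case using elim by (simp add: field_simps)
  qed
 qed
 moreover note eventually_separated_times[OF unit incr] eventually_ge_at_top[of "1::nat"]
 ultimately show ?thesis
 proof eventually_elim
  case (elim n)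
  note J = elim(1) and D = elim(2) and S = elim(3) and n = elim(4)
  have un: "u n > 0" using u n by simp
  have rn: "real n > 0" using n by simp
  have n2: "2 / real n = 1 / real n + 1 / real n" "1 / real n > 0" using n by simp_all
  define i where "i k = nat (\<lceil>real n * th k\<rceil> - 1)" for k
  have i: "real (i k) = of_int \<lceil>real n * th k\<rceil> - 1" "i k < n" if k: "k < K" for k
  proof -
   have t: "0 < th k" "th k < 1" using unit k by auto
   have c1: "1 <= \<lceil>real n * th k\<rceil>" using t rn by (simp add: one_le_ceiling)
   then show e: "real (i k) = of_int \<lceil>real n * th k\<rceil> - 1" by (simp add: i_def of_nat_nat)
   have "\<lceil>real n * th k\<rceil> <= int n" using t rn by (simp add: ceiling_le_iff)
   then show "i k < n" using c1 by (simp add: i_def) linarith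
  qed
  have grid: "real (i k) / real n = grid_below n (th k)" "real (i k + 1) / real n = grid_above n (th k)" if k: "k < K" for k
   using i(1)[OF k] by (simp_all add: grid_below_def grid_above_def)
  have near: "j = k" if "j < K" "k < K" "\<bar>th j - th k\<bar> <= 1 / real n" for j k
  proof (rule ccontr)
   assume "j ~= k"
   then have "\<bar>th j - th k\<bar> > 2 / real n" using S that by (auto simp: separated_def)
   then show False using that n2 by linarith
  qed
  have K_iff: "j < K \<longleftrightarrow> th j <= 1" for j using idx by blast
  have mono: "i j < i k" if "j < k" "k < K" for j k
  proof -
   have jK: "j < K" using that by simp
   have "th j < th k" by (rule strictly_increasing_times[OF incr that])
   moreover have "\<not> \<bar>th j - th k\<bar> <= 1 / real n" using near[OF jK that(2)] that by auto
   ultimately have "grid_above n (th j) < th k + 1 / real n & th k - th j > 1 / real n"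
    using grid_bounds(4)[OF n, of "th j"] by linarith
   then have "grid_below n (th j) < grid_below n (th k)"
    using grid_bounds(1)[OF n, of "th j"] grid_bounds(3)[OF n, of "th k"] by linarith
   then have "real (i j) / real n < real (i k) / real n" using grid(1)[OF jK] grid(1)[OF that(2)] by simp
   then show ?thesis using rn by (simp add: divide_less_cancel)
  qed
  have jumps_in: "{j. real l / real n < th j & th j <= real (l + 1) / real n} = {k}" if "k < K" "l = i k" for k l
  proof -
   have "real l / real n < th k & th k <= real (l + 1) / real n"
    unfolding that(2) grid[OF that(1)] using grid_bounds[OF n, of "th k"] by simp
   moreover have "j = k" if j: "real l / real n < th j" "th j <= real (l + 1) / real n" for j
   proof -
    have b: "grid_below n (th k) < th j" "th j <= grid_above n (th k)" using j unfolding \<open>l = i k\<close> grid[OF \<open>k < K\<close>] by auto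
    have "th j <= 1" using b grid_unit[OF n, of "th k"] unit \<open>k < K\<close> by auto
    then have "j < K" using K_iff by simp
    moreover have "\<bar>th j - th k\<bar> <= 1 / real n" using b grid_bounds[OF n, of "th k"] by linarith
    ultimately show ?thesis using near \<open>k < K\<close> by blast
   qed
   ultimately show ?thesis by auto
  qed
  have no_jumps: "{j. real l / real n < th j & th j <= real (l + 1) / real n} = {}" if l: "l < n" "l \<notin> i ` {..<K}" for l
  proof -
   have False if j: "real l / real n < th j" "th j <= real (l + 1) / real n" for j
   proof -
    have "real (l + 1) / real n <= 1" using l by (simp add: divide_le_eq)
    then have jK: "j < K" using K_iff j by auto
    have "real l < real n * th j" "real n * th j <= real l + 1" using j rn by (auto simp: field_simps)
    then have "\<lceil>real n * th j\<rceil> = int l + 1" by (intro ceiling_unique) auto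
    then have "i j = l" by (simp add: i_def)
    then show False using l jK by auto
   qed
   then show ?thesis by blast
  qed
  show ?case
  proof
   assume G: "ALL i<n. \<bar>I (real (i + 1) / real n) - I (real i / real n)\<bar> <= u n / 2"
   have ex: "\<bar>increment n x l - (I (real (l + 1) / real n) - I (real l / real n))
    - (\<Sum>j | real l / real n < th j & th j <= real (l + 1) / real n. J j)\<bar> <= drift_const / real n" if l: "l < n" for l
   proof -
    have "0 <= real l / real n" "real l / real n <= real (l + 1) / real n" "real (l + 1) / real n <= 1"
    using l by (auto simp: divide_right_mono divide_le_eq)
    note increment_expansion[OF this]
    moreover have "real (l + 1) / real n - real l / real n = 1 / real n" by (simp add: diff_divide_distrib[symmetric])
    ultimately show ?thesis by (simp add: increment_def)
   qed
   have E: "exceedances (u n) n x = i ` {..<K}"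
   proof (intro set_eqI iffI)
    fix l assume "l : i ` {..<K}"
    then obtain k where k: "k < K" "l = i k" by auto
    have l: "l < n" using i k by simp
    have "\<bar>increment n x l - (I (real (l + 1) / real n) - I (real l / real n)) - J k\<bar> <= u n / 4"
    proof -
    have s: "(\<Sum>j | real l / real n < th j & th j <= real (l + 1) / real n. J j) = J k" unfolding jumps_in[OF k] by simp
    show ?thesis using order_trans[OF ex[OF l] D] unfolding s .
    qed
    moreover have "\<bar>I (real (l + 1) / real n) - I (real l / real n)\<bar> <= u n / 2" using G l by blast
    moreover have "2 * u n < \<bar>J k\<bar>" using J k by auto
    ultimately have "\<bar>increment n x l\<bar> >= u n" using un by linarith
    then show "l : exceedances (u n) n x" using l by (simp add: exceedances_def)
   next
    fix l assume a: "l : exceedances (u n) n x"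
    then have l: "l < n" "\<bar>increment n x l\<bar> >= u n" by (auto simp: exceedances_def)
    show "l : i ` {..<K}"
    proof (rule ccontr)
    assume nl: "l \<notin> i ` {..<K}"
    have "\<bar>increment n x l - (I (real (l + 1) / real n) - I (real l / real n))\<bar> <= u n / 4"
    proof -
    have s: "(\<Sum>j | real l / real n < th j & th j <= real (l + 1) / real n. J j) = 0" unfolding no_jumps[OF l(1) nl] by simp
    show ?thesis using order_trans[OF ex[OF l(1)] D] unfolding s diff_zero .
    qed
    moreover have "\<bar>I (real (l + 1) / real n) - I (real l / real n)\<bar> <= u n / 2" using G l by blast
    ultimately show False using un l(2) by linarith
    qed
   qed
   have est: "jump_estimator (u n) n x k = (if k < K then increment n x (i k) else 0)" for k
    by (rule jump_estimator_of_exceedances[OF E mono])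
   show "(\<forall>k\<ge>K. jump_estimator (u n) n x k = 0) &
    (ALL k<K. \<bar>jump_estimator (u n) n x k - J k - (I (th k) - I (grid_below n (th k))) - (I (grid_above n (th k)) - I (th k))\<bar>
    <= drift_const / real n)"
   proof (intro conjI allI impI)
    fix k assume k: "k < K"
    have "\<bar>increment n x (i k) - (I (grid_above n (th k)) - I (grid_below n (th k))) - J k\<bar> <= drift_const / real n"
    using ex[OF i(2)[OF k]] unfolding jumps_in[OF k refl] unfolding grid[OF k] by simp
    moreover have "jump_estimator (u n) n x k = increment n x (i k)" using est k by simp
    ultimately show "\<bar>jump_estimator (u n) n x k - J k - (I (th k) - I (grid_below n (th k))) - (I (grid_above n (th k)) - I (th k))\<bar>
    <= drift_const / real n" by linarith
   qed (use est in auto)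
  qed
 qed
qed

end

section \<open>Linearisation of the stochastic integral\<close>

lemma borel_measurable_completion_AE_cong:
 assumes g: "g : borel_measurable (completion M)" and ae: "AE om in completion M. f om = g om"
 shows "f : borel_measurable (completion M)"
proof -
 from ae obtain N where N: "N : null_sets (completion M)" "{om : space (completion M). f om ~= g om} \<subseteq> N"
  by (auto simp: eventually_ae_filter)
 show ?thesis
 proof (rule measurableI)
  fix A :: "'b set" assume A: "A : sets borel"
  have 1: "(f -` A Int space (completion M)) Int N : sets (completion M)"
   using null_sets_completion_subset[OF _ N(1), of "(f -` A Int space (completion M)) Int N"] by auto
  have 2: "g -` A Int space (completion M) - N : sets (completion M)"
   using measurable_sets[OF g A] N(1) by (intro sets.Diff) auto
  have "f -` A Int space (completion M) = (g -` A Int space (completion M) - N) Un ((f -` A Int space (completion M)) Int N)"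
   using N(2) by auto
  also have "... : sets (completion M)" using 1 2 by (rule sets.Un[rotated])
  finally show "f -` A Int space (completion M) : sets (completion M)" .
 qed simp
qed

lemma finite_initial_segment:
 assumes "finite {k::nat. p k}" and down: "\<And>j k. j <= k ==> p k ==> p j"
 shows "{k. p k} = {..<card {k. p k}}"
proof -
 define m where "m = (LEAST k. \<not> p k)"
 have "EX k. \<not> p k"
 proof (rule ccontr)
  assume "\<nexists>k. \<not> p k"
  then have "{k. p k} = UNIV" by auto
  then show False using assms(1) by simp
 qed
 then have m: "\<not> p m" unfolding m_def by (rule LeastI_ex)
 have "{k. p k} = {..<m}"
 proof (intro set_eqI iffI)
  fix k assume "k : {k. p k}"
  then show "k : {..<m}" using down[of m k] m by (metis lessThan_iff linorder_not_le mem_Collect_eq)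
 next
  fix k assume "k : {..<m}"
  then show "k : {k. p k}" using not_less_Least[of k "%k. \<not> p k"] by (simp add: m_def)
 qed
 then show ?thesis by simp
qed

text \<open>The square integral of the oscillation over a short interval.\<close>

lemma nn_integral_oscillation:
 fixes g :: "real => real"
 assumes SR: "S <= R" "R - S <= d" and e: "\<And>x. S < x ==> x < R ==> \<bar>g x - y\<bar> <= e"
 shows "(\<integral>\<^sup>+x\<in>{S<..R}. ennreal ((g x - y)\<^sup>2) \<partial>lborel) <= ennreal (e\<^sup>2 * d)"
proof -
 have "(\<integral>\<^sup>+x\<in>{S<..R}. ennreal ((g x - y)\<^sup>2) \<partial>lborel) <= (\<integral>\<^sup>+x. ennreal (e\<^sup>2) * indicator {S<..R} x \<partial>lborel)"
 proof (rule nn_integral_mono_AE)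
  have "AE x in lborel. x ~= R" by (rule AE_lborel_singleton)
  then show "AE x in lborel. ennreal ((g x - y)\<^sup>2) * indicator {S<..R} x <= ennreal (e\<^sup>2) * indicator {S<..R} x"
  proof eventually_elim
   case (elim x)
   show ?case
   proof (cases "x : {S<..R}")
    case True
    then have b: "\<bar>g x - y\<bar> <= e" using elim e[of x] by auto
    have "(g x - y)\<^sup>2 <= e\<^sup>2" using power_mono[OF b abs_ge_zero, of 2] by simp
    then show ?thesis using True by (simp add: ennreal_leI)
   qed simp
  qed
 qed
 also have "... = ennreal (e\<^sup>2) * ennreal (R - S)" using SR by (subst nn_integral_cmult_indicator) auto
 also have "... = ennreal (e\<^sup>2 * (R - S))" using SR by (simp add: ennreal_mult)
 also have "... <= ennreal (e\<^sup>2 * d)" using SR by (intro ennreal_leI mult_left_mono) auto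
 finally show ?thesis .
qed

text \<open>The setting of the theorem after the choice of versions; \<open>H\<close> is the diffusion coefficient along the path,
extended by its values at 0 and 1 outside \<open>[0, 1]\<close>.\<close>

locale jump_diffusion = mix_model M1 M2 W T \<Lambda> w M' U Nm Np + ito_model M1 M2 W T \<Lambda> H I m \<tau> \<xi>
 for M1 :: "'a measure" and M2 :: "'b measure" and W T \<Lambda> and w and M' :: "'e measure" and U Nm Np
  and H I m \<tau> \<xi> +
 fixes X :: "real => 'a \<times> 'b => real" and x0 :: real and a b c :: "real => real => real" and u :: "nat => real"
 assumes Xc: "\<And>om. om : space P ==> cadlag_on_unit (%t. X t om)"
  and XP: "\<And>t. t : {0..1} ==> X t : borel_measurable P"
  and ac: "continuous_on ({0..1} \<times> UNIV) (%(t, x). a t x)"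
  and bc: "continuous_on ({0..1} \<times> UNIV) (%(t, x). b t x)"
  and Ha: "\<And>s om. H s om = a (clamp01 s) (X (clamp01 s) om)"
  and Icont: "\<And>om. om : space P ==> continuous_on {0..1} (%t. I t om)"
  and sde: "AE om in P. \<forall>t\<in>{0..1}. X t om = x0 + (LINT s:{0..t}|lborel. b s (X s om)) + I t om +
    (\<Sum>k | T k (snd om) <= t. c (left_lim (%s. X s om) (T k (snd om))) (\<Lambda> k (snd om)))"
  and cnz: "AE om in P. ALL k<num_jumps T (snd om). c (left_lim (%s. X s om) (T k (snd om))) (\<Lambda> k (snd om)) ~= 0"
  and wW: "AE x in M1. \<forall>t\<in>{0..1}. w t x = W t x"
  and u_pos: "\<And>n. n >= 1 ==> u n > 0" and u_lim: "u ----> 0"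
  and u_slow: "(%n. 1 / (real n * u n)) ----> 0"
  and u_exp: "\<And>C. C > 0 ==> (%n. real n * exp (- (real n * (u n / 2)\<^sup>2 / C))) ----> 0"
begin

abbreviation jmp :: "nat => 'a \<times> 'b => real" where
 "jmp k om \<equiv> c (left_lim (%s. X s om) (T k (snd om))) (\<Lambda> k (snd om))"

lemma AE_times:
 "AE om in P. {k. T k (snd om) <= 1} = {..<num_jumps T (snd om)} &
  (ALL k<num_jumps T (snd om). 0 < T k (snd om) & T k (snd om) < 1) &
  (ALL k. Suc k < num_jumps T (snd om) --> T k (snd om) < T (Suc k) (snd om))"
proof (rule AE_P_snd)
 have "AE x in M2. incseq (%k. T k x)" "AE x in M2. finite {k. T k x <= 1}"
  "AE x in M2. (ALL k<num_jumps T x. 0 < T k x & T k x < 1) & (ALL k. Suc k < num_jumps T x --> T k x < T (Suc k) x)"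
  using jt unfolding jump_times_def by auto
 then show "AE x in M2. {k. T k x <= 1} = {..<num_jumps T x} & (ALL k<num_jumps T x. 0 < T k x & T k x < 1)
   & (ALL k. Suc k < num_jumps T x --> T k x < T (Suc k) x)"
 proof eventually_elim
  case (elim x)
  have "{k. T k x <= 1} = {..<num_jumps T x}"
   unfolding num_jumps_def by (rule finite_initial_segment[OF elim(2)]) (use elim(1) in \<open>auto simp: incseq_def intro: order_trans\<close>)
  then show ?case using elim(3) by blast
 qed
qed

lemma AE_path:
 "AE om in P. jump_path (%t. X t om) (%t. I t om) b (%k. T k (snd om)) (%k. jmp k om) (num_jumps T (snd om)) x0"
 using AE_times sde AE_space
proof eventually_elim
 case (elim om)
 show ?case
  by standard (use elim Xc[of om] bc Icont[of om] in auto)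
qed

lemma X_right_continuous:
 "om : space P ==> continuous (at_right t) (%t. X (clamp01 t) om)"
 by (rule clamp01_right_continuous) (use Xc[of om] in \<open>auto simp: cadlag_on_unit_def\<close>)

lemma X_at_measurable:
 assumes S: "S : borel_measurable P"
 shows "(%om. X (clamp01 (S om)) om) : borel_measurable P"
proof -
 have "(%(t, om). X (clamp01 t) om) : borel_measurable (borel \<Otimes>\<^sub>M P)"
  by (rule joint_measurable_right_continuous) (use XP X_right_continuous in auto)
 from measurable_Pair_compose_split[OF this S measurable_ident] show ?thesis by simp
qed

lemma I_at_measurable:
 assumes S: "S : borel_measurable P"
 shows "(%om. I (clamp01 (S om)) om) : borel_measurable P"
proof -
 have "(%(t, om). I (clamp01 t) om) : borel_measurable (borel \<Otimes>\<^sub>M P)"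
 proof (rule joint_measurable_right_continuous)
  show "I (clamp01 t) : borel_measurable P" for t using Il[of "clamp01 t"] by (simp add: tendsto_in_prob_def)
  fix om t assume w: "om : space P"
  show "continuous (at_right t) (%t. I (clamp01 t) om)"
  proof (rule clamp01_right_continuous)
   fix t :: real assume t: "0 <= t" "t < 1"
   have "continuous (at t within {0..1}) (%t. I t om)"
    using Icont[OF w] t by (auto simp: continuous_on_eq_continuous_within)
   then have "continuous (at t within {t..1}) (%t. I t om)"
    by (rule continuous_within_subset) (use t in auto)
   moreover have "at t within {t..1} = at_right t" using t by (intro at_within_Icc_at_right) auto
   ultimately show "continuous (at_right t) (%t. I t om)" by simp
  qed
 qed
 from measurable_Pair_compose_split[OF this S measurable_ident] show ?thesis by simp
qed

definition proper :: "nat => 'b => bool" where "proper k x \<longleftrightarrow> 0 < T k x & T k x < 1"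
text \<open>The \<open>k\<close>-th jump time where it is meaningful; the default value makes it a time in \<open>(0, 1)\<close> everywhere.\<close>

definition tj :: "nat => 'b => real" where "tj k x = (if proper k x then T k x else 1 / 2)"

lemma tj: "0 < tj k x" "tj k x < 1" by (auto simp: tj_def proper_def)

lemma proper_measurable [measurable]: "Measurable.pred M2 (proper k)" unfolding proper_def by measurable
lemma tj_measurable [measurable]: "tj k : borel_measurable M2" unfolding tj_def by measurable
lemma tj_P: "(%om. tj k (snd om)) : borel_measurable P" by (rule measurable_P_snd) simp

definition coef_left :: "nat => 'a \<times> 'b => real" where
 "coef_left k om = a (tj k (snd om)) (left_lim (%s. X s om) (tj k (snd om)))"
definition coef_right :: "nat => 'a \<times> 'b => real" where
 "coef_right k om = a (tj k (snd om)) (X (tj k (snd om)) om)"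

lemma X_left_measurable: "(%om. left_lim (%s. X s om) (tj k (snd om))) : borel_measurable P"
proof (rule borel_measurable_LIMSEQ_real)
 show "(%om. X (clamp01 (tj k (snd om) - 1 / real (Suc n))) om) : borel_measurable P" for n
  by (rule X_at_measurable) (use tj_P in measurable)
 fix om assume w: "om : space P"
 let ?t = "tj k (snd om)"
 have l: "((%s. X s om) \<longlongrightarrow> left_lim (%s. X s om) ?t) (at_left ?t)"
  using cadlag_left_limit[OF Xc[OF w], of ?t] tj[of k "snd om"] by auto
 have t0: "(%n. ?t - 1 / real (Suc n)) ----> ?t - 0" by (intro tendsto_intros LIMSEQ_Suc[OF lim_1_over_n])
 have "filterlim (%n. clamp01 (?t - 1 / real (Suc n))) (at_left ?t) sequentially"
  unfolding filterlim_at
 proof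
  have "(%n. clamp01 (?t - 1 / real (Suc n))) ----> clamp01 (?t - 0)" by (intro tendsto_intros t0)
  then show "(%n. clamp01 (?t - 1 / real (Suc n))) ----> ?t" using tj[of k "snd om"] by (simp add: max_def min_def)
  show "\<forall>\<^sub>F n in sequentially. clamp01 (?t - 1 / real (Suc n)) : {..<?t} & clamp01 (?t - 1 / real (Suc n)) ~= ?t"
  proof (intro always_eventually allI)
   fix n
   define d where "d = 1 / real (Suc n)"
   have "d > 0" by (simp add: d_def)
   then show "clamp01 (?t - 1 / real (Suc n)) : {..<?t} & clamp01 (?t - 1 / real (Suc n)) ~= ?t"
    unfolding d_def[symmetric] using tj[of k "snd om"] by (auto simp: max_def min_def)
  qed
 qed
 from filterlim_compose[OF l this]
 show "(%n. X (clamp01 (?t - 1 / real (Suc n))) om) ----> left_lim (%s. X s om) ?t" .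
qed

lemma X_tj_measurable: "(%om. X (tj k (snd om)) om) : borel_measurable P"
proof -
 have "clamp01 (tj k x) = tj k x" for x using tj[of k x] by simp
 then show ?thesis using X_at_measurable[OF tj_P[of k]] by simp
qed

lemma a_measurable: "(%(t, x). a (clamp01 t) x) : borel_measurable (borel \<Otimes>\<^sub>M borel)"
proof -
 have "continuous_on UNIV ((%(t, x). a t x) \<circ> (%z. (clamp01 (fst z), snd z)))"
  by (rule continuous_on_compose) (auto intro!: continuous_intros continuous_on_subset[OF ac])
 then have "continuous_on UNIV (%(t, x). a (clamp01 t) x)" by (simp add: o_def case_prod_beta')
 then show ?thesis unfolding borel_prod by (rule borel_measurable_continuous_onI)
qed

lemma coef_measurable [measurable]: "coef_left k : borel_measurable P" "coef_right k : borel_measurable P"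
proof -
 have e: "clamp01 (tj k x) = tj k x" for x using tj[of k x] by simp
 show "coef_left k : borel_measurable P"
  using measurable_Pair_compose_split[OF a_measurable tj_P[of k] X_left_measurable[of k]] by (simp add: coef_left_def[abs_def] e)
 show "coef_right k : borel_measurable P"
  using measurable_Pair_compose_split[OF a_measurable tj_P[of k] X_tj_measurable[of k]] by (simp add: coef_right_def[abs_def] e)
qed

lemma H_left_limit:
 assumes w: "om : space P"
 shows "((%s. H s om) \<longlongrightarrow> coef_left k om) (at_left (tj k (snd om)))"
 unfolding Ha coef_left_def
proof (rule tendsto_along_path[OF ac])
 let ?t = "tj k (snd om)"
 show "?t : {0..1}" using tj[of k "snd om"] by simp
 have ev: "\<forall>\<^sub>F s in at_left ?t. s = clamp01 s"
  unfolding eventually_at_left_field by (rule exI[of _ 0]) (use tj[of k "snd om"] in auto)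
 have l: "((%s. X s om) \<longlongrightarrow> left_lim (%s. X s om) ?t) (at_left ?t)"
  using cadlag_left_limit[OF Xc[OF w], of ?t] tj[of k "snd om"] by auto
 show "((%s. X (clamp01 s) om) \<longlongrightarrow> left_lim (%s. X s om) ?t) (at_left ?t)"
  by (rule Lim_transform_eventually[OF l]) (use ev in eventually_elim, simp)
 have "((%s. s) \<longlongrightarrow> ?t) (at_left ?t)" by (rule tendsto_ident_at)
 then show "((%s. clamp01 s) \<longlongrightarrow> ?t) (at_left ?t)"
  by (rule Lim_transform_eventually) (use ev in eventually_elim, simp)
qed simp

lemma H_tj: "H (tj k (snd om)) om = coef_right k om"
 using tj[of k "snd om"] by (simp add: Ha coef_right_def)

lemma H_right_limit:
 assumes w: "om : space P"
 shows "((%s. H s om) \<longlongrightarrow> coef_right k om) (at_right (tj k (snd om)))"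
 using Hrc[OF w, of "tj k (snd om)"] tj[of k "snd om"] H_tj[of k om] by (simp add: continuous_within)

definition below :: "nat => nat => 'a \<times> 'b => real" where
 "below k n om = (if n = 0 then tj k (snd om) else grid_below n (tj k (snd om)))"
definition above :: "nat => nat => 'a \<times> 'b => real" where
 "above k n om = (if n = 0 then tj k (snd om) else grid_above n (tj k (snd om)))"

lemma below_above:
 "0 <= below k n om" "below k n om <= tj k (snd om)" "tj k (snd om) <= above k n om" "above k n om <= 1"
 "n >= 1 ==> tj k (snd om) - below k n om <= 1 / real n" "n >= 1 ==> above k n om - tj k (snd om) <= 1 / real n"
 "n >= 1 ==> below k n om < tj k (snd om)"
 using tj[of k "snd om"] grid_unit[of n "tj k (snd om)"] grid_bounds[of n "tj k (snd om)"]
 by (auto simp: below_def above_def)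

lemma times_F0:
 "(%om. tj k (snd om)) : borel_measurable (F 0)" "below k n : borel_measurable (F 0)" "above k n : borel_measurable (F 0)"
proof -
 have [measurable]: "(%om. T k (snd om)) : borel_measurable (F 0)" by (rule T_measurable_F) simp
 show [measurable]: "(%om. tj k (snd om)) : borel_measurable (F 0)" unfolding tj_def proper_def by measurable
 show "below k n : borel_measurable (F 0)" "above k n : borel_measurable (F 0)"
  unfolding below_def[abs_def] above_def[abs_def] by measurable
qed

lemma times_P [measurable]: "below k n : borel_measurable P" "above k n : borel_measurable P"
 by (rule F_measurable_P[of 0], simp, rule times_F0)+

text \<open>By the existence of left limits \<open>H\<close> oscillates little on the part before the jump; the jump time itself is a
null set.\<close>

lemma small_left:
 assumes w: "om : space P" and d: "\<delta> > 0"
 shows "eventually (%n. (\<integral>\<^sup>+x\<in>{below k n om<..tj k (snd om)}. ennreal ((H x om - H (below k n om) om)\<^sup>2) \<partial>lborel)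
  < ennreal (\<delta> / real n)) sequentially"
proof -
 let ?t = "tj k (snd om)"
 define e where "e = sqrt (\<delta> / 2)"
 have e: "e > 0" "e\<^sup>2 = \<delta> / 2" using d by (auto simp: e_def)
 have "\<forall>\<^sub>F s in at_left ?t. dist (H s om) (coef_left k om) < e / 2" using H_left_limit[OF w] e by (intro tendstoD) auto
 then obtain l where l: "l < ?t" "\<And>s. l < s ==> s < ?t ==> \<bar>H s om - coef_left k om\<bar> < e / 2"
  unfolding eventually_at_left_field dist_real_def by metis
 have "(%n. 1 / real n) ----> 0" by (rule lim_1_over_n)
 then have "\<forall>\<^sub>F n in sequentially. 1 / real n < ?t - l" by (rule order_tendstoD) (use l in simp)
 with eventually_ge_at_top[of 1] show ?thesis
 proof eventually_elim
  case (elim n)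
  have b: "l < below k n om" "below k n om < ?t" using below_above(5,7)[OF elim(1), of k om] elim(2) by linarith+
  have "(\<integral>\<^sup>+x\<in>{below k n om<..?t}. ennreal ((H x om - H (below k n om) om)\<^sup>2) \<partial>lborel) <= ennreal (e\<^sup>2 * (1 / real n))"
  proof (rule nn_integral_oscillation)
   fix x assume x: "below k n om < x" "x < ?t"
   show "\<bar>H x om - H (below k n om) om\<bar> <= e"
    using l(2)[of x] l(2)[of "below k n om"] x b by linarith
  qed (use below_above(5)[OF elim(1), of k om] b in auto)
  also have "... < ennreal (\<delta> / real n)" using e d elim(1) by (intro ennreal_lessI) (auto simp: field_simps)
  finally show ?case .
 qed
qed

lemma small_right:
 assumes w: "om : space P" and d: "\<delta> > 0"
 shows "eventually (%n. (\<integral>\<^sup>+x\<in>{tj k (snd om)<..above k n om}. ennreal ((H x om - H (tj k (snd om)) om)\<^sup>2) \<partial>lborel)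
  < ennreal (\<delta> / real n)) sequentially"
proof -
 let ?t = "tj k (snd om)"
 define e where "e = sqrt (\<delta> / 2)"
 have e: "e > 0" "e\<^sup>2 = \<delta> / 2" using d by (auto simp: e_def)
 have "\<forall>\<^sub>F s in at_right ?t. dist (H s om) (coef_right k om) < e" using H_right_limit[OF w] e by (intro tendstoD) auto
 then obtain l where l: "l > ?t" "\<And>s. ?t < s ==> s < l ==> \<bar>H s om - coef_right k om\<bar> < e"
  unfolding eventually_at_right_field dist_real_def by metis
 have "(%n. 1 / real n) ----> 0" by (rule lim_1_over_n)
 then have "\<forall>\<^sub>F n in sequentially. 1 / real n < l - ?t" by (rule order_tendstoD) (use l in simp)
 with eventually_ge_at_top[of 1] show ?thesis
 proof eventually_elim
  case (elim n)
  have "(\<integral>\<^sup>+x\<in>{?t<..above k n om}. ennreal ((H x om - H ?t om)\<^sup>2) \<partial>lborel) <= ennreal (e\<^sup>2 * (1 / real n))"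
  proof (rule nn_integral_oscillation)
   fix x assume x: "?t < x" "x < above k n om"
   then show "\<bar>H x om - H ?t om\<bar> <= e" unfolding H_tj
    using l(2)[of x] below_above(6)[OF elim(1), of k om] elim(2) by linarith
  qed (use below_above(3)[of k om n] below_above(6)[OF elim(1), of k om] in auto)
  also have "... < ennreal (\<delta> / real n)" using e d elim(1) by (intro ennreal_lessI) (auto simp: field_simps)
  finally show ?case .
 qed
qed

lemma AE_wW: "AE om in P. \<forall>t\<in>{0..1}. w t (fst om) = W t (fst om)"
 using wW by (rule AE_P_fst)

lemma w_at_P:
 assumes "S : borel_measurable P"
 shows "(%om. w (S om) (fst om)) : borel_measurable P"
 by (rule w_at_measurable[OF assms]) (rule measurable_P_fst, simp)

lemma I_times: "(%om. I (tj k (snd om)) om) : borel_measurable P" "(%om. I (below k n om) om) : borel_measurable P"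
 "(%om. I (above k n om) om) : borel_measurable P"
proof -
 have e: "clamp01 (tj k (snd om)) = tj k (snd om)" "clamp01 (below k n om) = below k n om" "clamp01 (above k n om) = above k n om" for om
  using tj[of k "snd om"] below_above(1,2,4)[of k n om] below_above(3)[of k om n] by auto
 show "(%om. I (tj k (snd om)) om) : borel_measurable P" "(%om. I (below k n om) om) : borel_measurable P"
 "(%om. I (above k n om) om) : borel_measurable P"
  using I_at_measurable[OF tj_P[of k]] I_at_measurable[OF times_P(1)[of k n]] I_at_measurable[OF times_P(2)[of k n]]
  unfolding e by auto
qed

definition err_left :: "nat => nat => 'a \<times> 'b => real" where
 "err_left k n om = sqrt (real n) * \<bar>I (tj k (snd om)) om - I (below k n om) om
  - H (below k n om) om * (w (tj k (snd om)) (fst om) - w (below k n om) (fst om))\<bar>"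
definition err_right :: "nat => nat => 'a \<times> 'b => real" where
 "err_right k n om = sqrt (real n) * \<bar>I (above k n om) om - I (tj k (snd om)) om
  - H (tj k (snd om)) om * (w (above k n om) (fst om) - w (tj k (snd om)) (fst om))\<bar>"

lemma err_measurable [measurable]: "err_left k n : borel_measurable P" "err_right k n : borel_measurable P"
proof -
 note [measurable] = I_times H_at_measurable[OF times_P(1)] H_at_measurable[OF tj_P] w_at_P[OF tj_P] w_at_P[OF times_P(1)] w_at_P[OF times_P(2)]
 show "err_left k n : borel_measurable P" "err_right k n : borel_measurable P"
  unfolding err_left_def[abs_def] err_right_def[abs_def] by measurable
qed

lemma err_left_tendsto_0:
 assumes e: "e > 0"
 shows "(%n. P.prob {om : space P. err_left k n om > e}) ----> 0"
proof (rule local_error_tendsto_0[where S="below k" and R="%_ om. tj k (snd om)", OF _ _ _ _ _ e])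
 show "AE om in P. om : {om : space P. err_left k n om > e} -->
  e < sqrt (real n) * \<bar>I (tj k (snd om)) om - I (below k n om) om - H (below k n om) om * (Wp (tj k (snd om)) om - Wp (below k n om) om)\<bar>" for n
  using AE_wW
 proof eventually_elim
  case (elim om)
  then show ?case using below_above(1,2)[of k n om] tj[of k "snd om"] by (simp add: err_left_def)
 qed
 show "AE om in P. \<forall>\<^sub>F n in sequentially. (\<integral>\<^sup>+x\<in>{below k n om<..tj k (snd om)}. ennreal ((H x om - H (below k n om) om)\<^sup>2) \<partial>lborel) < ennreal (\<delta> / real n)"
  if d: "0 < \<delta>" for \<delta>
  using AE_space by eventually_elim (rule small_left[OF _ d])
qed (use times_F0 below_above[of k] tj[of k] in \<open>auto simp: less_imp_le\<close>)

lemma err_right_tendsto_0: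
 assumes e: "e > 0"
 shows "(%n. P.prob {om : space P. err_right k n om > e}) ----> 0"
proof (rule local_error_tendsto_0[where R="above k" and S="%_ om. tj k (snd om)", OF _ _ _ _ _ e])
 show "AE om in P. om : {om : space P. err_right k n om > e} -->
  e < sqrt (real n) * \<bar>I (above k n om) om - I (tj k (snd om)) om - H (tj k (snd om)) om * (Wp (above k n om) om - Wp (tj k (snd om)) om)\<bar>" for n
  using AE_wW
 proof eventually_elim
  case (elim om)
  then show ?case using below_above(3)[of k om n] below_above(4)[of k n om] tj[of k "snd om"] by (simp add: err_right_def)
 qed
 show "AE om in P. \<forall>\<^sub>F n in sequentially. (\<integral>\<^sup>+x\<in>{tj k (snd om)<..above k n om}. ennreal ((H x om - H (tj k (snd om)) om)\<^sup>2) \<partial>lborel) < ennreal (\<delta> / real n)"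
  if d: "0 < \<delta>" for \<delta>
  using AE_space by eventually_elim (rule small_right[OF _ d])
qed (use times_F0 below_above[of k] tj[of k] in \<open>auto simp: less_imp_le\<close>)

end

section \<open>The remainder vanishes\<close>

lemma nat_valued_tail:
 fixes N :: "'z => nat"
 assumes "prob_space M" and N [measurable]: "N : measurable M (count_space UNIV)" and e: "e > 0"
 shows "EX m. \<forall>m'\<ge>m. measure M {om : space M. N om >= m'} < e"
proof -
 interpret prob_space M by fact
 have "(%om. real (N om)) : borel_measurable M" by measurable
 from tail_tendsto_0[OF assms(1) this e] obtain R where R: "prob {om : space M. \<bar>real (N om)\<bar> > R} < e" by blast
 obtain m where m: "R < real m" using reals_Archimedean2 by blast
 have "prob {om : space M. N om >= m'} <= prob {om : space M. \<bar>real (N om)\<bar> > R}" if "m' >= m" for m'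
  using m that by (intro finite_measure_mono) auto
 then show ?thesis using R by (intro exI[of _ m]) (auto intro: le_less_trans)
qed

lemma integral_partition_error:
 fixes N :: "'z => nat" and h :: "'z => real"
 assumes "prob_space M" and N [measurable]: "N : measurable M (count_space UNIV)" and h [measurable]: "h : borel_measurable M"
  and b: "\<And>om. \<bar>h om\<bar> <= C"
 shows "\<bar>(\<integral>om. h om \<partial>M) - (\<Sum>kp<m. \<integral>om. indicator {om : space M. N om = kp} om * h om \<partial>M)\<bar>
  <= C * measure M {om : space M. N om >= m}"
proof -
 interpret prob_space M by fact
 have C0: "C >= 0" using b[of undefined] by linarith
 have hi: "integrable M h" using b by (intro integrable_const_bound[where B=C]) auto
 have ii: "integrable M (%om. indicator {om : space M. N om = kp} om * h om)" for kp
  using b C0 by (intro integrable_const_bound[where B=C]) (auto simp: indicator_def)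
 have isum: "integrable M (%om. \<Sum>kp<m. indicator {om : space M. N om = kp} om * h om)"
  by (rule Bochner_Integration.integrable_sum) (rule ii)
 have "(\<Sum>kp<m. \<integral>om. indicator {om : space M. N om = kp} om * h om \<partial>M)
  = (\<integral>om. (\<Sum>kp<m. indicator {om : space M. N om = kp} om * h om) \<partial>M)"
  by (rule Bochner_Integration.integral_sum[symmetric]) (rule ii)
 then have "\<bar>(\<integral>om. h om \<partial>M) - (\<Sum>kp<m. \<integral>om. indicator {om : space M. N om = kp} om * h om \<partial>M)\<bar>
  = \<bar>\<integral>om. h om - (\<Sum>kp<m. indicator {om : space M. N om = kp} om * h om) \<partial>M\<bar>"
  using Bochner_Integration.integral_diff[OF hi isum] by (simp only:)
 also have "... <= (\<integral>om. C * indicator {om : space M. N om >= m} om \<partial>M)"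
 proof (rule abs_integral_le[OF Bochner_Integration.integrable_diff[OF hi isum]])
  show "integrable M (%om. C * indicator {om : space M. N om >= m} om)"
   by (intro integrable_mult_right integrable_real_indicator) (auto simp: emeasure_eq_measure)
  fix om assume w: "om : space M"
  have "(\<Sum>kp<m. indicator {om : space M. N om = kp} om * h om) = (\<Sum>kp<m. if N om = kp then h om else 0)"
   using w by (intro sum.cong) (auto simp: indicator_def)
  also have "... = (if N om < m then h om else 0)" by (simp add: sum.delta')
  finally show "\<bar>h om - (\<Sum>kp<m. indicator {om : space M. N om = kp} om * h om)\<bar> <= C * indicator {om : space M. N om >= m} om"
   using b[of om] w C0 by (simp add: indicator_def)
 qed
 also have "... = C * prob {om : space M. N om >= m}" by simp
 finally show ?thesis .
qed

lemma tendsto_integral_partition: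
 fixes N :: "'w => nat" and N' :: "'v => nat" and f :: "nat => 'w => real" and g :: "'v => real"
 assumes M: "prob_space M" and Q: "prob_space Q"
  and N: "N : measurable M (count_space UNIV)" and N': "N' : measurable Q (count_space UNIV)"
  and f: "\<And>n. f n : borel_measurable M" "\<And>n om. \<bar>f n om\<bar> <= C" and g: "g : borel_measurable Q" "\<And>om. \<bar>g om\<bar> <= C"
  and lim: "\<And>kp. (%n. \<integral>om. indicator {om : space M. N om = kp} om * f n om \<partial>M) ----> (\<integral>om. indicator {om : space Q. N' om = kp} om * g om \<partial>Q)"
 shows "(%n. \<integral>om. f n om \<partial>M) ----> (\<integral>om. g om \<partial>Q)"
proof (rule LIMSEQ_I)
 have C0: "C >= 0" using g(2)[of undefined] by linarith
 fix e :: real assume e: "e > 0"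
 define d where "d = e / (4 * (C + 1))"
 have d: "d > 0" "C * d <= e / 4" using e C0 by (auto simp: d_def field_simps)
 obtain m1 m2 where m1: "\<And>m'. m' >= m1 ==> measure M {om : space M. N om >= m'} < d"
  and m2: "\<And>m'. m' >= m2 ==> measure Q {om : space Q. N' om >= m'} < d"
  using nat_valued_tail[OF M N d(1)] nat_valued_tail[OF Q N' d(1)] by blast
 define m where "m = max m1 m2"
 have b1: "\<bar>(\<integral>om. f n om \<partial>M) - (\<Sum>kp<m. \<integral>om. indicator {om : space M. N om = kp} om * f n om \<partial>M)\<bar> <= e / 4" for n
 proof -
  have "C * measure M {om : space M. N om >= m} <= C * d" using m1[of m] C0 by (intro mult_left_mono) (auto simp: m_def)
  then show ?thesis using integral_partition_error[OF M N f, of n m] d(2) by linarith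
 qed
 have b2: "\<bar>(\<integral>om. g om \<partial>Q) - (\<Sum>kp<m. \<integral>om. indicator {om : space Q. N' om = kp} om * g om \<partial>Q)\<bar> <= e / 4"
 proof -
  have "C * measure Q {om : space Q. N' om >= m} <= C * d" using m2[of m] C0 by (intro mult_left_mono) (auto simp: m_def)
  then show ?thesis using integral_partition_error[OF Q N' g, of m] d(2) by linarith
 qed
 have "(%n. \<Sum>kp<m. \<integral>om. indicator {om : space M. N om = kp} om * f n om \<partial>M) ----> (\<Sum>kp<m. \<integral>om. indicator {om : space Q. N' om = kp} om * g om \<partial>Q)"
  by (intro tendsto_sum lim)
 from LIMSEQ_D[OF this, of "e / 4"] e obtain n0 where n0: "\<And>n. n >= n0 ==>
  \<bar>(\<Sum>kp<m. \<integral>om. indicator {om : space M. N om = kp} om * f n om \<partial>M) - (\<Sum>kp<m. \<integral>om. indicator {om : space Q. N' om = kp} om * g om \<partial>Q)\<bar> < e / 4"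
  by auto
 have "norm ((\<integral>om. f n om \<partial>M) - (\<integral>om. g om \<partial>Q)) < e" if "n >= n0" for n
  using b1[of n] b2 n0[OF that] e unfolding real_norm_def by linarith
 then show "EX n0. \<forall>n\<ge>n0. norm ((\<integral>om. f n om \<partial>M) - (\<integral>om. g om \<partial>Q)) < e" by blast
qed

context jump_diffusion
begin

definition scaled_error :: "nat => nat => 'a \<times> 'b => real" where
 "scaled_error n k om = sqrt (real n) * (jump_estimator (u n) n (%t. X t om) k - jump_size T X k om)"

definition leading :: "nat => nat => nat => 'a \<times> 'b => real" where
 "leading kp n k om = (if k < kp then coef_left k om * xis n kp om (0, k) + coef_right k om * xis n kp om (1, k) else 0)"

abbreviation cyl :: "nat => ('a \<times> 'b) set" where "cyl kp \<equiv> space M1 \<times> jump_set kp"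

lemma cyl_P [measurable]: "cyl kp : sets P" unfolding model_measure_def by (intro sets_completionI_sets) auto

lemma cyl_eq: "cyl kp = {om : space P. num_jumps T (snd om) = kp}"
 by (auto simp: jump_set_def space_P)

lemma num_jumps_P [measurable]: "(%om. num_jumps T (snd om)) : measurable P (count_space UNIV)"
 by (rule measurable_P_snd) simp

lemma xis_P [measurable]: "(%om. xis n kp om j) : borel_measurable P"
 by (rule measurable_P_prod) simp

lemma AE_proper: "AE om in P. ALL k<num_jumps T (snd om). proper k (snd om) & tj k (snd om) = T k (snd om)"
 using AE_times by eventually_elim (auto simp: proper_def tj_def)

lemma measurable_P_AE_cong:
 "g : borel_measurable P ==> (AE om in P. f om = g om) ==> f : borel_measurable P"
 unfolding model_measure_def by (rule borel_measurable_completion_AE_cong)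

lemma jump_size_measurable: "jump_size T X k : borel_measurable P"
proof (rule measurable_P_AE_cong)
 note [measurable] = X_tj_measurable X_left_measurable
 show "(%om. if k < num_jumps T (snd om) then X (tj k (snd om)) om - left_lim (%s. X s om) (tj k (snd om)) else 0) : borel_measurable P"
  by measurable
 show "AE om in P. jump_size T X k om = (if k < num_jumps T (snd om) then X (tj k (snd om)) om - left_lim (%s. X s om) (tj k (snd om)) else 0)"
  using AE_proper by eventually_elim (simp add: jump_size_def)
qed

lemma scaled_error_measurable [measurable]: "scaled_error n k : borel_measurable P"
proof -
 note [measurable] = jump_size_measurable
 have [measurable]: "(%om. jump_estimator (u n) n (%t. X t om) k) : borel_measurable P" by (rule jump_estimator_measurable[OF XP])
 show ?thesis unfolding scaled_error_def[abs_def] by measurable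
qed

lemma leading_measurable [measurable]: "leading kp n k : borel_measurable P"
 unfolding leading_def[abs_def] by measurable

lemma limit_var_measurable: "limit_var T a X U Nm Np k : borel_measurable (P \<Otimes>\<^sub>M M')"
proof -
 define A where "A om = (if k < num_jumps T (snd om) then a (T k (snd om)) (left_lim (%s. X s om) (T k (snd om))) else 0)" for om
 define B where "B om = (if k < num_jumps T (snd om) then a (T k (snd om)) (X (T k (snd om)) om) else 0)" for om
 have [measurable]: "A : borel_measurable P"
 proof (rule measurable_P_AE_cong)
  show "(%om. if k < num_jumps T (snd om) then coef_left k om else 0) : borel_measurable P" by measurable
  show "AE om in P. A om = (if k < num_jumps T (snd om) then coef_left k om else 0)"
   using AE_proper by eventually_elim (simp add: A_def coef_left_def)
 qed
 have [measurable]: "B : borel_measurable P"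
 proof (rule measurable_P_AE_cong)
  show "(%om. if k < num_jumps T (snd om) then coef_right k om else 0) : borel_measurable P" by measurable
  show "AE om in P. B om = (if k < num_jumps T (snd om) then coef_right k om else 0)"
   using AE_proper by eventually_elim (simp add: B_def coef_right_def)
 qed
 have "limit_var T a X U Nm Np k = (%z. sqrt (U k (snd z)) * A (fst z) * Nm k (snd z) + sqrt (1 - U k (snd z)) * B (fst z) * Np k (snd z))"
  by (rule HOL.ext) (auto simp: limit_var_def A_def B_def Let_def split: prod.split)
 then show ?thesis by simp
qed

lemma P_measure_eq: "A : sets P0 ==> P.prob A = measure P0 A"
 unfolding model_measure_def by simp

lemma xis_tail_P:
 assumes R: "R > 0"
 shows "P.prob {om : space P. \<bar>xis n kp om j\<bar> > R} <= 1 / R\<^sup>2"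
proof (cases "j : sides kp")
 case True
 have s: "{om : space P. \<bar>xis n kp om j\<bar> > R} = {om : space P0. \<bar>xis n kp om j\<bar> > R}" by (simp add: space_P space_pair_measure)
 have "{om : space P0. \<bar>xis n kp om j\<bar> > R} : sets P0" by measurable
 then show ?thesis unfolding s using xis_tail[OF R True] by (simp add: P_measure_eq)
next
 case False
 then have s: "{om : space P. \<bar>xis n kp om j\<bar> > R} = {}" using R by (auto simp: xis_def xi_def vec_def)
 show ?thesis unfolding s by simp
qed

lemma coefficient_error_tendsto_0:
 assumes e: "e > 0"
 shows "(%n. P.prob {om : space P. \<bar>(H (below k n om) om - coef_left k om) * xis n kp om j\<bar> > e}) ----> 0"
proof (rule LIMSEQ_I)
 fix r :: real assume r: "r > 0"
 define R where "R = 2 / sqrt r"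
 have R: "R > 0" "1 / R\<^sup>2 = r / 4" using r by (auto simp: R_def power_divide)
 have [measurable]: "(%om. H (below k n om) om) : borel_measurable P" for n by (rule H_at_measurable[OF times_P(1)])
 define F where "F n = {om : space P. \<bar>H (below k n om) om - coef_left k om\<bar> > e / R}" for n
 have F [measurable]: "F n : sets P" for n unfolding F_def by measurable
 have "(%n. P.prob (F n)) ----> 0"
 proof (rule measure_tendsto_0_of_eventually[where D="%_. {}"])
  show "finite_measure P" by (rule P.finite_measure)
  show "AE om in P. \<forall>\<^sub>F n in sequentially. om : F n --> om : {}"
   using AE_space
  proof eventually_elim
   case (elim om)
   let ?t = "tj k (snd om)"
   have "\<forall>\<^sub>F s in at_left ?t. dist (H s om) (coef_left k om) < e / R" using H_left_limit[OF elim] e R by (intro tendstoD) auto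
   then obtain l where l: "l < ?t" "\<And>s. l < s ==> s < ?t ==> \<bar>H s om - coef_left k om\<bar> < e / R"
    unfolding eventually_at_left_field dist_real_def by metis
   have "(%n. 1 / real n) ----> 0" by (rule lim_1_over_n)
   then have "\<forall>\<^sub>F n in sequentially. 1 / real n < ?t - l" by (rule order_tendstoD) (use l in simp)
   with eventually_ge_at_top[of 1] show ?case
   proof eventually_elim
    case (elim n)
    have "l < below k n om" "below k n om < ?t" using below_above(5,7)[OF elim(1), of k om] elim(2) by linarith+
    from l(2)[OF this] show ?case by (simp add: F_def)
   qed
  qed
 qed auto
 from LIMSEQ_D[OF this, of "r / 2"] r obtain n0 where n0: "\<And>n. n >= n0 ==> P.prob (F n) < r / 2" by auto
 have "P.prob {om : space P. \<bar>(H (below k n om) om - coef_left k om) * xis n kp om j\<bar> > e} < r" if n: "n >= n0" for n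
 proof -
  let ?X = "{om : space P. \<bar>xis n kp om j\<bar> > R}"
  have sub: "{om : space P. \<bar>(H (below k n om) om - coef_left k om) * xis n kp om j\<bar> > e} \<subseteq> ?X Un F n"
  proof
   fix om assume w: "om : {om : space P. \<bar>(H (below k n om) om - coef_left k om) * xis n kp om j\<bar> > e}"
   show "om : ?X Un F n"
   proof (rule ccontr)
    assume "om \<notin> ?X Un F n"
    then have "\<bar>xis n kp om j\<bar> <= R" "\<bar>H (below k n om) om - coef_left k om\<bar> <= e / R" using w by (auto simp: F_def)
    then have "\<bar>H (below k n om) om - coef_left k om\<bar> * \<bar>xis n kp om j\<bar> <= e / R * R"
    using e R by (intro mult_mono) auto
    then show False using w R(1) by (simp add: abs_mult)
   qed
  qed
  have "P.prob {om : space P. \<bar>(H (below k n om) om - coef_left k om) * xis n kp om j\<bar> > e} <= P.prob (?X Un F n)"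
   by (rule P.finite_measure_mono[OF sub]) measurable
  also have "... <= P.prob ?X + P.prob (F n)" by (rule measure_Un_le) measurable
  finally show ?thesis using xis_tail_P[OF R(1), of n kp j] R(2) n0[OF n] r by linarith
 qed
 then show "EX n0. \<forall>n\<ge>n0. norm (P.prob {om : space P. \<bar>(H (below k n om) om - coef_left k om) * xis n kp om j\<bar> > e} - 0) < r"
  by (intro exI[of _ n0]) auto
qed

text \<open>Outside the four exceptional events the expansion of the estimator holds and each of the error terms is at most
\<open>e / 4\<close>, the drift contributing less than \<open>e / 4\<close> for large \<open>n\<close>.\<close>

lemma remainder_tendsto_0:
 assumes e: "e > 0"
 shows "(%n. P.prob (cyl kp Int {om : space P. \<bar>scaled_error n k om - leading kp n k om\<bar> > e})) ----> 0"
proof -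
 define G where "G n = {om : space P. EX i<n. \<bar>I (real (i + 1) / real n) om - I (real i / real n) om\<bar> > u n / 2}" for n
 define B1 where "B1 n = {om : space P. err_left k n om > e / 4}" for n
 define B2 where "B2 n = {om : space P. err_right k n om > e / 4}" for n
 define B3 where "B3 n = {om : space P. \<bar>(H (below k n om) om - coef_left k om) * xis n kp om (0, k)\<bar> > e / 4}" for n
 have e4: "e / 4 > 0" using e by simp
 have half: "0 < u n / 2" if "n >= 1" for n using u_pos[OF that] by simp
 have G1: "G n : sets P" for n
  unfolding G_def by (rule increments_below_threshold(1)[OF half u_exp])
 have G2: "(%n. P.prob (G n)) ----> 0"
  unfolding G_def[abs_def] by (rule increments_below_threshold(2)[OF half u_exp])
 have [measurable]: "(%om. H (below k n om) om) : borel_measurable P" for n by (rule H_at_measurable[OF times_P(1)])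
 have B: "B1 n : sets P" "B2 n : sets P" "B3 n : sets P" for n unfolding B1_def B2_def B3_def by measurable
 note [measurable] = G1 B
 show ?thesis
 proof (rule measure_tendsto_0_of_eventually[where D="%n. ((G n Un B1 n) Un B2 n) Un B3 n"])
  show "finite_measure P" by (rule P.finite_measure)
  have "(%n. ((P.prob (G n) + P.prob (B1 n)) + P.prob (B2 n)) + P.prob (B3 n)) ----> ((0 + 0) + 0) + 0"
   unfolding B1_def B2_def B3_def
   by (intro tendsto_add G2 err_left_tendsto_0[OF e4] err_right_tendsto_0[OF e4] coefficient_error_tendsto_0[OF e4])
  then have s: "(%n. ((P.prob (G n) + P.prob (B1 n)) + P.prob (B2 n)) + P.prob (B3 n)) ----> 0" by simp
  have le: "P.prob (((G n Un B1 n) Un B2 n) Un B3 n) <= ((P.prob (G n) + P.prob (B1 n)) + P.prob (B2 n)) + P.prob (B3 n)" for n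
  proof -
   have "P.prob (((G n Un B1 n) Un B2 n) Un B3 n) <= P.prob ((G n Un B1 n) Un B2 n) + P.prob (B3 n)" by (rule measure_Un_le) measurable
   moreover have "P.prob ((G n Un B1 n) Un B2 n) <= P.prob (G n Un B1 n) + P.prob (B2 n)" by (rule measure_Un_le) measurable
   moreover have "P.prob (G n Un B1 n) <= P.prob (G n) + P.prob (B1 n)" by (rule measure_Un_le) measurable
   ultimately show ?thesis by linarith
  qed
  show "(%n. P.prob (((G n Un B1 n) Un B2 n) Un B3 n)) ----> 0"
   by (rule tendsto_sandwich[OF _ _ tendsto_const s]) (use le in auto)
  have "AE om in P. snd om : jump_set kp --> eventually (%n. snd om : sep_set n kp) sequentially"
   by (rule AE_P_snd[OF eventually_separated])
  with AE_path cnz AE_space AE_proper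
  show "AE om in P. \<forall>\<^sub>F n in sequentially. om : cyl kp Int {om : space P. \<bar>scaled_error n k om - leading kp n k om\<bar> > e} -->
    om : ((G n Un B1 n) Un B2 n) Un B3 n"
  proof eventually_elim
   case (elim om)
   note path = elim(1) and nz = elim(2) and w = elim(3) and proper = elim(4) and ev_sep = elim(5)
   show ?case
   proof (cases "om : cyl kp")
    case False
    then show ?thesis by simp
   next
    case True
    then have K: "num_jumps T (snd om) = kp" and js: "snd om : jump_set kp" by (auto simp: jump_set_def)
    interpret path: jump_path "%t. X t om" "%t. I t om" b "%k. T k (snd om)" "%k. jmp k om" kp x0
    using path unfolding K .
    define B where "B = path.drift_const"
    have nz': "ALL k<kp. jmp k om ~= 0" using nz K by simp
    have ev: "\<forall>\<^sub>F n in sequentially. (ALL i<n. \<bar>I (real (i + 1) / real n) om - I (real i / real n) om\<bar> <= u n / 2) -->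
    (\<forall>k\<ge>kp. jump_estimator (u n) n (%t. X t om) k = 0) &
    (ALL k<kp. \<bar>jump_estimator (u n) n (%t. X t om) k - jmp k om
    - (I (T k (snd om)) om - I (grid_below n (T k (snd om))) om)
    - (I (grid_above n (T k (snd om))) om - I (T k (snd om)) om)\<bar> <= B / real n)"
    unfolding B_def by (rule path.estimator_expansion[OF nz' u_pos u_lim u_slow])
    have "(%n. B * (sqrt (real n) / real n)) ----> B * 0" by (intro tendsto_intros) real_asymp
    then have "\<forall>\<^sub>F n in sequentially. B * (sqrt (real n) / real n) < e / 4" by (rule order_tendstoD(2)) (use e in simp)
    with ev eventually_ge_at_top[of 1] ev_sep[rule_format, OF js]
    show ?thesis
    proof eventually_elim
    case (elim n)
    note exp = elim(1) and n = elim(2) and sep = elim(3) and small = elim(4)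
    show ?case
    proof (rule impI, rule ccontr)
    assume E: "om : cyl kp Int {om : space P. \<bar>scaled_error n k om - leading kp n k om\<bar> > e}"
    and nD: "om \<notin> ((G n Un B1 n) Un B2 n) Un B3 n"
    have big: "\<bar>scaled_error n k om - leading kp n k om\<bar> > e" using E by simp
    have "ALL i<n. \<bar>I (real (i + 1) / real n) om - I (real i / real n) om\<bar> <= u n / 2"
    using nD w unfolding G_def not_less[symmetric] by blast
    note exp = exp[rule_format, OF this[rule_format]]
    show False
    proof (cases "k < kp")
    case False
    then have "scaled_error n k om = 0" using exp K by (simp add: scaled_error_def jump_size_def)
    then show False using False big e by (simp add: leading_def)
    next
    case True
    have tk: "tj k (snd om) = T k (snd om)" using proper K True by simp
    define t where "t = T k (snd om)"
    define s where "s = sqrt (real n)"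
    have s: "s > 0" using n by (simp add: s_def)
    define L where "L = I t om - I (grid_below n t) om"
    define R where "R = I (grid_above n t) om - I t om"
    define dl where "dl = w t (fst om) - w (grid_below n t) (fst om)"
    define dr where "dr = w (grid_above n t) (fst om) - w t (fst om)"
    define Hb where "Hb = H (grid_below n t) om"
    define est where "est = jump_estimator (u n) n (%t. X t om) k"
    have bl: "below k n om = grid_below n t" "above k n om = grid_above n t"
    using n tk by (auto simp: below_def above_def t_def)
    have J: "jump_size T X k om = jmp k om" using path.jump_at[OF True] True K by (simp add: jump_size_def)
    have V: "scaled_error n k om = s * (est - jmp k om)" by (simp add: scaled_error_def s_def est_def J)
    have x0: "xis n kp om (0, k) = s * dl" and x1: "xis n kp om (1, k) = s * dr"
    using sep True by (auto simp: xis_def xi_def vec_def sides_def left_end_def right_end_def s_def dl_def dr_def t_def)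
    have "\<bar>est - jmp k om - L - R\<bar> <= B / real n"
    using exp True by (simp add: est_def L_def R_def t_def)
    then have "s * \<bar>est - jmp k om - L - R\<bar> <= s * (B / real n)" using s by (intro mult_left_mono) auto
    also have "... = B * (sqrt (real n) / real n)" by (simp add: s_def)
    finally have i1: "s * \<bar>est - jmp k om - L - R\<bar> < e / 4" by (rule order_le_less_trans[OF _ small])
    have i2: "s * \<bar>L - Hb * dl\<bar> <= e / 4"
    proof -
    have "err_left k n om <= e / 4" using nD w unfolding B1_def not_less[symmetric] by blast
    then show ?thesis by (simp only: err_left_def bl tk L_def Hb_def dl_def t_def s_def)
    qed
    have Ht: "H t om = coef_right k om" using H_tj[of k om] by (simp add: tk t_def)
    have i3: "s * \<bar>R - coef_right k om * dr\<bar> <= e / 4"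
    proof -
    have "err_right k n om <= e / 4" using nD w unfolding B2_def not_less[symmetric] by blast
    then show ?thesis unfolding Ht[symmetric] by (simp only: err_right_def bl tk R_def dr_def t_def s_def)
    qed
    have i4: "\<bar>(Hb - coef_left k om) * (s * dl)\<bar> <= e / 4"
    proof -
    have "\<bar>(H (below k n om) om - coef_left k om) * xis n kp om (0, k)\<bar> <= e / 4"
    using nD w unfolding B3_def not_less[symmetric] by blast
    then show ?thesis unfolding bl x0 Hb_def .
    qed
    have "scaled_error n k om - leading kp n k om = s * (est - jmp k om - L - R) + s * (L - Hb * dl) + s * (R - coef_right k om * dr)
    + (Hb - coef_left k om) * (s * dl)"
    using True unfolding leading_def V x0 x1 by (simp add: algebra_simps)
    moreover have "\<bar>s * y\<bar> = s * \<bar>y\<bar>" for y using s by (simp add: abs_mult)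
    then have "\<bar>s * (est - jmp k om - L - R)\<bar> < e / 4" "\<bar>s * (L - Hb * dl)\<bar> <= e / 4"
    "\<bar>s * (R - coef_right k om * dr)\<bar> <= e / 4" using i1 i2 i3 by simp_all
    ultimately show False using big i4 by linarith
    qed
    qed
    qed
   qed
  qed
 qed measurable
qed

lemma mixing_P:
 assumes cont: "continuous_on UNIV ph" and bd: "\<And>x. \<bar>ph x\<bar> <= C" and A: "A : sets P"
 shows "(%n. \<integral>om. indicator (A Int cyl kp) om * ph (xis n kp om) \<partial>P)
  ----> P.prob (A Int cyl kp) * (\<integral>y. ph (lim_vec kp (%k. U k y) y) \<partial>M')"
proof -
 obtain S N N' where S: "A = S Un N" "N \<subseteq> N'" "N' : null_sets P0" "S : sets P0"
  using A unfolding model_measure_def by (rule sets_completionE)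
 have "AE om in P. om \<notin> N'" using AE_completion[OF AE_not_in[OF S(3)]] unfolding model_measure_def .
 then have ae: "AE om in P. om : A Int cyl kp \<longleftrightarrow> om : S Int cyl kp" by eventually_elim (use S in auto)
 have SP: "S Int cyl kp : sets P0" "S Int cyl kp : sets P" using S(4) cyl_P by (auto simp: model_measure_def)
 have pm: "(%om. ph (xis n kp om)) : borel_measurable P0" "(%om. ph (xis n kp om)) : borel_measurable P" for n
  by (rule borel_measurable_continuous_vector[OF cont]; simp)+
 have "(\<integral>om. indicator (A Int cyl kp) om * ph (xis n kp om) \<partial>P) = (\<integral>om. indicator (S Int cyl kp) om * ph (xis n kp om) \<partial>P0)" for n
 proof -
  have "(\<integral>om. indicator (A Int cyl kp) om * ph (xis n kp om) \<partial>P) = (\<integral>om. indicator (S Int cyl kp) om * ph (xis n kp om) \<partial>P)"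
  proof (rule integral_cong_AE)
   show "AE om in P. indicator (A Int cyl kp) om * ph (xis n kp om) = indicator (S Int cyl kp) om * ph (xis n kp om)"
    using ae by eventually_elim (simp add: indicator_def)
   show "(%om. indicator (A Int cyl kp) om * ph (xis n kp om)) : borel_measurable P"
    "(%om. indicator (S Int cyl kp) om * ph (xis n kp om)) : borel_measurable P"
    by (intro borel_measurable_times borel_measurable_indicator pm(2) sets.Int A cyl_P SP(2))+
  qed
  also have "... = (\<integral>om. indicator (S Int cyl kp) om * ph (xis n kp om) \<partial>P0)"
   unfolding model_measure_def by (intro integral_completion borel_measurable_times borel_measurable_indicator pm(1) SP(1))
  finally show ?thesis .
 qed
 moreover have "P.prob (A Int cyl kp) = measure P0 (S Int cyl kp)"
 proof -
  have "P.prob (A Int cyl kp) = P.prob (S Int cyl kp)" using A SP ae by (intro P.finite_measure_eq_AE) auto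
  then show ?thesis using P_measure_eq[OF SP(1)] by simp
 qed
 ultimately show ?thesis using increments_mixing[OF cont bd S(4), of kp] by simp
qed

end

section \<open>Stable convergence\<close>

lemma slutsky_difference:
 fixes \<Psi> :: "('i::countable => real) => real" and v v' :: "nat => 'w => 'i => real"
 assumes M: "prob_space M" and D [measurable]: "D : sets M" and J: "finite J"
  and cont: "continuous_on UNIV \<Psi>" and bd: "\<And>x. \<bar>\<Psi> x\<bar> <= C"
  and vm: "\<And>n i. (%om. v n om i) : borel_measurable M" "\<And>n i. (%om. v' n om i) : borel_measurable M"
  and supp: "\<And>n om i. i \<notin> J ==> v n om i = 0 & v' n om i = 0"
  and tight: "\<And>e. e > 0 ==> EX R. ALL n. \<forall>i\<in>J. measure M (D Int {om : space M. \<bar>v n om i\<bar> > R}) <= e"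
  and close: "\<And>d i. d > 0 ==> i : J ==> (%n. measure M (D Int {om : space M. \<bar>v n om i - v' n om i\<bar> > d})) ----> 0"
 shows "(%n. (\<integral>om. indicator D om * \<Psi> (v n om) \<partial>M) - (\<integral>om. indicator D om * \<Psi> (v' n om) \<partial>M)) ----> 0"
proof (rule LIMSEQ_I)
 interpret prob_space M by fact
 fix e :: real assume e: "e > 0"
 have C0: "C >= 0" using bd[of undefined] by linarith
 define K where "K = 2 * C * real (card J) + 1"
 have K: "K > 0" "2 * C * real (card J) <= K" using C0 by (auto simp: K_def add_nonneg_pos)
 have "e / (4 * K) > 0" "e / 4 > 0" using e K by auto
 from tight[OF this(1)] obtain R where R: "\<And>n i. i : J ==> measure M (D Int {om : space M. \<bar>v n om i\<bar> > R}) <= e / (4 * K)" by blast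
 from continuous_vector_L1_close[OF cont bd \<open>e / 4 > 0\<close> J, of R]
 obtain d where d: "d > 0" and dd: "\<forall>(M :: 'w measure) D (v :: 'w => 'i => real) v'. prob_space M --> D : sets M -->
  (ALL i. (%om. v om i) : borel_measurable M) --> (ALL i. (%om. v' om i) : borel_measurable M) -->
  (ALL om i. i \<notin> J --> v om i = 0 & v' om i = 0) -->
  (\<integral>om. indicator D om * \<bar>\<Psi> (v om) - \<Psi> (v' om)\<bar> \<partial>M) <= e / 4 + 2 * C * (\<Sum>i\<in>J.
    measure M (D Int {om : space M. \<bar>v om i\<bar> > R}) + measure M (D Int {om : space M. \<bar>v om i - v' om i\<bar> > d}))"
  by (elim exE conjE)
 define q where "q n = (\<Sum>i\<in>J. measure M (D Int {om : space M. \<bar>v n om i - v' n om i\<bar> > d}))" for n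
 have "(%n. 2 * C * q n) ----> 2 * C * (\<Sum>i\<in>J. 0)"
  unfolding q_def by (intro tendsto_mult tendsto_const tendsto_sum close d)
 then have "\<forall>\<^sub>F n in sequentially. 2 * C * q n < e / 4" by (intro order_tendstoD(2)) (use e in auto)
 then obtain n0 where n0: "\<And>n. n >= n0 ==> 2 * C * q n < e / 4" unfolding eventually_sequentially by blast
 have "norm ((\<integral>om. indicator D om * \<Psi> (v n om) \<partial>M) - (\<integral>om. indicator D om * \<Psi> (v' n om) \<partial>M) - 0) < e" if n: "n >= n0" for n
 proof -
  have pm [measurable]: "(%om. \<Psi> (v n om)) : borel_measurable M" "(%om. \<Psi> (v' n om)) : borel_measurable M"
   by (rule borel_measurable_continuous_vector[OF cont] vm)+
  have i1: "integrable M (%om. indicator D om * \<Psi> (v n om))" "integrable M (%om. indicator D om * \<Psi> (v' n om))"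
   using bd C0 by (auto intro!: integrable_const_bound[where B=C] simp: indicator_def)
  have i2: "integrable M (%om. indicator D om * \<bar>\<Psi> (v n om) - \<Psi> (v' n om)\<bar>)"
  proof (rule integrable_const_bound[where B="2 * C"])
   have "\<bar>\<Psi> (v n om) - \<Psi> (v' n om)\<bar> <= 2 * C" for om using bd[of "v n om"] bd[of "v' n om"] by linarith
   then show "AE om in M. norm (indicator D om * \<bar>\<Psi> (v n om) - \<Psi> (v' n om)\<bar>) <= 2 * C" using C0 by (auto simp: indicator_def)
  qed measurable
  have "\<bar>(\<integral>om. indicator D om * \<Psi> (v n om) \<partial>M) - (\<integral>om. indicator D om * \<Psi> (v' n om) \<partial>M)\<bar>
   = \<bar>\<integral>om. indicator D om * \<Psi> (v n om) - indicator D om * \<Psi> (v' n om) \<partial>M\<bar>" using i1 by simp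
  also have "... <= (\<integral>om. indicator D om * \<bar>\<Psi> (v n om) - \<Psi> (v' n om)\<bar> \<partial>M)"
   by (rule abs_integral_le[OF Bochner_Integration.integrable_diff[OF i1] i2]) (auto simp: indicator_def)
  also have "... <= e / 4 + 2 * C * (\<Sum>i\<in>J. measure M (D Int {om : space M. \<bar>v n om i\<bar> > R}) + measure M (D Int {om : space M. \<bar>v n om i - v' n om i\<bar> > d}))"
   by (rule dd[rule_format]) (use M D vm supp in auto)
  also have "... = e / 4 + 2 * C * (\<Sum>i\<in>J. measure M (D Int {om : space M. \<bar>v n om i\<bar> > R})) + 2 * C * q n"
   by (simp add: q_def sum.distrib distrib_left)
  also have "2 * C * (\<Sum>i\<in>J. measure M (D Int {om : space M. \<bar>v n om i\<bar> > R})) <= 2 * C * (real (card J) * (e / (4 * K)))"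
   using C0 R by (intro mult_left_mono sum_bounded_above) auto
  also have "... = 2 * C * real (card J) * (e / (4 * K))" by simp
  also have "... <= K * (e / (4 * K))" using K e by (intro mult_right_mono) auto
  also have "... = e / 4" using K by simp
  finally show ?thesis using n0[OF n] e by simp
 qed
 then show "EX n0. \<forall>n\<ge>n0. norm ((\<integral>om. indicator D om * \<Psi> (v n om) \<partial>M) - (\<integral>om. indicator D om * \<Psi> (v' n om) \<partial>M) - 0) < e" by blast
qed

text \<open>Coordinates \<open>(0, k)\<close> and \<open>(1, k)\<close> hold the normalised increments, \<open>(2, k)\<close> and \<open>(3, k)\<close> the coefficients before and
after the jump, and \<open>(5, k)\<close> the remainder; \<open>(4, 0)\<close> will hold the variable of the stable convergence.\<close>

definition assemble :: "nat => nat => (nat \<times> nat => real) => real" where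
 "assemble kp k z = (if k < kp then z (2, k) * z (0, k) + z (3, k) * z (1, k) else 0) + z (5, k)"

lemma continuous_assemble: "continuous_on UNIV (assemble kp k)"
proof (cases "k < kp")
 case True
 have "continuous_on UNIV (%z :: nat \<times> nat => real. z (2, k) * z (0, k) + z (3, k) * z (1, k) + z (5, k))"
  by (intro continuous_intros continuous_on_product_coordinates)
 then show ?thesis using True by (simp add: assemble_def[abs_def])
next
 case False
 then show ?thesis by (simp add: assemble_def[abs_def] continuous_on_product_coordinates)
qed

locale test_function =
 fixes K :: "nat set" and f :: "(nat => real) \<times> real => real" and C :: real
 assumes K: "finite K"
  and f: "continuous_map (prod_topology (product_topology (%_. euclideanreal) K) euclideanreal) euclideanreal f"
  and fb: "\<And>x y. \<bar>f (\<lambda>k\<in>K. x k, y)\<bar> <= C"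
begin

definition psi :: "nat => (nat \<times> nat => real) => real" where
 "psi kp z = f (\<lambda>k\<in>K. assemble kp k z, z (4, 0))"

lemma psi_continuous: "continuous_on UNIV (psi kp)"
proof -
 have c: "continuous_map euclidean euclideanreal (assemble kp k)" for k
  unfolding continuous_map_iff_continuous2 by (rule continuous_assemble)
 have c2: "continuous_map euclidean euclideanreal (%z :: nat \<times> nat => real. z (4, 0))"
  unfolding continuous_map_iff_continuous2 by (rule continuous_on_product_coordinates)
 have "continuous_map euclidean (product_topology (%_. euclideanreal) K) (%z. \<lambda>k\<in>K. assemble kp k z)"
  unfolding continuous_map_componentwise
 proof (intro conjI ballI)
  show "(%z. \<lambda>k\<in>K. assemble kp k z) ` topspace euclidean \<subseteq> extensional K" by auto
  fix k assume "k : K"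
  then show "continuous_map euclidean euclideanreal (%z. (\<lambda>k\<in>K. assemble kp k z) k)" using c[of k] by simp
 qed
 then have "continuous_map euclidean (prod_topology (product_topology (%_. euclideanreal) K) euclideanreal)
  (%z. (\<lambda>k\<in>K. assemble kp k z, z (4, 0)))"
  by (rule continuous_map_pairedI[OF _ c2])
 from continuous_map_compose[OF this f] show ?thesis
  unfolding continuous_map_iff_continuous2 by (simp add: psi_def[abs_def] o_def)
qed

lemma psi_bound: "\<bar>psi kp z\<bar> <= C" unfolding psi_def by (rule fb)

lemma test_measurable:
 assumes L: "\<And>k. L k : borel_measurable N" and y: "y : borel_measurable N"
 shows "(%om. f (\<lambda>k\<in>K. L k om, y om)) : borel_measurable N"
proof -
 define v where "v om j = (if fst j = 5 then L (snd j) om else if j = (4, 0) then y om else (0 :: real))" for om and j :: "nat \<times> nat"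
 have "(%om. v om j) : borel_measurable N" for j
  unfolding v_def using L y by (cases "fst j = 5"; cases "j = (4, 0)") auto
 then have "(%om. psi 0 (v om)) : borel_measurable N" by (rule borel_measurable_continuous_vector[OF psi_continuous])
 moreover have "psi 0 (v om) = f (\<lambda>k\<in>K. L k om, y om)" for om
  by (simp add: psi_def assemble_def v_def)
 ultimately show ?thesis by simp
qed

end

context jump_diffusion
begin

lemma xis_outside: "j \<notin> sides kp ==> xis n kp om j = 0" "j \<notin> sides kp ==> lim_vec kp v y j = 0"
 by (auto simp: xis_def xi_def vec_def lim_vec_def)

lemma lim_vec_measurable: "(%y. lim_vec kp (%k. U k y) y j) : borel_measurable M'"
 unfolding lim_vec_def by measurable

definition frozen :: "nat => ('a \<times> 'b => real) => 'a \<times> 'b => nat \<times> nat => real" where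
 "frozen kp Y om j = (if fst j = 2 & snd j < kp then coef_left (snd j) om
  else if fst j = 3 & snd j < kp then coef_right (snd j) om else if j = (4, 0) then Y om else 0)"

definition remainder :: "nat => nat set => nat => 'a \<times> 'b => nat \<times> nat => real" where
 "remainder kp K n om j = (if fst j = 5 & snd j : K then scaled_error n (snd j) om - leading kp n (snd j) om else 0)"

definition frozen_index :: "nat => (nat \<times> nat) set" where "frozen_index kp = {2, 3} \<times> {..<kp} Un {(4, 0)}"

lemma frozen_outside: "j \<notin> frozen_index kp ==> frozen kp Y om j = 0"
 by (cases j) (auto simp: frozen_def frozen_index_def)

lemma frozen_measurable: "Y : borel_measurable P ==> (%om. frozen kp Y om j) : borel_measurable P"
 unfolding frozen_def by (cases "fst j = 2 & snd j < kp"; cases "fst j = 3 & snd j < kp"; cases "j = (4, 0)") auto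

lemma remainder_measurable: "(%om. remainder kp K n om j) : borel_measurable P"
 unfolding remainder_def by (cases "fst j = 5 & snd j : K") auto

lemma xis_tight:
 assumes e: "e > 0"
 shows "EX R0. \<forall>R\<ge>R0. ALL n. ALL j. P.prob (D Int {om : space P. \<bar>xis n kp om j\<bar> > R}) <= e"
proof (intro exI[of _ "1 / sqrt e"] allI impI)
 fix R n j assume R: "R >= 1 / sqrt e"
 have R0: "R > 0" using R e by (smt (verit) divide_pos_pos real_sqrt_gt_zero)
 have "1 / e = (1 / sqrt e)\<^sup>2" using e by (simp add: power_divide)
 also have "... <= R\<^sup>2" using R e by (intro power_mono) auto
 finally have "1 / R\<^sup>2 <= e" using e R0 by (simp add: field_simps)
 moreover have "P.prob (D Int {om : space P. \<bar>xis n kp om j\<bar> > R}) <= P.prob {om : space P. \<bar>xis n kp om j\<bar> > R}"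
  by (rule P.finite_measure_mono) auto
 ultimately show "P.prob (D Int {om : space P. \<bar>xis n kp om j\<bar> > R}) <= e" using xis_tail_P[OF R0, of n kp j] by linarith
qed

lemma frozen_tight:
 assumes Y: "Y : borel_measurable P" and e: "e > 0"
 shows "EX R0. \<forall>R\<ge>R0. \<forall>j\<in>frozen_index kp. P.prob {om : space P. \<bar>frozen kp Y om j\<bar> > R} <= e"
proof -
 have fin: "finite (frozen_index kp)" by (simp add: frozen_index_def)
 define h where "h om = (\<Sum>j\<in>frozen_index kp. \<bar>frozen kp Y om j\<bar>)" for om
 note [measurable] = frozen_measurable[OF Y]
 have hm [measurable]: "h : borel_measurable P" unfolding h_def by measurable
 from tail_tendsto_0[OF P.prob_space_axioms hm e] obtain R0 where R0: "P.prob {om : space P. \<bar>h om\<bar> > R0} < e" by blast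
 have "P.prob {om : space P. \<bar>frozen kp Y om j\<bar> > R} <= e" if R: "R >= R0" and j: "j : frozen_index kp" for R j
 proof -
  have "\<bar>frozen kp Y om j\<bar> <= \<bar>h om\<bar>" for om
  proof -
   have "\<bar>frozen kp Y om j\<bar> <= h om" unfolding h_def by (rule member_le_sum[OF j _ fin]) auto
   then show ?thesis by linarith
  qed
  then have "{om : space P. \<bar>frozen kp Y om j\<bar> > R} \<subseteq> {om : space P. \<bar>h om\<bar> > R0}"
   using R by (auto intro: le_less_trans less_le_trans)
  then have "P.prob {om : space P. \<bar>frozen kp Y om j\<bar> > R} <= P.prob {om : space P. \<bar>h om\<bar> > R0}"
   by (rule P.finite_measure_mono) measurable
  then show ?thesis using R0 by linarith
 qed
 then show ?thesis by blast
qed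

lemma convergence_given_num_jumps:
 assumes tf: "test_function K f C" and Y [measurable]: "Y : borel_measurable P"
 shows "(%n. \<integral>om. indicator (cyl kp) om * f (\<lambda>k\<in>K. scaled_error n k om, Y om) \<partial>P)
  ----> (\<integral>z. indicator (cyl kp) (fst z) * f (\<lambda>k\<in>K. limit_var T a X U Nm Np k z, Y (fst z)) \<partial>(P \<Otimes>\<^sub>M M'))"
proof -
 interpret test_function K f C by fact
 define v where "v n om i = xis n kp om i + frozen kp Y om i" for n om i
 define v' where "v' n om i = v n om i + remainder kp K n om i" for n om i
 define J where "J = sides kp Un frozen_index kp Un {5} \<times> K"
 have finF: "finite (frozen_index kp)" by (simp add: frozen_index_def)
 have J: "finite J" using K finF by (simp add: J_def)
 have disj: "sides kp Int frozen_index kp = {}" by (auto simp: sides_def frozen_index_def)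
 note [measurable] = frozen_measurable[OF Y] remainder_measurable
 have vm: "(%om. v n om i) : borel_measurable P" "(%om. v' n om i) : borel_measurable P" for n i
  unfolding v_def v'_def by measurable
 have full: "psi kp (v' n om) = f (\<lambda>k\<in>K. scaled_error n k om, Y om)" for n om
 proof -
  have "assemble kp k (v' n om) = scaled_error n k om" if "k : K" for k
   using that xis_outside(1)[of "(2, k)" kp] xis_outside(1)[of "(3, k)" kp] xis_outside(1)[of "(5, k)" kp]
   by (simp add: assemble_def v'_def v_def frozen_def remainder_def leading_def sides_def)
  moreover have "v' n om (4, 0) = Y om"
   using xis_outside(1)[of "(4, 0)" kp] by (simp add: v'_def v_def frozen_def remainder_def sides_def)
  ultimately show ?thesis unfolding psi_def by (simp cong: restrict_cong)
 qed
 have diff: "(%n. (\<integral>om. indicator (cyl kp) om * psi kp (v n om) \<partial>P) - (\<integral>om. indicator (cyl kp) om * psi kp (v' n om) \<partial>P)) ----> 0"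
 proof (rule slutsky_difference[OF P.prob_space_axioms cyl_P J psi_continuous psi_bound vm])
  fix n om i assume "i \<notin> J"
  then show "v n om i = 0 & v' n om i = 0"
   using xis_outside(1)[of i kp n om] frozen_outside[of i kp Y om]
   by (cases i) (auto simp: J_def v_def v'_def remainder_def)
 next
  fix e :: real assume e: "e > 0"
  obtain R1 where R1: "\<And>R n j. R >= R1 ==> P.prob (cyl kp Int {om : space P. \<bar>xis n kp om j\<bar> > R}) <= e"
   using xis_tight[OF e, of "cyl kp" kp] by blast
  obtain R2 where R2: "\<And>R j. R >= R2 ==> j : frozen_index kp ==> P.prob {om : space P. \<bar>frozen kp Y om j\<bar> > R} <= e"
   using frozen_tight[OF Y e, of kp] by blast
  define R where "R = max 0 (max R1 R2)"
  show "EX R. ALL n. \<forall>i\<in>J. P.prob (cyl kp Int {om : space P. \<bar>v n om i\<bar> > R}) <= e"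
  proof (intro exI[of _ R] allI ballI)
   fix n i assume "i : J"
   show "P.prob (cyl kp Int {om : space P. \<bar>v n om i\<bar> > R}) <= e"
   proof (cases "i : frozen_index kp")
    case True
    then have "i \<notin> sides kp" using disj by blast
    then have "v n om i = frozen kp Y om i" for om by (simp add: v_def xis_outside)
    then have "P.prob (cyl kp Int {om : space P. \<bar>v n om i\<bar> > R}) <= P.prob {om : space P. \<bar>frozen kp Y om i\<bar> > R}"
    by (intro P.finite_measure_mono) auto
    moreover have "R >= R2" by (simp add: R_def)
    ultimately show ?thesis using R2[OF _ True, of R] by linarith
   next
    case False
    then have "v n om i = xis n kp om i" for om by (simp add: v_def frozen_outside)
    then show ?thesis using R1[of R n i] by (simp add: R_def)
   qed
  qed
 next
  fix d :: real and i assume d: "d > 0" and i: "i : J"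
  show "(%n. P.prob (cyl kp Int {om : space P. \<bar>v n om i - v' n om i\<bar> > d})) ----> 0"
  proof (cases "fst i = 5 & snd i : K")
   case True
   have "\<bar>v n om i - v' n om i\<bar> = \<bar>scaled_error n (snd i) om - leading kp n (snd i) om\<bar>" for n om
    using True by (simp add: v'_def remainder_def)
   then show ?thesis using remainder_tendsto_0[OF d, of kp "snd i"] by simp
  next
   case False
   then have "\<bar>v n om i - v' n om i\<bar> = 0" for n om by (auto simp: v'_def remainder_def)
   then show ?thesis using d by simp
  qed
 qed
 have "(%n. \<integral>om. indicator (cyl kp) om * psi kp (%i. xis n kp om i + frozen kp Y om i) \<partial>P) ---->
  (\<integral>z. indicator (cyl kp) (fst z) * psi kp (%i. lim_vec kp (%k. U k (snd z)) (snd z) i + frozen kp Y (fst z) i) \<partial>(P \<Otimes>\<^sub>M M'))"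
 proof (rule stable_from_mixing[OF P.prob_space_axioms M'.prob_space_axioms finite_sides finF disj _ _ lim_vec_measurable _ _ _ cyl_P _ _ psi_continuous psi_bound])
  show "EX R0. \<forall>R\<ge>R0. ALL n. \<forall>i\<in>sides kp. P.prob (cyl kp Int {om : space P. \<bar>xis n kp om i\<bar> > R}) <= e" if "e > 0" for e
   using xis_tight[OF that, of "cyl kp" kp] by blast
  show "(%n. \<integral>om. indicator (A Int cyl kp) om * ph (xis n kp om) \<partial>P) ----> P.prob (A Int cyl kp) * (\<integral>om. ph (lim_vec kp (%k. U k om) om) \<partial>M')"
   if "A : sets P" "continuous_on UNIV ph" "\<And>x. \<bar>ph x\<bar> <= C'" for A ph C'
   by (rule mixing_P[OF that(2,3,1)])
 qed (use xis_outside frozen_outside in auto)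
 then have lim: "(%n. \<integral>om. indicator (cyl kp) om * psi kp (v n om) \<partial>P) ---->
  (\<integral>z. indicator (cyl kp) (fst z) * psi kp (%i. lim_vec kp (%k. U k (snd z)) (snd z) i + frozen kp Y (fst z) i) \<partial>(P \<Otimes>\<^sub>M M'))"
  by (simp add: v_def[abs_def])
 have rhs: "(\<integral>z. indicator (cyl kp) (fst z) * psi kp (%i. lim_vec kp (%k. U k (snd z)) (snd z) i + frozen kp Y (fst z) i) \<partial>(P \<Otimes>\<^sub>M M'))
  = (\<integral>z. indicator (cyl kp) (fst z) * f (\<lambda>k\<in>K. limit_var T a X U Nm Np k z, Y (fst z)) \<partial>(P \<Otimes>\<^sub>M M'))"
 proof (rule integral_cong_AE)
  have im: "(%z. indicator (cyl kp) (fst z) :: real) : borel_measurable (P \<Otimes>\<^sub>M M')"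
   by (rule measurable_compose[OF measurable_fst]) simp
  have lm [measurable]: "(%z. lim_vec kp (%k. U k (snd z)) (snd z) i) : borel_measurable (P \<Otimes>\<^sub>M M')" for i
   using measurable_compose[OF measurable_snd lim_vec_measurable] .
  have fm [measurable]: "(%z. frozen kp Y (fst z) i) : borel_measurable (P \<Otimes>\<^sub>M M')" for i
   using measurable_compose[OF measurable_fst frozen_measurable[OF Y]] .
  have Ym: "(%z. Y (fst z)) : borel_measurable (P \<Otimes>\<^sub>M M')" by measurable
  show "(%z. indicator (cyl kp) (fst z) * psi kp (%i. lim_vec kp (%k. U k (snd z)) (snd z) i + frozen kp Y (fst z) i)) : borel_measurable (P \<Otimes>\<^sub>M M')"
   by (intro borel_measurable_times im borel_measurable_continuous_vector[OF psi_continuous]) measurable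
  show "(%z. indicator (cyl kp) (fst z) * f (\<lambda>k\<in>K. limit_var T a X U Nm Np k z, Y (fst z))) : borel_measurable (P \<Otimes>\<^sub>M M')"
   by (intro borel_measurable_times im test_measurable limit_var_measurable Ym)
  show "AE z in P \<Otimes>\<^sub>M M'. indicator (cyl kp) (fst z) * psi kp (%i. lim_vec kp (%k. U k (snd z)) (snd z) i + frozen kp Y (fst z) i)
   = indicator (cyl kp) (fst z) * f (\<lambda>k\<in>K. limit_var T a X U Nm Np k z, Y (fst z))"
   using AE_pair_fst[OF M'.sigma_finite_measure_axioms AE_proper]
  proof eventually_elim
   case (elim z)
   show ?case
   proof (cases "fst z : cyl kp")
    case True
    then have n: "num_jumps T (snd (fst z)) = kp" by (auto simp: jump_set_def)
    define v where "v i = lim_vec kp (%k. U k (snd z)) (snd z) i + frozen kp Y (fst z) i" for i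
    have "assemble kp k v = limit_var T a X U Nm Np k z" for k
    proof (cases "k < kp")
    case True
    then have "tj k (snd (fst z)) = T k (snd (fst z))" using elim n by simp
    then show ?thesis using True n
    by (cases z) (simp add: assemble_def v_def lim_vec_def frozen_def sides_def limit_var_def coef_left_def coef_right_def Let_def mult_ac)
    next
    case False
    then show ?thesis using n by (cases z) (simp add: assemble_def v_def lim_vec_def frozen_def sides_def limit_var_def)
    qed
    moreover have "v (4, 0) = Y (fst z)" by (simp add: v_def lim_vec_def frozen_def sides_def)
    ultimately have "psi kp v = f (\<lambda>k\<in>K. limit_var T a X U Nm Np k z, Y (fst z))" by (simp add: psi_def)
    then show ?thesis by (simp add: v_def[abs_def])
   qed simp
  qed
 qed
 have "(%n. (\<integral>om. indicator (cyl kp) om * psi kp (v n om) \<partial>P) - ((\<integral>om. indicator (cyl kp) om * psi kp (v n om) \<partial>P)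
   - (\<integral>om. indicator (cyl kp) om * psi kp (v' n om) \<partial>P)))
  ----> (\<integral>z. indicator (cyl kp) (fst z) * f (\<lambda>k\<in>K. limit_var T a X U Nm Np k z, Y (fst z)) \<partial>(P \<Otimes>\<^sub>M M')) - 0"
  by (rule tendsto_diff[OF lim[unfolded rhs] diff])
 then show ?thesis by (simp add: full)
qed

lemma stable_convergence:
 assumes tf: "test_function K f C" and Y [measurable]: "Y : borel_measurable P"
 shows "(%n. \<integral>om. f (\<lambda>k\<in>K. scaled_error n k om, Y om) \<partial>P)
  ----> (\<integral>z. f (\<lambda>k\<in>K. limit_var T a X U Nm Np k z, Y (fst z)) \<partial>(P \<Otimes>\<^sub>M M'))"
proof (rule tendsto_integral_partition[where N="%om. num_jumps T (snd om)" and N'="%z. num_jumps T (snd (fst z))" and C=C])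
 interpret test_function K f C by fact
 interpret PM: pair_prob_space P M' ..
 show "prob_space P" by (rule P.prob_space_axioms)
 show "prob_space (P \<Otimes>\<^sub>M M')" by (rule PM.prob_space_axioms)
 show "(%z. num_jumps T (snd (fst z))) : measurable (P \<Otimes>\<^sub>M M') (count_space UNIV)"
  by (rule measurable_compose[OF measurable_fst num_jumps_P])
 show "(%om. f (\<lambda>k\<in>K. scaled_error n k om, Y om)) : borel_measurable P" for n
  by (rule test_measurable) auto
 show "(%z. f (\<lambda>k\<in>K. limit_var T a X U Nm Np k z, Y (fst z))) : borel_measurable (P \<Otimes>\<^sub>M M')"
  by (rule test_measurable[OF limit_var_measurable]) measurable
 show "(%n. \<integral>om. indicator {om : space P. num_jumps T (snd om) = kp} om * f (\<lambda>k\<in>K. scaled_error n k om, Y om) \<partial>P)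
  ----> (\<integral>z. indicator {z : space (P \<Otimes>\<^sub>M M'). num_jumps T (snd (fst z)) = kp} z * f (\<lambda>k\<in>K. limit_var T a X U Nm Np k z, Y (fst z)) \<partial>(P \<Otimes>\<^sub>M M'))" for kp
 proof -
  have "(\<integral>z. indicator {z : space (P \<Otimes>\<^sub>M M'). num_jumps T (snd (fst z)) = kp} z * f (\<lambda>k\<in>K. limit_var T a X U Nm Np k z, Y (fst z)) \<partial>(P \<Otimes>\<^sub>M M'))
   = (\<integral>z. indicator (cyl kp) (fst z) * f (\<lambda>k\<in>K. limit_var T a X U Nm Np k z, Y (fst z)) \<partial>(P \<Otimes>\<^sub>M M'))"
   by (intro Bochner_Integration.integral_cong refl) (auto simp: cyl_eq space_pair_measure indicator_def)
  then show ?thesis using convergence_given_num_jumps[OF tf Y, of kp] by (simp add: cyl_eq)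
 qed
qed (use test_function.fb[OF tf] in \<open>auto\<close>)

lemma test_function_intro:
 assumes "finite K" and f: "continuous_map (prod_topology (product_topology (%_. euclideanreal) K) euclideanreal) euclideanreal f"
  and b: "bounded (f ` topspace (prod_topology (product_topology (%_. euclideanreal) K) euclideanreal))"
 shows "EX C. test_function K f C"
proof -
 obtain C where C: "\<And>y. y : f ` topspace (prod_topology (product_topology (%_. euclideanreal) K) euclideanreal) ==> norm y <= C"
  using b unfolding bounded_iff by blast
 have "\<bar>f (\<lambda>k\<in>K. x k, y)\<bar> <= C" for x y
  using C[of "f (\<lambda>k\<in>K. x k, y)"] by (auto simp: topspace_product_topology)
 then show ?thesis using assms by (intro exI[of _ C]) (simp add: test_function_def)
qed

lemma conclusion:
 "fidi_converges_in_law P scaled_error (P \<Otimes>\<^sub>M M') (limit_var T a X U Nm Np)"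
 "fidi_converges_stably P (F 1) scaled_error M' (limit_var T a X U Nm Np)"
proof -
 show "fidi_converges_stably P (F 1) scaled_error M' (limit_var T a X U Nm Np)"
  unfolding fidi_converges_stably_def converges_in_law_def
 proof (intro conjI allI impI)
  fix K :: "nat set" and Y :: "'a \<times> 'b => real" and f :: "(nat => real) \<times> real => real"
  assume KY: "finite K & Y : borel_measurable (F 1)"
   and f: "continuous_map (prod_topology (product_topology (%_. euclideanreal) K) euclideanreal) euclideanreal f
    & bounded (f ` topspace (prod_topology (product_topology (%_. euclideanreal) K) euclideanreal))"
  obtain C where tf: "test_function K f C" using test_function_intro[of K f] KY f by blast
  have "Y : borel_measurable P" using KY by (intro F_measurable_P[of 1]) auto
  from stable_convergence[OF tf this]
  show "(%n. \<integral>om. f (\<lambda>k\<in>K. scaled_error n k om, Y om) \<partial>P)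
   ----> (\<integral>z. f (\<lambda>k\<in>K. limit_var T a X U Nm Np k z, Y (fst z)) \<partial>(P \<Otimes>\<^sub>M M'))" .
 qed (auto intro: limit_var_measurable)
 show "fidi_converges_in_law P scaled_error (P \<Otimes>\<^sub>M M') (limit_var T a X U Nm Np)"
  unfolding fidi_converges_in_law_def converges_in_law_def
 proof (intro conjI allI impI)
  fix K :: "nat set" and f :: "(nat => real) => real"
  assume K: "finite K" and f: "continuous_map (product_topology (%_. euclideanreal) K) euclideanreal f
    & bounded (f ` topspace (product_topology (%_. euclideanreal) K))"
  have c: "continuous_map (prod_topology (product_topology (%_. euclideanreal) K) euclideanreal) euclideanreal (%z. f (fst z))"
  proof -
   have "continuous_map (prod_topology (product_topology (%_. euclideanreal) K) euclideanreal) euclideanreal (f \<circ> fst)"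
    by (rule continuous_map_compose[OF continuous_map_fst]) (use f in blast)
   then show ?thesis by (simp add: o_def)
  qed
  have "(%z. f (fst z)) ` topspace (prod_topology (product_topology (%_. euclideanreal) K) euclideanreal)
   \<subseteq> f ` topspace (product_topology (%_. euclideanreal) K)" by auto
  then obtain C where tf: "test_function K (%z. f (fst z)) C"
   using test_function_intro[OF K c] f bounded_subset by blast
  from stable_convergence[OF tf, of "%_. 0"]
  show "(%n. \<integral>om. f (\<lambda>k\<in>K. scaled_error n k om) \<partial>P)
   ----> (\<integral>z. f (\<lambda>k\<in>K. limit_var T a X U Nm Np k z) \<partial>(P \<Otimes>\<^sub>M M'))" by simp
 qed (auto intro: limit_var_measurable)
qed

end

text \<open>The exponent below \<open>1/2\<close> is needed for the second limit, where \<open>n u\<^sub>n\<^sup>2\<close> is of order \<open>n\<close> to the power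
\<open>1 - 2 \<alpha> > 0\<close>.\<close>

lemma threshold_rate:
 fixes u :: "nat => real"
 assumes u: "u \<sim>[sequentially] (%n. real n powr (- \<alpha>))" and \<alpha>: "0 < \<alpha>" "\<alpha> < 1 / 2"
 shows "(%n. 1 / (real n * u n)) ----> 0"
  and "C > 0 ==> (%n. real n * exp (- (real n * (u n / 2)\<^sup>2 / C))) ----> 0"
proof -
 have "((%n. if u n = 0 & real n powr (- \<alpha>) = 0 then 1 else u n / real n powr (- \<alpha>)) \<longlongrightarrow> 1) sequentially"
  using u by (simp add: asymp_equiv_def)
 then have "\<forall>\<^sub>F n in sequentially. 1 / 2 < (if u n = 0 & real n powr (- \<alpha>) = 0 then 1 else u n / real n powr (- \<alpha>))"
  by (rule order_tendstoD) simp
 with eventually_ge_at_top[of 1] have low: "\<forall>\<^sub>F n in sequentially. real n powr (- \<alpha>) / 2 <= u n"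
 proof eventually_elim
  case (elim n)
  have p: "real n powr (- \<alpha>) > 0" using elim(1) by simp
  then show ?case using elim(2) by (simp add: field_simps)
 qed
 show "(%n. 1 / (real n * u n)) ----> 0"
 proof (rule Lim_null_comparison)
  show "\<forall>\<^sub>F n in sequentially. norm (1 / (real n * u n)) <= 2 * real n powr (\<alpha> - 1)"
   using low eventually_ge_at_top[of 1]
  proof eventually_elim
   case (elim n)
   have p: "real n powr (- \<alpha>) > 0" "real n > 0" using elim(2) by auto
   then have pu: "u n > 0" using elim(1) by linarith
   have "real n * (real n powr (- \<alpha>) / 2) <= real n * u n" using elim(1) p by (intro mult_left_mono) auto
   then have "1 / (real n * u n) <= 1 / (real n * (real n powr (- \<alpha>) / 2))"
    using p pu by (intro divide_left_mono) auto
   also have "... = 2 * real n powr (\<alpha> - 1)"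
    using p by (simp add: powr_diff powr_minus field_simps)
   finally show ?case using p pu by simp
  qed
  have "((%n::nat. real n powr (\<alpha> - 1)) \<longlongrightarrow> 0) sequentially"
   by (rule tendsto_neg_powr[OF _ filterlim_real_sequentially]) (use \<alpha> in simp)
  then show "(%n. 2 * real n powr (\<alpha> - 1)) ----> 0" by (rule tendsto_mult_right_zero)
 qed
 show "(%n. real n * exp (- (real n * (u n / 2)\<^sup>2 / C))) ----> 0" if C: "C > 0"
 proof (rule Lim_null_comparison)
  define \<beta> where "\<beta> = 1 - 2 * \<alpha>"
  define k where "k = 1 / (16 * C)"
  have bk: "\<beta> > 0" "k > 0" using \<alpha> C by (auto simp: \<beta>_def k_def)
  show "\<forall>\<^sub>F n in sequentially. norm (real n * exp (- (real n * (u n / 2)\<^sup>2 / C))) <= real n * exp (- (k * real n powr \<beta>))"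
   using low eventually_ge_at_top[of 1]
  proof eventually_elim
   case (elim n)
   have p: "real n powr (- \<alpha>) > 0" "real n > 0" using elim(2) by auto
   have "(real n powr (- \<alpha>) / 4)\<^sup>2 <= (u n / 2)\<^sup>2" using elim(1) p by (intro power_mono) auto
   then have "real n * (real n powr (- \<alpha>) / 4)\<^sup>2 / C <= real n * (u n / 2)\<^sup>2 / C"
    using p C by (intro divide_right_mono mult_left_mono) auto
   moreover have "real n * (real n powr (- \<alpha>) / 4)\<^sup>2 / C = k * real n powr \<beta>"
   proof -
    have "(real n powr (- \<alpha>))\<^sup>2 = real n powr (- (2 * \<alpha>))" by (simp add: power2_eq_square powr_add[symmetric])
    moreover have "real n powr \<beta> = real n * real n powr (- (2 * \<alpha>))"
    using p by (simp add: \<beta>_def powr_diff powr_minus field_simps)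
    ultimately show ?thesis by (simp add: k_def power_divide)
   qed
   ultimately show ?case using p by simp
  qed
  show "(%n. real n * exp (- (k * real n powr \<beta>))) ----> 0" using bk by real_asymp
 qed
qed

theorem theorem4p1:
  fixes M1 :: "'a measure" and M2 :: "'b measure" and M' :: "'e measure"
    and W :: "real \<Rightarrow> 'a \<Rightarrow> real"
    and T \<Lambda> :: "nat \<Rightarrow> 'b \<Rightarrow> real"
    and X :: "real \<Rightarrow> 'a \<times> 'b \<Rightarrow> real"
    and x0 \<alpha> :: real
    and a b c :: "real \<Rightarrow> real \<Rightarrow> real"
    and U Nm Np :: "nat \<Rightarrow> 'e \<Rightarrow> real"
    and u :: "nat \<Rightarrow> real"
  assumes W: "standard_brownian_motion M1 W"
    and T: "jump_times M2 T"
    and marks: "\<And>k. \<Lambda> k \<in> borel_measurable M2"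
    and indep: "prob_space.indep_var M2 (\<Pi>\<^sub>M k\<in>UNIV. borel) (\<lambda>\<omega> k. T k \<omega>)
                  (\<Pi>\<^sub>M k\<in>UNIV. borel) (\<lambda>\<omega> k. \<Lambda> k \<omega>)"
    and X_cadlag: "\<And>\<omega>. \<omega> \<in> space (model_measure M1 M2) \<Longrightarrow> cadlag_on_unit (\<lambda>t. X t \<omega>)"
    and X_adapted: "\<And>t. t \<in> {0..1} \<Longrightarrow> X t \<in> borel_measurable (model_filtration M1 M2 W T \<Lambda> t)"
    and X_sde: "solves_jump_sde M1 M2 W T \<Lambda> x0 b a c X"
    and ext: "extension_variables M' U Nm Np"
    and density: "jump_times_cond_density M2 T"
    and a_cont: "continuous_on ({0..1} \<times> UNIV) (\<lambda>(t, x). a t x)"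
    and b_cont: "continuous_on ({0..1} \<times> UNIV) (\<lambda>(t, x). b t x)"
    and c_cont: "continuous_on UNIV (\<lambda>(x, l). c x l)"
    and c_nonzero: "AE \<omega> in model_measure M1 M2. \<forall>k<num_jumps T (snd \<omega>).
                      c (left_lim (\<lambda>s. X s \<omega>) (T k (snd \<omega>))) (\<Lambda> k (snd \<omega>)) \<noteq> 0"
    and u_pos: "\<And>n. n \<ge> 1 \<Longrightarrow> u n > 0"
    and u_lim: "u \<longlonglongrightarrow> 0"
    and u_equiv: "u \<sim>[sequentially] (\<lambda>n. real n powr (- \<alpha>))"
    and \<alpha>: "0 < \<alpha>" "\<alpha> < 1 / 2"
  shows "fidi_converges_in_law
           (model_measure M1 M2)
           (\<lambda>n k \<omega>. sqrt (real n) * (jump_estimator (u n) n (\<lambda>t. X t \<omega>) k - jump_size T X k \<omega>))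
           (model_measure M1 M2 \<Otimes>\<^sub>M M')
           (limit_var T a X U Nm Np)
       \<and> fidi_converges_stably
           (model_measure M1 M2) (model_filtration M1 M2 W T \<Lambda> 1)
           (\<lambda>n k \<omega>. sqrt (real n) * (jump_estimator (u n) n (\<lambda>t. X t \<omega>) k - jump_size T X k \<omega>))
           M'
           (limit_var T a X U Nm Np)"
proof -
 have jm: "jump_model M1 M2 W T \<Lambda>" by (rule jump_model.intro) (rule W T marks)+
 interpret J0: jump_model M1 M2 W T \<Lambda> by (rule jm)
 obtain w where w: "standard_brownian_motion M1 w" "(%(t, om). w t om) : borel_measurable (borel \<Otimes>\<^sub>M M1)"
  "\<And>om. continuous_on UNIV (%t. w t om)" "\<And>om. w 0 om = 0" "AE om in M1. \<forall>t\<in>{0..1}. w t om = W t om"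
  by (rule bm_continuous_version[OF W]) (rule that)
 from X_sde obtain I where I: "is_ito_integral J0.P J0.F (%t om. W t (fst om)) (%s om. a s (X s om)) I"
  and sde: "AE om in J0.P. \<forall>t\<in>{0..1}. X t om = x0 + (LINT s:{0..t}|lborel. b s (X s om)) + I t om +
    (\<Sum>k | T k (snd om) <= t. c (left_lim (%s. X s om) (T k (snd om))) (\<Lambda> k (snd om)))"
  unfolding solves_jump_sde_def by blast
 from I have Icont: "AE om in J0.P. continuous_on {0..1} (%t. I t om)"
  unfolding is_ito_integral_def by blast
 from I obtain m \<tau> \<xi> where approx: "(ALL n. simple_data J0.P J0.F (m n) (\<tau> n) (\<xi> n)) &
   (\<forall>\<epsilon>>0. (%n. measure J0.P {om : space J0.P.
    (\<integral>\<^sup>+s\<in>{0..1}. ennreal ((simple_integrand (m n) (\<tau> n) (\<xi> n) s om - a s (X s om))\<^sup>2) \<partial>lborel) > ennreal \<epsilon>}) ----> 0) &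
   (\<forall>t\<in>{0..1}. tendsto_in_prob J0.P (%n. simple_integral (%t om. W t (fst om)) (m n) (\<tau> n) (\<xi> n) t) (I t))"
  unfolding is_ito_integral_def by (elim conjE exE) (rule that, intro conjI)
 note sd = approx[THEN conjunct1, rule_format] and conv = approx[THEN conjunct2, THEN conjunct1, rule_format]
  and Il = approx[THEN conjunct2, THEN conjunct2, rule_format]
 obtain N where N: "N : null_sets J0.P" "{om : space J0.P. \<not> continuous_on {0..1} (%t. I t om)} \<subseteq> N"
  using Icont by (auto simp: eventually_ae_filter)
 \<comment> \<open>The version has continuous paths everywhere, so that it can be evaluated at random times.\<close>
 define I' where "I' t om = (if om : N then 0 else I t om)" for t om
 have I'_eq: "AE om in J0.P. ALL t. I' t om = I t om" using AE_not_in[OF N(1)] by eventually_elim (simp add: I'_def)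
 define H where "H s om = a (clamp01 s) (X (clamp01 s) om)" for s om
 have H_eq: "H s om = a s (X s om)" if "s : {0..1}" for s om using that by (simp add: H_def)
 have XP: "X t : borel_measurable J0.P" if "t : {0..1}" for t
  using J0.F_measurable_P[OF _ X_adapted[OF that]] that by simp
 have HF: "H t : borel_measurable (J0.F t)" if t: "t : {0..1}" for t
 proof -
  have "continuous_on UNIV ((%(t, x). a t x) \<circ> (%x. (t, x)))"
   by (rule continuous_on_compose) (use t in \<open>auto intro!: continuous_intros continuous_on_subset[OF a_cont]\<close>)
  then have "continuous_on UNIV (a t)" by (simp add: o_def)
  then have "(%om. a t (X t om)) : borel_measurable (J0.F t)"
   using measurable_compose[OF X_adapted[OF t] borel_measurable_continuous_onI] by blast
  then show ?thesis using H_eq[OF t] by (simp cong: measurable_cong)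
 qed
 have Hrc: "continuous (at_right t) (%t. H t om)" if "om : space J0.P" for om t
  unfolding H_def
  by (rule clamp01_right_continuous[where g="%s. a s (X s om)"])
   (rule path_coefficient_right_continuous[OF X_cadlag[OF that] a_cont])
 have Il': "tendsto_in_prob J0.P (%n. simple_integral (%t om. W t (fst om)) (m n) (\<tau> n) (\<xi> n) t) (I' t)"
  if t: "t : {0..1}" for t
 proof -
  let ?S = "%n. simple_integral (%t om. W t (fst om)) (m n) (\<tau> n) (\<xi> n) t"
  have S [measurable]: "\<And>n. ?S n : borel_measurable J0.P" and It [measurable]: "I t : borel_measurable J0.P"
   and l: "\<And>\<epsilon>. \<epsilon> > 0 ==> (%n. measure J0.P {om : space J0.P. \<bar>?S n om - I t om\<bar> > \<epsilon>}) ----> 0"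
   using Il[OF t] unfolding tendsto_in_prob_def by auto
  have I't [measurable]: "I' t : borel_measurable J0.P"
   using It I'_eq unfolding model_measure_def by (elim borel_measurable_completion_AE_cong) (auto elim: eventually_mono)
  have "measure J0.P {om : space J0.P. \<bar>?S n om - I' t om\<bar> > \<epsilon>} = measure J0.P {om : space J0.P. \<bar>?S n om - I t om\<bar> > \<epsilon>}" for n \<epsilon>
  proof (rule J0.P.finite_measure_eq_AE)
   show "AE om in J0.P. om : {om : space J0.P. \<bar>?S n om - I' t om\<bar> > \<epsilon>} \<longleftrightarrow> om : {om : space J0.P. \<bar>?S n om - I t om\<bar> > \<epsilon>}"
    using I'_eq by eventually_elim simp
  qed measurable
  then show ?thesis unfolding tendsto_in_prob_def using S I't l by simp
 qed
 have conv': "(%n. measure J0.P {om : space J0.P.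
   (\<integral>\<^sup>+s\<in>{0..1}. ennreal ((simple_integrand (m n) (\<tau> n) (\<xi> n) s om - H s om)\<^sup>2) \<partial>lborel) > ennreal \<epsilon>}) ----> 0"
  if e: "\<epsilon> > 0" for \<epsilon>
 proof -
  have "(\<integral>\<^sup>+s\<in>{0..1}. ennreal ((simple_integrand (m n) (\<tau> n) (\<xi> n) s om - H s om)\<^sup>2) \<partial>lborel)
   = (\<integral>\<^sup>+s\<in>{0..1}. ennreal ((simple_integrand (m n) (\<tau> n) (\<xi> n) s om - a s (X s om))\<^sup>2) \<partial>lborel)" for n om
  proof (rule nn_integral_cong)
   fix s :: real
   show "ennreal ((simple_integrand (m n) (\<tau> n) (\<xi> n) s om - H s om)\<^sup>2) * indicator {0..1} s
    = ennreal ((simple_integrand (m n) (\<tau> n) (\<xi> n) s om - a s (X s om))\<^sup>2) * indicator {0..1} s"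
    using H_eq[of s om] by (cases "s : {0..1}") simp_all
  qed
  then show ?thesis using conv[OF e] by simp
 qed
 interpret jump_diffusion M1 M2 W T \<Lambda> w M' U Nm Np H I' m \<tau> \<xi> X x0 a b c u
 proof (unfold_locales, goal_cases)
  case 1 show ?case by (rule w(1))
 next case 2 show ?case by (rule w(2))
 next case 3 show ?case by (rule ext)
 next case 4 show ?case by (rule density)
 next case (5 n) show ?case by (rule sd)
 next case 6
  show ?case
  proof (rule joint_measurable_right_continuous)
   fix t
   have "H t = H (clamp01 t)" unfolding H_def clamp01_eq[OF clamp01_in] ..
   then show "H t : borel_measurable J0.P" using J0.F_measurable_P[OF _ HF[OF clamp01_in[of t]]] clamp01_in[of t] by simp
  qed (rule Hrc)
 next case (7 e) then show ?case by (rule conv')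
 next case (8 t) then show ?case by (rule Il')
 next case (9 t) then show ?case by (rule HF)
 next case (10 om t) then show ?case by (intro Hrc)
 next case (11 om)
  obtain B where "\<forall>t\<in>{0..1}. \<bar>a t (X t om)\<bar> <= B" using path_coefficient_bounded[OF X_cadlag[OF 11] a_cont] by blast
  then show ?case by (intro exI[of _ B]) (simp add: H_eq)
 next case 12
  show ?case using Icont I'_eq by eventually_elim simp
 next case (13 om) then show ?case by (rule X_cadlag)
 next case (14 t) then show ?case by (rule XP)
 next case 15 show ?case by (rule a_cont)
 next case 16 show ?case by (rule b_cont)
 next case (17 s om) show ?case by (rule H_def)
 next case (18 om) then show ?case using N(2) by (cases "om : N") (auto simp: I'_def)
 next case 19 show ?case using sde I'_eq by eventually_elim simp
 next case 20 show ?case by (rule c_nonzero)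
 next case 21 show ?case by (rule w(5))
 next case (22 n) then show ?case by (rule u_pos)
 next case 23 show ?case by (rule u_lim)
 next case 24 show ?case by (rule threshold_rate(1)[OF u_equiv \<alpha>])
 next case (25 C) then show ?case by (rule threshold_rate(2)[OF u_equiv \<alpha>])
 qed
 show ?thesis using conclusion unfolding scaled_error_def[abs_def] by blast
qed

end
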